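(* Suppose that (A1), (A2), (A3) and (A6) of the context hold and that $\hat\theta_n^*$ and $\mathring\theta_n^*$ are uniformly tight. Suppose that $$\frac{\lambda_n}{n^2}\to\infty\quad\text{and}\quad r_n=o_p\left(\frac1n\right)\qquad\text{as }n\to\infty$$ (the latter for $r_n=r_n(\Theta_0,\Gamma_0)$ with every compact $\Theta_0\subset\Theta$ and compact $\Gamma_0\subset\Gamma$), and that the matrix $$V_{\theta_0^*}=-E_{\theta_0^*}\left[\frac{\partial g}{\partial x}(Y_i,\mathbf{x}(\theta_0^*,T_i))\,\frac{\partial^2\mathbf{x}}{\partial\theta^*\partial\theta^{*T}}(\theta_0^*,T_i)+\frac{\partial^2g}{\partial x^2}(Y_i,\mathbf{x}(\theta_0^*,T_i))\,\frac{\partial\mathbf{x}}{\partial\theta^*}(\theta_0^*,T_i)\,\frac{\partial\mathbf{x}}{\partial\theta^*}(\theta_0^*,T_i)^T\right]$$ is nonsingular. Then both $\sqrt n(\hat\theta_n^*-\theta_0^* )$ and $\sqrt n(\mathring\theta_n^*-\theta_0^* )$ are asymptotically normal with mean zero and the same asymptotic covariance matrix (convergence in distribution under $P_{\theta_0^*}$).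
   Context: Let $T>0$, let $\Theta\subset\mathbb{R}^d$ be open and convex, and let $\Gamma\subset\mathbb{R}\times\mathbb{R}$ be open and convex. Let $F,G:\mathbb{R}\times\mathbb{R}\times[0,T]\times\Theta\to\mathbb{R}$. Write $\theta^*=(\theta,x,z)\in\Theta\times\Gamma$. Consider on $[0,T]$ the initial value problem $$\frac{d\mathbf{x}}{dt}=F(\mathbf{x}(t),\mathbf{z}(t),t,\theta),\quad \frac{d\mathbf{z}}{dt}=G(\mathbf{x}(t),\mathbf{z}(t),t,\theta),\quad \mathbf{x}(0)=x,\ \mathbf{z}(0)=z,$$ whose solution is denoted $(\mathbf{x}(\theta^*,t),\mathbf{z}(\theta^*,t))$. Here $\frac{\partial\mathbf{x}}{\partial\theta^*}$ is the gradient (column vector in $\mathbb{R}^{d+2}$) and $\frac{\partial^2\mathbf{x}}{\partial\theta^*\partial\theta^{*T}}$ the Hessian matrix with respect to $\theta^*$. Data: $(Y_1,T_1),(Y_2,T_2),\ldots$ are i.i.d., $Y_i$ real valued, $T_i\in[0,T]$ with distribution $Q$; their joint law is $P_{\theta_0^*}$ (expectation $E_{\theta_0^*}$), where $\theta_0^*\in\Theta\times\Gamma$ is the combination of the true parameter and true initial values. Let $g:\mathbb{R}\times\mathbb{R}\to\mathbb{R}$, $g=g(y,x)$, and for a function $\mathbf{f}$ on $[0,T]$ put $H_n(\mathbf{f})=-\frac1n\sum_{i=1}^n g(Y_i,\mathbf{f}(T_i))$. Let $M(\theta^* )=-E_{\theta_0^*}[g(Y_i,\mathbf{x}(\theta^*,T_i))]$.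 Assumptions: (A1) $Q$ has a density $f$ with respect to Lebesgue measure on $[0,T]$ with $c\le f(t)\le C$ for all $t\in[0,T]$, for two positive numbers $c,C$. (A2) $F,G\in C^3(\mathbb{R}\times\mathbb{R}\times[0,T]\times\Theta)$; for each $\theta\in\Theta$ and $(x,z)\in\Gamma$ the initial value problem has a unique solution on $[0,T]$; and for any $\theta^*\ne\theta^{*\prime}$ in $\Theta\times\Gamma$, $\mathbf{x}(\theta^*,\cdot)\neq\mathbf{x}(\theta^{*\prime},\cdot)$. (A3) On $\Theta\times\Gamma$, $M$ is continuous and has a unique maximum at $\theta_0^*$. (A6) $g$ is nonnegative and belongs to $C^2(\mathbb{R}\times\mathbb{R})$, with $E_{\theta_0^*}\big[\big|\frac{\partial g}{\partial x}(Y_i,\mathbf{x}(\theta_0^*,T_i))\big|^2\big]<\infty$ and $E_{\theta_0^*}\big[\big|\frac{\partial^2g}{\partial x^2}(Y_i,\mathbf{x}(\theta_0^*,T_i))\big|\big]<\infty$. If $Y_i$ is not a bounded random variable, then for any compact $\Lambda\subset\mathbb{R}$, $\liminf_{|y|\to\infty}\frac{1+\inf_{x\in\Lambda}|h(y,x)|}{\sup_{x\in\Lambda}|h(y,x)|}>0$ for each of $h=g$, $h=\frac{\partial g}{\partial x}$ and $h=\frac{\partial^2g}{\partial x^2}$. Norms: $\|f\|_\infty=\sup_{t\in[0,T]}|f(t)|$; $a\vee b=\max(a,b)$. For $\mathbf{x},\mathbf{z}\in C^1[0,T]$, $$J(\mathbf{x},\mathbf{z},\theta)=\int_0^T\Big[\frac{d\mathbf{x}}{dt}-F(\mathbf{x}(t),\mathbf{z}(t),t,\theta)\Big]^2dt+\int_0^T\Big[\frac{d\mathbf{z}}{dt}-G(\mathbf{x}(t),\mathbf{z}(t),t,\theta)\Big]^2dt.$$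 Let $\{\mathbb{L}_n\}$ be a sequence of finite-dimensional subspaces of $C^1[0,T]$ and $\lambda_n>0$ smoothing parameters. For $\theta^*=(\theta,x,z)\in\Theta\times\Gamma$, $(\hat{\mathbf{x}}_n(\theta^*,\cdot),\hat{\mathbf{z}}_n(\theta^*,\cdot))$ denotes a maximizer (assumed to exist) of $H_n(\tilde{\mathbf{x}})-\lambda_nJ(\tilde{\mathbf{x}},\tilde{\mathbf{z}},\theta)$ over $\tilde{\mathbf{x}},\tilde{\mathbf{z}}\in\mathbb{L}_n$ with $\tilde{\mathbf{x}}(0)=x$, $\tilde{\mathbf{z}}(0)=z$. The generalized profiling estimator $\hat\theta_n^*$ is a maximizer over $\theta^*\in\Theta\times\Gamma$ of $H_n(\hat{\mathbf{x}}_n(\theta^*,\cdot))$. The estimator $\mathring\theta_n^*$ is a maximizer over $\theta^*\in\Theta\times\Gamma$ of $H_n(\mathbf{x}(\theta^*,\cdot))$ (using the exact ODE solution). For compact $\Theta_0\subset\Theta$, $\Gamma_0\subset\Gamma$, $r_n=r_n(\Theta_0,\Gamma_0)$ is the maximum of $$\sup_{\theta^*\in\Theta_0\times\Gamma_0}\inf_{\mathbf{w}\in\mathbb{L}_n,\mathbf{w}(0)=x}\Big[\|\mathbf{x}(\theta^*,\cdot)-\mathbf{w}\|_\infty\vee\Big\|\frac{d\mathbf{x}}{dt}(\theta^*,\cdot)-\frac{d\mathbf{w}}{dt}\Big\|_\infty\Big]$$ and $$\sup_{\theta^*\in\Theta_0\times\Gamma_0}\inf_{\mathbf{v}\in\mathbb{L}_n,\mathbf{v}(0)=z}\Big[\|\mathbf{z}(\theta^*,\cdot)-\mathbf{v}\|_\infty\vee\Big\|\frac{d\mathbf{z}}{dt}(\theta^*,\cdot)-\frac{d\mathbf{v}}{dt}\Big\|_\infty\Big].$$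 (For deterministic $\mathbb{L}_n$, $r_n=o_p(1/n)$ means $nr_n\to0$.) A sequence of $\Theta\times\Gamma$-valued estimators $\tilde\theta_n^*$ is uniformly tight if for any $\varepsilon>0$ there is a compact set $\Theta_\varepsilon^*\subset\Theta\times\Gamma$ such that $\sup_nP_{\theta_0^*}(\tilde\theta_n^*\notin\Theta_\varepsilon^* )<\varepsilon$. *)

theory Defs
  imports "HOL-Probability.Probability"
begin

text \<open>A full parameter is a triple \<open>(\<theta>, x, z)\<close> of the parameter of the system and
  the two initial values.  Gradients, Hessians and covariance matrices are indexed by the
  type \<open>'d + 2\<close>: \<open>Inl i\<close> is the \<open>i\<close>-th coordinate of \<open>\<theta>\<close>,
  \<open>Inr 0\<close> is \<open>x\<close> and \<open>Inr 1\<close> is \<open>z\<close>.\<close>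

type_synonym 'd param = "(real ^ 'd) \<times> real \<times> real"

definition param_unit :: "'d::finite + 2 \<Rightarrow> 'd param" where
  "param_unit k = (case k of Inl i \<Rightarrow> (axis i 1, 0, 0)
                   | Inr j \<Rightarrow> if j = 0 then (0, 1, 0) else (0, 0, 1))"

definition param_coord :: "'d::finite param \<Rightarrow> real ^ ('d + 2)" where
  "param_coord p = (\<chi> k. p \<bullet> param_unit k)"

lemma param_coord_eq:
  fixes p :: "'d::finite param"
  shows "param_coord p $ Inl i = fst p $ i"
    and "param_coord p $ Inr 0 = fst (snd p)"
    and "param_coord p $ Inr 1 = snd (snd p)"
  by (cases p; simp add: param_coord_def param_unit_def inner_axis inner_prod_def)+

definition partial :: "'d::finite + 2 \<Rightarrow> ('d param \<Rightarrow> real) \<Rightarrow> 'd param \<Rightarrow> real" where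
  "partial k f p = deriv (\<lambda>s. f (p + s *\<^sub>R param_unit k)) 0"

text \<open>Derivatives are taken within \<open>S\<close>, hence one-sided at boundary points.  The
  definition is meant for convex sets with nonempty interior, where they are unique.\<close>

primrec Ck_on ::
  "nat \<Rightarrow> 'a::real_normed_vector set \<Rightarrow> ('a \<Rightarrow> 'b::real_normed_vector) \<Rightarrow> bool" where
  "Ck_on 0 S f \<longleftrightarrow> continuous_on S f"
| "Ck_on (Suc k) S f \<longleftrightarrow>
     (\<exists>D. (\<forall>x\<in>S. (f has_derivative D x) (at x within S)) \<and> (\<forall>v. Ck_on k S (\<lambda>x. D x v)))"

text \<open>Functions on \<open>[0,T]\<close> are represented by functions on the real line whose
  values outside \<open>[0,T]\<close> are irrelevant.\<close>

abbreviation time_deriv :: "real \<Rightarrow> (real \<Rightarrow> real) \<Rightarrow> real \<Rightarrow> real" where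
  "time_deriv T f t \<equiv> vector_derivative f (at t within {0..T})"

definition finite_dim_subspace_C1 :: "real \<Rightarrow> (real \<Rightarrow> real) set \<Rightarrow> bool" where
  "finite_dim_subspace_C1 T L \<longleftrightarrow>
     (\<forall>w\<in>L. Ck_on 1 {0..T} w) \<and>
     (\<lambda>t. 0) \<in> L \<and>
     (\<forall>v\<in>L. \<forall>w\<in>L. (\<lambda>t. v t + w t) \<in> L) \<and>
     (\<forall>a. \<forall>w\<in>L. (\<lambda>t. a * w t) \<in> L) \<and>
     (\<exists>B. finite B \<and> B \<subseteq> L \<and> (\<forall>w\<in>L. \<exists>a. w = (\<lambda>t. \<Sum>b\<in>B. a b * b t)))"

definition ivp_solution ::
  "real \<Rightarrow> (real \<times> real \<times> real \<times> (real ^ 'd) \<Rightarrow> real) \<Rightarrow> (real \<times> real \<times> real \<times> (real ^ 'd) \<Rightarrow> real) \<Rightarrow>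
   'd::finite param \<Rightarrow> (real \<Rightarrow> real) \<Rightarrow> (real \<Rightarrow> real) \<Rightarrow> bool" where
  "ivp_solution T F G p u v \<longleftrightarrow>
     (case p of (\<theta>, x, z) \<Rightarrow>
       (\<forall>t\<in>{0..T}. (u has_real_derivative F (u t, v t, t, \<theta>)) (at t within {0..T}) \<and>
                   (v has_real_derivative G (u t, v t, t, \<theta>)) (at t within {0..T})) \<and>
       u 0 = x \<and> v 0 = z)"

definition penalty ::
  "real \<Rightarrow> (real \<times> real \<times> real \<times> (real ^ 'd) \<Rightarrow> real) \<Rightarrow> (real \<times> real \<times> real \<times> (real ^ 'd) \<Rightarrow> real) \<Rightarrow>
   (real \<Rightarrow> real) \<Rightarrow> (real \<Rightarrow> real) \<Rightarrow> real ^ 'd::finite \<Rightarrow> real" where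
  "penalty T F G u v \<theta> =
     integral {0..T} (\<lambda>t. (time_deriv T u t - F (u t, v t, t, \<theta>))\<^sup>2) +
     integral {0..T} (\<lambda>t. (time_deriv T v t - G (u t, v t, t, \<theta>))\<^sup>2)"

text \<open>Suprema and infima are formed in \<^typ>\<open>ennreal\<close>, so that they carry their
  usual meaning also for unbounded or empty sets.\<close>

definition sup_norm :: "real \<Rightarrow> (real \<Rightarrow> real) \<Rightarrow> ennreal" where
  "sup_norm T f = (SUP t\<in>{0..T}. ennreal \<bar>f t\<bar>)"

definition C1_approx_error ::
  "real \<Rightarrow> (real \<Rightarrow> real) set \<Rightarrow> (real \<Rightarrow> real) \<Rightarrow> real \<Rightarrow> ennreal" where
  "C1_approx_error T L f a =
     (INF w\<in>{w\<in>L. w 0 = a}.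
        max (sup_norm T (\<lambda>t. f t - w t)) (sup_norm T (\<lambda>t. time_deriv T f t - time_deriv T w t)))"

definition approx_rate ::
  "real \<Rightarrow> (real \<Rightarrow> real) set \<Rightarrow> ('d::finite param \<Rightarrow> real \<Rightarrow> real) \<Rightarrow>
   ('d param \<Rightarrow> real \<Rightarrow> real) \<Rightarrow> (real ^ 'd) set \<Rightarrow> (real \<times> real) set \<Rightarrow> ennreal" where
  "approx_rate T L xs zs \<Theta>0 \<Gamma>0 =
     max (SUP (\<theta>, x, z)\<in>\<Theta>0 \<times> \<Gamma>0. C1_approx_error T L (xs (\<theta>, x, z)) x)
         (SUP (\<theta>, x, z)\<in>\<Theta>0 \<times> \<Gamma>0. C1_approx_error T L (zs (\<theta>, x, z)) z)"

definition loss_dx :: "(real \<times> real \<Rightarrow> real) \<Rightarrow> real \<times> real \<Rightarrow> real" where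
  "loss_dx g = (\<lambda>(y, x). deriv (\<lambda>u. g (y, u)) x)"

definition loss_dxx :: "(real \<times> real \<Rightarrow> real) \<Rightarrow> real \<times> real \<Rightarrow> real" where
  "loss_dxx g = loss_dx (loss_dx g)"

text \<open>In \<^typ>\<open>ennreal\<close> the quotient is \<open>\<infinity>\<close> when the denominator vanishes;
  the filter \<^term>\<open>at_infinity\<close> on the reals is \<open>\<bar>y\<bar> \<rightarrow> \<infinity>\<close>.\<close>

definition tail_comparable :: "(real \<times> real \<Rightarrow> real) \<Rightarrow> bool" where
  "tail_comparable h \<longleftrightarrow>
     (\<forall>\<Lambda>. compact \<Lambda> \<longrightarrow>
        Liminf at_infinity (\<lambda>y::real.
          (1 + (INF x\<in>\<Lambda>. ennreal \<bar>h (y, x)\<bar>)) / (SUP x\<in>\<Lambda>. ennreal \<bar>h (y, x)\<bar>)) > 0)"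

definition empirical_criterion ::
  "(real \<times> real \<Rightarrow> real) \<Rightarrow> (nat \<Rightarrow> 'w \<Rightarrow> real) \<Rightarrow> (nat \<Rightarrow> 'w \<Rightarrow> real) \<Rightarrow>
   nat \<Rightarrow> 'w \<Rightarrow> (real \<Rightarrow> real) \<Rightarrow> real" where
  "empirical_criterion g Y Tm n \<omega> f = - (1 / real n) * (\<Sum>i=1..n. g (Y i \<omega>, f (Tm i \<omega>)))"

definition limit_criterion ::
  "'w measure \<Rightarrow> (real \<times> real \<Rightarrow> real) \<Rightarrow> ('w \<Rightarrow> real) \<Rightarrow> ('w \<Rightarrow> real) \<Rightarrow>
   ('d::finite param \<Rightarrow> real \<Rightarrow> real) \<Rightarrow> 'd param \<Rightarrow> real" where
  "limit_criterion P g Y1 T1 xs p = - (\<integral>\<omega>. g (Y1 \<omega>, xs p (T1 \<omega>)) \<partial>P)"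

definition criterion_matrix ::
  "'w measure \<Rightarrow> (real \<times> real \<Rightarrow> real) \<Rightarrow> ('w \<Rightarrow> real) \<Rightarrow> ('w \<Rightarrow> real) \<Rightarrow>
   ('d::finite param \<Rightarrow> real \<Rightarrow> real) \<Rightarrow> 'd param \<Rightarrow> real ^ ('d + 2) ^ ('d + 2)" where
  "criterion_matrix P g Y1 T1 xs p =
     (\<chi> j k. - (\<integral>\<omega>.
         loss_dx g (Y1 \<omega>, xs p (T1 \<omega>)) * partial j (partial k (\<lambda>q. xs q (T1 \<omega>))) p +
         loss_dxx g (Y1 \<omega>, xs p (T1 \<omega>)) *
           (partial j (\<lambda>q. xs q (T1 \<omega>)) p * partial k (\<lambda>q. xs q (T1 \<omega>)) p) \<partial>P))"

definition uniformly_tight ::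
  "'w measure \<Rightarrow> 'a::topological_space set \<Rightarrow> (nat \<Rightarrow> 'w \<Rightarrow> 'a) \<Rightarrow> bool" where
  "uniformly_tight P S X \<longleftrightarrow>
     (\<forall>\<epsilon>>0. \<exists>K. compact K \<and> K \<subseteq> S \<and>
        (SUP n\<in>{1..}. measure P {\<omega>\<in>space P. X n \<omega> \<notin> K}) < \<epsilon>)"

definition std_normal :: "(real ^ 'n::finite) measure" where
  "std_normal = density lborel (\<lambda>z. ennreal (\<Prod>i\<in>UNIV. std_normal_density (z $ i)))"

text \<open>Singular covariance matrices, including 0, are allowed.\<close>

definition multivariate_normal ::
  "real ^ 'n::finite \<Rightarrow> real ^ 'n ^ 'n \<Rightarrow> (real ^ 'n) measure \<Rightarrow> bool" where
  "multivariate_normal m C \<mu> \<longleftrightarrow>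
     (\<exists>A :: real ^ 'n ^ 'n. A ** transpose A = C \<and> \<mu> = distr std_normal borel (\<lambda>z. m + A *v z))"

definition converges_in_distribution ::
  "'w measure \<Rightarrow> (nat \<Rightarrow> 'w \<Rightarrow> 'a::euclidean_space) \<Rightarrow> 'a measure \<Rightarrow> bool" where
  "converges_in_distribution P X \<mu> \<longleftrightarrow>
     (\<forall>h :: 'a \<Rightarrow> real. continuous_on UNIV h \<and> bounded (range h) \<longrightarrow>
        (\<lambda>n. \<integral>\<omega>. h (X n \<omega>) \<partial>P) \<longlonglongrightarrow> (\<integral>v. h v \<partial>\<mu>))"

end

theory Submission
  imports Defs
begin

text \<open>
  Write \<open>H n p\<close> for the empirical criterion at the exact path with parameter \<open>p\<close>.  Both estimators
  nearly maximise this one random function, and that is why they share their limit law.  The estimator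
  based on the exact solution maximises it.  The profiled estimator maximises a criterion that differs
  from \<open>H n\<close> by \<open>o(1/n)\<close> uniformly on compact sets, so it maximises \<open>H n\<close> up to \<open>o(1/n)\<close>.

  The second fact is \<open>profiled_criterion_close\<close>.  Compare the profile with an approximant \<open>w\<close> of the exact
  path in the approximating space.  The loss is nonnegative and the criterion at \<open>w\<close> is bounded in
  probability, so the penalty of the profile is at most \<open>O(1/\<lambda>)\<close> plus the penalty of \<open>w\<close>; the latter is
  quadratic in the approximation error (\<open>penalty_of_approximant\<close>).  By the two rates the penalty of the
  profile is \<open>o(1/n\<^sup>2)\<close>.  Gronwall's inequality for the squared distance turns the integrated
  squared residual into a squared uniform distance (\<open>penalty_controls_distance\<close>), so the profile is
  within \<open>o(1/n)\<close> of the exact path, and the criterion is Lipschitz in the path.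

  Around \<open>\<theta>0\<close> the function \<open>H n\<close> is a quadratic \<open>S \<bullet> h + (h \<bullet> V h) / 2\<close>, up to a constant and
  \<open>o(\<bar>h\<bar>\<^sup>2)\<close>.  Here \<open>S\<close> is the mean of the scores, hence of order \<open>1 / sqrt n\<close>, and
  \<open>V\<close> is negative definite, being nonsingular at a maximum.  A point where such a function is within
  \<open>o(1/n)\<close> of its maximum lies within \<open>o(1 / sqrt n)\<close> of the vertex \<open>- V\<^sup>-\<^sup>1 S\<close>.  So the
  errors of both estimators, times \<open>sqrt n\<close>, are a normalised sum of the same independent vectors up to
  \<open>o(1)\<close> (\<open>near_maximizers_asymptotically_linear\<close>), and the central limit theorem applies.  That the
  estimators come near \<open>\<theta>0\<close> at all is \<open>consistency\<close>.

  The quadratic expansion requires two derivatives of the path with respect to parameters and initial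
  values, jointly continuous.  With the parameters added to the state, these are derivatives of a flow with
  respect to its initial value.  Gronwall's inequality shows that its difference quotients are uniformly
  Cauchy; the limit solves the variational equation (\<open>derivative_flow_exists\<close>).  The flow together with
  its derivative is again such a flow, and gives the second derivative.  The tail condition on the loss
  makes its derivatives over a compact range comparable with those at the true path, so that the moments
  assumed there bound the remainder (\<open>envelope\<close>, \<open>loss_expansion\<close>).

  The one-dimensional central limit theorem supplies limits of \<open>cos\<close> and \<open>sin\<close> of linear
  functionals.  Trigonometric polynomials approximate continuous functions on balls, so for a tight sequence
  this is convergence in distribution (\<open>weak_convergence_of_trigonometric_moments\<close>).
\<close>

section \<open>Gronwall estimates and stability of differential equations\<close>

text \<open>The quantity \<open>exp (- K s) * \<phi> s - \<integral>\<rho>\<close> is nonincreasing, because \<open>exp (- K s) \<le> 1\<close> lets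
  \<open>\<rho>\<close> absorb the factor.\<close>

lemma gronwall_differential:
  fixes \<phi> \<rho> :: "real \<Rightarrow> real"
  assumes der: "\<And>t. t \<in> {0..T} \<Longrightarrow> (\<phi> has_real_derivative \<phi>' t) (at t within {0..T})"
    and le: "\<And>t. t \<in> {0..T} \<Longrightarrow> \<phi>' t \<le> K * \<phi> t + \<rho> t"
    and cont: "continuous_on {0..T} \<rho>" and nonneg: "\<And>t. t \<in> {0..T} \<Longrightarrow> 0 \<le> \<rho> t"
    and K: "0 \<le> K" and t: "t \<in> {0..T}"
  shows "\<phi> t \<le> exp (K * t) * (\<phi> 0 + integral {0..t} \<rho>)"
proof -
  define \<psi> where "\<psi> s = exp (- (K * s)) * \<phi> s - integral {0..s} \<rho>" for s
  have d: "(\<psi> has_real_derivative exp (- (K * s)) * (\<phi>' s - K * \<phi> s) - \<rho> s) (at s within {0..T})"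
    if "s \<in> {0..T}" for s
    unfolding \<psi>_def
    by (rule derivative_eq_intros der[OF that] integral_has_real_derivative[OF cont that] refl)+
       (simp add: algebra_simps)
  have "\<psi> t \<le> \<psi> 0"
  proof (rule DERIV_nonpos_imp_decreasing_open[of 0 t \<psi>])
    show "0 \<le> t" using t by simp
    show "continuous_on {0..t} \<psi>"
      using t by (intro continuous_on_subset[OF DERIV_continuous_on[OF d]]) auto
    fix s assume s: "0 < s" "s < t"
    have "\<phi>' s - K * \<phi> s \<le> \<rho> s" using le[of s] s t by auto
    then have "exp (- (K * s)) * (\<phi>' s - K * \<phi> s) \<le> exp (- (K * s)) * \<rho> s" by simp
    also have "\<dots> \<le> 1 * \<rho> s" using nonneg[of s] K s t by (intro mult_right_mono) auto
    finally have "exp (- (K * s)) * (\<phi>' s - K * \<phi> s) - \<rho> s \<le> 0" by simp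
    moreover have "(\<psi> has_real_derivative exp (- (K * s)) * (\<phi>' s - K * \<phi> s) - \<rho> s) (at s)"
      using d[of s] s t by (simp add: at_within_Icc_at)
    ultimately show "\<exists>y. (\<psi> has_real_derivative y) (at s) \<and> y \<le> 0" by blast
  qed
  then have "exp (- (K * t)) * \<phi> t \<le> \<phi> 0 + integral {0..t} \<rho>" by (simp add: \<psi>_def)
  then have "exp (K * t) * (exp (- (K * t)) * \<phi> t) \<le> exp (K * t) * (\<phi> 0 + integral {0..t} \<rho>)"
    by simp
  then show ?thesis by (simp add: mult.assoc[symmetric] exp_add[symmetric])
qed

text \<open>The residual enters through its squared integral, the form in which the penalty measures it.\<close>

lemma gronwall_norm_square:
  fixes e r :: "real \<Rightarrow> 'a::real_inner"
  assumes der: "\<And>t. t \<in> {0..T} \<Longrightarrow> (e has_vector_derivative a t + r t) (at t within {0..T})"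
    and le: "\<And>t. t \<in> {0..T} \<Longrightarrow> norm (a t) \<le> K * norm (e t)"
    and cont: "continuous_on {0..T} r" and K: "0 \<le> K" and t: "t \<in> {0..T}"
  shows "(norm (e t))\<^sup>2 \<le> exp ((2 * K + 1) * T) * ((norm (e 0))\<^sup>2 + integral {0..T} (\<lambda>s. (norm (r s))\<^sup>2))"
proof -
  let ?\<phi> = "\<lambda>t. e t \<bullet> e t" and ?\<rho> = "\<lambda>t. (norm (r t))\<^sup>2"
  have c: "continuous_on {0..T} ?\<rho>" using cont by (intro continuous_intros)
  have "?\<phi> t \<le> exp ((2 * K + 1) * t) * (?\<phi> 0 + integral {0..t} ?\<rho>)"
  proof (rule gronwall_differential[where T=T and \<phi>' = "\<lambda>t. 2 * (e t \<bullet> (a t + r t))"])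
    fix s assume s: "s \<in> {0..T}"
    show "(?\<phi> has_real_derivative 2 * (e s \<bullet> (a s + r s))) (at s within {0..T})"
      unfolding has_real_derivative_iff_has_vector_derivative
      using bounded_bilinear.has_vector_derivative[OF bounded_bilinear_inner der[OF s] der[OF s]]
      by (simp add: inner_commute)
    have "e s \<bullet> a s \<le> norm (e s) * norm (a s)" by (rule norm_cauchy_schwarz)
    also have "\<dots> \<le> norm (e s) * (K * norm (e s))" using le[OF s] by (intro mult_left_mono) auto
    finally have 1: "e s \<bullet> a s \<le> K * ?\<phi> s"
      by (simp add: power2_norm_eq_inner[symmetric] power2_eq_square algebra_simps)
    \<comment> \<open>Young's inequality for this term adds 1 to the rate \<open>2 * K\<close>.\<close>
    have "e s \<bullet> r s \<le> norm (e s) * norm (r s)" by (rule norm_cauchy_schwarz)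
    moreover have "0 \<le> (norm (e s) - norm (r s))\<^sup>2" by simp
    ultimately have 2: "2 * (e s \<bullet> r s) \<le> ?\<phi> s + ?\<rho> s"
      unfolding power2_norm_eq_inner[symmetric] by (simp add: power2_diff)
    show "2 * (e s \<bullet> (a s + r s)) \<le> (2 * K + 1) * ?\<phi> s + ?\<rho> s"
      using 1 2 by (simp add: inner_add_right algebra_simps)
  qed (use c K t in auto)
  also have "\<dots> \<le> exp ((2 * K + 1) * T) * (?\<phi> 0 + integral {0..T} ?\<rho>)"
  proof (intro mult_mono add_mono)
    show "integral {0..t} ?\<rho> \<le> integral {0..T} ?\<rho>"
      using t c by (intro integral_subset_le integrable_continuous_real continuous_on_subset[OF c]) auto
    show "0 \<le> ?\<phi> 0 + integral {0..t} ?\<rho>"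
      by (intro add_nonneg_nonneg integral_nonneg integrable_continuous_real continuous_on_subset[OF c])
         (use t in auto)
    show "exp ((2 * K + 1) * t) \<le> exp ((2 * K + 1) * T)"
      using t K by (auto intro!: mult_left_mono)
  qed auto
  finally show ?thesis by (simp add: power2_norm_eq_inner)
qed

text \<open>At the first time where \<open>\<phi>\<close> reached \<open>\<eta>\<close>, continuity would give equality, which the step
  excludes.\<close>

lemma stays_below_if_no_first_exit:
  fixes \<phi> :: "real \<Rightarrow> real"
  assumes cont: "continuous_on {0..T} \<phi>" and start: "\<phi> 0 < \<eta>"
    and step: "\<And>s. s \<in> {0..T} \<Longrightarrow> (\<forall>t\<in>{0..s}. \<phi> t \<le> \<eta>) \<Longrightarrow> \<phi> s < \<eta>"
    and t: "t \<in> {0..T}"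
  shows "\<phi> t < \<eta>"
proof (rule ccontr)
  assume *: "\<not> \<phi> t < \<eta>"
  define S where "S = {t \<in> {0..T}. \<eta> \<le> \<phi> t}"
  have "closed S" unfolding S_def
    using continuous_on_closed_Collect_le[OF continuous_on_const cont, of \<eta>] by simp
  moreover have ne: "S \<noteq> {}" and bd: "bdd_below S" using * t by (auto simp: S_def)
  ultimately have inf: "Inf S \<in> S" by (intro closed_contains_Inf)
  define s where "s = Inf S"
  have s: "s \<in> {0..T}" "\<eta> \<le> \<phi> s" using inf by (auto simp: S_def s_def)
  have below: "\<phi> u < \<eta>" if "u \<in> {0..T}" "u < s" for u
    using cInf_lower[OF _ bd, of u] that by (force simp: S_def s_def)
  have "\<exists>x\<ge>0. x \<le> s \<and> \<phi> x = \<eta>"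
    using s start by (intro IVT' continuous_on_subset[OF cont]) auto
  then have "\<phi> s = \<eta>" using below s by force
  then have "\<phi> s < \<eta>" using s below by (intro step) (auto simp: less_eq_real_def)
  then show False using s by simp
qed

text \<open>Uniformity in time of the continuity in the parameter is what makes the two separate
  continuities add up.\<close>

lemma joint_continuity:
  fixes Z :: "'b::metric_space \<Rightarrow> real \<Rightarrow> 'c::real_normed_vector"
  assumes t: "\<And>p. p \<in> V \<Longrightarrow> continuous_on I (Z p)"
    and p: "\<And>p \<epsilon>. p \<in> V \<Longrightarrow> \<epsilon> > 0 \<Longrightarrow> \<exists>\<delta>>0. \<forall>q\<in>V. dist q p < \<delta> \<longrightarrow> (\<forall>t\<in>I. norm (Z q t - Z p t) \<le> \<epsilon>)"
  shows "continuous_on (V \<times> I) (\<lambda>(p, t). Z p t)"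
  unfolding continuous_on_iff
proof (intro ballI allI impI)
  fix x :: "'b \<times> real" and \<epsilon> :: real assume x: "x \<in> V \<times> I" and \<epsilon>: "\<epsilon> > 0"
  obtain a s where as: "x = (a, s)" "a \<in> V" "s \<in> I" using x by auto
  obtain d1 where d1: "d1 > 0" "\<And>q t. q \<in> V \<Longrightarrow> dist q a < d1 \<Longrightarrow> t \<in> I \<Longrightarrow> norm (Z q t - Z a t) \<le> \<epsilon>/2"
    using p[OF as(2), of "\<epsilon>/2"] \<epsilon> by auto
  obtain d2 where d2: "d2 > 0" "\<And>t. t \<in> I \<Longrightarrow> dist t s < d2 \<Longrightarrow> dist (Z a t) (Z a s) < \<epsilon>/2"
    using t[OF as(2)] as(3) \<epsilon> unfolding continuous_on_iff by (meson half_gt_zero)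
  show "\<exists>d>0. \<forall>x'\<in>V \<times> I. dist x' x < d \<longrightarrow> dist (case x' of (p, t) \<Rightarrow> Z p t) (case x of (p, t) \<Rightarrow> Z p t) < \<epsilon>"
  proof (intro exI[of _ "min d1 d2"] conjI ballI impI)
    fix x' assume x': "x' \<in> V \<times> I" "dist x' x < min d1 d2"
    obtain q r where qr: "x' = (q, r)" "q \<in> V" "r \<in> I" using x' by auto
    have "dist q a < d1" "dist r s < d2"
      using x'(2) dist_fst_le[of x' x] dist_snd_le[of x' x] by (auto simp: qr as)
    then have "dist (Z q r) (Z a r) \<le> \<epsilon>/2" "dist (Z a r) (Z a s) < \<epsilon>/2"
      using d1(2) d2(2) qr by (auto simp: dist_norm)
    then have "dist (Z q r) (Z a s) < \<epsilon>" using dist_triangle[of "Z q r" "Z a s" "Z a r"] by linarith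
    then show "dist (case x' of (p, t) \<Rightarrow> Z p t) (case x of (p, t) \<Rightarrow> Z p t) < \<epsilon>"
      by (simp add: qr as)
  qed (use d1 d2 in auto)
qed

locale C1_flow =
  fixes T :: real and D U :: "'a::euclidean_space set"
    and f :: "real \<Rightarrow> 'a \<Rightarrow> 'a" and f' :: "real \<Rightarrow> 'a \<Rightarrow> 'a \<Rightarrow>\<^sub>L 'a"
    and Y :: "'a \<Rightarrow> real \<Rightarrow> 'a"
  assumes T_pos: "0 < T" and open_D: "open D" and open_U: "open U"
    and deriv: "\<And>t y. t \<in> {0..T} \<Longrightarrow> y \<in> D \<Longrightarrow> (f t has_derivative blinfun_apply (f' t y)) (at y)"
    and cont_f: "continuous_on ({0..T} \<times> D) (\<lambda>(t, y). f t y)"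
    and cont_f': "continuous_on ({0..T} \<times> D) (\<lambda>(t, y). f' t y)"
    and sol: "\<And>p t. p \<in> U \<Longrightarrow> t \<in> {0..T} \<Longrightarrow>
      (Y p has_vector_derivative f t (Y p t)) (at t within {0..T})"
    and init: "\<And>p. p \<in> U \<Longrightarrow> Y p 0 = p"
    and in_D: "\<And>p t. p \<in> U \<Longrightarrow> t \<in> {0..T} \<Longrightarrow> Y p t \<in> D"
begin

lemma cont_Y: "p \<in> U \<Longrightarrow> continuous_on {0..T} (Y p)"
  by (rule continuous_on_vector_derivative[OF sol])

lemma compact_trajectory: "p \<in> U \<Longrightarrow> compact (Y p ` {0..T})"
  by (intro compact_continuous_image cont_Y) auto

text \<open>Local bounds on the field and its derivative hold uniformly near a compact set, since a closed
  neighbourhood of it is still compact and inside the domain.  The last clause is uniform continuity of the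
  derivative, integrated along a segment.\<close>

lemma tube:
  assumes C: "compact C" "C \<subseteq> D"
  obtains \<eta> K where "\<eta> > 0" "K \<ge> 0" "\<forall>c\<in>C. cball c \<eta> \<subseteq> D"
    "\<forall>t\<in>{0..T}. \<forall>c\<in>C. \<forall>y\<in>cball c \<eta>. norm (f' t y) \<le> K \<and> norm (f t y - f t c) \<le> K * norm (y - c)"
    "\<forall>\<epsilon>>0. \<exists>\<delta>>0. \<delta> \<le> \<eta> \<and> (\<forall>t\<in>{0..T}. \<forall>c\<in>C. \<forall>y\<in>cball c \<delta>. norm (f' t y - f' t c) \<le> \<epsilon> \<and>
        norm (f t y - f t c - f' t c (y - c)) \<le> \<epsilon> * norm (y - c))"
proof -
  obtain \<eta> where \<eta>: "\<eta> > 0" "(\<Union>c\<in>C. cball c \<eta>) \<subseteq> D"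
    using compact_subset_open_imp_cball_epsilon_subset[OF C(1) open_D C(2)] .
  define C' where "C' = (\<Union>c\<in>C. cball c \<eta>)"
  have C': "compact ({0..T} \<times> C')" "{0..T} \<times> C' \<subseteq> {0..T} \<times> D"
    unfolding C'_def using \<eta> by (auto intro!: compact_Times compact_minkowski_sum_cball C)
  note cf' = continuous_on_subset[OF cont_f' C'(2)]
  have "bounded ((\<lambda>(t, y). f' t y) ` ({0..T} \<times> C'))"
    by (intro compact_imp_bounded compact_continuous_image cf' C')
  then obtain K where K: "K > 0" "\<And>t y. t \<in> {0..T} \<Longrightarrow> y \<in> C' \<Longrightarrow> norm (f' t y) \<le> K"
    unfolding bounded_pos by (auto simp: image_iff)
  have inC': "y \<in> C'" if "c \<in> C" "y \<in> cball c \<eta>" for c y using that by (auto simp: C'_def)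
  have inD: "y \<in> D" if "c \<in> C" "y \<in> cball c \<eta>" for c y using that \<eta>(2) by blast
  have lip: "norm (f t y - f t c) \<le> K * norm (y - c)"
      if "t \<in> {0..T}" "c \<in> C" "y \<in> cball c \<eta>" for t c y
    proof (rule differentiable_bound[OF convex_cball[of c \<eta>], where f' = "\<lambda>u. blinfun_apply (f' t u)"])
      fix u assume "u \<in> cball c \<eta>"
      then show "(f t has_derivative blinfun_apply (f' t u)) (at u within cball c \<eta>)"
        "onorm (blinfun_apply (f' t u)) \<le> K"
        using that(1,2) inD inC' K(2) unfolding norm_blinfun.rep_eq[symmetric]
        by (blast intro: has_derivative_at_withinI deriv)+
    qed (use that \<eta> in auto)
  have diff: "\<exists>\<delta>>0. \<delta> \<le> \<eta> \<and> (\<forall>t\<in>{0..T}. \<forall>c\<in>C. \<forall>y\<in>cball c \<delta>. norm (f' t y - f' t c) \<le> \<epsilon> \<and>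
        norm (f t y - f t c - f' t c (y - c)) \<le> \<epsilon> * norm (y - c))" if \<epsilon>: "\<epsilon> > 0" for \<epsilon>
  proof -
    have "uniformly_continuous_on ({0..T} \<times> C') (\<lambda>(t, y). f' t y)"
      by (rule compact_uniformly_continuous[OF cf' C'(1)])
    then obtain d where d: "d > 0" and dd: "\<And>x x'. x \<in> {0..T} \<times> C' \<Longrightarrow> x' \<in> {0..T} \<times> C' \<Longrightarrow>
        dist x' x < d \<Longrightarrow> dist (case x' of (t, y) \<Rightarrow> f' t y) (case x of (t, y) \<Rightarrow> f' t y) < \<epsilon>"
      unfolding uniformly_continuous_on_def using \<epsilon> by metis
    define \<delta> where "\<delta> = min (d/2) \<eta>"
    have \<delta>: "\<delta> > 0" "\<delta> \<le> \<eta>" "\<delta> < d" using d \<eta> by (auto simp: \<delta>_def min_def)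
    have close: "norm (f' t y - f' t c) \<le> \<epsilon>" if "t \<in> {0..T}" "c \<in> C" "y \<in> cball c \<delta>" for t c y
    proof -
      have "y \<in> C'" "c \<in> C'" using that \<delta> \<eta> inC'[of c y] inC'[of c c] by auto
      then show ?thesis using dd[of "(t, c)" "(t, y)"] that \<delta>
        by (auto simp: dist_Pair_Pair dist_norm norm_minus_commute)
    qed
    have 2: "norm (f t y - f t c - f' t c (y - c)) \<le> \<epsilon> * norm (y - c)"
      if t: "t \<in> {0..T}" and c: "c \<in> C" and y: "y \<in> cball c \<delta>" for t c y
    proof -
      let ?g = "\<lambda>u. f t u - f' t c u"
      have "norm (?g y - ?g c) \<le> \<epsilon> * norm (y - c)"
      proof (rule differentiable_bound[OF convex_cball[of c \<delta>], where f' = "\<lambda>u. blinfun_apply (f' t u - f' t c)"])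
        fix u assume u: "u \<in> cball c \<delta>"
        then have "u \<in> D" using inD[OF c, of u] \<delta> by auto
        then have 1: "(f t has_derivative blinfun_apply (f' t u)) (at u within cball c \<delta>)"
          by (rule has_derivative_at_withinI[OF deriv[OF t]])
        have 2: "(blinfun_apply (f' t c) has_derivative blinfun_apply (f' t c)) (at u within cball c \<delta>)"
          by (rule bounded_linear_imp_has_derivative[OF blinfun.bounded_linear_right])
        have 3: "blinfun_apply (f' t u - f' t c) = (\<lambda>v. f' t u v - f' t c v)"
          by (rule ext) (rule blinfun.diff_left)
        show "(?g has_derivative blinfun_apply (f' t u - f' t c)) (at u within cball c \<delta>)"
          unfolding 3 by (rule has_derivative_diff[OF 1 2])
        show "onorm (blinfun_apply (f' t u - f' t c)) \<le> \<epsilon>"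
          using close[OF t c u] unfolding norm_blinfun.rep_eq .
      qed (use y \<delta> in auto)
      then show ?thesis by (simp add: blinfun.diff_right algebra_simps)
    qed
    show "\<exists>\<delta>>0. \<delta> \<le> \<eta> \<and> (\<forall>t\<in>{0..T}. \<forall>c\<in>C. \<forall>y\<in>cball c \<delta>. norm (f' t y - f' t c) \<le> \<epsilon> \<and>
        norm (f t y - f t c - f' t c (y - c)) \<le> \<epsilon> * norm (y - c))"
      using close 2 \<delta> by blast
  qed
  have "\<forall>t\<in>{0..T}. \<forall>c\<in>C. \<forall>y\<in>cball c \<eta>. norm (f' t y) \<le> K \<and> norm (f t y - f t c) \<le> K * norm (y - c)"
    using lip K(2) inC' by blast
  moreover have "\<forall>c\<in>C. cball c \<eta> \<subseteq> D" using inD by blast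
  ultimately show ?thesis using that[OF \<eta>(1) less_imp_le[OF K(1)]] diff by blast
qed

text \<open>A Lipschitz constant of the field is available only in a tube around \<open>C\<close>.  The smallness of the
  residual keeps the perturbed path \<open>z\<close> in that tube.\<close>

lemma stability:
  assumes C: "compact C" "C \<subseteq> D"
  obtains \<eta> A where "\<eta> > 0" "A \<ge> 1"
    "\<forall>y z r B. (\<forall>t\<in>{0..T}. (y has_vector_derivative f t (y t)) (at t within {0..T}) \<and> y t \<in> C \<and>
        (z has_vector_derivative f t (z t) + r t) (at t within {0..T})) \<longrightarrow>
      continuous_on {0..T} r \<longrightarrow>
      (norm (z 0 - y 0))\<^sup>2 + integral {0..T} (\<lambda>t. (norm (r t))\<^sup>2) \<le> B \<longrightarrow> A * B < \<eta>\<^sup>2 \<longrightarrow>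
      (\<forall>t\<in>{0..T}. (norm (z t - y t))\<^sup>2 \<le> A * B)"
proof -
  obtain \<eta> K where \<eta>: "\<eta> > 0" and K: "K \<ge> 0" and lip: "\<forall>t\<in>{0..T}. \<forall>c\<in>C. \<forall>y\<in>cball c \<eta>.
      norm (f' t y) \<le> K \<and> norm (f t y - f t c) \<le> K * norm (y - c)"
    by (rule tube[OF C]) blast
  define A where "A = exp ((2 * K + 1) * T)"
  have A1: "A \<ge> 1" using K T_pos by (simp add: A_def)
  show ?thesis
  proof (rule that[OF \<eta> A1], intro allI impI)
    fix y z r :: "real \<Rightarrow> 'a" and B :: real
    assume yz: "\<forall>t\<in>{0..T}. (y has_vector_derivative f t (y t)) (at t within {0..T}) \<and> y t \<in> C \<and>
        (z has_vector_derivative f t (z t) + r t) (at t within {0..T})"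
      and r: "continuous_on {0..T} r"
      and B: "(norm (z 0 - y 0))\<^sup>2 + integral {0..T} (\<lambda>t. (norm (r t))\<^sup>2) \<le> B"
      and AB: "A * B < \<eta>\<^sup>2"
    note y = bspec[OF yz, THEN conjunct1] and yC = bspec[OF yz, THEN conjunct2, THEN conjunct1]
      and z = bspec[OF yz, THEN conjunct2, THEN conjunct2]
    let ?e = "\<lambda>t. z t - y t"
    have e: "(?e has_vector_derivative (f t (z t) - f t (y t)) + r t) (at t within {0..T})"
      if "t \<in> {0..T}" for t
      using has_vector_derivative_diff[OF z[OF that] y[OF that]] by (simp add: algebra_simps)
    have r2: "continuous_on {0..T} (\<lambda>t. (norm (r t))\<^sup>2)" using r by (intro continuous_intros)
    have ce: "continuous_on {0..T} (\<lambda>t. norm (?e t))"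
      by (intro continuous_on_norm continuous_on_vector_derivative[OF e])
    \<comment> \<open>The Lipschitz bound is at hand only while \<open>z\<close> stays in the tube, so the estimate carries that proviso.\<close>
    have key: "(norm (?e s))\<^sup>2 \<le> A * B" if s: "s \<in> {0..T}" and le: "\<forall>t\<in>{0..s}. norm (?e t) \<le> \<eta>" for s
    proof -
      have I: "integral {0..s} (\<lambda>t. (norm (r t))\<^sup>2) \<le> integral {0..T} (\<lambda>t. (norm (r t))\<^sup>2)"
        using s by (intro integral_subset_le integrable_continuous_real continuous_on_subset[OF r2]) auto
      have I0: "0 \<le> integral {0..s} (\<lambda>t. (norm (r t))\<^sup>2)"
        using s by (intro integral_nonneg integrable_continuous_real continuous_on_subset[OF r2]) auto
      have "(norm (?e s))\<^sup>2 \<le> exp ((2 * K + 1) * s) * ((norm (?e 0))\<^sup>2 + integral {0..s} (\<lambda>t. (norm (r t))\<^sup>2))"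
      proof (rule gronwall_norm_square[where a = "\<lambda>t. f t (z t) - f t (y t)"])
        fix t assume t: "t \<in> {0..s}"
        then show "(?e has_vector_derivative (f t (z t) - f t (y t)) + r t) (at t within {0..s})"
          using s by (intro has_vector_derivative_within_subset[OF e]) auto
        show "norm (f t (z t) - f t (y t)) \<le> K * norm (?e t)"
          using t s le yC[of t] by (intro lip[rule_format, THEN conjunct2]) (auto simp: dist_norm norm_minus_commute)
      qed (use s K continuous_on_subset[OF r] in auto)
      also have "\<dots> \<le> A * B"
        unfolding A_def using s K B I I0 by (intro mult_mono) (auto intro!: mult_left_mono)
      finally show ?thesis .
    qed
    \<comment> \<open>The bound \<open>A * B < \<eta>\<^sup>2\<close> excludes a first exit from the tube, which removes the proviso.\<close>
    have lt: "norm (?e t) < \<eta>" if "t \<in> {0..T}" for t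
    proof (rule stays_below_if_no_first_exit[OF ce _ _ that])
      have "0 \<le> integral {0..T} (\<lambda>t. (norm (r t))\<^sup>2)"
        by (intro integral_nonneg integrable_continuous_real r2) auto
      then have "(norm (?e 0))\<^sup>2 \<le> B" "0 \<le> B" using B zero_le_power2[of "norm (?e 0)"] by linarith+
      then have "(norm (?e 0))\<^sup>2 \<le> A * B" using A1 mult_right_mono[of 1 A B] by linarith
      then show "norm (?e 0) < \<eta>" using AB \<eta> by (intro power2_less_imp_less[of _ \<eta>]) auto
      show "norm (?e s) < \<eta>" if "s \<in> {0..T}" "\<forall>t\<in>{0..s}. norm (?e t) \<le> \<eta>" for s
        using key[OF that] AB \<eta> by (intro power2_less_imp_less[of _ \<eta>]) auto
    qed
    show "\<forall>t\<in>{0..T}. (norm (?e t))\<^sup>2 \<le> A * B"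
    proof
      fix t assume "t \<in> {0..T}"
      then show "(norm (?e t))\<^sup>2 \<le> A * B"
        using lt by (intro key ballI less_imp_le) auto
    qed
  qed
qed

section \<open>Lipschitz dependence on the initial value\<close>

text \<open>Two exact solutions are compared by taking the residual to be zero.\<close>

lemma flow_lipschitz:
  assumes p: "p \<in> U"
  obtains \<delta> A where "\<delta> > 0" "A \<ge> 0" "ball p \<delta> \<subseteq> U"
    "\<And>q t. q \<in> ball p \<delta> \<Longrightarrow> t \<in> {0..T} \<Longrightarrow> norm (Y q t - Y p t) \<le> A * norm (q - p)"
proof -
  have C: "compact (Y p ` {0..T})" "Y p ` {0..T} \<subseteq> D"
    using compact_trajectory[OF p] in_D[OF p] by auto
  obtain \<eta> A where \<eta>: "\<eta> > 0" and A: "A \<ge> 1" and st: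
    "\<forall>y z r B. (\<forall>t\<in>{0..T}. (y has_vector_derivative f t (y t)) (at t within {0..T}) \<and> y t \<in> Y p ` {0..T} \<and>
        (z has_vector_derivative f t (z t) + r t) (at t within {0..T})) \<longrightarrow>
      continuous_on {0..T} r \<longrightarrow>
      (norm (z 0 - y 0))\<^sup>2 + integral {0..T} (\<lambda>t. (norm (r t))\<^sup>2) \<le> B \<longrightarrow> A * B < \<eta>\<^sup>2 \<longrightarrow>
      (\<forall>t\<in>{0..T}. (norm (z t - y t))\<^sup>2 \<le> A * B)"
    by (rule stability[OF C]) blast
  obtain \<delta>0 where \<delta>0: "\<delta>0 > 0" "ball p \<delta>0 \<subseteq> U" using open_U p open_contains_ball by blast
  define \<delta> where "\<delta> = min \<delta>0 (\<eta> / sqrt A)"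
  have "\<delta> > 0" using \<delta>0 \<eta> A by (simp add: \<delta>_def)
  moreover have "ball p \<delta> \<subseteq> U" using \<delta>0 by (auto simp: \<delta>_def)
  moreover have "norm (Y q t - Y p t) \<le> sqrt A * norm (q - p)"
    if q: "q \<in> ball p \<delta>" and t: "t \<in> {0..T}" for q t
  proof -
    have qU: "q \<in> U" using q \<open>ball p \<delta> \<subseteq> U\<close> by auto
    have "norm (q - p) < \<eta> / sqrt A" using q by (simp add: \<delta>_def dist_norm norm_minus_commute)
    then have "sqrt A * norm (q - p) < \<eta>" using A by (simp add: field_simps)
    then have "(sqrt A * norm (q - p))\<^sup>2 < \<eta>\<^sup>2" using A by (intro power_strict_mono) auto
    then have lt: "A * (norm (q - p))\<^sup>2 < \<eta>\<^sup>2" using A by (simp add: power_mult_distrib)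
    have "\<forall>t\<in>{0..T}. (norm (Y q t - Y p t))\<^sup>2 \<le> A * (norm (q - p))\<^sup>2"
      by (rule ballI, rule st[rule_format, where r = "\<lambda>_. 0"]) (use sol[OF p] sol[OF qU] lt in \<open>auto simp: init p qU\<close>)
    then have "(norm (Y q t - Y p t))\<^sup>2 \<le> (sqrt A * norm (q - p))\<^sup>2"
      using t A by (simp add: power_mult_distrib)
    then show ?thesis by (rule power2_le_imp_le) (use A in auto)
  qed
  ultimately show ?thesis using A by (intro that[of \<delta> "sqrt A"]) auto
qed

lemma cont_Y_joint: "continuous_on (U \<times> {0..T}) (\<lambda>(p, t). Y p t)"
proof (rule joint_continuity)
  fix p and \<epsilon> :: real assume p: "p \<in> U" and \<epsilon>: "\<epsilon> > 0"
  obtain \<delta> A where *: "\<delta> > 0" "A \<ge> 0"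
    "\<And>q t. q \<in> ball p \<delta> \<Longrightarrow> t \<in> {0..T} \<Longrightarrow> norm (Y q t - Y p t) \<le> A * norm (q - p)"
    using flow_lipschitz[OF p] by metis
  show "\<exists>\<delta>>0. \<forall>q\<in>U. dist q p < \<delta> \<longrightarrow> (\<forall>t\<in>{0..T}. norm (Y q t - Y p t) \<le> \<epsilon>)"
  proof (intro exI[of _ "min \<delta> (\<epsilon> / (A + 1))"] conjI ballI impI)
    fix q t assume q: "dist q p < min \<delta> (\<epsilon> / (A + 1))" and t: "t \<in> {0..T}"
    have "norm (Y q t - Y p t) \<le> A * norm (q - p)" using q t by (intro *) (auto simp: dist_commute)
    also have "\<dots> \<le> (A + 1) * (\<epsilon> / (A + 1))" using q * by (intro mult_mono) (auto simp: dist_norm)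
    finally show "norm (Y q t - Y p t) \<le> \<epsilon>" using * by simp
  qed (use * \<epsilon> in auto)
qed (rule cont_Y)

text \<open>The coefficients of the variational equation at nearby initial values, and the linearisation
  error relative to \<open>norm (q - p)\<close>.  Both come from the tube around the trajectory, in which
  nearby trajectories lie.\<close>

lemma coefficient_bounds:
  assumes p: "p \<in> U"
  obtains K where "K \<ge> 0" "\<And>t. t \<in> {0..T} \<Longrightarrow> norm (f' t (Y p t)) \<le> K"
    "\<And>\<epsilon>. \<epsilon> > 0 \<Longrightarrow> \<exists>\<delta>>0. \<forall>q\<in>ball p \<delta>. q \<in> U \<and> (\<forall>t\<in>{0..T}.
        norm (f' t (Y q t)) \<le> K \<and> norm (f' t (Y q t) - f' t (Y p t)) \<le> \<epsilon> \<and>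
        norm (f t (Y q t) - f t (Y p t) - f' t (Y p t) (Y q t - Y p t)) \<le> \<epsilon> * norm (q - p))"
proof -
  have C: "compact (Y p ` {0..T})" "Y p ` {0..T} \<subseteq> D"
    using compact_trajectory[OF p] in_D[OF p] by auto
  obtain \<eta> K where \<eta>: "\<eta> > 0" and K0: "K \<ge> 0"
    and tb: "\<forall>t\<in>{0..T}. \<forall>c\<in>Y p ` {0..T}. \<forall>y\<in>cball c \<eta>. norm (f' t y) \<le> K \<and> norm (f t y - f t c) \<le> K * norm (y - c)"
    and u: "\<forall>\<epsilon>>0. \<exists>\<delta>>0. \<delta> \<le> \<eta> \<and> (\<forall>t\<in>{0..T}. \<forall>c\<in>Y p ` {0..T}. \<forall>y\<in>cball c \<delta>. norm (f' t y - f' t c) \<le> \<epsilon> \<and>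
        norm (f t y - f t c - f' t c (y - c)) \<le> \<epsilon> * norm (y - c))"
    by (rule tube[OF C]) blast
  have K: "norm (f' t y) \<le> K" if "t \<in> {0..T}" "c \<in> Y p ` {0..T}" "y \<in> cball c \<eta>" for t c y
    using tb that by blast
  obtain d A where d: "d > 0" and A: "A \<ge> 0" and dU: "ball p d \<subseteq> U" and
    lip: "\<And>q t. q \<in> ball p d \<Longrightarrow> t \<in> {0..T} \<Longrightarrow> norm (Y q t - Y p t) \<le> A * norm (q - p)"
    using flow_lipschitz[OF p] by metis
  show ?thesis
  proof (rule that[OF K0])
    show "norm (f' t (Y p t)) \<le> K" if "t \<in> {0..T}" for t
      using that \<eta> by (intro K[of t "Y p t"]) auto
  next
    fix \<epsilon> :: real assume \<epsilon>: "\<epsilon> > 0"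
    define \<epsilon>' where "\<epsilon>' = min \<epsilon> (\<epsilon> / (A + 1))"
    have \<epsilon>': "\<epsilon>' > 0" "\<epsilon>' \<le> \<epsilon>" "\<epsilon>' * A \<le> \<epsilon>"
    proof -
      show "\<epsilon>' > 0" "\<epsilon>' \<le> \<epsilon>" using \<epsilon> A by (auto simp: \<epsilon>'_def)
      have "\<epsilon>' * A \<le> (\<epsilon> / (A + 1)) * (A + 1)" using \<epsilon> A by (intro mult_mono) (auto simp: \<epsilon>'_def)
      then show "\<epsilon>' * A \<le> \<epsilon>" using A by simp
    qed
    obtain \<delta> where \<delta>: "\<delta> > 0" "\<delta> \<le> \<eta>" and close: "\<And>t c y. t \<in> {0..T} \<Longrightarrow> c \<in> Y p ` {0..T} \<Longrightarrow> y \<in> cball c \<delta> \<Longrightarrow>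
        norm (f' t y - f' t c) \<le> \<epsilon>' \<and> norm (f t y - f t c - f' t c (y - c)) \<le> \<epsilon>' * norm (y - c)"
      using u[rule_format, OF \<epsilon>'(1)] by blast
    define r where "r = min d (\<delta> / (A + 1))"
    have r: "r > 0" "r \<le> d" using d \<delta> A by (auto simp: r_def)
    show "\<exists>\<delta>>0. \<forall>q\<in>ball p \<delta>. q \<in> U \<and> (\<forall>t\<in>{0..T}.
        norm (f' t (Y q t)) \<le> K \<and> norm (f' t (Y q t) - f' t (Y p t)) \<le> \<epsilon> \<and>
        norm (f t (Y q t) - f t (Y p t) - f' t (Y p t) (Y q t - Y p t)) \<le> \<epsilon> * norm (q - p))"
    proof (intro exI[of _ r] conjI ballI)
      fix q assume q: "q \<in> ball p r"
      then have qd: "q \<in> ball p d" using r by auto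
      then show "q \<in> U" using dU by auto
      fix t assume t: "t \<in> {0..T}"
      have l: "norm (Y q t - Y p t) \<le> A * norm (q - p)" by (rule lip[OF qd t])
      also have "\<dots> \<le> (A + 1) * (\<delta> / (A + 1))"
        using q A by (intro mult_mono) (auto simp: r_def dist_norm norm_minus_commute)
      finally have "norm (Y q t - Y p t) \<le> \<delta>" using A by simp
      then have near: "Y q t \<in> cball (Y p t) \<delta>" by (simp add: dist_norm norm_minus_commute)
      have c: "Y p t \<in> Y p ` {0..T}" using t by auto
      show "norm (f' t (Y q t)) \<le> K" by (rule K[OF t c]) (use near \<delta> in auto)
      note cl = close[OF t c near]
      show "norm (f' t (Y q t) - f' t (Y p t)) \<le> \<epsilon>" using cl \<epsilon>'(2) by linarith
      have "\<epsilon>' * norm (Y q t - Y p t) \<le> \<epsilon>' * (A * norm (q - p))"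
        using l \<epsilon>' by (intro mult_left_mono) auto
      also have "\<dots> \<le> \<epsilon> * norm (q - p)"
        using mult_right_mono[OF \<epsilon>'(3), of "norm (q - p)"] by (simp add: mult.assoc)
      finally show "norm (f t (Y q t) - f t (Y p t) - f' t (Y p t) (Y q t - Y p t)) \<le> \<epsilon> * norm (q - p)"
        using cl by linarith
    qed (use r in auto)
  qed
qed

section \<open>The directional derivative of a flow\<close>

lemma cont_field_along:
  assumes "continuous_on {0..T} y" "\<And>t. t \<in> {0..T} \<Longrightarrow> y t \<in> D"
  shows "continuous_on {0..T} (\<lambda>t. f t (y t))" "continuous_on {0..T} (\<lambda>t. f' t (y t))"
proof -
  have c: "continuous_on {0..T} (\<lambda>t. (t, y t))" using assms(1) by (intro continuous_intros)
  have im: "(\<lambda>t. (t, y t)) ` {0..T} \<subseteq> {0..T} \<times> D" using assms(2) by auto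
  show "continuous_on {0..T} (\<lambda>t. f t (y t))" "continuous_on {0..T} (\<lambda>t. f' t (y t))"
    using continuous_on_compose2[OF cont_f c im] continuous_on_compose2[OF cont_f' c im] by simp_all
qed

lemma cont_along_flow:
  assumes "p \<in> U"
  shows "continuous_on {0..T} (\<lambda>t. f t (Y p t))" "continuous_on {0..T} (\<lambda>t. f' t (Y p t))"
  by (intro cont_field_along cont_Y in_D assms; assumption)+

text \<open>The difference quotients solve the variational equation up to an error that tends to zero
  uniformly in time, so by Gronwall they form a Cauchy family.  This yields the solution of the variational
  equation and the derivative of the flow at once.\<close>

lemma derivative_flow_exists:
  assumes p: "p \<in> U"
  shows "\<exists>W. W 0 = v \<and>
    (\<forall>t\<in>{0..T}. (W has_vector_derivative f' t (Y p t) (W t)) (at t within {0..T})) \<and>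
    (\<forall>\<epsilon>>0. \<exists>\<delta>>0. \<forall>h. h \<noteq> 0 \<and> \<bar>h\<bar> < \<delta> \<longrightarrow> (\<forall>t\<in>{0..T}.
        norm ((1 / h) *\<^sub>R (Y (p + h *\<^sub>R v) t - Y p t) - W t) \<le> \<epsilon>))"
proof -
  \<comment> \<open>The difference quotient \<open>q h\<close> solves the variational equation up to the linearisation error \<open>r h\<close>.\<close>
  define q where "q h t = (1 / h) *\<^sub>R (Y (p + h *\<^sub>R v) t - Y p t)" for h t
  define r where "r h t = (1 / h) *\<^sub>R (f t (Y (p + h *\<^sub>R v) t) - f t (Y p t) -
      f' t (Y p t) (Y (p + h *\<^sub>R v) t - Y p t))" for h t
  obtain K where K: "K \<ge> 0" "\<And>t. t \<in> {0..T} \<Longrightarrow> norm (f' t (Y p t)) \<le> K" and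
    cb: "\<forall>\<epsilon>>0. \<exists>\<delta>>0. \<forall>q\<in>ball p \<delta>. q \<in> U \<and> (\<forall>t\<in>{0..T}.
        norm (f' t (Y q t)) \<le> K \<and> norm (f' t (Y q t) - f' t (Y p t)) \<le> \<epsilon> \<and>
        norm (f t (Y q t) - f t (Y p t) - f' t (Y p t) (Y q t - Y p t)) \<le> \<epsilon> * norm (q - p))"
    by (rule coefficient_bounds[OF p]) blast
  have small: "\<exists>\<delta>>0. \<forall>h. h \<noteq> 0 \<and> \<bar>h\<bar> < \<delta> \<longrightarrow> p + h *\<^sub>R v \<in> U \<and> (\<forall>t\<in>{0..T}. norm (r h t) \<le> \<epsilon>)"
    if \<epsilon>: "\<epsilon> > 0" for \<epsilon>
  proof -
    define c where "c = norm v + 1"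
    have c: "c > 0" "norm v \<le> c" by (auto simp: c_def intro: add_nonneg_pos)
    have "\<epsilon> / c > 0" using \<epsilon> c by simp
    then obtain \<delta> where \<delta>: "\<delta> > 0" and *: "\<forall>q\<in>ball p \<delta>. q \<in> U \<and> (\<forall>t\<in>{0..T}.
        norm (f' t (Y q t)) \<le> K \<and> norm (f' t (Y q t) - f' t (Y p t)) \<le> \<epsilon> / c \<and>
        norm (f t (Y q t) - f t (Y p t) - f' t (Y p t) (Y q t - Y p t)) \<le> \<epsilon> / c * norm (q - p))"
      using cb by blast
    show ?thesis
    proof (intro exI[of _ "\<delta> / c"] conjI allI impI ballI; (elim conjE)?)
      fix h :: real assume h: "h \<noteq> 0" "\<bar>h\<bar> < \<delta> / c"
      have "\<bar>h\<bar> * norm v \<le> \<bar>h\<bar> * c" using c by (intro mult_left_mono) auto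
      also have "\<dots> < \<delta>" using h c by (simp add: field_simps)
      finally have b: "p + h *\<^sub>R v \<in> ball p \<delta>" by (simp add: dist_norm)
      then show "p + h *\<^sub>R v \<in> U" using * by blast
      fix t assume t: "t \<in> {0..T}"
      have "norm (r h t) \<le> (1 / \<bar>h\<bar>) * (\<epsilon> / c * norm (p + h *\<^sub>R v - p))"
        unfolding r_def norm_scaleR using *[rule_format, OF b] t by (intro mult_mono) auto
      also have "\<dots> = \<epsilon> * (norm v / c)" using h by simp
      also have "\<dots> \<le> \<epsilon> * 1" using c \<epsilon> by (intro mult_left_mono) auto
      finally show "norm (r h t) \<le> \<epsilon>" by simp
    qed (use \<delta> c in auto)
  qed
  have q_der: "(q h has_vector_derivative f' t (Y p t) (q h t) + r h t) (at t within {0..T})"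
    if "h \<noteq> 0" "p + h *\<^sub>R v \<in> U" "t \<in> {0..T}" for h t
  proof -
    have "(q h has_vector_derivative (1 / h) *\<^sub>R (f t (Y (p + h *\<^sub>R v) t) - f t (Y p t))) (at t within {0..T})"
      unfolding q_def[abs_def]
      using has_vector_derivative_scaleR[OF DERIV_const has_vector_derivative_diff[OF sol[OF that(2,3)] sol[OF p that(3)]], of "1/h"]
      by simp
    moreover have "(1 / h) *\<^sub>R (f t (Y (p + h *\<^sub>R v) t) - f t (Y p t)) = f' t (Y p t) (q h t) + r h t"
      by (simp add: q_def r_def blinfun.scaleR_right blinfun.diff_right scaleR_diff_right)
    ultimately show ?thesis by simp
  qed
  have r_cont: "continuous_on {0..T} (r h)" if "p + h *\<^sub>R v \<in> U" for h
    unfolding r_def[abs_def]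
    by (intro continuous_intros blinfun.continuous_on cont_along_flow cont_Y p that)
  define c where "c = 2 * sqrt (exp ((2 * K + 1) * T) * T)"
  have c: "c > 0" using T_pos by (simp add: c_def)
  \<comment> \<open>Two quotients start at the same value \<open>v\<close>, so their distance is governed by the two errors alone.\<close>
  have cauchy: "norm (q h t - q k t) \<le> c * \<epsilon>"
    if hk: "h \<noteq> 0" "k \<noteq> 0" "p + h *\<^sub>R v \<in> U" "p + k *\<^sub>R v \<in> U"
      and rh: "\<And>t. t \<in> {0..T} \<Longrightarrow> norm (r h t) \<le> \<epsilon>" and rk: "\<And>t. t \<in> {0..T} \<Longrightarrow> norm (r k t) \<le> \<epsilon>"
      and t: "t \<in> {0..T}" for h k \<epsilon> t
  proof -
    have \<epsilon>: "\<epsilon> \<ge> 0" using rh[OF t] norm_ge_zero order_trans by blast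
    have cr: "continuous_on {0..T} (\<lambda>t. r h t - r k t)" by (intro continuous_intros r_cont hk)
    have "(norm (q h t - q k t))\<^sup>2 \<le> exp ((2 * K + 1) * T) *
      ((norm (q h 0 - q k 0))\<^sup>2 + integral {0..T} (\<lambda>s. (norm (r h s - r k s))\<^sup>2))"
    proof (rule gronwall_norm_square[where a = "\<lambda>t. f' t (Y p t) (q h t - q k t)"])
      fix t assume t: "t \<in> {0..T}"
      show "((\<lambda>t. q h t - q k t) has_vector_derivative f' t (Y p t) (q h t - q k t) + (r h t - r k t)) (at t within {0..T})"
        using has_vector_derivative_diff[OF q_der[OF hk(1,3) t] q_der[OF hk(2,4) t]]
        by (simp add: blinfun.diff_right algebra_simps)
      show "norm (f' t (Y p t) (q h t - q k t)) \<le> K * norm (q h t - q k t)"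
        by (rule order_trans[OF norm_blinfun mult_right_mono[OF K(2)[OF t]]]) simp
    qed (use t K cr in auto)
    also have "\<dots> \<le> exp ((2 * K + 1) * T) * (0 + T * (2 * \<epsilon>)\<^sup>2)"
    proof (intro mult_left_mono add_mono)
      have "q h 0 = v" "q k 0 = v" using hk by (auto simp: q_def init p)
      then show "(norm (q h 0 - q k 0))\<^sup>2 \<le> 0" by simp
      have "integral {0..T} (\<lambda>s. (norm (r h s - r k s))\<^sup>2) \<le> integral {0..T} (\<lambda>s. (2 * \<epsilon>)\<^sup>2)"
      proof (intro integral_le integrable_continuous_real continuous_intros r_cont hk power_mono)
        fix s assume s: "s \<in> {0..T}"
        show "norm (r h s - r k s) \<le> 2 * \<epsilon>"
          using norm_triangle_ineq4[of "r h s" "r k s"] rh[OF s] rk[OF s] by linarith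
      qed auto
      then show "integral {0..T} (\<lambda>s. (norm (r h s - r k s))\<^sup>2) \<le> T * (2 * \<epsilon>)\<^sup>2" using T_pos by simp
    qed auto
    also have "\<dots> = (c * \<epsilon>)\<^sup>2" using T_pos by (simp add: c_def power_mult_distrib)
    finally show ?thesis by (rule power2_le_imp_le) (use c \<epsilon> in simp)
  qed
  obtain \<delta>1 where \<delta>1: "\<delta>1 > 0" "\<And>h. h \<noteq> 0 \<Longrightarrow> \<bar>h\<bar> < \<delta>1 \<Longrightarrow> p + h *\<^sub>R v \<in> U"
    using small[of 1] by auto
  define h where "h n = \<delta>1 / real (n + 2)" for n
  have h: "h n \<noteq> 0" "p + h n *\<^sub>R v \<in> U" for n
  proof -
    show 1: "h n \<noteq> 0" using \<delta>1 by (simp add: h_def)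
    have "\<bar>h n\<bar> < \<delta>1" using \<delta>1 by (simp add: h_def divide_less_eq)
    then show "p + h n *\<^sub>R v \<in> U" using \<delta>1 1 by blast
  qed
  have h0: "h \<longlonglongrightarrow> 0"
    unfolding h_def by (rule LIMSEQ_ignore_initial_segment[OF lim_const_over_n])
  have ev_h: "\<forall>\<^sub>F n in sequentially. \<bar>h n\<bar> < \<delta>" if "\<delta> > 0" for \<delta>
    using order_tendstoD(2)[OF tendsto_rabs[OF h0]] that by simp
  have near: "\<exists>\<delta>>0. \<forall>a b. a \<noteq> 0 \<and> \<bar>a\<bar> < \<delta> \<and> b \<noteq> 0 \<and> \<bar>b\<bar> < \<delta> \<longrightarrow>
      (\<forall>t\<in>{0..T}. norm (q a t - q b t) \<le> \<epsilon> \<and> norm (r a t) \<le> \<epsilon>)" if \<epsilon>: "\<epsilon> > 0" for \<epsilon>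
  proof -
    have "min \<epsilon> (\<epsilon> / c) > 0" using \<epsilon> c by simp
    from small[OF this] obtain \<delta> where \<delta>: "\<delta> > 0"
      "\<And>h. h \<noteq> 0 \<Longrightarrow> \<bar>h\<bar> < \<delta> \<Longrightarrow> p + h *\<^sub>R v \<in> U"
      "\<And>h t. h \<noteq> 0 \<Longrightarrow> \<bar>h\<bar> < \<delta> \<Longrightarrow> t \<in> {0..T} \<Longrightarrow> norm (r h t) \<le> min \<epsilon> (\<epsilon> / c)"
      by blast
    show ?thesis
    proof (intro exI[of _ \<delta>] conjI allI impI ballI \<delta>(1); (elim conjE)?)
      fix a b t assume *: "a \<noteq> 0" "\<bar>a\<bar> < \<delta>" "b \<noteq> 0" "\<bar>b\<bar> < \<delta>" "t \<in> {0..T}"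
      have "norm (q a t - q b t) \<le> c * (\<epsilon> / c)"
        using * \<delta>(3)[of a] \<delta>(3)[of b] by (intro cauchy \<delta>(2)) auto
      then show "norm (q a t - q b t) \<le> \<epsilon>" using c by simp
      show "norm (r a t) \<le> \<epsilon>" using \<delta>(3)[of a t] * by auto
    qed
  qed
  define W where "W t = lim (\<lambda>n. q (h n) t)" for t
  have lim: "(\<lambda>n. q (h n) t) \<longlonglongrightarrow> W t" if t: "t \<in> {0..T}" for t
    unfolding W_def convergent_LIMSEQ_iff[symmetric]
  proof (rule Cauchy_convergent, rule metric_CauchyI)
    fix e :: real assume e: "e > 0"
    then obtain \<delta> where \<delta>: "\<delta> > 0" "\<And>a b. a \<noteq> 0 \<and> \<bar>a\<bar> < \<delta> \<and> b \<noteq> 0 \<and> \<bar>b\<bar> < \<delta> \<Longrightarrow> norm (q a t - q b t) \<le> e/2"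
      using near[of "e/2"] t by (metis half_gt_zero)
    obtain N where N: "\<And>n. n \<ge> N \<Longrightarrow> \<bar>h n\<bar> < \<delta>" using ev_h[OF \<delta>(1)] by (auto simp: eventually_sequentially)
    have "dist (q (h m) t) (q (h n) t) < e" if "m \<ge> N" "n \<ge> N" for m n
      using \<delta>(2)[of "h m" "h n"] N[OF that(1)] N[OF that(2)] h(1) e by (simp add: dist_norm)
    then show "\<exists>M. \<forall>m\<ge>M. \<forall>n\<ge>M. dist (q (h m) t) (q (h n) t) < e" by blast
  qed
  have unif: "\<exists>\<delta>>0. \<forall>a. a \<noteq> 0 \<and> \<bar>a\<bar> < \<delta> \<longrightarrow> (\<forall>t\<in>{0..T}. norm (q a t - W t) \<le> \<epsilon> \<and> norm (r a t) \<le> \<epsilon>)"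
    if \<epsilon>: "\<epsilon> > 0" for \<epsilon>
  proof -
    obtain \<delta> where d0: "\<delta> > 0" and d: "\<forall>a b. a \<noteq> 0 \<and> \<bar>a\<bar> < \<delta> \<and> b \<noteq> 0 \<and> \<bar>b\<bar> < \<delta> \<longrightarrow>
      (\<forall>t\<in>{0..T}. norm (q a t - q b t) \<le> \<epsilon> \<and> norm (r a t) \<le> \<epsilon>)"
      using near[OF \<epsilon>] by blast
    have \<delta>: "\<delta> > 0" "norm (q a t - q b t) \<le> \<epsilon> \<and> norm (r a t) \<le> \<epsilon>"
      if "a \<noteq> 0" "\<bar>a\<bar> < \<delta>" "b \<noteq> 0" "\<bar>b\<bar> < \<delta>" "t \<in> {0..T}" for a b t
      using d0 d that by blast+
    have "norm (q a t - W t) \<le> \<epsilon>" if a: "a \<noteq> 0" "\<bar>a\<bar> < \<delta>" and t: "t \<in> {0..T}" for a t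
    proof (rule tendsto_upperbound[OF tendsto_norm[OF tendsto_diff[OF tendsto_const lim[OF t]]]])
      show "\<forall>\<^sub>F n in sequentially. norm (q a t - q (h n) t) \<le> \<epsilon>"
        using ev_h[OF d0] by eventually_elim (use \<delta>(2)[OF a] h t in blast)
    qed simp
    then show ?thesis using d0 d by blast
  qed
  \<comment> \<open>The time derivatives converge uniformly as well, so the limit may be differentiated.\<close>
  have "\<exists>g. \<forall>t\<in>{0..T}. (\<lambda>n. q (h n) t) \<longlonglongrightarrow> g t \<and>
      (g has_derivative (\<lambda>s. s *\<^sub>R f' t (Y p t) (W t))) (at t within {0..T})"
  proof (rule has_derivative_sequence)
    show "(q (h n) has_derivative (\<lambda>s. s *\<^sub>R (f' t (Y p t) (q (h n) t) + r (h n) t))) (at t within {0..T})"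
      if "t \<in> {0..T}" for n t
      using q_der[OF h that] unfolding has_vector_derivative_def .
    show "0 \<in> {0..T}" "convex {0..T}" using T_pos by auto
    show "(\<lambda>n. q (h n) 0) \<longlonglongrightarrow> W 0" using T_pos by (intro lim) auto
    fix e :: real assume e: "e > 0"
    define e' where "e' = e / (K + 1)"
    have e': "e' > 0" "(K + 1) * e' = e" using e K by (auto simp: e'_def)
    obtain \<delta> where \<delta>: "\<delta> > 0" "\<And>a t. a \<noteq> 0 \<Longrightarrow> \<bar>a\<bar> < \<delta> \<Longrightarrow> t \<in> {0..T} \<Longrightarrow>
        norm (q a t - W t) \<le> e' \<and> norm (r a t) \<le> e'"
      using unif[OF e'(1)] by metis
    show "\<forall>\<^sub>F n in sequentially. \<forall>t\<in>{0..T}. \<forall>s. norm (s *\<^sub>R (f' t (Y p t) (q (h n) t) + r (h n) t) -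
        s *\<^sub>R f' t (Y p t) (W t)) \<le> e * norm s"
      using ev_h[OF \<delta>(1)]
    proof eventually_elim
      case (elim n)
      show ?case
      proof (intro ballI allI)
        fix t and s :: real assume t: "t \<in> {0..T}"
        note * = \<delta>(2)[OF h(1) elim t]
        have "norm (f' t (Y p t) (q (h n) t - W t)) \<le> K * e'"
          by (rule order_trans[OF norm_blinfun mult_mono[OF K(2)[OF t]]]) (use * K in auto)
        then have "norm (f' t (Y p t) (q (h n) t - W t) + r (h n) t) \<le> K * e' + e'"
          using * norm_triangle_ineq[of "f' t (Y p t) (q (h n) t - W t)" "r (h n) t"] by linarith
        also have "\<dots> = e" using e'(2) by (simp add: algebra_simps)
        finally have "norm (f' t (Y p t) (q (h n) t - W t) + r (h n) t) \<le> e" .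
        moreover have "s *\<^sub>R (f' t (Y p t) (q (h n) t) + r (h n) t) - s *\<^sub>R f' t (Y p t) (W t) =
            s *\<^sub>R (f' t (Y p t) (q (h n) t - W t) + r (h n) t)"
          by (simp add: blinfun.diff_right algebra_simps)
        ultimately show "norm (s *\<^sub>R (f' t (Y p t) (q (h n) t) + r (h n) t) -
            s *\<^sub>R f' t (Y p t) (W t)) \<le> e * norm s"
          by (simp only: norm_scaleR real_norm_def, subst mult.commute[of e], intro mult_left_mono) simp_all
      qed
    qed
  qed
  then obtain g where g: "\<And>t. t \<in> {0..T} \<Longrightarrow> (\<lambda>n. q (h n) t) \<longlonglongrightarrow> g t"
    "\<And>t. t \<in> {0..T} \<Longrightarrow> (g has_derivative (\<lambda>s. s *\<^sub>R f' t (Y p t) (W t))) (at t within {0..T})" by metis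
  have gW: "W t = g t" if "t \<in> {0..T}" for t using LIMSEQ_unique[OF lim[OF that] g(1)[OF that]] .
  have "(W has_vector_derivative f' t (Y p t) (W t)) (at t within {0..T})" if "t \<in> {0..T}" for t
    unfolding has_vector_derivative_def
    by (rule has_derivative_transform[OF that gW g(2)[OF that]])
  moreover have "W 0 = v"
  proof (rule LIMSEQ_unique[OF lim])
    show "(\<lambda>n. q (h n) 0) \<longlonglongrightarrow> v" using h by (simp add: q_def init p)
  qed (use T_pos in simp)
  moreover have "\<exists>\<delta>>0. \<forall>h. h \<noteq> 0 \<and> \<bar>h\<bar> < \<delta> \<longrightarrow> (\<forall>t\<in>{0..T}. norm (q h t - W t) \<le> \<epsilon>)"
    if "\<epsilon> > 0" for \<epsilon>
    using unif[OF that] by blast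
  ultimately show ?thesis
    unfolding q_def by (intro exI[of _ W] conjI ballI allI impI)
qed

section \<open>Continuity and linearity of the derivative\<close>

text \<open>Only the values on \<open>[0, T]\<close> are determined, which is why the path is chosen and not characterised.\<close>

definition flow_deriv :: "'a \<Rightarrow> 'a \<Rightarrow> real \<Rightarrow> 'a" where
  "flow_deriv p v = (SOME W. W 0 = v \<and>
    (\<forall>t\<in>{0..T}. (W has_vector_derivative f' t (Y p t) (W t)) (at t within {0..T})) \<and>
    (\<forall>\<epsilon>>0. \<exists>\<delta>>0. \<forall>h. h \<noteq> 0 \<and> \<bar>h\<bar> < \<delta> \<longrightarrow> (\<forall>t\<in>{0..T}.
        norm ((1 / h) *\<^sub>R (Y (p + h *\<^sub>R v) t - Y p t) - W t) \<le> \<epsilon>)))"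

lemma flow_deriv_spec:
  assumes p: "p \<in> U"
  shows flow_deriv_init: "flow_deriv p v 0 = v"
    and flow_deriv_sol: "t \<in> {0..T} \<Longrightarrow>
      (flow_deriv p v has_vector_derivative f' t (Y p t) (flow_deriv p v t)) (at t within {0..T})"
    and flow_deriv_quotient: "\<epsilon> > 0 \<Longrightarrow> \<exists>\<delta>>0. \<forall>h. h \<noteq> 0 \<and> \<bar>h\<bar> < \<delta> \<longrightarrow> (\<forall>t\<in>{0..T}.
        norm ((1 / h) *\<^sub>R (Y (p + h *\<^sub>R v) t - Y p t) - flow_deriv p v t) \<le> \<epsilon>)"
  using someI_ex[OF derivative_flow_exists[OF p, of v]] unfolding flow_deriv_def[symmetric] by auto

lemma flow_deriv_works:
  assumes p: "p \<in> U" and t: "t \<in> {0..T}"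
  shows "((\<lambda>s. Y (p + s *\<^sub>R v) t) has_vector_derivative flow_deriv p v t) (at 0)"
proof -
  have "((\<lambda>h. (1 / h) *\<^sub>R (Y (p + h *\<^sub>R v) t - Y p t)) \<longlongrightarrow> flow_deriv p v t) (at 0)"
  proof (rule tendstoI)
    fix e :: real assume e: "e > 0"
    obtain \<delta> where \<delta>: "\<delta> > 0" "\<And>h. h \<noteq> 0 \<Longrightarrow> \<bar>h\<bar> < \<delta> \<Longrightarrow>
        norm ((1 / h) *\<^sub>R (Y (p + h *\<^sub>R v) t - Y p t) - flow_deriv p v t) \<le> e/2"
      using flow_deriv_quotient[OF p, of "e/2" v] e t by (metis half_gt_zero)
    show "\<forall>\<^sub>F h in at 0. dist ((1 / h) *\<^sub>R (Y (p + h *\<^sub>R v) t - Y p t)) (flow_deriv p v t) < e"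
      unfolding eventually_at using \<delta> e by (intro exI[of _ \<delta>]) (fastforce simp: dist_norm)
  qed
  then have "((\<lambda>h. norm ((1 / h) *\<^sub>R (Y (p + h *\<^sub>R v) t - Y p t) - flow_deriv p v t)) \<longlongrightarrow> 0) (at 0)"
    by (intro tendsto_norm_zero LIM_zero)
  then have "((\<lambda>h. norm (Y (p + h *\<^sub>R v) t - Y p t - h *\<^sub>R flow_deriv p v t) / norm h) \<longlongrightarrow> 0) (at 0)"
  proof (rule Lim_transform_eventually)
    show "\<forall>\<^sub>F h in at 0. norm ((1 / h) *\<^sub>R (Y (p + h *\<^sub>R v) t - Y p t) - flow_deriv p v t) =
      norm (Y (p + h *\<^sub>R v) t - Y p t - h *\<^sub>R flow_deriv p v t) / norm h"
    proof (rule eventually_at_filter[THEN iffD2], rule always_eventually, intro allI impI)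
      fix h :: real assume h: "h \<noteq> 0"
      have *: "Y (p + h *\<^sub>R v) t - Y p t - h *\<^sub>R flow_deriv p v t =
          h *\<^sub>R ((1 / h) *\<^sub>R (Y (p + h *\<^sub>R v) t - Y p t) - flow_deriv p v t)"
        using h by (simp add: scaleR_diff_right)
      show "norm ((1 / h) *\<^sub>R (Y (p + h *\<^sub>R v) t - Y p t) - flow_deriv p v t) =
        norm (Y (p + h *\<^sub>R v) t - Y p t - h *\<^sub>R flow_deriv p v t) / norm h"
        unfolding * norm_scaleR using h by simp
    qed
  qed
  then show ?thesis
    unfolding has_vector_derivative_def has_derivative_at by (simp add: bounded_linear_scaleR_left)
qed

lemma cont_flow_deriv_time: "p \<in> U \<Longrightarrow> continuous_on {0..T} (flow_deriv p v)"
  by (rule continuous_on_vector_derivative[OF flow_deriv_sol])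

lemma linear_ode_bound:
  fixes A :: "real \<Rightarrow> 'a \<Rightarrow>\<^sub>L 'a"
  assumes A: "\<And>t. t \<in> {0..T} \<Longrightarrow> norm (A t) \<le> K" and K: "K \<ge> 0"
    and e: "\<And>t. t \<in> {0..T} \<Longrightarrow> (e has_vector_derivative blinfun_apply (A t) (e t) + r t) (at t within {0..T})"
    and r: "continuous_on {0..T} r" "\<And>t. t \<in> {0..T} \<Longrightarrow> norm (r t) \<le> \<epsilon>" and e0: "e 0 = 0" and t: "t \<in> {0..T}"
  shows "norm (e t) \<le> sqrt (exp ((2 * K + 1) * T) * T) * \<epsilon>"
proof (rule power2_le_imp_le)
  have \<epsilon>: "0 \<le> \<epsilon>" using r(2)[OF t] norm_ge_zero order_trans by blast
  then show "0 \<le> sqrt (exp ((2 * K + 1) * T) * T) * \<epsilon>" using T_pos by simp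
  have "(norm (e t))\<^sup>2 \<le> exp ((2 * K + 1) * T) * ((norm (e 0))\<^sup>2 + integral {0..T} (\<lambda>s. (norm (r s))\<^sup>2))"
  proof (rule gronwall_norm_square[where a = "\<lambda>t. blinfun_apply (A t) (e t)"])
    show "norm (blinfun_apply (A t) (e t)) \<le> K * norm (e t)" if "t \<in> {0..T}" for t
      by (rule order_trans[OF norm_blinfun mult_right_mono[OF A[OF that]]]) simp
  qed (use K e r t in auto)
  also have "\<dots> \<le> exp ((2 * K + 1) * T) * (0 + T * \<epsilon>\<^sup>2)"
  proof (intro mult_left_mono add_mono)
    have "integral {0..T} (\<lambda>s. (norm (r s))\<^sup>2) \<le> integral {0..T} (\<lambda>s. \<epsilon>\<^sup>2)"
      by (intro integral_le integrable_continuous_real continuous_intros r power_mono) auto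
    then show "integral {0..T} (\<lambda>s. (norm (r s))\<^sup>2) \<le> T * \<epsilon>\<^sup>2" using T_pos by simp
  qed (auto simp: e0)
  also have "\<dots> = (sqrt (exp ((2 * K + 1) * T) * T) * \<epsilon>)\<^sup>2" using T_pos by (simp add: power_mult_distrib)
  finally show "(norm (e t))\<^sup>2 \<le> (sqrt (exp ((2 * K + 1) * T) * T) * \<epsilon>)\<^sup>2" .
qed

text \<open>The derivatives at two initial values solve linear equations with nearby coefficients; their
  difference solves one with a small inhomogeneity.\<close>

lemma cont_flow_deriv: "continuous_on (U \<times> {0..T}) (\<lambda>(p, t). flow_deriv p v t)"
proof (rule joint_continuity[OF cont_flow_deriv_time])
  fix p and \<epsilon> :: real assume p: "p \<in> U" and \<epsilon>: "\<epsilon> > 0"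
  let ?W = "\<lambda>q. flow_deriv q v"
  obtain K where K: "K \<ge> 0" "\<And>t. t \<in> {0..T} \<Longrightarrow> norm (f' t (Y p t)) \<le> K" and
    cb: "\<forall>\<epsilon>>0. \<exists>\<delta>>0. \<forall>q\<in>ball p \<delta>. q \<in> U \<and> (\<forall>t\<in>{0..T}.
        norm (f' t (Y q t)) \<le> K \<and> norm (f' t (Y q t) - f' t (Y p t)) \<le> \<epsilon> \<and>
        norm (f t (Y q t) - f t (Y p t) - f' t (Y p t) (Y q t - Y p t)) \<le> \<epsilon> * norm (q - p))"
    by (rule coefficient_bounds[OF p]) blast
  have "bounded (?W p ` {0..T})"
    by (intro compact_imp_bounded compact_continuous_image cont_flow_deriv_time p) auto
  then obtain B where B: "B > 0" "\<And>t. t \<in> {0..T} \<Longrightarrow> norm (?W p t) \<le> B"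
    unfolding bounded_pos by auto
  define c where "c = sqrt (exp ((2 * K + 1) * T) * T)"
  have c: "c > 0" using T_pos by (simp add: c_def)
  have "\<epsilon> / (c * B) > 0" using \<epsilon> c B by simp
  then obtain \<delta> where \<delta>: "\<delta> > 0" and *: "\<forall>q\<in>ball p \<delta>. q \<in> U \<and> (\<forall>t\<in>{0..T}.
        norm (f' t (Y q t)) \<le> K \<and> norm (f' t (Y q t) - f' t (Y p t)) \<le> \<epsilon> / (c * B) \<and>
        norm (f t (Y q t) - f t (Y p t) - f' t (Y p t) (Y q t - Y p t)) \<le> \<epsilon> / (c * B) * norm (q - p))"
    using cb by blast
  show "\<exists>\<delta>>0. \<forall>q\<in>U. dist q p < \<delta> \<longrightarrow> (\<forall>t\<in>{0..T}. norm (?W q t - ?W p t) \<le> \<epsilon>)"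
  proof (intro exI[of _ \<delta>] conjI ballI impI \<delta>)
    fix q t assume q: "q \<in> U" "dist q p < \<delta>" and t: "t \<in> {0..T}"
    have b: "q \<in> ball p \<delta>" using q by (simp add: dist_commute)
    have "norm (?W q t - ?W p t) \<le> c * ((\<epsilon> / (c * B)) * B)"
      unfolding c_def
    proof (rule linear_ode_bound[where A = "\<lambda>t. f' t (Y q t)" and r = "\<lambda>t. (f' t (Y q t) - f' t (Y p t)) (?W p t)"])
      fix t assume t: "t \<in> {0..T}"
      show "norm (f' t (Y q t)) \<le> K" using * b t by blast
      show "((\<lambda>t. ?W q t - ?W p t) has_vector_derivative f' t (Y q t) (?W q t - ?W p t) +
          (f' t (Y q t) - f' t (Y p t)) (?W p t)) (at t within {0..T})"
        using has_vector_derivative_diff[OF flow_deriv_sol[OF q(1) t] flow_deriv_sol[OF p t]]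
        by (simp add: blinfun.diff_right blinfun.diff_left algebra_simps)
      have "norm (f' t (Y q t) - f' t (Y p t)) \<le> \<epsilon> / (c * B)" using * b t by blast
      then show "norm ((f' t (Y q t) - f' t (Y p t)) (?W p t)) \<le> \<epsilon> / (sqrt (exp ((2 * K + 1) * T) * T) * B) * B"
        unfolding c_def[symmetric]
        by (intro order_trans[OF norm_blinfun mult_mono]) (use B t \<epsilon> c in auto)
    next
      show "continuous_on {0..T} (\<lambda>t. (f' t (Y q t) - f' t (Y p t)) (?W p t))"
        by (intro blinfun.continuous_on continuous_intros cont_along_flow cont_flow_deriv_time p q)
    qed (use K t in \<open>auto simp: flow_deriv_init p q\<close>)
    also have "\<dots> = \<epsilon>" using c B by simp
    finally show "norm (?W q t - ?W p t) \<le> \<epsilon>" .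
  qed
qed

text \<open>The variational equation is linear and its solutions are unique.\<close>

lemma linear_flow_deriv:
  assumes p: "p \<in> U" and t: "t \<in> {0..T}"
  shows "linear (\<lambda>v. flow_deriv p v t)"
proof -
  have *: "flow_deriv p (a *\<^sub>R v + b *\<^sub>R w) t = a *\<^sub>R flow_deriv p v t + b *\<^sub>R flow_deriv p w t" for a b v w
  proof -
    obtain K where K: "K \<ge> 0" "\<And>t. t \<in> {0..T} \<Longrightarrow> norm (f' t (Y p t)) \<le> K"
      by (rule coefficient_bounds[OF p]) blast
    let ?e = "\<lambda>t. flow_deriv p (a *\<^sub>R v + b *\<^sub>R w) t - (a *\<^sub>R flow_deriv p v t + b *\<^sub>R flow_deriv p w t)"
    have "norm (?e t) \<le> sqrt (exp ((2 * K + 1) * T) * T) * 0"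
    proof (rule linear_ode_bound[where A = "\<lambda>t. f' t (Y p t)" and r = "\<lambda>_. 0"])
      fix t assume t: "t \<in> {0..T}"
      note d = flow_deriv_sol[OF p t]
      show "(?e has_vector_derivative f' t (Y p t) (?e t) + 0) (at t within {0..T})"
        using has_vector_derivative_diff[OF d[of "a *\<^sub>R v + b *\<^sub>R w"]
            has_vector_derivative_add[OF has_vector_derivative_scaleR[OF DERIV_const d[of v], of a]
              has_vector_derivative_scaleR[OF DERIV_const d[of w], of b]]]
        by (simp add: blinfun.diff_right blinfun.add_right blinfun.scaleR_right)
    qed (use K t in \<open>auto simp: flow_deriv_init p\<close>)
    then show ?thesis by simp
  qed
  show ?thesis
    using *[of 1 _ 1] *[of _ _ 0] by (intro linearI) auto
qed

end

section \<open>The second derivative of a flow\<close>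

lemma DERIV_along_line:
  fixes \<phi> :: "'a::real_normed_vector \<Rightarrow> real"
  assumes "((\<lambda>s. \<phi> ((c + a *\<^sub>R v) + s *\<^sub>R v)) has_real_derivative d) (at 0)"
  shows "((\<lambda>s. \<phi> (c + s *\<^sub>R v)) has_real_derivative d) (at a)"
  using DERIV_shift[of "\<lambda>s. \<phi> (c + s *\<^sub>R v)" d 0 a] assms
  by (simp add: scaleR_add_left add.commute add.left_commute add.assoc)

text \<open>Two applications of the mean value theorem, first in the direction \<open>v\<close> to the difference in
  direction \<open>w\<close>, then in the direction \<open>w\<close>.\<close>

lemma second_difference_mean_value:
  fixes \<phi> :: "'a::real_normed_vector \<Rightarrow> real"
  assumes r: "ball p r \<subseteq> U" and s: "s > 0" "s * (norm v + norm w) < r"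
    and d1: "\<And>q. q \<in> U \<Longrightarrow> ((\<lambda>s. \<phi> (q + s *\<^sub>R v)) has_real_derivative \<phi>v q) (at 0)"
    and d2: "\<And>q. q \<in> U \<Longrightarrow> ((\<lambda>s. \<phi>v (q + s *\<^sub>R w)) has_real_derivative \<phi>vw q) (at 0)"
  shows "\<exists>\<xi> \<eta>. \<xi> \<in> {0..s} \<and> \<eta> \<in> {0..s} \<and>
    \<phi> (p + s *\<^sub>R v + s *\<^sub>R w) - \<phi> (p + s *\<^sub>R v) - \<phi> (p + s *\<^sub>R w) + \<phi> p = s\<^sup>2 * \<phi>vw (p + \<xi> *\<^sub>R v + \<eta> *\<^sub>R w)"
proof -
  have inU: "p + a *\<^sub>R v + b *\<^sub>R w \<in> U" if "0 \<le> a" "a \<le> s" "0 \<le> b" "b \<le> s" for a b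
  proof -
    have "norm (a *\<^sub>R v + b *\<^sub>R w) \<le> a * norm v + b * norm w"
      using norm_triangle_ineq[of "a *\<^sub>R v" "b *\<^sub>R w"] that by simp
    also have "\<dots> \<le> s * (norm v + norm w)"
      unfolding distrib_left using that by (intro add_mono mult_right_mono) auto
    also have "\<dots> < r" by (rule s)
    finally have "p + (a *\<^sub>R v + b *\<^sub>R w) \<in> ball p r" by (simp only: mem_ball dist_norm norm_minus_commute[of p]) simp
    then show ?thesis using r by (auto simp: add.assoc)
  qed
  have D1: "((\<lambda>a. \<phi> (c + a *\<^sub>R v)) has_real_derivative \<phi>v (c + a *\<^sub>R v)) (at a)"
    if "c + a *\<^sub>R v \<in> U" for a c
    by (rule DERIV_along_line[OF d1[OF that]])
  have D2: "((\<lambda>b. \<phi>v (c + b *\<^sub>R w)) has_real_derivative \<phi>vw (c + b *\<^sub>R w)) (at b)"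
    if "c + b *\<^sub>R w \<in> U" for b c
    by (rule DERIV_along_line[OF d2[OF that]])
  let ?g = "\<lambda>a. \<phi> ((p + s *\<^sub>R w) + a *\<^sub>R v) - \<phi> (p + a *\<^sub>R v)"
  have "\<exists>z>0. z < s \<and> ?g s - ?g 0 = (s - 0) * (\<phi>v ((p + s *\<^sub>R w) + z *\<^sub>R v) - \<phi>v (p + z *\<^sub>R v))"
  proof (rule MVT2[OF s(1)])
    fix a assume "0 \<le> a" "a \<le> s"
    then show "DERIV ?g a :> \<phi>v ((p + s *\<^sub>R w) + a *\<^sub>R v) - \<phi>v (p + a *\<^sub>R v)"
      using inU[of a s] inU[of a 0] s(1) by (intro DERIV_diff D1) (auto simp: algebra_simps)
  qed
  then obtain \<xi> where \<xi>: "0 < \<xi>" "\<xi> < s"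
    and g: "?g s - ?g 0 = s * (\<phi>v ((p + \<xi> *\<^sub>R v) + s *\<^sub>R w) - \<phi>v ((p + \<xi> *\<^sub>R v) + 0 *\<^sub>R w))"
    by (auto simp: algebra_simps)
  have "\<exists>z>0. z < s \<and> \<phi>v ((p + \<xi> *\<^sub>R v) + s *\<^sub>R w) - \<phi>v ((p + \<xi> *\<^sub>R v) + 0 *\<^sub>R w) = (s - 0) * \<phi>vw ((p + \<xi> *\<^sub>R v) + z *\<^sub>R w)"
    by (rule MVT2[OF s(1)]) (use \<xi> inU in \<open>auto intro!: D2\<close>)
  then obtain \<eta> where \<eta>: "0 < \<eta>" "\<eta> < s" and k: "\<phi>v ((p + \<xi> *\<^sub>R v) + s *\<^sub>R w) - \<phi>v ((p + \<xi> *\<^sub>R v) + 0 *\<^sub>R w) = s * \<phi>vw ((p + \<xi> *\<^sub>R v) + \<eta> *\<^sub>R w)"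
    by auto
  have "?g s - ?g 0 = s\<^sup>2 * \<phi>vw (p + \<xi> *\<^sub>R v + \<eta> *\<^sub>R w)"
    unfolding g k by (simp add: power2_eq_square)
  then show ?thesis using \<xi> \<eta> by (intro exI[of _ \<xi>] exI[of _ \<eta>]) (auto simp: algebra_simps)
qed

text \<open>The second difference is symmetric in the two directions; divided by \<open>s\<^sup>2\<close> it tends to either
  mixed derivative.\<close>

lemma mixed_directional_derivatives_commute:
  fixes \<phi> :: "'a::real_normed_vector \<Rightarrow> real"
  assumes U: "open U" "p \<in> U"
    and dv: "\<And>q. q \<in> U \<Longrightarrow> ((\<lambda>s. \<phi> (q + s *\<^sub>R v)) has_real_derivative \<phi>v q) (at 0)"
    and dvw: "\<And>q. q \<in> U \<Longrightarrow> ((\<lambda>s. \<phi>v (q + s *\<^sub>R w)) has_real_derivative \<phi>vw q) (at 0)"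
    and dw: "\<And>q. q \<in> U \<Longrightarrow> ((\<lambda>s. \<phi> (q + s *\<^sub>R w)) has_real_derivative \<phi>w q) (at 0)"
    and dwv: "\<And>q. q \<in> U \<Longrightarrow> ((\<lambda>s. \<phi>w (q + s *\<^sub>R v)) has_real_derivative \<phi>wv q) (at 0)"
    and cont: "continuous_on U \<phi>vw" "continuous_on U \<phi>wv"
  shows "\<phi>vw p = \<phi>wv p"
proof (rule ccontr)
  assume ne: "\<phi>vw p \<noteq> \<phi>wv p"
  define \<epsilon> where "\<epsilon> = \<bar>\<phi>vw p - \<phi>wv p\<bar> / 2"
  have \<epsilon>: "\<epsilon> > 0" using ne by (simp add: \<epsilon>_def)
  obtain r0 where r0: "r0 > 0" "ball p r0 \<subseteq> U" using U open_contains_ball by blast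
  obtain d1 where d1: "d1 > 0" "\<And>q. q \<in> U \<Longrightarrow> dist q p < d1 \<Longrightarrow> \<bar>\<phi>vw q - \<phi>vw p\<bar> < \<epsilon>"
    using cont(1) U(2) \<epsilon> unfolding continuous_on_iff dist_real_def by meson
  obtain d2 where d2: "d2 > 0" "\<And>q. q \<in> U \<Longrightarrow> dist q p < d2 \<Longrightarrow> \<bar>\<phi>wv q - \<phi>wv p\<bar> < \<epsilon>"
    using cont(2) U(2) \<epsilon> unfolding continuous_on_iff dist_real_def by meson
  define r where "r = min r0 (min d1 d2)"
  have r: "r > 0" "ball p r \<subseteq> U" "r \<le> d1" "r \<le> d2" using r0 d1 d2 by (auto simp: r_def)
  define n where "n = norm v + norm w + 1"
  have n: "n > 0" unfolding n_def by (intro add_nonneg_pos add_nonneg_nonneg) auto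
  define s where "s = r / (2 * n)"
  have s: "s > 0" using r n by (simp add: s_def)
  have "s * (norm v + norm w) < s * (2 * n)" using s n by (intro mult_strict_left_mono) (simp_all add: n_def add_nonneg_pos)
  also have "\<dots> = r" using n by (simp add: s_def)
  finally have sr: "s * (norm v + norm w) < r" .
  have near: "dist (p + a *\<^sub>R v + b *\<^sub>R w) p < r" if "a \<in> {0..s}" "b \<in> {0..s}" for a b
  proof -
    have "norm (a *\<^sub>R v + b *\<^sub>R w) \<le> a * norm v + b * norm w"
      using norm_triangle_ineq[of "a *\<^sub>R v" "b *\<^sub>R w"] that by simp
    also have "\<dots> \<le> s * (norm v + norm w)"
      unfolding distrib_left using that by (intro add_mono mult_right_mono) auto
    finally show ?thesis using sr by (simp add: dist_norm add.assoc)
  qed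
  obtain \<xi> \<eta> where 1: "\<xi> \<in> {0..s}" "\<eta> \<in> {0..s}"
    "\<phi> (p + s *\<^sub>R v + s *\<^sub>R w) - \<phi> (p + s *\<^sub>R v) - \<phi> (p + s *\<^sub>R w) + \<phi> p = s\<^sup>2 * \<phi>vw (p + \<xi> *\<^sub>R v + \<eta> *\<^sub>R w)"
    using second_difference_mean_value[OF r(2) s sr dv dvw] by blast
  have sr': "s * (norm w + norm v) < r" using sr by (simp add: add.commute)
  obtain \<eta>' \<xi>' where 2: "\<eta>' \<in> {0..s}" "\<xi>' \<in> {0..s}"
    "\<phi> (p + s *\<^sub>R w + s *\<^sub>R v) - \<phi> (p + s *\<^sub>R w) - \<phi> (p + s *\<^sub>R v) + \<phi> p = s\<^sup>2 * \<phi>wv (p + \<eta>' *\<^sub>R w + \<xi>' *\<^sub>R v)"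
    using second_difference_mean_value[OF r(2) s sr' dw dwv] by blast
  have "p + s *\<^sub>R w + s *\<^sub>R v = p + s *\<^sub>R v + s *\<^sub>R w" by (simp add: algebra_simps)
  then have "\<phi> (p + s *\<^sub>R w + s *\<^sub>R v) = \<phi> (p + s *\<^sub>R v + s *\<^sub>R w)" by (rule arg_cong)
  then have "s\<^sup>2 * \<phi>vw (p + \<xi> *\<^sub>R v + \<eta> *\<^sub>R w) = s\<^sup>2 * \<phi>wv (p + \<eta>' *\<^sub>R w + \<xi>' *\<^sub>R v)"
    using 1(3) 2(3) by linarith
  then have eq: "\<phi>vw (p + \<xi> *\<^sub>R v + \<eta> *\<^sub>R w) = \<phi>wv (p + \<eta>' *\<^sub>R w + \<xi>' *\<^sub>R v)" using s by simp
  have n1: "dist (p + \<xi> *\<^sub>R v + \<eta> *\<^sub>R w) p < r" by (rule near[OF 1(1,2)])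
  have n2: "dist (p + \<eta>' *\<^sub>R w + \<xi>' *\<^sub>R v) p < r" using near[OF 2(2,1)] by (simp add: algebra_simps)
  have "p + \<xi> *\<^sub>R v + \<eta> *\<^sub>R w \<in> U" "p + \<eta>' *\<^sub>R w + \<xi>' *\<^sub>R v \<in> U"
    using n1 n2 r(2) by (auto simp: dist_commute subset_eq)
  then have "\<bar>\<phi>vw (p + \<xi> *\<^sub>R v + \<eta> *\<^sub>R w) - \<phi>vw p\<bar> < \<epsilon>" "\<bar>\<phi>wv (p + \<eta>' *\<^sub>R w + \<xi>' *\<^sub>R v) - \<phi>wv p\<bar> < \<epsilon>"
    using d1(2) d2(2) n1 n2 r by force+
  then show False using eq unfolding \<epsilon>_def by (simp add: abs_if split: if_splits)
qed

text \<open>The second derivative is given along basis vectors \<open>b\<close> only: each \<open>y \<mapsto> f' t y b\<close> is then a vector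
  function whose derivative is an ordinary linear map.\<close>

locale C2_flow = C1_flow +
  fixes f'' :: "real \<Rightarrow> 'a \<Rightarrow> 'a \<Rightarrow> 'a \<Rightarrow>\<^sub>L 'a"
  assumes deriv2: "\<And>t y b. t \<in> {0..T} \<Longrightarrow> y \<in> D \<Longrightarrow> b \<in> Basis \<Longrightarrow>
      ((\<lambda>y. f' t y b) has_derivative blinfun_apply (f'' t y b)) (at y)"
    and cont_f'': "\<And>b. b \<in> Basis \<Longrightarrow> continuous_on ({0..T} \<times> D) (\<lambda>(t, y). f'' t y b)"
begin

text \<open>The variational equation added to the original one: its flow is the pair of the original flow and
  its derivative.\<close>

definition "aug_field t = (\<lambda>(y, w). (f t y, f' t y w))"

text \<open>The derivative of the augmented field; \<open>w\<close> is expanded in the basis because \<open>f''\<close> is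
  given on basis vectors.\<close>

definition aug_deriv_fun :: "real \<Rightarrow> 'a \<times> 'a \<Rightarrow> 'a \<times> 'a \<Rightarrow> 'a \<times> 'a" where
  "aug_deriv_fun t = (\<lambda>(y, w) (u, v). (f' t y u, (\<Sum>b\<in>Basis. (w \<bullet> b) *\<^sub>R f'' t y b u) + f' t y v))"

definition "aug_deriv t x = Blinfun (aug_deriv_fun t x)"

lemma aug_deriv_apply [simp]: "blinfun_apply (aug_deriv t x) = aug_deriv_fun t x"
proof -
  have "linear (aug_deriv_fun t x)"
    by (cases x) (auto intro!: linearI simp: aug_deriv_fun_def blinfun.add_right blinfun.scaleR_right
        scaleR_add_right sum.distrib scaleR_sum_right mult.commute)
  then show ?thesis
    unfolding aug_deriv_def by (intro bounded_linear_Blinfun_apply linear_conv_bounded_linear[THEN iffD1])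
qed

lemma deriv_expand: "f' t y w = (\<Sum>b\<in>Basis. (w \<bullet> b) *\<^sub>R f' t y b)"
proof -
  have "f' t y w = f' t y (\<Sum>b\<in>Basis. (w \<bullet> b) *\<^sub>R b)" by (simp add: euclidean_representation)
  then show ?thesis by (simp only: blinfun.sum_right blinfun.scaleR_right)
qed

lemma aug_has_derivative:
  assumes t: "t \<in> {0..T}" and x: "x \<in> D \<times> UNIV"
  shows "(aug_field t has_derivative blinfun_apply (aug_deriv t x)) (at x)"
proof -
  obtain y w where yw: "x = (y, w)" "y \<in> D" using x by auto
  have fst: "(fst has_derivative fst) (at x)" and snd: "(snd has_derivative snd) (at x)"
    by (auto intro!: derivative_intros)
  have 1: "((\<lambda>x. f t (fst x)) has_derivative (\<lambda>u. f' t y (fst u))) (at x)"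
    using has_derivative_compose[OF fst deriv[OF t]] yw by simp
  have 2: "((\<lambda>x. (snd x \<bullet> b) *\<^sub>R f' t (fst x) b) has_derivative
      (\<lambda>u. (w \<bullet> b) *\<^sub>R f'' t y b (fst u) + (snd u \<bullet> b) *\<^sub>R f' t y b)) (at x)" if b: "b \<in> Basis" for b
  proof -
    have i: "((\<lambda>x. snd x \<bullet> b) has_derivative (\<lambda>u. snd u \<bullet> b)) (at x)"
      by (auto intro!: derivative_eq_intros)
    have j: "((\<lambda>x. f' t (fst x) b) has_derivative (\<lambda>u. f'' t y b (fst u))) (at x)"
      using has_derivative_compose[OF fst deriv2[OF t _ b]] yw by simp
    show ?thesis using has_derivative_scaleR[OF i j] yw by simp
  qed
  have "((\<lambda>x. f' t (fst x) (snd x)) has_derivative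
      (\<lambda>u. (\<Sum>b\<in>Basis. (w \<bullet> b) *\<^sub>R f'' t y b (fst u)) + f' t y (snd u))) (at x)"
    unfolding deriv_expand[of t _ "snd _"] sum.distrib[symmetric]
    by (rule has_derivative_sum) (rule 2)
  from has_derivative_Pair[OF 1 this] show ?thesis
    by (simp add: aug_field_def aug_deriv_fun_def yw split_def)
qed

lemma aug_C1_flow: "C1_flow T (D \<times> UNIV) (U \<times> UNIV) aug_field aug_deriv (\<lambda>(p, v) t. (Y p t, flow_deriv p v t))"
proof
  show "0 < T" "open (D \<times> (UNIV :: 'a set))" "open (U \<times> (UNIV :: 'a set))"
    using T_pos open_D open_U by (auto intro: open_Times)
  let ?S = "{0..T} \<times> D \<times> (UNIV :: 'a set)"
  have pr: "continuous_on ?S (\<lambda>x. (fst x, fst (snd x)))" by (intro continuous_intros)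
  have im: "(\<lambda>x. (fst x, fst (snd x))) ` ?S \<subseteq> {0..T} \<times> D" by auto
  note cf = continuous_on_compose2[OF cont_f pr im, unfolded case_prod_beta fst_conv snd_conv]
  note cf' = continuous_on_compose2[OF cont_f' pr im, unfolded case_prod_beta fst_conv snd_conv]
  note cf'' = continuous_on_compose2[OF cont_f'' pr im, unfolded case_prod_beta fst_conv snd_conv]
  show "continuous_on ?S (\<lambda>(t, y). aug_field t y)"
    unfolding aug_field_def case_prod_beta
    by (intro continuous_intros cf blinfun.continuous_on cf')
  have "continuous_on ?S (\<lambda>x. aug_deriv (fst x) (snd x))"
    unfolding continuous_on_eq_continuous_within
  proof (intro ballI continuous_blinfun_componentwiseI1)
    fix x and i :: "'a \<times> 'a" assume "x \<in> ?S" "i \<in> Basis"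
    have "continuous_on ?S (\<lambda>x. aug_deriv (fst x) (snd x) i)"
      unfolding aug_deriv_apply aug_deriv_fun_def case_prod_beta
      by (intro continuous_intros blinfun.continuous_on cf' cf'')
    then show "continuous (at x within ?S) (\<lambda>x. aug_deriv (fst x) (snd x) i)"
      using \<open>x \<in> ?S\<close> continuous_on_eq_continuous_within by blast
  qed
  then show "continuous_on ?S (\<lambda>(t, y). aug_deriv t y)" by (simp add: case_prod_beta)
next
  fix p and t :: real assume p: "p \<in> U \<times> (UNIV :: 'a set)" and t: "t \<in> {0..T}"
  then show "((case p of (p, v) \<Rightarrow> \<lambda>t. (Y p t, flow_deriv p v t)) has_vector_derivative
      aug_field t ((case p of (p, v) \<Rightarrow> \<lambda>t. (Y p t, flow_deriv p v t)) t)) (at t within {0..T})"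
    by (auto simp: aug_field_def intro!: has_vector_derivative_Pair sol flow_deriv_sol)
next
  fix t :: real and x assume "t \<in> {0..T}" "x \<in> D \<times> (UNIV :: 'a set)"
  then show "(aug_field t has_derivative blinfun_apply (aug_deriv t x)) (at x)" by (rule aug_has_derivative)
next
  fix p assume p: "p \<in> U \<times> (UNIV :: 'a set)"
  then show "(case p of (p, v) \<Rightarrow> \<lambda>t. (Y p t, flow_deriv p v t)) 0 = p"
    by (auto simp: init flow_deriv_init)
  show "(case p of (p, v) \<Rightarrow> \<lambda>t. (Y p t, flow_deriv p v t)) t \<in> D \<times> UNIV" if "t \<in> {0..T}" for t
    using p that by (auto intro: in_D)
qed

sublocale aug: C1_flow T "D \<times> UNIV" "U \<times> UNIV" aug_field aug_deriv "\<lambda>(p, v) t. (Y p t, flow_deriv p v t)"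
  by (rule aug_C1_flow)

text \<open>Varying \<open>p\<close> with \<open>v\<close> fixed is a variation of the augmented initial value in the direction \<open>(u, 0)\<close>.\<close>

definition "flow_deriv2 p u v t = snd (aug.flow_deriv (p, v) (u, 0) t)"

lemma flow_deriv2_works:
  assumes p: "p \<in> U" and t: "t \<in> {0..T}"
  shows "((\<lambda>s. flow_deriv (p + s *\<^sub>R u) v t) has_vector_derivative flow_deriv2 p u v t) (at 0)"
  using bounded_linear.has_vector_derivative[OF bounded_linear_snd aug.flow_deriv_works[of "(p, v)" t "(u, 0)"]] p t
  by (simp add: flow_deriv2_def)

lemma cont_flow_deriv2: "continuous_on (U \<times> {0..T}) (\<lambda>(p, t). flow_deriv2 p u v t)"
proof -
  have "continuous_on (U \<times> {0..T}) (\<lambda>x. ((fst x, v), snd x))" by (intro continuous_intros)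
  moreover have "(\<lambda>x. ((fst x, v), snd x)) ` (U \<times> {0..T}) \<subseteq> (U \<times> UNIV) \<times> {0..T}" by auto
  ultimately show ?thesis
    using continuous_on_snd[OF continuous_on_compose2[OF aug.cont_flow_deriv, of "U \<times> {0..T}" "\<lambda>x. ((fst x, v), snd x)" "(u, 0)"]]
    by (simp add: flow_deriv2_def case_prod_beta)
qed

lemma linear_flow_deriv2_left:
  assumes "p \<in> U" "t \<in> {0..T}"
  shows "linear (\<lambda>u. flow_deriv2 p u v t)"
proof -
  have "linear (\<lambda>w. aug.flow_deriv (p, v) w t)" using assms by (intro aug.linear_flow_deriv) auto
  from linear_compose[OF linear_compose[OF _ this, of "\<lambda>u. (u, 0)"], of snd]
  show ?thesis by (simp add: o_def flow_deriv2_def linear_snd linear_iff)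
qed

lemma flow_deriv2_commute:
  assumes p: "p \<in> U" and t: "t \<in> {0..T}"
  shows "flow_deriv2 p u v t = flow_deriv2 p v u t"
proof (rule euclidean_eqI)
  fix b :: 'a assume "b \<in> Basis"
  have c: "continuous_on U (\<lambda>p. flow_deriv2 p u v t \<bullet> b)" for u v
  proof -
    have "continuous_on U (\<lambda>p. (p, t))" by (intro continuous_intros)
    moreover have "(\<lambda>p. (p, t)) ` U \<subseteq> U \<times> {0..T}" using t by auto
    ultimately show ?thesis
      using continuous_on_compose2[OF cont_flow_deriv2, of U "\<lambda>p. (p, t)" u v]
      by (simp add: continuous_on_inner continuous_on_const)
  qed
  have d1: "((\<lambda>s. Y (q + s *\<^sub>R v) t \<bullet> b) has_real_derivative flow_deriv q v t \<bullet> b) (at 0)" if "q \<in> U" for q v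
    unfolding has_real_derivative_iff_has_vector_derivative
    by (rule bounded_linear.has_vector_derivative[OF bounded_linear_inner_left flow_deriv_works[OF that t]])
  have d2: "((\<lambda>s. flow_deriv (q + s *\<^sub>R u) v t \<bullet> b) has_real_derivative flow_deriv2 q u v t \<bullet> b) (at 0)" if "q \<in> U" for q u v
    unfolding has_real_derivative_iff_has_vector_derivative
    by (rule bounded_linear.has_vector_derivative[OF bounded_linear_inner_left flow_deriv2_works[OF that t]])
  show "flow_deriv2 p u v t \<bullet> b = flow_deriv2 p v u t \<bullet> b"
    by (rule mixed_directional_derivatives_commute[OF open_U p d1 d2 d1 d2 c c])
qed

lemma linear_flow_deriv2_right:
  assumes "p \<in> U" "t \<in> {0..T}"
  shows "linear (\<lambda>v. flow_deriv2 p u v t)"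
  unfolding flow_deriv2_commute[OF assms, of u] by (rule linear_flow_deriv2_left[OF assms])

end

section \<open>The parametrised system as a flow\<close>

lemma Ck_on_SucD: "Ck_on (Suc k) S f \<Longrightarrow> Ck_on k S f"
proof (induction k arbitrary: f)
  case 0
  then obtain D where "\<And>x. x \<in> S \<Longrightarrow> (f has_derivative D x) (at x within S)" by auto
  then show ?case using has_derivative_continuous_on by auto
next
  case (Suc k)
  then obtain D where "\<forall>x\<in>S. (f has_derivative D x) (at x within S)" "\<forall>v. Ck_on (Suc k) S (\<lambda>x. D x v)"
    unfolding Ck_on.simps(2)[of "Suc k"] by blast
  then show ?case using Suc.IH unfolding Ck_on.simps(2)[of k] by blast
qed

text \<open>The field takes its state first and the parameter last, a full parameter is ordered the other way.\<close>

definition field_arg :: "real \<Rightarrow> 'd::finite param \<Rightarrow> real \<times> real \<times> real \<times> (real ^ 'd)" where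
  "field_arg t = (\<lambda>(\<theta>, x, z). (x, z, t, \<theta>))"

text \<open>The time interval is closed, so the given derivatives are one-sided at its ends.  With time fixed
  and the remaining variables in an open set they become two-sided.\<close>

lemma field_component_C2:
  fixes h :: "real \<times> real \<times> real \<times> (real ^ 'd::finite) \<Rightarrow> real"
  assumes h: "Ck_on 2 (UNIV \<times> UNIV \<times> {0..T} \<times> \<Theta>) h" and \<Theta>: "open \<Theta>"
  obtains h1 h2 where
    "\<forall>t\<in>{0..T}. \<forall>y\<in>\<Theta> \<times> UNIV. ((\<lambda>y. h (field_arg t y)) has_derivative h1 t y) (at y)"
    "\<forall>t\<in>{0..T}. \<forall>y\<in>\<Theta> \<times> UNIV. \<forall>b. ((\<lambda>y. h1 t y b) has_derivative h2 t y b) (at y)"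
    "continuous_on ({0..T} \<times> \<Theta> \<times> UNIV) (\<lambda>(t, y). h (field_arg t y))"
    "\<forall>v. continuous_on ({0..T} \<times> \<Theta> \<times> UNIV) (\<lambda>(t, y). h1 t y v)"
    "\<forall>b v. continuous_on ({0..T} \<times> \<Theta> \<times> UNIV) (\<lambda>(t, y). h2 t y b v)"
proof -
  define S where "S = (UNIV :: real set) \<times> (UNIV :: real set) \<times> {0..T} \<times> \<Theta>"
  define D where "D = \<Theta> \<times> (UNIV :: (real \<times> real) set)"
  have oD: "open D" unfolding D_def using \<Theta> by (intro open_Times) auto
  have "Ck_on (Suc (Suc 0)) S h" using h by (simp add: S_def numeral_2_eq_2)
  then obtain D1 where D1: "\<And>x. x \<in> S \<Longrightarrow> (h has_derivative D1 x) (at x within S)" "\<And>v. Ck_on (Suc 0) S (\<lambda>x. D1 x v)"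
    unfolding Ck_on.simps(2)[of "Suc 0"] by blast
  have "\<forall>v. \<exists>E. (\<forall>x\<in>S. ((\<lambda>x. D1 x v) has_derivative E x) (at x within S)) \<and> (\<forall>w. continuous_on S (\<lambda>x. E x w))"
    using D1(2) by simp
  then obtain D2 where D2: "\<And>v x. x \<in> S \<Longrightarrow> ((\<lambda>x. D1 x v) has_derivative D2 v x) (at x within S)"
    "\<And>v w. continuous_on S (\<lambda>x. D2 v x w)" by metis
  have c0: "continuous_on S h" by (rule has_derivative_continuous_on[OF D1(1)])
  have c1: "continuous_on S (\<lambda>x. D1 x v)" for v by (rule has_derivative_continuous_on[OF D2(1)])
  define emb :: "'d param \<Rightarrow> real \<times> real \<times> real \<times> (real ^ 'd)" where "emb = (\<lambda>(\<theta>, x, z). (x, z, 0, \<theta>))"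
  have arg: "(field_arg t has_derivative emb) (at y within D)" for t y
    unfolding field_arg_def emb_def case_prod_beta by (auto intro!: derivative_eq_intros)
  have im: "field_arg t ` D \<subseteq> S" if "t \<in> {0..T}" for t
    using that by (auto simp: field_arg_def S_def D_def)
  have comp: "((\<lambda>y. k (field_arg t y)) has_derivative (\<lambda>v. k' (field_arg t y) (emb v))) (at y)"
    if k: "\<And>x. x \<in> S \<Longrightarrow> (k has_derivative k' x) (at x within S)" and t: "t \<in> {0..T}" and y: "y \<in> D"
    for k :: "_ \<Rightarrow> real" and k' t y
  proof -
    have "field_arg t y \<in> S" using im[OF t] y by blast
    from has_derivative_subset[OF k[OF this] im[OF t]]
    have "(k has_derivative k' (field_arg t y)) (at (field_arg t y) within field_arg t ` D)" .
    from has_derivative_in_compose[OF arg this] show ?thesis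
      using oD y by (simp add: at_within_open[of y D])
  qed
  have cc: "continuous_on ({0..T} \<times> D) (\<lambda>(t, y). k (field_arg t y))" if "continuous_on S k" for k :: "_ \<Rightarrow> real"
  proof -
    have "continuous_on ({0..T} \<times> D) (\<lambda>x. field_arg (fst x) (snd x))"
      unfolding field_arg_def case_prod_beta by (intro continuous_intros)
    moreover have "(\<lambda>x. field_arg (fst x) (snd x)) ` ({0..T} \<times> D) \<subseteq> S" using im by (auto simp: image_subset_iff)
    ultimately show ?thesis
      using continuous_on_compose2[OF that, of "{0..T} \<times> D" "\<lambda>x. field_arg (fst x) (snd x)"] by (simp add: case_prod_beta)
  qed
  show ?thesis
  proof (rule that[of "\<lambda>t y v. D1 (field_arg t y) (emb v)" "\<lambda>t y b v. D2 (emb b) (field_arg t y) (emb v)"])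
    show "\<forall>t\<in>{0..T}. \<forall>y\<in>\<Theta> \<times> UNIV. ((\<lambda>y. h (field_arg t y)) has_derivative (\<lambda>v. D1 (field_arg t y) (emb v))) (at y)"
      unfolding D_def[symmetric] by (intro ballI comp D1)
    show "\<forall>t\<in>{0..T}. \<forall>y\<in>\<Theta> \<times> UNIV. \<forall>b. ((\<lambda>y. D1 (field_arg t y) (emb b)) has_derivative (\<lambda>v. D2 (emb b) (field_arg t y) (emb v))) (at y)"
      unfolding D_def[symmetric] by (intro ballI allI comp D2)
    show "continuous_on ({0..T} \<times> \<Theta> \<times> UNIV) (\<lambda>(t, y). h (field_arg t y))"
      unfolding D_def[symmetric] by (rule cc[OF c0])
    show "\<forall>v. continuous_on ({0..T} \<times> \<Theta> \<times> UNIV) (\<lambda>(t, y). D1 (field_arg t y) (emb v))"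
      unfolding D_def[symmetric] by (intro allI cc[OF c1])
    show "\<forall>b v. continuous_on ({0..T} \<times> \<Theta> \<times> UNIV) (\<lambda>(t, y). D2 (emb b) (field_arg t y) (emb v))"
      unfolding D_def[symmetric] by (intro allI cc[OF D2(2)])
  qed
qed

text \<open>The parameter is part of the state and does not move, so derivatives with respect to parameters are
  derivatives with respect to initial values.\<close>

definition ode_field :: "(real \<times> real \<times> real \<times> (real ^ 'd) \<Rightarrow> real) \<Rightarrow> (real \<times> real \<times> real \<times> (real ^ 'd) \<Rightarrow> real) \<Rightarrow>
   real \<Rightarrow> 'd::finite param \<Rightarrow> 'd param" where
  "ode_field F G t y = (0, F (field_arg t y), G (field_arg t y))"

lemma ode_C2_flow:
  fixes \<Theta> :: "(real ^ 'd::finite) set"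
  assumes T: "0 < T" and \<Theta>: "open \<Theta>" and \<Gamma>: "open \<Gamma>"
    and F: "Ck_on 3 (UNIV \<times> UNIV \<times> {0..T} \<times> \<Theta>) F" and G: "Ck_on 3 (UNIV \<times> UNIV \<times> {0..T} \<times> \<Theta>) G"
    and sol: "\<And>p. p \<in> \<Theta> \<times> \<Gamma> \<Longrightarrow> ivp_solution T F G p (xs p) (zs p)"
  shows "\<exists>f' f''. C2_flow T (\<Theta> \<times> UNIV) (\<Theta> \<times> \<Gamma>) (ode_field F G) f' (\<lambda>p t. (fst p, xs p t, zs p t)) f''"
proof -
  define D where "D = \<Theta> \<times> (UNIV :: (real \<times> real) set)"
  have oD: "open D" unfolding D_def using \<Theta> by (intro open_Times) auto
  have three: "(3 :: nat) = Suc 2" by simp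
  note F2 = F[unfolded three, THEN Ck_on_SucD] and G2 = G[unfolded three, THEN Ck_on_SucD]
  obtain F1 F2 where F:
    "\<forall>t\<in>{0..T}. \<forall>y\<in>D. ((\<lambda>y. F (field_arg t y)) has_derivative F1 t y) (at y)"
    "\<forall>t\<in>{0..T}. \<forall>y\<in>D. \<forall>b. ((\<lambda>y. F1 t y b) has_derivative F2 t y b) (at y)"
    "continuous_on ({0..T} \<times> D) (\<lambda>(t, y). F (field_arg t y))"
    "\<forall>v. continuous_on ({0..T} \<times> D) (\<lambda>(t, y). F1 t y v)"
    "\<forall>b v. continuous_on ({0..T} \<times> D) (\<lambda>(t, y). F2 t y b v)"
    unfolding D_def by (rule field_component_C2[OF F2 \<Theta>])
  obtain G1 G2 where G:
    "\<forall>t\<in>{0..T}. \<forall>y\<in>D. ((\<lambda>y. G (field_arg t y)) has_derivative G1 t y) (at y)"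
    "\<forall>t\<in>{0..T}. \<forall>y\<in>D. \<forall>b. ((\<lambda>y. G1 t y b) has_derivative G2 t y b) (at y)"
    "continuous_on ({0..T} \<times> D) (\<lambda>(t, y). G (field_arg t y))"
    "\<forall>v. continuous_on ({0..T} \<times> D) (\<lambda>(t, y). G1 t y v)"
    "\<forall>b v. continuous_on ({0..T} \<times> D) (\<lambda>(t, y). G2 t y b v)"
    unfolding D_def by (rule field_component_C2[OF G2 \<Theta>])
  define f1 where "f1 t y v = (0 :: real ^ 'd, F1 t y v, G1 t y v)" for t y v
  define f2 where "f2 t y b v = (0 :: real ^ 'd, F2 t y b v, G2 t y b v)" for t y b v
  have d1: "(ode_field F G t has_derivative f1 t y) (at y)" if "t \<in> {0..T}" "y \<in> D" for t y
    unfolding ode_field_def f1_def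
    by (intro has_derivative_Pair has_derivative_const F(1)[rule_format, OF that] G(1)[rule_format, OF that])
  have d2: "((\<lambda>y. f1 t y b) has_derivative f2 t y b) (at y)" if "t \<in> {0..T}" "y \<in> D" for t y b
    unfolding f1_def f2_def
    by (intro has_derivative_Pair has_derivative_const F(2)[rule_format, OF that] G(2)[rule_format, OF that])
  have b1: "blinfun_apply (Blinfun (f1 t y)) = f1 t y" if "t \<in> {0..T}" "y \<in> D" for t y
    by (rule bounded_linear_Blinfun_apply[OF has_derivative_bounded_linear[OF d1[OF that]]])
  have b2: "blinfun_apply (Blinfun (f2 t y b)) = f2 t y b" if "t \<in> {0..T}" "y \<in> D" for t y b
    by (rule bounded_linear_Blinfun_apply[OF has_derivative_bounded_linear[OF d2[OF that]]])
  have c1: "continuous_on ({0..T} \<times> D) (\<lambda>(t, y). f1 t y v)" for v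
    using F(4)[rule_format, of v] G(4)[rule_format, of v] unfolding f1_def case_prod_beta by (intro continuous_intros)
  have c2: "continuous_on ({0..T} \<times> D) (\<lambda>(t, y). f2 t y b v)" for b v
    using F(5)[rule_format, of b v] G(5)[rule_format, of b v] unfolding f2_def case_prod_beta by (intro continuous_intros)
  have blin: "continuous_on ({0..T} \<times> D) (\<lambda>(t, y). Blinfun (k t y))"
    if b: "\<And>t y. t \<in> {0..T} \<Longrightarrow> y \<in> D \<Longrightarrow> blinfun_apply (Blinfun (k t y)) = k t y"
      and c: "\<And>v. continuous_on ({0..T} \<times> D) (\<lambda>(t, y). k t y v)" for k :: "real \<Rightarrow> 'd param \<Rightarrow> 'd param \<Rightarrow> 'd param"
    unfolding continuous_on_eq_continuous_within
  proof (intro ballI continuous_blinfun_componentwiseI1)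
    fix x and i :: "'d param" assume x: "x \<in> {0..T} \<times> D"
    have "continuous_on ({0..T} \<times> D) (\<lambda>x. (case x of (t, y) \<Rightarrow> Blinfun (k t y)) i)"
      by (rule continuous_on_eq[OF c[of i]]) (auto simp: b)
    then show "continuous (at x within {0..T} \<times> D) (\<lambda>x. (case x of (t, y) \<Rightarrow> Blinfun (k t y)) i)"
      using x continuous_on_eq_continuous_within by blast
  qed
  have "C2_flow T D (\<Theta> \<times> \<Gamma>) (ode_field F G) (\<lambda>t y. Blinfun (f1 t y)) (\<lambda>p t. (fst p, xs p t, zs p t)) (\<lambda>t y b. Blinfun (f2 t y b))"
  proof
    show "0 < T" "open D" "open (\<Theta> \<times> \<Gamma>)" using T \<Theta> \<Gamma> oD by (auto intro: open_Times)
    show "continuous_on ({0..T} \<times> D) (\<lambda>(t, y). ode_field F G t y)"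
      using F(3) G(3) unfolding ode_field_def case_prod_beta by (intro continuous_intros)
    show "continuous_on ({0..T} \<times> D) (\<lambda>(t, y). Blinfun (f1 t y))"
      by (intro blin b1 c1)
    show "continuous_on ({0..T} \<times> D) (\<lambda>(t, y). Blinfun (f2 t y b))" for b
      by (intro blin b2 c2)
    show "((\<lambda>y. blinfun_apply (Blinfun (f1 t y)) b) has_derivative blinfun_apply (Blinfun (f2 t y b))) (at y)"
      if "t \<in> {0..T}" "y \<in> D" for t y b
      unfolding b2[OF that]
      by (rule has_derivative_transform_within_open[OF d2[OF that, of b] oD that(2)]) (simp only: b1[OF that(1)])
  next
    fix p and t :: real assume p: "p \<in> \<Theta> \<times> \<Gamma>" and t: "t \<in> {0..T}"
    obtain \<theta> x z where p': "p = (\<theta>, x, z)" by (cases p)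
    show "((\<lambda>t. (fst p, xs p t, zs p t)) has_vector_derivative ode_field F G t (fst p, xs p t, zs p t)) (at t within {0..T})"
      using sol[OF p] t unfolding ode_field_def
      by (intro has_vector_derivative_Pair)
         (auto simp: ivp_solution_def field_arg_def p' has_real_derivative_iff_has_vector_derivative)
    show "(fst p, xs p t, zs p t) \<in> D" using p by (auto simp: D_def)
  next
    fix p assume p: "p \<in> \<Theta> \<times> \<Gamma>"
    then show "(fst p, xs p 0, zs p 0) = p" using sol[OF p] by (auto simp: ivp_solution_def)
  next
    fix t :: real and y assume ty: "t \<in> {0..T}" "y \<in> D"
    show "(ode_field F G t has_derivative blinfun_apply (Blinfun (f1 t y))) (at y)"
      unfolding b1[OF ty] by (rule d1[OF ty])
  qed
  then show ?thesis unfolding D_def by blast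
qed

section \<open>The penalty and the distance to the exact path\<close>

lemma C1_time_deriv:
  assumes T: "0 < T" and u: "Ck_on 1 {0..T} u"
  shows "t \<in> {0..T} \<Longrightarrow> (u has_vector_derivative time_deriv T u t) (at t within {0..T})"
    and "continuous_on {0..T} (time_deriv T u)"
proof -
  obtain D where D: "\<And>t. t \<in> {0..T} \<Longrightarrow> (u has_derivative D t) (at t within {0..T})"
    and c: "\<And>v. continuous_on {0..T} (\<lambda>t. D t v)"
    using u unfolding One_nat_def Ck_on.simps by blast
  have d: "(u has_vector_derivative D t 1) (at t within {0..T})" if "t \<in> {0..T}" for t
  proof -
    have "D t s = s *\<^sub>R D t 1" for s
      using linear_scale[OF has_derivative_linear[OF D[OF that]], of s 1] by simp
    then have "D t = (\<lambda>s. s *\<^sub>R D t 1)" by blast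
    then show ?thesis using D[OF that] unfolding has_vector_derivative_def by metis
  qed
  have e: "time_deriv T u t = D t 1" if "t \<in> {0..T}" for t
    by (rule vector_derivative_within_closed_interval[OF T that d[OF that]])
  show "t \<in> {0..T} \<Longrightarrow> (u has_vector_derivative time_deriv T u t) (at t within {0..T})"
    using d e by simp
  show "continuous_on {0..T} (time_deriv T u)"
    by (rule continuous_on_eq[OF c[of 1]]) (simp add: e)
qed

locale smooth_ivp =
  fixes T :: real and \<Theta> :: "(real ^ 'd::finite) set" and \<Gamma> :: "(real \<times> real) set"
    and F G :: "real \<times> real \<times> real \<times> (real ^ 'd) \<Rightarrow> real" and xs zs :: "'d param \<Rightarrow> real \<Rightarrow> real"
  assumes T_pos: "0 < T" and open_Theta: "open \<Theta>" and open_Gamma: "open \<Gamma>"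
    and F_smooth: "Ck_on 3 (UNIV \<times> UNIV \<times> {0..T} \<times> \<Theta>) F"
    and G_smooth: "Ck_on 3 (UNIV \<times> UNIV \<times> {0..T} \<times> \<Theta>) G"
    and solution: "\<And>p. p \<in> \<Theta> \<times> \<Gamma> \<Longrightarrow> ivp_solution T F G p (xs p) (zs p)"
begin

lemma solution_C2:
  "\<exists>X1 X2.
    continuous_on ((\<Theta> \<times> \<Gamma>) \<times> {0..T}) (\<lambda>(p, t). xs p t) \<and>
    (\<forall>v. continuous_on ((\<Theta> \<times> \<Gamma>) \<times> {0..T}) (\<lambda>(p, t). X1 p v t)) \<and>
    (\<forall>u v. continuous_on ((\<Theta> \<times> \<Gamma>) \<times> {0..T}) (\<lambda>(p, t). X2 p u v t)) \<and>
    (\<forall>p\<in>\<Theta> \<times> \<Gamma>. \<forall>t\<in>{0..T}.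
      (\<forall>v. ((\<lambda>s. xs (p + s *\<^sub>R v) t) has_real_derivative X1 p v t) (at 0)) \<and>
      (\<forall>u v. ((\<lambda>s. X1 (p + s *\<^sub>R u) v t) has_real_derivative X2 p u v t) (at 0)) \<and>
      linear (\<lambda>v. X1 p v t) \<and> (\<forall>u. linear (\<lambda>v. X2 p u v t)) \<and> (\<forall>v. linear (\<lambda>u. X2 p u v t)) \<and>
      (\<forall>u v. X2 p u v t = X2 p v u t))"
proof -
  obtain f' f'' where "C2_flow T (\<Theta> \<times> UNIV) (\<Theta> \<times> \<Gamma>) (ode_field F G) f' (\<lambda>p t. (fst p, xs p t, zs p t)) f''"
    using ode_C2_flow[OF T_pos open_Theta open_Gamma F_smooth G_smooth solution] by blast
  then interpret C2_flow T "\<Theta> \<times> UNIV" "\<Theta> \<times> \<Gamma>" "ode_field F G" f' "\<lambda>p t. (fst p, xs p t, zs p t)" f'' .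
  have bl: "bounded_linear (\<lambda>p :: 'd param. fst (snd p))"
    by (intro bounded_linear_compose[OF bounded_linear_fst bounded_linear_snd])
  note li = bounded_linear.linear[OF bl]
  let ?X1 = "\<lambda>p v t. fst (snd (flow_deriv p v t))" and ?X2 = "\<lambda>p u v t. fst (snd (flow_deriv2 p u v t))"
  have l: "linear (\<lambda>v. fst (snd (k v)))" if "linear k" for k :: "'d param \<Rightarrow> 'd param"
    using linear_compose[OF that li] by (simp add: o_def)
  show ?thesis
  proof (rule exI[of _ ?X1], rule exI[of _ ?X2], intro conjI allI ballI)
    show "continuous_on ((\<Theta> \<times> \<Gamma>) \<times> {0..T}) (\<lambda>(p, t). xs p t)"
      using bounded_linear.continuous_on[OF bl cont_Y_joint] by (simp add: case_prod_beta)
    show "continuous_on ((\<Theta> \<times> \<Gamma>) \<times> {0..T}) (\<lambda>(p, t). ?X1 p v t)" for v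
      using bounded_linear.continuous_on[OF bl cont_flow_deriv] by (simp add: case_prod_beta)
    show "continuous_on ((\<Theta> \<times> \<Gamma>) \<times> {0..T}) (\<lambda>(p, t). ?X2 p u v t)" for u v
      using bounded_linear.continuous_on[OF bl cont_flow_deriv2] by (simp add: case_prod_beta)
    fix p t assume p: "p \<in> \<Theta> \<times> \<Gamma>" and t: "t \<in> {0..T}"
    show "((\<lambda>s. xs (p + s *\<^sub>R v) t) has_real_derivative ?X1 p v t) (at 0)" for v
      unfolding has_real_derivative_iff_has_vector_derivative
      using bounded_linear.has_vector_derivative[OF bl flow_deriv_works[OF p t]] by simp
    show "((\<lambda>s. ?X1 (p + s *\<^sub>R u) v t) has_real_derivative ?X2 p u v t) (at 0)" for u v
      unfolding has_real_derivative_iff_has_vector_derivative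
      by (rule bounded_linear.has_vector_derivative[OF bl flow_deriv2_works[OF p t]])
    show "linear (\<lambda>v. ?X1 p v t)" by (rule l[OF linear_flow_deriv[OF p t]])
    show "linear (\<lambda>v. ?X2 p u v t)" for u by (rule l[OF linear_flow_deriv2_right[OF p t]])
    show "linear (\<lambda>u. ?X2 p u v t)" for v by (rule l[OF linear_flow_deriv2_left[OF p t]])
    show "?X2 p u v t = ?X2 p v u t" for u v by (simp add: flow_deriv2_commute[OF p t, of u])
  qed
qed

lemma cont_solution: "continuous_on ((\<Theta> \<times> \<Gamma>) \<times> {0..T}) (\<lambda>(p, t). xs p t)"
  using solution_C2 by blast

lemma cont_residual:
  assumes u: "Ck_on 1 {0..T} u" and v: "Ck_on 1 {0..T} v" and \<theta>: "\<theta> \<in> \<Theta>"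
  shows "continuous_on {0..T} (\<lambda>t. time_deriv T u t - F (u t, v t, t, \<theta>))"
    and "continuous_on {0..T} (\<lambda>t. time_deriv T v t - G (u t, v t, t, \<theta>))"
proof -
  have c: "continuous_on {0..T} (\<lambda>t. (u t, v t, t, \<theta>))"
    by (intro continuous_intros continuous_on_vector_derivative[OF C1_time_deriv(1)[OF T_pos u]]
        continuous_on_vector_derivative[OF C1_time_deriv(1)[OF T_pos v]])
  have im: "(\<lambda>t. (u t, v t, t, \<theta>)) ` {0..T} \<subseteq> UNIV \<times> UNIV \<times> {0..T} \<times> \<Theta>" using \<theta> by auto
  have three: "(3 :: nat) = Suc (Suc (Suc 0))" by simp
  have "continuous_on (UNIV \<times> UNIV \<times> {0..T} \<times> \<Theta>) h" if "Ck_on 3 (UNIV \<times> UNIV \<times> {0..T} \<times> \<Theta>) h" for h :: "_ \<Rightarrow> real"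
    using that[unfolded three, THEN Ck_on_SucD, THEN Ck_on_SucD, THEN Ck_on_SucD] by simp
  note cF = this[OF F_smooth] and cG = this[OF G_smooth]
  show "continuous_on {0..T} (\<lambda>t. time_deriv T u t - F (u t, v t, t, \<theta>))"
    by (intro continuous_on_diff C1_time_deriv(2)[OF T_pos u] continuous_on_compose2[OF cF c im])
  show "continuous_on {0..T} (\<lambda>t. time_deriv T v t - G (u t, v t, t, \<theta>))"
    by (intro continuous_on_diff C1_time_deriv(2)[OF T_pos v] continuous_on_compose2[OF cG c im])
qed

text \<open>A pair of paths with the prescribed initial values solves the system up to its own residual, whose
  squared integral is the penalty.  All constants are uniform over \<open>K\<close> because the trajectories that start
  in \<open>K\<close> fill a compact set.\<close>

lemma penalty_controls_distance:
  assumes K: "compact K" "K \<subseteq> \<Theta> \<times> \<Gamma>"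
  shows "\<exists>\<eta>>0. \<exists>A\<ge>1. \<forall>\<theta> x z u v B. (\<theta>, x, z) \<in> K \<longrightarrow> Ck_on 1 {0..T} u \<longrightarrow> Ck_on 1 {0..T} v \<longrightarrow>
    u 0 = x \<longrightarrow> v 0 = z \<longrightarrow> penalty T F G u v \<theta> \<le> B \<longrightarrow> A * B < \<eta>\<^sup>2 \<longrightarrow>
    (\<forall>t\<in>{0..T}. (u t - xs (\<theta>, x, z) t)\<^sup>2 \<le> A * B)"
proof -
  obtain f' f'' where "C2_flow T (\<Theta> \<times> UNIV) (\<Theta> \<times> \<Gamma>) (ode_field F G) f' (\<lambda>p t. (fst p, xs p t, zs p t)) f''"
    using ode_C2_flow[OF T_pos open_Theta open_Gamma F_smooth G_smooth solution] by blast
  then interpret C2_flow T "\<Theta> \<times> UNIV" "\<Theta> \<times> \<Gamma>" "ode_field F G" f' "\<lambda>p t. (fst p, xs p t, zs p t)" f'' .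
  define Y where "Y p t = (fst p, xs p t, zs p t)" for p t
  define C where "C = (\<lambda>(p, t). Y p t) ` (K \<times> {0..T})"
  have "continuous_on (K \<times> {0..T}) (\<lambda>(p, t). Y p t)"
    unfolding Y_def by (rule continuous_on_subset[OF cont_Y_joint]) (use K in auto)
  then have C: "compact C" unfolding C_def by (intro compact_continuous_image compact_Times K) auto
  have CD: "C \<subseteq> \<Theta> \<times> UNIV" using K by (auto simp: C_def Y_def)
  obtain \<eta> A where \<eta>: "\<eta> > 0" and A: "A \<ge> 1" and st:
    "\<forall>y z r B. (\<forall>t\<in>{0..T}. (y has_vector_derivative ode_field F G t (y t)) (at t within {0..T}) \<and> y t \<in> C \<and>
        (z has_vector_derivative ode_field F G t (z t) + r t) (at t within {0..T})) \<longrightarrow>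
      continuous_on {0..T} r \<longrightarrow>
      (norm (z 0 - y 0))\<^sup>2 + integral {0..T} (\<lambda>t. (norm (r t))\<^sup>2) \<le> B \<longrightarrow> A * B < \<eta>\<^sup>2 \<longrightarrow>
      (\<forall>t\<in>{0..T}. (norm (z t - y t))\<^sup>2 \<le> A * B)"
    by (rule stability[OF C CD]) blast
  show ?thesis
  proof (rule exI[of _ \<eta>], rule conjI[OF \<eta>], rule exI[of _ A], rule conjI[OF A], intro allI impI ballI)
    fix \<theta> x z u v B t
    assume p: "(\<theta>, x, z) \<in> K" and u: "Ck_on 1 {0..T} u" and v: "Ck_on 1 {0..T} v" and u0: "u 0 = x" and v0: "v 0 = z"
      and B: "penalty T F G u v \<theta> \<le> B" and AB: "A * B < \<eta>\<^sup>2" and t: "t \<in> {0..T}"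
    have pU: "(\<theta>, x, z) \<in> \<Theta> \<times> \<Gamma>" using p K by auto
    let ?w = "\<lambda>t. (\<theta>, u t, v t)"
    let ?a = "\<lambda>t. time_deriv T u t - F (u t, v t, t, \<theta>)" and ?b = "\<lambda>t. time_deriv T v t - G (u t, v t, t, \<theta>)"
    let ?r = "\<lambda>t. (0 :: real ^ 'd, ?a t, ?b t)"
    have \<theta>: "\<theta> \<in> \<Theta>" using pU by simp
    note ca = cont_residual(1)[OF u v \<theta>] and cb = cont_residual(2)[OF u v \<theta>]
    have "\<forall>t\<in>{0..T}. (norm (?w t - Y (\<theta>, x, z) t))\<^sup>2 \<le> A * B"
    proof (rule st[THEN spec[of _ "Y (\<theta>, x, z)"], THEN spec[of _ ?w], THEN spec[of _ ?r], THEN spec[of _ B],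
          THEN mp, THEN mp, THEN mp, THEN mp])
      show "\<forall>t\<in>{0..T}. (Y (\<theta>, x, z) has_vector_derivative ode_field F G t (Y (\<theta>, x, z) t)) (at t within {0..T}) \<and>
          Y (\<theta>, x, z) t \<in> C \<and> (?w has_vector_derivative ode_field F G t (?w t) + ?r t) (at t within {0..T})"
      proof (intro ballI conjI)
        fix s assume s: "s \<in> {0..T}"
        show "(Y (\<theta>, x, z) has_vector_derivative ode_field F G s (Y (\<theta>, x, z) s)) (at s within {0..T})"
          unfolding Y_def[abs_def] by (rule sol[OF pU s])
        show "Y (\<theta>, x, z) s \<in> C" using s p by (auto simp: C_def)
        have "(?w has_vector_derivative (0, time_deriv T u s, time_deriv T v s)) (at s within {0..T})"
          by (intro has_vector_derivative_Pair has_vector_derivative_const C1_time_deriv(1)[OF T_pos] u v s)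
        then show "(?w has_vector_derivative ode_field F G s (?w s) + ?r s) (at s within {0..T})"
          by (simp add: ode_field_def field_arg_def)
      qed
      show "continuous_on {0..T} ?r" by (intro continuous_intros ca cb)
      have "integral {0..T} (\<lambda>t. (norm (?r t))\<^sup>2) = integral {0..T} (\<lambda>t. (?a t)\<^sup>2 + (?b t)\<^sup>2)"
        by (simp add: norm_Pair)
      also have "\<dots> = integral {0..T} (\<lambda>t. (?a t)\<^sup>2) + integral {0..T} (\<lambda>t. (?b t)\<^sup>2)"
        by (intro integral_add integrable_continuous_real continuous_on_power ca cb)
      finally show "(norm (?w 0 - Y (\<theta>, x, z) 0))\<^sup>2 + integral {0..T} (\<lambda>t. (norm (?r t))\<^sup>2) \<le> B"
        using B u0 v0 init[OF pU] by (simp add: penalty_def Y_def)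
    qed (rule AB)
    then have "(norm (?w t - Y (\<theta>, x, z) t))\<^sup>2 \<le> A * B" using t by blast
    moreover have "(u t - xs (\<theta>, x, z) t)\<^sup>2 \<le> (norm (?w t - Y (\<theta>, x, z) t))\<^sup>2"
      by (simp add: Y_def norm_Pair)
    ultimately show "(u t - xs (\<theta>, x, z) t)\<^sup>2 \<le> A * B" by linarith
  qed
qed

text \<open>The field is Lipschitz near the exact trajectories, so the residual of an approximant is of the order
  of its \<open>C\<^sup>1\<close> error, and the penalty is quadratic in it.\<close>

lemma penalty_of_approximant:
  assumes K: "compact K" "K \<subseteq> \<Theta> \<times> \<Gamma>"
  shows "\<exists>\<eta>>0. \<exists>A\<ge>0. \<forall>\<theta> x z u v e. (\<theta>, x, z) \<in> K \<longrightarrow> Ck_on 1 {0..T} u \<longrightarrow> Ck_on 1 {0..T} v \<longrightarrow>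
    e \<le> \<eta> \<longrightarrow> (\<forall>t\<in>{0..T}. \<bar>xs (\<theta>, x, z) t - u t\<bar> \<le> e \<and> \<bar>zs (\<theta>, x, z) t - v t\<bar> \<le> e \<and>
      \<bar>time_deriv T (xs (\<theta>, x, z)) t - time_deriv T u t\<bar> \<le> e \<and>
      \<bar>time_deriv T (zs (\<theta>, x, z)) t - time_deriv T v t\<bar> \<le> e) \<longrightarrow>
    penalty T F G u v \<theta> \<le> A * e\<^sup>2"
proof -
  obtain f' f'' where "C2_flow T (\<Theta> \<times> UNIV) (\<Theta> \<times> \<Gamma>) (ode_field F G) f' (\<lambda>p t. (fst p, xs p t, zs p t)) f''"
    using ode_C2_flow[OF T_pos open_Theta open_Gamma F_smooth G_smooth solution] by blast
  then interpret C2_flow T "\<Theta> \<times> UNIV" "\<Theta> \<times> \<Gamma>" "ode_field F G" f' "\<lambda>p t. (fst p, xs p t, zs p t)" f'' .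
  define Y where "Y p t = (fst p, xs p t, zs p t)" for p t
  define C where "C = (\<lambda>(p, t). Y p t) ` (K \<times> {0..T})"
  have "continuous_on (K \<times> {0..T}) (\<lambda>(p, t). Y p t)"
    unfolding Y_def by (rule continuous_on_subset[OF cont_Y_joint]) (use K in auto)
  then have C: "compact C" unfolding C_def by (intro compact_continuous_image compact_Times K) auto
  have CD: "C \<subseteq> \<Theta> \<times> UNIV" using K by (auto simp: C_def Y_def)
  obtain \<eta> L where \<eta>: "\<eta> > 0" and L: "L \<ge> 0" and lip: "\<forall>t\<in>{0..T}. \<forall>c\<in>C. \<forall>y\<in>cball c \<eta>.
      norm (f' t y) \<le> L \<and> norm (ode_field F G t y - ode_field F G t c) \<le> L * norm (y - c)"
    by (rule tube[OF C CD]) blast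
  define A where "A = 2 * (T * (1 + 2 * L)\<^sup>2)"
  have A: "A \<ge> 0" using T_pos by (simp add: A_def)
  have \<eta>2: "\<eta> / 2 > 0" using \<eta> by simp
  show ?thesis
  proof (rule exI[of _ "\<eta>/2"], rule conjI[OF \<eta>2], rule exI[of _ A], rule conjI[OF A], intro allI impI)
    fix \<theta> x z u v e
    assume p: "(\<theta>, x, z) \<in> K" and u: "Ck_on 1 {0..T} u" and v: "Ck_on 1 {0..T} v" and e: "e \<le> \<eta>/2" and
      close: "\<forall>t\<in>{0..T}. \<bar>xs (\<theta>, x, z) t - u t\<bar> \<le> e \<and> \<bar>zs (\<theta>, x, z) t - v t\<bar> \<le> e \<and>
      \<bar>time_deriv T (xs (\<theta>, x, z)) t - time_deriv T u t\<bar> \<le> e \<and>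
      \<bar>time_deriv T (zs (\<theta>, x, z)) t - time_deriv T v t\<bar> \<le> e"
    let ?p = "(\<theta>, x, z)"
    have pU: "?p \<in> \<Theta> \<times> \<Gamma>" using p K by auto
    then have \<theta>: "\<theta> \<in> \<Theta>" by simp
    let ?a = "\<lambda>t. time_deriv T u t - F (u t, v t, t, \<theta>)" and ?b = "\<lambda>t. time_deriv T v t - G (u t, v t, t, \<theta>)"
    have bound: "(?a t)\<^sup>2 \<le> ((1 + 2 * L) * e)\<^sup>2 \<and> (?b t)\<^sup>2 \<le> ((1 + 2 * L) * e)\<^sup>2" if t: "t \<in> {0..T}" for t
    proof -
      let ?y = "(\<theta>, u t, v t)"
      have "0 \<le> e" using close t abs_ge_zero order_trans by blast
      have "norm (?y - Y ?p t) \<le> \<bar>u t - xs ?p t\<bar> + \<bar>v t - zs ?p t\<bar>"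
        using norm_Pair_le[of "u t - xs ?p t" "v t - zs ?p t"] by (simp add: Y_def norm_Pair)
      then have d: "norm (?y - Y ?p t) \<le> 2 * e" using close[rule_format, OF t] by linarith
      have c: "Y ?p t \<in> C" using t p by (auto simp: C_def)
      have "?y \<in> cball (Y ?p t) \<eta>" using d e by (simp add: dist_norm norm_minus_commute)
      then have "norm (ode_field F G t ?y - ode_field F G t (Y ?p t)) \<le> L * norm (?y - Y ?p t)"
        using lip t c by blast
      also have "\<dots> \<le> L * (2 * e)" using d L by (intro mult_left_mono) auto
      finally have "norm (ode_field F G t ?y - ode_field F G t (Y ?p t)) \<le> 2 * L * e" by simp
      moreover have "\<bar>F (u t, v t, t, \<theta>) - F (xs ?p t, zs ?p t, t, \<theta>)\<bar> \<le> norm (ode_field F G t ?y - ode_field F G t (Y ?p t))"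
        "\<bar>G (u t, v t, t, \<theta>) - G (xs ?p t, zs ?p t, t, \<theta>)\<bar> \<le> norm (ode_field F G t ?y - ode_field F G t (Y ?p t))"
        by (simp_all add: ode_field_def field_arg_def Y_def norm_Pair real_le_rsqrt)
      moreover have "time_deriv T (xs ?p) t = F (xs ?p t, zs ?p t, t, \<theta>)" "time_deriv T (zs ?p) t = G (xs ?p t, zs ?p t, t, \<theta>)"
        using solution[OF pU] t T_pos
        by (auto simp: ivp_solution_def has_real_derivative_iff_has_vector_derivative
            intro!: vector_derivative_within_closed_interval)
      ultimately have "\<bar>?a t\<bar> \<le> (1 + 2 * L) * e" "\<bar>?b t\<bar> \<le> (1 + 2 * L) * e"
        using close[rule_format, OF t] unfolding distrib_right by linarith+
      then show ?thesis using L \<open>0 \<le> e\<close> by (auto simp: abs_le_square_iff[symmetric])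
    qed
    have i: "integral {0..T} (\<lambda>t. (k t)\<^sup>2) \<le> T * ((1 + 2 * L) * e)\<^sup>2"
      if "continuous_on {0..T} k" "\<And>t. t \<in> {0..T} \<Longrightarrow> (k t)\<^sup>2 \<le> ((1 + 2 * L) * e)\<^sup>2" for k :: "real \<Rightarrow> real"
    proof -
      have "integral {0..T} (\<lambda>t. (k t)\<^sup>2) \<le> integral {0..T} (\<lambda>t. ((1 + 2 * L) * e)\<^sup>2)"
        by (intro integral_le integrable_continuous_real continuous_on_power continuous_on_const that)
      then show ?thesis using T_pos by simp
    qed
    have "integral {0..T} (\<lambda>t. (?a t)\<^sup>2) \<le> T * ((1 + 2 * L) * e)\<^sup>2"
      by (rule i[OF cont_residual(1)[OF u v \<theta>]]) (use bound in blast)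
    moreover have "integral {0..T} (\<lambda>t. (?b t)\<^sup>2) \<le> T * ((1 + 2 * L) * e)\<^sup>2"
      by (rule i[OF cont_residual(2)[OF u v \<theta>]]) (use bound in blast)
    ultimately show "penalty T F G u v \<theta> \<le> A * e\<^sup>2"
      unfolding penalty_def A_def by (simp add: power_mult_distrib)
  qed
qed

end

section \<open>Likely events and independent samples\<close>

text \<open>The property \<open>Q n\<close> may involve suprema over uncountably many parameters and arbitrarily selected
  profile paths, so it need not be measurable.  Hence the probability is that of a measurable event inside
  it.  Holding for every \<open>e > 0\<close> means holding with probability tending to one.\<close>

definition likely :: "'w measure \<Rightarrow> real \<Rightarrow> (nat \<Rightarrow> 'w \<Rightarrow> bool) \<Rightarrow> bool" where
  "likely M e Q \<longleftrightarrow> (\<forall>\<^sub>F n in sequentially. \<exists>B\<in>sets M. 1 - e \<le> measure M B \<and> (\<forall>\<omega>\<in>B. Q n \<omega>))"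

lemma likely_mono:
  assumes "likely M a Q" "a \<le> b" "\<forall>\<^sub>F n in sequentially. \<forall>\<omega>\<in>space M. Q n \<omega> \<longrightarrow> R n \<omega>"
  shows "likely M b R"
  using assms(1,3) unfolding likely_def
proof eventually_elim
  case (elim n)
  then obtain B where "B \<in> sets M" "1 - a \<le> measure M B" "\<forall>\<omega>\<in>B. Q n \<omega>" by blast
  then show ?case using elim(2) assms(2) sets.sets_into_space[of B M] by (intro bexI[of _ B]) auto
qed

lemma (in prob_space) likely_conj:
  assumes "likely M a Q" "likely M b R"
  shows "likely M (a + b) (\<lambda>n \<omega>. Q n \<omega> \<and> R n \<omega>)"
  using assms unfolding likely_def
proof eventually_elim
  case (elim n)
  then obtain A B where A: "A \<in> sets M" "1 - a \<le> measure M A" "\<forall>\<omega>\<in>A. Q n \<omega>"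
    and B: "B \<in> sets M" "1 - b \<le> measure M B" "\<forall>\<omega>\<in>B. R n \<omega>" by blast
  have "prob (A \<union> B) = prob A + prob B - prob (A \<inter> B)"
    using A B finite_measure_Union'[of A B] finite_measure_Diff'[of B A] by (simp add: Int_commute)
  then have "1 - (a + b) \<le> prob (A \<inter> B)" using A B prob_le_1[of "A \<union> B"] by linarith
  then show ?case using A B by (intro bexI[of _ "A \<inter> B"]) auto
qed

lemma (in prob_space) likely_markov:
  assumes X: "\<forall>\<^sub>F n in sequentially. integrable M (X n) \<and> (AE \<omega> in M. 0 \<le> X n \<omega>) \<and> expectation (X n) \<le> c" and a: "0 < a"
  shows "likely M (c / a) (\<lambda>n \<omega>. X n \<omega> \<le> a)"
  using X unfolding likely_def
proof eventually_elim
  case (elim n)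
  let ?A = "{\<omega> \<in> space M. a \<le> X n \<omega>}"
  have m: "X n \<in> borel_measurable M" using elim by auto
  have A: "?A \<in> sets M" using m by measurable
  have "prob ?A \<le> expectation (X n) / a"
    by (rule integral_Markov_inequality_measure[OF _ A]) (use elim a in auto)
  also have "\<dots> \<le> c / a" using elim a by (simp add: divide_right_mono)
  finally have "1 - c / a \<le> prob (space M - ?A)" using A by (simp add: prob_compl)
  then show ?case using A by (intro bexI[of _ "space M - ?A"]) auto
qed

lemma (in prob_space) likely_AE:
  assumes "AE \<omega> in M. \<forall>n. Q n \<omega>" "0 \<le> e"
  shows "likely M e Q"
proof -
  obtain N where N: "{\<omega>\<in>space M. \<not> (\<forall>n. Q n \<omega>)} \<subseteq> N" "emeasure M N = 0" "N \<in> sets M"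
    using AE_E[OF assms(1)] .
  have "prob N = 0" by (simp add: measure_def N(2))
  then have "prob (space M - N) = 1" by (simp add: prob_compl[OF N(3)])
  then show ?thesis unfolding likely_def using N assms(2)
    by (intro always_eventually allI bexI[of _ "space M - N"]) auto
qed

lemma (in prob_space) indep_sets_reindex:
  assumes "inj_on h I" "indep_sets A (h ` I)"
  shows "indep_sets (\<lambda>i. A (h i)) I"
proof (rule indep_setsI)
  show "A (h i) \<subseteq> events" if "i \<in> I" for i using assms(2) that unfolding indep_sets_def by auto
  fix B J assume J: "J \<noteq> {}" "J \<subseteq> I" "finite J" "\<forall>j\<in>J. B j \<in> A (h j)"
  have inj: "inj_on h J" using assms(1) J inj_on_subset by blast
  have inv: "the_inv_into J h (h j) = j" if "j \<in> J" for j using inj that by (rule the_inv_into_f_f)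
  have "prob (\<Inter>j\<in>h ` J. B (the_inv_into J h j)) = (\<Prod>j\<in>h ` J. prob (B (the_inv_into J h j)))"
    by (rule indep_setsD[OF assms(2)]) (use J inv in auto)
  then show "prob (\<Inter>j\<in>J. B j) = (\<Prod>j\<in>J. prob (B j))"
    by (simp add: prod.reindex[OF inj] inv)
qed

locale iid_sample = prob_space M for M :: "'w measure" +
  fixes Z :: "nat \<Rightarrow> 'w \<Rightarrow> 'z::topological_space"
  assumes indep: "indep_vars (\<lambda>_. borel) Z {1..}"
    and ident: "\<And>i. 1 \<le> i \<Longrightarrow> distr M borel (Z i) = distr M borel (Z 1)"
begin

lemma Z_measurable: "1 \<le> i \<Longrightarrow> Z i \<in> borel_measurable M"
  using indep unfolding indep_vars_def by auto

lemma comp_measurable: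
  assumes "\<phi> \<in> borel_measurable borel" "1 \<le> i"
  shows "(\<lambda>\<omega>. \<phi> (Z i \<omega>)) \<in> borel_measurable M"
  by (rule measurable_compose[OF Z_measurable[OF assms(2)] assms(1)])

lemma integrable_transfer:
  fixes \<phi> :: "'z \<Rightarrow> real"
  assumes "\<phi> \<in> borel_measurable borel" "1 \<le> i"
  shows "integrable M (\<lambda>\<omega>. \<phi> (Z i \<omega>)) \<longleftrightarrow> integrable M (\<lambda>\<omega>. \<phi> (Z 1 \<omega>))"
  using integrable_distr_eq[OF Z_measurable[OF assms(2)] assms(1)]
    integrable_distr_eq[OF Z_measurable[OF order_refl] assms(1)] ident[OF assms(2)] by simp

lemma expectation_transfer:
  fixes \<phi> :: "'z \<Rightarrow> real"
  assumes "\<phi> \<in> borel_measurable borel" "1 \<le> i"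
  shows "expectation (\<lambda>\<omega>. \<phi> (Z i \<omega>)) = expectation (\<lambda>\<omega>. \<phi> (Z 1 \<omega>))"
  using integral_distr[OF Z_measurable[OF assms(2)] assms(1)]
    integral_distr[OF Z_measurable[OF order_refl] assms(1)] ident[OF assms(2)] by simp

lemma AE_transfer:
  assumes "Measurable.pred borel Q" "AE \<omega> in M. Q (Z 1 \<omega>)"
  shows "AE \<omega> in M. \<forall>i\<ge>1. Q (Z i \<omega>)"
proof -
  have "AE \<omega> in M. Q (Z i \<omega>)" if "1 \<le> i" for i
  proof -
    have Q: "{z \<in> space borel. Q z} \<in> sets borel" using assms(1) by measurable
    have "AE z in distr M borel (Z 1). Q z" using assms(2) by (subst AE_distr_iff[OF Z_measurable Q]) auto
    then have "AE z in distr M borel (Z i). Q z" unfolding ident[OF that] .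
    then show ?thesis by (subst (asm) AE_distr_iff[OF Z_measurable[OF that] Q])
  qed
  then show ?thesis unfolding AE_all_countable by auto
qed

definition sample_mean :: "('z \<Rightarrow> 'b::real_vector) \<Rightarrow> nat \<Rightarrow> 'w \<Rightarrow> 'b" where
  "sample_mean \<phi> n \<omega> = (1 / real n) *\<^sub>R (\<Sum>i=1..n. \<phi> (Z i \<omega>))"

lemma sample_mean_add: "sample_mean (\<lambda>z. \<phi> z + \<psi> z) n \<omega> = sample_mean \<phi> n \<omega> + sample_mean \<psi> n \<omega>"
  by (simp add: sample_mean_def sum.distrib scaleR_add_right)

lemma sample_mean_mono:
  fixes \<phi> \<psi> :: "'z \<Rightarrow> real"
  shows "(\<And>i. 1 \<le> i \<Longrightarrow> i \<le> n \<Longrightarrow> \<phi> (Z i \<omega>) \<le> \<psi> (Z i \<omega>)) \<Longrightarrow> sample_mean \<phi> n \<omega> \<le> sample_mean \<psi> n \<omega>"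
  unfolding sample_mean_def by (auto intro!: divide_right_mono sum_mono)

lemma sample_mean_linear:
  assumes "linear l" shows "l (sample_mean \<phi> n \<omega>) = sample_mean (\<lambda>z. l (\<phi> z)) n \<omega>"
  by (simp add: sample_mean_def linear_scale[OF assms] linear_sum[OF assms])

lemma sample_mean_integrable:
  fixes \<phi> :: "'z \<Rightarrow> real"
  assumes m: "\<phi> \<in> borel_measurable borel" and i: "integrable M (\<lambda>\<omega>. \<phi> (Z 1 \<omega>))"
  shows "integrable M (sample_mean \<phi> n)"
    and "1 \<le> n \<Longrightarrow> expectation (sample_mean \<phi> n) = expectation (\<lambda>\<omega>. \<phi> (Z 1 \<omega>))"
proof -
  have ii: "integrable M (\<lambda>\<omega>. \<phi> (Z i \<omega>))" if "1 \<le> i" for i using integrable_transfer[OF m that] i by simp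
  then show "integrable M (sample_mean \<phi> n)" unfolding sample_mean_def[abs_def]
    by (intro integrable_scaleR_right Bochner_Integration.integrable_sum) auto
  show "expectation (sample_mean \<phi> n) = expectation (\<lambda>\<omega>. \<phi> (Z 1 \<omega>))" if "1 \<le> n"
  proof -
    have "expectation (sample_mean \<phi> n) = (1 / real n) * (\<Sum>i=1..n. expectation (\<lambda>\<omega>. \<phi> (Z i \<omega>)))"
      unfolding sample_mean_def[abs_def] using ii by (simp add: Bochner_Integration.integral_sum)
    also have "(\<Sum>i=1..n. expectation (\<lambda>\<omega>. \<phi> (Z i \<omega>))) = (\<Sum>i=1..n. expectation (\<lambda>\<omega>. \<phi> (Z 1 \<omega>)))"
      by (intro sum.cong expectation_transfer m) auto
    finally show ?thesis using that by simp
  qed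
qed

text \<open>Independence makes the mixed terms vanish.\<close>

lemma second_moment_of_sum:
  fixes \<phi> :: "'z \<Rightarrow> real"
  assumes m: "\<phi> \<in> borel_measurable borel" and sq: "integrable M (\<lambda>\<omega>. (\<phi> (Z 1 \<omega>))\<^sup>2)"
    and mean: "expectation (\<lambda>\<omega>. \<phi> (Z 1 \<omega>)) = 0"
  shows "integrable M (\<lambda>\<omega>. (\<Sum>i=1..n. \<phi> (Z i \<omega>))\<^sup>2)"
    and "expectation (\<lambda>\<omega>. (\<Sum>i=1..n. \<phi> (Z i \<omega>))\<^sup>2) = real n * expectation (\<lambda>\<omega>. (\<phi> (Z 1 \<omega>))\<^sup>2)"
proof -
  let ?X = "\<lambda>i \<omega>. \<phi> (Z i \<omega>)"
  have m2: "(\<lambda>z. (\<phi> z)\<^sup>2) \<in> borel_measurable borel" using m by measurable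
  have sqi: "integrable M (\<lambda>\<omega>. (?X i \<omega>)\<^sup>2)" if "1 \<le> i" for i
    using integrable_transfer[OF m2 that] sq by simp
  have xi: "integrable M (?X i)" if "1 \<le> i" for i
    by (rule square_integrable_imp_integrable[OF comp_measurable[OF m that] sqi[OF that]])
  have prod: "integrable M (\<lambda>\<omega>. ?X i \<omega> * ?X j \<omega>) \<and> expectation (\<lambda>\<omega>. ?X i \<omega> * ?X j \<omega>) =
      (if i = j then expectation (\<lambda>\<omega>. (?X 1 \<omega>)\<^sup>2) else 0)" if ij: "1 \<le> i" "1 \<le> j" for i j
  proof (cases "i = j")
    case True
    then show ?thesis using sqi[OF ij(1)] expectation_transfer[OF m2 ij(1)] by (simp add: power2_eq_square)
  next
    case False
    have "indep_vars (\<lambda>_. borel) ?X {1..}" by (rule indep_vars_compose2[OF indep]) (use m in auto)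
    then have I: "indep_vars (\<lambda>_. borel) ?X {i, j}" by (rule indep_vars_subset) (use ij in auto)
    have "integrable M (\<lambda>\<omega>. \<Prod>k\<in>{i, j}. ?X k \<omega>)" "expectation (\<lambda>\<omega>. \<Prod>k\<in>{i, j}. ?X k \<omega>) = (\<Prod>k\<in>{i, j}. expectation (?X k))"
      using xi ij by (auto intro!: indep_vars_integrable indep_vars_lebesgue_integral I)
    moreover have "expectation (?X i) = 0" using expectation_transfer[OF m ij(1)] mean by simp
    ultimately show ?thesis using False by simp
  qed
  have eq: "(\<lambda>\<omega>. (\<Sum>i=1..n. ?X i \<omega>)\<^sup>2) = (\<lambda>\<omega>. \<Sum>i=1..n. \<Sum>j=1..n. ?X i \<omega> * ?X j \<omega>)"
    by (simp add: power2_eq_square sum_product)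
  show "integrable M (\<lambda>\<omega>. (\<Sum>i=1..n. ?X i \<omega>)\<^sup>2)"
    unfolding eq using prod by (intro Bochner_Integration.integrable_sum) auto
  have "expectation (\<lambda>\<omega>. (\<Sum>i=1..n. ?X i \<omega>)\<^sup>2) = (\<Sum>i=1..n. \<Sum>j=1..n. expectation (\<lambda>\<omega>. ?X i \<omega> * ?X j \<omega>))"
    unfolding eq using prod by (subst Bochner_Integration.integral_sum, force intro!: Bochner_Integration.integrable_sum)
      (auto intro!: sum.cong Bochner_Integration.integral_sum)
  also have "\<dots> = (\<Sum>i=1..n. \<Sum>j=1..n. if i = j then expectation (\<lambda>\<omega>. (?X 1 \<omega>)\<^sup>2) else 0)"
    using prod by (intro sum.cong refl) auto
  also have "\<dots> = real n * expectation (\<lambda>\<omega>. (?X 1 \<omega>)\<^sup>2)" by simp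
  finally show "expectation (\<lambda>\<omega>. (\<Sum>i=1..n. ?X i \<omega>)\<^sup>2) = real n * expectation (\<lambda>\<omega>. (?X 1 \<omega>)\<^sup>2)" .
qed

end

section \<open>The weak law and characteristic functions\<close>

lemma (in prob_space) truncated_tail_small:
  fixes X :: "'a \<Rightarrow> real"
  assumes X: "integrable M X" and \<eta>: "\<eta> > 0"
  obtains K where "K > 0" "expectation (\<lambda>\<omega>. \<bar>X \<omega>\<bar> * indicator {z. K < \<bar>z\<bar>} (X \<omega>)) \<le> \<eta>"
proof -
  have [measurable]: "X \<in> borel_measurable M" using X by auto
  have "(\<lambda>k. expectation (\<lambda>\<omega>. \<bar>X \<omega>\<bar> * indicator {z. real k < \<bar>z\<bar>} (X \<omega>))) \<longlonglongrightarrow> expectation (\<lambda>\<omega>. 0)"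
  proof (rule integral_dominated_convergence[where w = "\<lambda>\<omega>. \<bar>X \<omega>\<bar>"])
    show "AE \<omega> in M. (\<lambda>k. \<bar>X \<omega>\<bar> * indicator {z. real k < \<bar>z\<bar>} (X \<omega>)) \<longlonglongrightarrow> 0"
    proof (intro AE_I2 tendsto_eventually)
      fix \<omega>
      obtain k0 :: nat where "\<bar>X \<omega>\<bar> \<le> real k0" using real_arch_simple by blast
      then show "\<forall>\<^sub>F k in sequentially. \<bar>X \<omega>\<bar> * indicator {z. real k < \<bar>z\<bar>} (X \<omega>) = 0"
        by (intro eventually_sequentiallyI[of k0]) (auto simp: indicator_def)
    qed
    show "AE \<omega> in M. norm (\<bar>X \<omega>\<bar> * indicator {z. real k < \<bar>z\<bar>} (X \<omega>)) \<le> \<bar>X \<omega>\<bar>" for k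
      by (auto simp: indicator_def)
  qed (use X in auto)
  then have "(\<lambda>k. expectation (\<lambda>\<omega>. \<bar>X \<omega>\<bar> * indicator {z. real k < \<bar>z\<bar>} (X \<omega>))) \<longlonglongrightarrow> 0" by simp
  from order_tendstoD(2)[OF this \<eta>] eventually_gt_at_top[of 0]
  have "\<forall>\<^sub>F k in sequentially. expectation (\<lambda>\<omega>. \<bar>X \<omega>\<bar> * indicator {z. real k < \<bar>z\<bar>} (X \<omega>)) < \<eta> \<and> 0 < k"
    by (rule eventually_conj)
  then obtain k where "expectation (\<lambda>\<omega>. \<bar>X \<omega>\<bar> * indicator {z. real k < \<bar>z\<bar>} (X \<omega>)) < \<eta> \<and> 0 < k"
    unfolding eventually_sequentially by blast
  then show ?thesis by (intro that[of "real k"]) auto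
qed

text \<open>The second derivative of the loss has a first moment only, so the summands are truncated: Chebyshev's
  inequality applies to the bounded part and Markov's to the rest.\<close>

lemma (in iid_sample) weak_law_of_large_numbers:
  fixes \<phi> :: "'z \<Rightarrow> real"
  assumes m: "\<phi> \<in> borel_measurable borel" and i: "integrable M (\<lambda>\<omega>. \<phi> (Z 1 \<omega>))"
    and \<kappa>: "\<kappa> > 0" and e: "e > 0"
  shows "likely M e (\<lambda>n \<omega>. \<bar>sample_mean \<phi> n \<omega> - expectation (\<lambda>\<omega>. \<phi> (Z 1 \<omega>))\<bar> \<le> \<kappa>)"
proof -
  note [measurable] = m comp_measurable[OF m order_refl]
  define \<eta> where "\<eta> = min (\<kappa> / 4) (e / 2 * (\<kappa> / 4))"
  have \<eta>: "\<eta> > 0" "\<eta> \<le> \<kappa> / 4" "\<eta> \<le> e / 2 * (\<kappa> / 4)" using \<kappa> e by (auto simp: \<eta>_def)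
  obtain K where K: "K > 0" and tail: "expectation (\<lambda>\<omega>. \<bar>\<phi> (Z 1 \<omega>)\<bar> * indicator {z. K < \<bar>z\<bar>} (\<phi> (Z 1 \<omega>))) \<le> \<eta>"
    by (rule truncated_tail_small[OF i \<eta>(1)])
  \<comment> \<open>The part \<open>t\<close> below the truncation level is bounded, the rest \<open>u\<close> has small mean.\<close>
  define t where "t z = \<phi> z * indicator {x. \<bar>x\<bar> \<le> K} (\<phi> z)" for z
  define u where "u z = \<bar>\<phi> z\<bar> * indicator {x. K < \<bar>x\<bar>} (\<phi> z)" for z
  define c where "c = expectation (\<lambda>\<omega>. t (Z 1 \<omega>))"
  define v where "v z = t z - c" for z
  have tb: "\<bar>t z\<bar> \<le> K" for z using K by (auto simp: t_def indicator_def)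
  have u0: "0 \<le> u z" for z by (simp add: u_def)
  have tu: "\<bar>\<phi> z - t z\<bar> \<le> u z" for z by (auto simp: t_def u_def indicator_def)
  have mt: "t \<in> borel_measurable borel" and mu: "u \<in> borel_measurable borel" and mv: "v \<in> borel_measurable borel"
    unfolding t_def[abs_def] u_def[abs_def] v_def[abs_def] by measurable
  note mtZ = comp_measurable[OF mt order_refl] and muZ = comp_measurable[OF mu order_refl]
  have it: "integrable M (\<lambda>\<omega>. t (Z 1 \<omega>))"
    by (rule integrable_const_bound[of _ K]) (use tb mtZ in auto)
  have iu: "integrable M (\<lambda>\<omega>. u (Z 1 \<omega>))"
    by (rule Bochner_Integration.integrable_bound[OF i muZ]) (auto simp: u_def indicator_def)
  have cK: "\<bar>c\<bar> \<le> K"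
  proof -
    have "\<bar>c\<bar> \<le> expectation (\<lambda>\<omega>. \<bar>t (Z 1 \<omega>)\<bar>)" unfolding c_def by (rule integral_abs_bound)
    also have "\<dots> \<le> expectation (\<lambda>\<omega>. K)" using it tb by (intro integral_mono) auto
    finally show ?thesis by (simp add: prob_space)
  qed
  have vb: "\<bar>v z\<bar> \<le> 2 * K" for z using tb[of z] cK unfolding v_def by linarith
  have v2: "(v z)\<^sup>2 \<le> (2 * K)\<^sup>2" for z using power_mono[OF vb[of z] abs_ge_zero, of 2] by simp
  have mvZ: "(\<lambda>\<omega>. (v (Z 1 \<omega>))\<^sup>2) \<in> borel_measurable M" using comp_measurable[OF mv order_refl] by measurable
  have iv2: "integrable M (\<lambda>\<omega>. (v (Z 1 \<omega>))\<^sup>2)"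
    by (rule integrable_const_bound[of _ "(2 * K)\<^sup>2"]) (use v2 mvZ in auto)
  have v0: "expectation (\<lambda>\<omega>. v (Z 1 \<omega>)) = 0" using it by (simp add: v_def c_def prob_space)
  have diff: "\<bar>expectation (\<lambda>\<omega>. \<phi> (Z 1 \<omega>)) - c\<bar> \<le> \<eta>"
  proof -
    have "expectation (\<lambda>\<omega>. \<phi> (Z 1 \<omega>)) - c = expectation (\<lambda>\<omega>. \<phi> (Z 1 \<omega>) - t (Z 1 \<omega>))"
      unfolding c_def by (rule Bochner_Integration.integral_diff[OF i it, symmetric])
    also have "\<bar>\<dots>\<bar> \<le> expectation (\<lambda>\<omega>. \<bar>\<phi> (Z 1 \<omega>) - t (Z 1 \<omega>)\<bar>)" by (rule integral_abs_bound)
    also have "\<dots> \<le> expectation (\<lambda>\<omega>. u (Z 1 \<omega>))" using i it iu tu by (intro integral_mono) auto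
    also have "\<dots> \<le> \<eta>" using tail by (simp add: u_def)
    finally show ?thesis .
  qed
  have "likely M (e / 2 * (\<kappa> / 4) / (\<kappa> / 4)) (\<lambda>n \<omega>. sample_mean u n \<omega> \<le> \<kappa> / 4)"
  proof (rule likely_markov)
    show "\<forall>\<^sub>F n in sequentially. integrable M (sample_mean u n) \<and> (AE \<omega> in M. 0 \<le> sample_mean u n \<omega>) \<and>
        expectation (sample_mean u n) \<le> e / 2 * (\<kappa> / 4)"
    proof (rule eventually_sequentiallyI[of 1], intro conjI)
      fix n :: nat assume n: "1 \<le> n"
      show "integrable M (sample_mean u n)" by (rule sample_mean_integrable(1)[OF mu iu])
      show "AE \<omega> in M. 0 \<le> sample_mean u n \<omega>" unfolding sample_mean_def by (intro AE_I2) (simp add: sum_nonneg u0)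
      show "expectation (sample_mean u n) \<le> e / 2 * (\<kappa> / 4)"
        unfolding sample_mean_integrable(2)[OF mu iu n] using tail \<eta>(3) by (simp add: u_def)
    qed
  qed (use \<kappa> in simp)
  then have A: "likely M (e / 2) (\<lambda>n \<omega>. sample_mean u n \<omega> \<le> \<kappa> / 4)" using \<kappa> by simp
  have "likely M (e / 2 * (\<kappa> / 4)\<^sup>2 / (\<kappa> / 4)\<^sup>2) (\<lambda>n \<omega>. (sample_mean v n \<omega>)\<^sup>2 \<le> (\<kappa> / 4)\<^sup>2)"
  proof (rule likely_markov)
    have "(\<lambda>n. (2 * K)\<^sup>2 / real n) \<longlonglongrightarrow> 0" by (rule lim_const_over_n)
    then have "\<forall>\<^sub>F n in sequentially. (2 * K)\<^sup>2 / real n < e / 2 * (\<kappa> / 4)\<^sup>2"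
      using e \<kappa> by (intro order_tendstoD(2)) auto
    then show "\<forall>\<^sub>F n in sequentially. integrable M (\<lambda>\<omega>. (sample_mean v n \<omega>)\<^sup>2) \<and>
        (AE \<omega> in M. 0 \<le> (sample_mean v n \<omega>)\<^sup>2) \<and> expectation (\<lambda>\<omega>. (sample_mean v n \<omega>)\<^sup>2) \<le> e / 2 * (\<kappa> / 4)\<^sup>2"
      using eventually_gt_at_top[of 0]
    proof eventually_elim
      case (elim n)
      have eq: "(sample_mean v n \<omega>)\<^sup>2 = (1 / real n)\<^sup>2 * (\<Sum>i=1..n. v (Z i \<omega>))\<^sup>2" for \<omega>
        by (simp add: sample_mean_def power_divide)
      have "expectation (\<lambda>\<omega>. (sample_mean v n \<omega>)\<^sup>2) = (1 / real n)\<^sup>2 * (real n * expectation (\<lambda>\<omega>. (v (Z 1 \<omega>))\<^sup>2))"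
        unfolding eq second_moment_of_sum(2)[OF mv iv2 v0, of n, symmetric] by simp
      also have "\<dots> = expectation (\<lambda>\<omega>. (v (Z 1 \<omega>))\<^sup>2) / real n" using elim by (simp add: power2_eq_square)
      also have "\<dots> \<le> expectation (\<lambda>\<omega>. (2 * K)\<^sup>2) / real n"
        using iv2 v2 by (intro divide_right_mono integral_mono) auto
      also have "\<dots> \<le> e / 2 * (\<kappa> / 4)\<^sup>2" using elim by (simp add: prob_space)
      finally show ?case using second_moment_of_sum(1)[OF mv iv2 v0, of n] unfolding eq by simp
    qed
  qed (use \<kappa> in simp)
  then have B: "likely M (e / 2) (\<lambda>n \<omega>. (sample_mean v n \<omega>)\<^sup>2 \<le> (\<kappa> / 4)\<^sup>2)" using \<kappa> by simp
  show ?thesis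
  proof (rule likely_mono[OF likely_conj[OF A B]])
    show "\<forall>\<^sub>F n in sequentially. \<forall>\<omega>\<in>space M. sample_mean u n \<omega> \<le> \<kappa> / 4 \<and> (sample_mean v n \<omega>)\<^sup>2 \<le> (\<kappa> / 4)\<^sup>2 \<longrightarrow>
        \<bar>sample_mean \<phi> n \<omega> - expectation (\<lambda>\<omega>. \<phi> (Z 1 \<omega>))\<bar> \<le> \<kappa>"
    proof (rule eventually_sequentiallyI[of 1], intro ballI impI, elim conjE)
      fix n :: nat and \<omega> assume n: "1 \<le> n" and U: "sample_mean u n \<omega> \<le> \<kappa> / 4" and V: "(sample_mean v n \<omega>)\<^sup>2 \<le> (\<kappa> / 4)\<^sup>2"
      have V': "\<bar>sample_mean v n \<omega>\<bar> \<le> \<kappa> / 4" using V \<kappa> abs_le_square_iff[of "sample_mean v n \<omega>" "\<kappa> / 4"] by simp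
      have "sample_mean \<phi> n \<omega> = sample_mean (\<lambda>z. v z + (c + (\<phi> z - t z))) n \<omega>" by (simp add: v_def)
      also have "\<dots> = sample_mean v n \<omega> + (c + sample_mean (\<lambda>z. \<phi> z - t z) n \<omega>)"
        unfolding sample_mean_add using n by (simp add: sample_mean_def)
      finally have eq: "sample_mean \<phi> n \<omega> = sample_mean v n \<omega> + (c + sample_mean (\<lambda>z. \<phi> z - t z) n \<omega>)" .
      have "\<bar>sample_mean (\<lambda>z. \<phi> z - t z) n \<omega>\<bar> \<le> sample_mean (\<lambda>z. \<bar>\<phi> z - t z\<bar>) n \<omega>"
        unfolding sample_mean_def by (auto simp: abs_mult intro!: divide_right_mono sum_abs)
      also have "\<dots> \<le> sample_mean u n \<omega>" by (rule sample_mean_mono) (rule tu)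
      finally have "\<bar>sample_mean (\<lambda>z. \<phi> z - t z) n \<omega>\<bar> \<le> \<kappa> / 4" using U by linarith
      then show "\<bar>sample_mean \<phi> n \<omega> - expectation (\<lambda>\<omega>. \<phi> (Z 1 \<omega>))\<bar> \<le> \<kappa>"
        using V' diff \<eta>(2) unfolding eq by linarith
    qed
  qed simp
qed

text \<open>The variance zero, at which standardisation is impossible, is a case of its own: then the summands
  vanish almost surely.\<close>

lemma (in iid_sample) central_limit_characteristic:
  fixes \<phi> :: "'z \<Rightarrow> real"
  assumes m: "\<phi> \<in> borel_measurable borel" and sq: "integrable M (\<lambda>\<omega>. (\<phi> (Z 1 \<omega>))\<^sup>2)"
    and mean: "expectation (\<lambda>\<omega>. \<phi> (Z 1 \<omega>)) = 0"
  defines "v \<equiv> expectation (\<lambda>\<omega>. (\<phi> (Z 1 \<omega>))\<^sup>2)"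
  shows "(\<lambda>n. expectation (\<lambda>\<omega>. cos ((\<Sum>i=1..n. \<phi> (Z i \<omega>)) / sqrt (real n)))) \<longlonglongrightarrow> exp (- v / 2)"
    and "(\<lambda>n. expectation (\<lambda>\<omega>. sin ((\<Sum>i=1..n. \<phi> (Z i \<omega>)) / sqrt (real n)))) \<longlonglongrightarrow> 0"
proof -
  have m2: "(\<lambda>z. (\<phi> z)\<^sup>2) \<in> borel_measurable borel" using m by measurable
  define S where "S n \<omega> = (\<Sum>i=1..n. \<phi> (Z i \<omega>)) / sqrt (real n)" for n \<omega>
  have mS: "S n \<in> borel_measurable M" for n
    unfolding S_def[abs_def] using comp_measurable[OF m] by (intro borel_measurable_divide borel_measurable_sum borel_measurable_const) auto
  have "(\<lambda>n. expectation (\<lambda>\<omega>. cos (S n \<omega>))) \<longlonglongrightarrow> exp (- v / 2) \<and> (\<lambda>n. expectation (\<lambda>\<omega>. sin (S n \<omega>))) \<longlonglongrightarrow> 0"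
  proof (cases "v = 0")
    case True
    have "AE \<omega> in M. (\<phi> (Z 1 \<omega>))\<^sup>2 = 0"
      using integral_nonneg_eq_0_iff_AE[OF sq] True by (simp add: v_def)
    then have "AE \<omega> in M. \<forall>i\<ge>1. \<phi> (Z i \<omega>) = 0"
      by (intro AE_transfer) (use m in \<open>auto simp: pred_def\<close>)
    then have ae: "AE \<omega> in M. S n \<omega> = 0" for n by (rule AE_mp) (auto simp: S_def)
    have "expectation (\<lambda>\<omega>. cos (S n \<omega>)) = expectation (\<lambda>\<omega>. 1)" for n
      by (rule integral_cong_AE) (use ae[of n] mS in \<open>auto intro: AE_mp\<close>)
    moreover have "expectation (\<lambda>\<omega>. sin (S n \<omega>)) = expectation (\<lambda>\<omega>. 0)" for n
      by (rule integral_cong_AE) (use ae[of n] mS in \<open>auto intro: AE_mp\<close>)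
    ultimately show ?thesis using True by (simp add: prob_space)
  next
    case False
    have "v \<ge> 0" unfolding v_def by (rule Bochner_Integration.integral_nonneg) simp
    then have v: "v > 0" using False by simp
    define \<sigma> where "\<sigma> = sqrt v"
    have \<sigma>: "\<sigma> > 0" "\<sigma>\<^sup>2 = v" using v by (auto simp: \<sigma>_def)
    define X where "X i \<omega> = \<phi> (Z (Suc i) \<omega>)" for i \<omega>
    have mX: "X i \<in> borel_measurable M" for i unfolding X_def[abs_def] by (rule comp_measurable[OF m]) simp
    have ind1: "indep_vars (\<lambda>_. borel) (\<lambda>i \<omega>. \<phi> (Z i \<omega>)) {1..}"
      by (rule indep_vars_compose2[OF indep]) (use m in auto)
    have ind: "indep_vars (\<lambda>_. borel) X UNIV"
      unfolding indep_vars_def2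
    proof (intro conjI ballI mX)
      have img: "Suc ` UNIV \<subseteq> {1..}" by auto
      have "indep_sets (\<lambda>i. {(\<lambda>\<omega>. \<phi> (Z i \<omega>)) -` A \<inter> space M |A. A \<in> sets borel}) (Suc ` UNIV)"
        using ind1 indep_sets_mono_index[OF img] unfolding indep_vars_def2 by blast
      then show "indep_sets (\<lambda>i. {X i -` A \<inter> space M |A. A \<in> sets borel}) UNIV"
        using indep_sets_reindex[of Suc UNIV "\<lambda>i. {(\<lambda>\<omega>. \<phi> (Z i \<omega>)) -` A \<inter> space M |A. A \<in> sets borel}"]
        unfolding X_def[abs_def] by simp
    qed
    have d: "distr M borel (X n) = distr M borel (X 0)" for n
    proof -
      have "distr M borel (\<lambda>\<omega>. \<phi> (Z (Suc i) \<omega>)) = distr (distr M borel (Z 1)) borel \<phi>" for i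
        using distr_distr[OF m Z_measurable[of "Suc i"]] ident[of "Suc i"] by (simp add: o_def)
      then show ?thesis by (simp add: X_def[abs_def])
    qed
    have X2: "integrable M (\<lambda>\<omega>. (X n \<omega>)\<^sup>2)" "expectation (\<lambda>\<omega>. (X n \<omega>)\<^sup>2) = v" "expectation (X n) = 0" for n
      using integrable_transfer[OF m2, of "Suc n"] expectation_transfer[OF m2, of "Suc n"] expectation_transfer[OF m, of "Suc n"] sq mean
      by (simp_all add: X_def[abs_def] v_def)
    have w: "weak_conv_m (\<lambda>n. distr M borel (\<lambda>x. (\<Sum>i<n. X i x) / sqrt (n * \<sigma>\<^sup>2))) std_normal_distribution"
      by (rule central_limit_theorem_zero_mean[OF ind _ \<sigma>(1)]) (use X2 d \<sigma> in auto)
    have sum: "(\<Sum>i<n. X i x) = (\<Sum>i=1..n. \<phi> (Z i x))" for n x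
      unfolding X_def by (rule sum.reindex_bij_witness[of _ "\<lambda>i. i - 1" Suc]) auto
    have mN: "(\<lambda>x. (\<Sum>i<n. X i x) / sqrt (n * \<sigma>\<^sup>2)) \<in> borel_measurable M" for n using mX by measurable
    have rd: "real_distribution (distr M borel (\<lambda>x. (\<Sum>i<n. X i x) / sqrt (n * \<sigma>\<^sup>2)))" for n
      by (rule real_distribution_distr) (rule mN)
    have "(\<lambda>n. char (distr M borel (\<lambda>x. (\<Sum>i<n. X i x) / sqrt (n * \<sigma>\<^sup>2))) \<sigma>) \<longlonglongrightarrow> char std_normal_distribution \<sigma>"
      by (rule levy_continuity1[OF rd real_dist_normal_dist w])
    moreover have "char (distr M borel (\<lambda>x. (\<Sum>i<n. X i x) / sqrt (n * \<sigma>\<^sup>2))) \<sigma> = (CLINT \<omega>|M. iexp (S n \<omega>))" for n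
    proof -
      have "\<sigma> * ((\<Sum>i<n. X i x) / sqrt (n * \<sigma>\<^sup>2)) = S n x" for x
        using \<sigma>(1) by (simp add: S_def sum real_sqrt_mult)
      then show ?thesis unfolding char_def using mN by (subst integral_distr) auto
    qed
    ultimately have lim: "(\<lambda>n. CLINT \<omega>|M. iexp (S n \<omega>)) \<longlonglongrightarrow> complex_of_real (exp (- (\<sigma>\<^sup>2) / 2))"
      by (simp add: char_std_normal_distribution)
    have ii: "complex_integrable M (\<lambda>\<omega>. iexp (S n \<omega>))" for n
      by (rule integrable_const_bound[of _ 1]) (use mS in auto)
    have ri: "Re (iexp x) = cos x" "Im (iexp x) = sin x" for x by (simp_all add: Re_exp Im_exp)
    have "Re (CLINT \<omega>|M. iexp (S n \<omega>)) = expectation (\<lambda>\<omega>. cos (S n \<omega>))" for n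
      using integral_Re[OF ii[of n], symmetric] unfolding ri .
    moreover have "Im (CLINT \<omega>|M. iexp (S n \<omega>)) = expectation (\<lambda>\<omega>. sin (S n \<omega>))" for n
      using integral_Im[OF ii[of n], symmetric] unfolding ri .
    ultimately show ?thesis using tendsto_Re[OF lim] tendsto_Im[OF lim] \<sigma>(2) by simp
  qed
  then show "(\<lambda>n. expectation (\<lambda>\<omega>. cos ((\<Sum>i=1..n. \<phi> (Z i \<omega>)) / sqrt (real n)))) \<longlonglongrightarrow> exp (- v / 2)"
    "(\<lambda>n. expectation (\<lambda>\<omega>. sin ((\<Sum>i=1..n. \<phi> (Z i \<omega>)) / sqrt (real n)))) \<longlonglongrightarrow> 0"
    unfolding S_def by blast+
qed

section \<open>Covariance roots and normal laws\<close>

text \<open>One step of the Cholesky factorisation: split off the coordinate \<open>m\<close> and pass to the Schur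
  complement.  The condition on the support of the vectors provides a new axis orthogonal to the old ones.\<close>

lemma gram_vectors_exist:
  fixes Q :: "'n::finite \<Rightarrow> 'n \<Rightarrow> real"
  assumes "finite I" and "\<And>i j. Q i j = Q j i" and "\<And>x. 0 \<le> (\<Sum>i\<in>I. \<Sum>j\<in>I. x i * x j * Q i j)"
  shows "\<exists>a :: 'n \<Rightarrow> real ^ 'n. (\<forall>i\<in>I. \<forall>j\<in>I. a i \<bullet> a j = Q i j) \<and> (\<forall>i\<in>I. \<forall>k. k \<notin> I \<longrightarrow> a i $ k = 0)"
  using assms
proof (induction I arbitrary: Q rule: finite_induct)
  case empty
  then show ?case by auto
next
  case (insert m I)
  note fin = insert.hyps(1) and m = insert.hyps(2) and sym = insert.prems(1)
  have expand: "(\<Sum>i\<in>insert m I. \<Sum>j\<in>insert m I. x i * x j * Q i j) =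
      (\<Sum>i\<in>I. \<Sum>j\<in>I. x i * x j * Q i j) + 2 * x m * (\<Sum>j\<in>I. x j * Q j m) + (x m)\<^sup>2 * Q m m" for x
  proof -
    have "(\<Sum>j\<in>I. x m * x j * Q m j) = x m * (\<Sum>j\<in>I. x j * Q j m)"
      by (simp add: sum_distrib_left sym[of m] mult.assoc)
    moreover have "(\<Sum>i\<in>I. x i * x m * Q i m) = x m * (\<Sum>j\<in>I. x j * Q j m)"
      by (simp add: sum_distrib_left mult_ac)
    ultimately show ?thesis
      using fin m by (simp add: sum.distrib power2_eq_square)
  qed
  note psd = insert.prems(2)[unfolded expand]
  define q where "q = Q m m"
  have q0: "q \<ge> 0" using psd[of "\<lambda>i. if i = m then 1 else 0"] m by (simp add: q_def sum.delta' if_distrib cong: if_cong)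
     (smt (verit, ccfv_SIG) mult_eq_0_iff sum.neutral)
  show ?case
  proof (cases "q = 0")
    case True
    have zero: "Q j m = 0" if j: "j \<in> I" for j
    proof (rule ccontr)
      assume ne: "Q j m \<noteq> 0"
      \<comment> \<open>At \<open>e\<^sub>j + s e\<^sub>m\<close> with this \<open>s\<close> the form would take the value \<open>-1\<close>.\<close>
      define s where "s = - (Q j j + 1) / (2 * Q j m)"
      define x where "x i = (if i = m then s else if i = j then 1 else 0)" for i
      have jm: "j \<noteq> m" using j m by auto
      have xI: "x i = (if i = j then 1 else 0)" if "i \<in> I" for i using that m by (auto simp: x_def)
      have "(\<Sum>i\<in>I. \<Sum>k\<in>I. x i * x k * Q i k) = (\<Sum>i\<in>I. \<Sum>k\<in>I. if i = j then (if k = j then Q j j else 0) else 0)"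
        by (intro sum.cong refl) (auto simp: xI)
      also have "\<dots> = (\<Sum>i\<in>I. if i = j then Q j j else 0)"
        by (intro sum.cong refl) (use fin j in \<open>auto simp: sum.delta\<close>)
      also have "\<dots> = Q j j" using fin j by (simp add: sum.delta)
      finally have 1: "(\<Sum>i\<in>I. \<Sum>k\<in>I. x i * x k * Q i k) = Q j j" .
      have "(\<Sum>k\<in>I. x k * Q k m) = (\<Sum>k\<in>I. if k = j then Q j m else 0)"
        by (intro sum.cong refl) (auto simp: xI)
      then have 2: "(\<Sum>k\<in>I. x k * Q k m) = Q j m" using fin j by (simp add: sum.delta)
      have "x m = s" by (simp add: x_def)
      then have "0 \<le> Q j j + 2 * s * Q j m" using psd[of x] True unfolding 1 2 q_def by simp
      also have "\<dots> = -1" using ne by (simp add: s_def field_simps)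
      finally show False by simp
    qed
    have "0 \<le> (\<Sum>i\<in>I. \<Sum>j\<in>I. x i * x j * Q i j)" for x
      using psd[of "\<lambda>i. if i = m then 0 else x i"] m
      by (simp cong: sum.cong_simp) (smt (verit) sum.cong)
    from insert.IH[OF sym this] obtain a :: "'n \<Rightarrow> real ^ 'n" where
      a: "\<forall>i\<in>I. \<forall>j\<in>I. a i \<bullet> a j = Q i j" "\<forall>i\<in>I. \<forall>k. k \<notin> I \<longrightarrow> a i $ k = 0" by blast
    have zero': "Q m j = 0" if "j \<in> I" for j using zero[OF that] sym[of m j] by simp
    have "(a(m := 0)) i \<bullet> (a(m := 0)) j = Q i j" if "i \<in> insert m I" "j \<in> insert m I" for i j
      using that a(1) m zero zero' True by (cases "i = m"; cases "j = m") (auto simp: q_def)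
    moreover have "(a(m := 0)) i $ k = 0" if "i \<in> insert m I" "k \<notin> insert m I" for i k
      using that a(2) by auto
    ultimately show ?thesis by (intro exI[of _ "a(m := 0)"]) blast
  next
    case False
    then have q: "q > 0" using q0 by simp
    \<comment> \<open>The Schur complement of the entry \<open>q\<close>.\<close>
    define Q' where "Q' i j = Q i j - Q i m * Q j m / q" for i j
    have "0 \<le> (\<Sum>i\<in>I. \<Sum>j\<in>I. x i * x j * Q' i j)" for x
    proof -
      define s where "s = (\<Sum>j\<in>I. x j * Q j m)"
      define y where "y i = (if i = m then - s / q else x i)" for i
      have yI: "y i = x i" if "i \<in> I" for i using that m by (auto simp: y_def)
      have "(\<Sum>i\<in>I. \<Sum>j\<in>I. x i * x j * Q' i j) = (\<Sum>i\<in>I. \<Sum>j\<in>I. x i * x j * Q i j) - (\<Sum>i\<in>I. \<Sum>j\<in>I. (x i * Q i m) * (x j * Q j m) / q)"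
        unfolding Q'_def sum_subtractf[symmetric] by (intro sum.cong refl) (simp add: algebra_simps)
      also have "(\<Sum>i\<in>I. \<Sum>j\<in>I. (x i * Q i m) * (x j * Q j m) / q) = s\<^sup>2 / q"
        unfolding s_def power2_eq_square sum_product sum_divide_distrib ..
      also have "(\<Sum>i\<in>I. \<Sum>j\<in>I. x i * x j * Q i j) - s\<^sup>2 / q =
        (\<Sum>i\<in>I. \<Sum>j\<in>I. y i * y j * Q i j) + 2 * y m * (\<Sum>j\<in>I. y j * Q j m) + (y m)\<^sup>2 * Q m m"
      proof -
        have "(\<Sum>i\<in>I. \<Sum>j\<in>I. y i * y j * Q i j) = (\<Sum>i\<in>I. \<Sum>j\<in>I. x i * x j * Q i j)" "(\<Sum>j\<in>I. y j * Q j m) = s"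
          unfolding s_def by (auto intro!: sum.cong simp: yI)
        moreover have "y m = - s / q" by (simp add: y_def)
        ultimately show ?thesis using q unfolding q_def[symmetric] by (simp add: power2_eq_square)
      qed
      finally show ?thesis using psd[of y] by simp
    qed
    moreover have "Q' i j = Q' j i" for i j unfolding Q'_def by (simp add: sym[of i j] mult.commute)
    ultimately obtain a :: "'n \<Rightarrow> real ^ 'n" where
      a: "\<forall>i\<in>I. \<forall>j\<in>I. a i \<bullet> a j = Q' i j" "\<forall>i\<in>I. \<forall>k. k \<notin> I \<longrightarrow> a i $ k = 0"
      using insert.IH[of Q'] by blast
    define e :: "real ^ 'n" where "e = axis m 1"
    define b where "b i = (if i = m then sqrt q *\<^sub>R e else a i + (Q i m / sqrt q) *\<^sub>R e)" for i
    have e: "e \<bullet> e = 1" by (simp add: e_def inner_axis_axis)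
    have ae: "a i \<bullet> e = 0" if "i \<in> I" for i using a(2) that m by (simp add: e_def inner_axis)
    have ea: "e \<bullet> a i = 0" if "i \<in> I" for i using ae[OF that] by (simp add: inner_commute)
    have bI: "b i = a i + (Q i m / sqrt q) *\<^sub>R e" if "i \<in> I" for i using that m by (auto simp: b_def)
    have bm: "b m = sqrt q *\<^sub>R e" by (simp add: b_def)
    have sq: "sqrt q * sqrt q = q" using q by simp
    have 1: "b i \<bullet> b j = Q i j" if "i \<in> I" "j \<in> I" for i j
      using a(1) that ae ea e q by (simp add: bI inner_add_left inner_add_right Q'_def)
    have 2: "b m \<bullet> b i = Q m i" "b i \<bullet> b m = Q i m" if "i \<in> I" for i
      using that ae ea e q by (simp_all add: bI bm inner_add_left inner_add_right sym[of m i])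
    have 3: "b m \<bullet> b m = Q m m" using e q by (simp add: bm q_def)
    have 4: "b i $ k = 0" if "i \<in> insert m I" "k \<notin> insert m I" for i k
      using that a(2) by (auto simp: b_def e_def axis_def)
    have "b i \<bullet> b j = Q i j" if "i \<in> insert m I" "j \<in> insert m I" for i j
      using that 1 2 3 by blast
    then show ?thesis using 4 by (intro exI[of _ b]) blast
  qed
qed

lemma covariance_square_root:
  fixes C :: "real ^ 'n ^ 'n"
  assumes sym: "\<And>i j. C $ i $ j = C $ j $ i" and psd: "\<And>x. 0 \<le> (\<Sum>i\<in>UNIV. \<Sum>j\<in>UNIV. x i * x j * C $ i $ j)"
  obtains A :: "real ^ 'n ^ 'n" where "A ** transpose A = C"
proof -
  obtain a :: "'n \<Rightarrow> real ^ 'n" where a: "\<And>i j. a i \<bullet> a j = C $ i $ j"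
    using gram_vectors_exist[of UNIV "\<lambda>i j. C $ i $ j", OF finite sym psd] by auto
  have "(\<chi> i. a i) ** transpose (\<chi> i. a i) = C"
    by (simp add: vec_eq_iff matrix_matrix_mult_def transpose_def a[symmetric] inner_vec_def)
  then show ?thesis by (rule that)
qed

text \<open>The density is a product, so the characteristic function is the product of one-dimensional ones.\<close>

lemma integral_std_normal_iexp:
  fixes s :: "real ^ 'n::finite"
  shows "prob_space (std_normal :: (real ^ 'n) measure)"
    and "(CLINT z|std_normal. iexp (s \<bullet> z)) = complex_of_real (exp (- (s \<bullet> s) / 2))"
proof -
  let ?d = "\<lambda>z :: real ^ 'n. \<Prod>i\<in>UNIV. std_normal_density (z $ i)"
  have d_Basis: "?d z = (\<Prod>b\<in>Basis. std_normal_density (z \<bullet> b))" for z :: "real ^ 'n"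
    unfolding Basis_vec_def
    by (simp add: image_image UNION_singleton_eq_range prod.reindex inj_on_def axis_eq_axis inner_axis o_def)
  have [measurable]: "?d \<in> borel_measurable borel" unfolding d_Basis by measurable
  have "(\<integral>\<^sup>+ z. ennreal (?d z) \<partial>lborel) = (\<integral>\<^sup>+ z. (\<Prod>b\<in>Basis. ennreal (std_normal_density (z \<bullet> b))) \<partial>(lborel :: (real ^ 'n) measure))"
    unfolding d_Basis by (simp add: prod_ennreal)
  also have "\<dots> = (\<Prod>b\<in>(Basis :: (real ^ 'n) set). \<integral>\<^sup>+ x. ennreal (std_normal_density x) \<partial>lborel)"
    by (rule nn_integral_lborel_prod) auto
  also have "(\<integral>\<^sup>+ x. ennreal (std_normal_density x) \<partial>lborel) = 1"
    using prob_space.emeasure_space_1[OF prob_space_normal_density[of 1 0]] by (simp add: emeasure_density)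
  finally have one: "(\<integral>\<^sup>+ z. ennreal (?d z) \<partial>lborel) = 1" by simp
  show "prob_space (std_normal :: (real ^ 'n) measure)"
    unfolding std_normal_def by (rule prob_spaceI) (simp add: emeasure_density one)
  interpret product_sigma_finite "\<lambda>_ :: real ^ 'n. lborel :: real measure" ..
  define f where "f b x = std_normal_density x *\<^sub>R iexp ((s \<bullet> b) * x)" for b and x :: real
  have fi: "integrable lborel (f b)" for b
  proof -
    have "integrable std_normal_distribution (\<lambda>x. iexp ((s \<bullet> b) * x))"
      using prob_space_normal_density[of 1 0]
      by (intro finite_measure.integrable_const_bound[of _ _ 1] prob_space.finite_measure) auto
    then show ?thesis unfolding f_def[abs_def] by (subst (asm) integrable_density) auto
  qed
  have fc: "integral\<^sup>L lborel (f b) = complex_of_real (exp (- (s \<bullet> b)\<^sup>2 / 2))" for b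
  proof -
    have "integral\<^sup>L lborel (f b) = (CLINT x|std_normal_distribution. iexp ((s \<bullet> b) * x))"
      unfolding f_def[abs_def] by (subst integral_density) auto
    also have "\<dots> = char std_normal_distribution (s \<bullet> b)" by (simp add: char_def)
    finally show ?thesis by (simp add: char_std_normal_distribution)
  qed
  have "(CLINT z|std_normal. iexp (s \<bullet> z)) = (CLINT z|lborel. ?d z *\<^sub>R iexp (s \<bullet> z))"
    unfolding std_normal_def by (subst integral_density) (auto intro!: prod_nonneg)
  also have "\<dots> = (CLINT x|(\<Pi>\<^sub>M b\<in>(Basis :: (real ^ 'n) set). lborel). \<Prod>b\<in>Basis. f b (x b))"
  proof (subst lborel_eq, subst integral_distr)
    show "(CLINT x|(\<Pi>\<^sub>M b\<in>(Basis :: (real ^ 'n) set). lborel). ?d (\<Sum>b\<in>Basis. x b *\<^sub>R b) *\<^sub>R iexp (s \<bullet> (\<Sum>b\<in>Basis. x b *\<^sub>R b))) =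
      (CLINT x|(\<Pi>\<^sub>M b\<in>(Basis :: (real ^ 'n) set). lborel). \<Prod>b\<in>Basis. f b (x b))"
    proof (rule Bochner_Integration.integral_cong[OF refl])
      fix x :: "real ^ 'n \<Rightarrow> real"
      have "?d (\<Sum>b\<in>Basis. x b *\<^sub>R b) = (\<Prod>b\<in>Basis. std_normal_density (x b))"
        unfolding d_Basis by (intro prod.cong refl) simp
      moreover have "iexp (s \<bullet> (\<Sum>b\<in>Basis. x b *\<^sub>R b)) = (\<Prod>b\<in>Basis. iexp ((s \<bullet> b) * x b))"
        by (simp add: inner_sum_right sum_distrib_left exp_sum mult.commute)
      ultimately show "?d (\<Sum>b\<in>Basis. x b *\<^sub>R b) *\<^sub>R iexp (s \<bullet> (\<Sum>b\<in>Basis. x b *\<^sub>R b)) = (\<Prod>b\<in>Basis. f b (x b))"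
        by (simp add: f_def scaleR_conv_of_real prod.distrib)
    qed
  qed measurable
  also have "\<dots> = (\<Prod>b\<in>Basis. complex_of_real (exp (- (s \<bullet> b)\<^sup>2 / 2)))"
    by (subst product_integral_prod) (auto simp: fi fc)
  also have "\<dots> = complex_of_real (exp (\<Sum>b\<in>Basis. - (s \<bullet> b)\<^sup>2 / 2))"
    by (simp add: exp_sum)
  also have "(\<Sum>b\<in>Basis. - (s \<bullet> b)\<^sup>2 / 2) = - (s \<bullet> s) / 2"
    by (simp add: sum_negf sum_divide_distrib[symmetric] euclidean_inner[of s s] power2_eq_square)
  finally show "(CLINT z|std_normal. iexp (s \<bullet> z)) = complex_of_real (exp (- (s \<bullet> s) / 2))" .
qed

lemma multivariate_normal_facts:
  fixes A :: "real ^ 'n::finite ^ 'n"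
  defines "\<mu> \<equiv> distr std_normal borel (\<lambda>z. 0 + A *v z)"
  shows "prob_space \<mu>" "sets \<mu> = sets borel"
    and "(\<integral>v. cos (t \<bullet> v) \<partial>\<mu>) = exp (- (t \<bullet> ((A ** transpose A) *v t)) / 2)"
    and "(\<integral>v. sin (t \<bullet> v) \<partial>\<mu>) = 0"
proof -
  interpret N: prob_space "std_normal :: (real ^ 'n) measure" by (rule integral_std_normal_iexp)
  have sN: "sets (std_normal :: (real ^ 'n) measure) = sets borel" by (simp add: std_normal_def)
  have mA: "(\<lambda>z. 0 + A *v z) \<in> measurable std_normal borel"
    unfolding measurable_cong_sets[OF sN refl]
    by (intro borel_measurable_continuous_onI continuous_intros linear_continuous_on matrix_vector_mul_bounded_linear)
  show "prob_space \<mu>" unfolding \<mu>_def by (rule N.prob_space_distr[OF mA])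
  show "sets \<mu> = sets borel" by (simp add: \<mu>_def)
  have ii: "complex_integrable std_normal (\<lambda>z. iexp (s \<bullet> z))" for s :: "real ^ 'n"
    by (rule N.integrable_const_bound[of _ 1]) (auto simp: measurable_cong_sets[OF sN refl])
  have ri: "Re (iexp x) = cos x" "Im (iexp x) = sin x" for x by (simp_all add: Re_exp Im_exp)
  have c: "(\<integral>z. cos (s \<bullet> z) \<partial>std_normal) = exp (- (s \<bullet> s) / 2)" and si: "(\<integral>z. sin (s \<bullet> z) \<partial>std_normal) = 0" for s :: "real ^ 'n"
    using integral_Re[OF ii[of s]] integral_Im[OF ii[of s]] unfolding integral_std_normal_iexp(2) ri by simp_all
  have tA: "t \<bullet> (0 + A *v z) = (transpose A *v t) \<bullet> z" for z
    by (simp add: dot_lmul_matrix matrix_transpose_mul[symmetric] transpose_matrix_vector)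
  have "(\<integral>v. cos (t \<bullet> v) \<partial>\<mu>) = (\<integral>z. cos ((transpose A *v t) \<bullet> z) \<partial>std_normal)"
    unfolding \<mu>_def tA[symmetric] by (rule integral_distr[OF mA]) measurable
  then show "(\<integral>v. cos (t \<bullet> v) \<partial>\<mu>) = exp (- (t \<bullet> ((A ** transpose A) *v t)) / 2)"
    using tA[of "transpose A *v t"] unfolding c matrix_vector_mul_assoc[symmetric] by simp
  have "(\<integral>v. sin (t \<bullet> v) \<partial>\<mu>) = (\<integral>z. sin ((transpose A *v t) \<bullet> z) \<partial>std_normal)"
    unfolding \<mu>_def tA[symmetric] by (rule integral_distr[OF mA]) measurable
  then show "(\<integral>v. sin (t \<bullet> v) \<partial>\<mu>) = 0" unfolding si .
qed

section \<open>Convergence in distribution\<close>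

text \<open>Finite real combinations of \<open>cos (t \<bullet> x)\<close> and \<open>sin (t \<bullet> x)\<close> with arbitrary frequencies; these form an
  algebra by the product formulas.\<close>

inductive trig_poly :: "('a::real_inner \<Rightarrow> real) \<Rightarrow> bool" where
  trig_cos: "trig_poly (\<lambda>x. c * cos (t \<bullet> x))"
| trig_sin: "trig_poly (\<lambda>x. c * sin (t \<bullet> x))"
| trig_add: "trig_poly f \<Longrightarrow> trig_poly g \<Longrightarrow> trig_poly (\<lambda>x. f x + g x)"

lemma trig_poly_mult_base:
  assumes "trig_poly g"
  shows "trig_poly (\<lambda>x. (c * cos (t \<bullet> x)) * g x) \<and> trig_poly (\<lambda>x. (c * sin (t \<bullet> x)) * g x)"
  using assms
proof induction
  case (trig_cos d s)
  have eq: "(c * cos (t \<bullet> x)) * (d * cos (s \<bullet> x)) = (c * d / 2) * cos ((t - s) \<bullet> x) + (c * d / 2) * cos ((t + s) \<bullet> x)"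
    "(c * sin (t \<bullet> x)) * (d * cos (s \<bullet> x)) = (c * d / 2) * sin ((t + s) \<bullet> x) + (c * d / 2) * sin ((t - s) \<bullet> x)" for x
  proof -
    have "(c * cos (t \<bullet> x)) * (d * cos (s \<bullet> x)) = c * d * (cos (t \<bullet> x) * cos (s \<bullet> x))"
      "(c * sin (t \<bullet> x)) * (d * cos (s \<bullet> x)) = c * d * (sin (t \<bullet> x) * cos (s \<bullet> x))" by simp_all
    then show "(c * cos (t \<bullet> x)) * (d * cos (s \<bullet> x)) = (c * d / 2) * cos ((t - s) \<bullet> x) + (c * d / 2) * cos ((t + s) \<bullet> x)"
      "(c * sin (t \<bullet> x)) * (d * cos (s \<bullet> x)) = (c * d / 2) * sin ((t + s) \<bullet> x) + (c * d / 2) * sin ((t - s) \<bullet> x)"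
      unfolding cos_times_cos sin_times_cos inner_diff_left inner_add_left by (simp_all add: distrib_left add_divide_distrib)
  qed
  show ?case unfolding eq by (intro conjI trig_poly.intros)
next
  case (trig_sin d s)
  have eq: "(c * cos (t \<bullet> x)) * (d * sin (s \<bullet> x)) = (c * d / 2) * sin ((t + s) \<bullet> x) + (- (c * d / 2)) * sin ((t - s) \<bullet> x)"
    "(c * sin (t \<bullet> x)) * (d * sin (s \<bullet> x)) = (c * d / 2) * cos ((t - s) \<bullet> x) + (- (c * d / 2)) * cos ((t + s) \<bullet> x)" for x
  proof -
    have "(c * cos (t \<bullet> x)) * (d * sin (s \<bullet> x)) = c * d * (cos (t \<bullet> x) * sin (s \<bullet> x))"
      "(c * sin (t \<bullet> x)) * (d * sin (s \<bullet> x)) = c * d * (sin (t \<bullet> x) * sin (s \<bullet> x))" by simp_all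
    then show "(c * cos (t \<bullet> x)) * (d * sin (s \<bullet> x)) = (c * d / 2) * sin ((t + s) \<bullet> x) + (- (c * d / 2)) * sin ((t - s) \<bullet> x)"
      "(c * sin (t \<bullet> x)) * (d * sin (s \<bullet> x)) = (c * d / 2) * cos ((t - s) \<bullet> x) + (- (c * d / 2)) * cos ((t + s) \<bullet> x)"
      unfolding cos_times_sin sin_times_sin inner_diff_left inner_add_left by (simp_all add: right_diff_distrib diff_divide_distrib)
  qed
  show ?case unfolding eq by (intro conjI trig_poly.intros)
next
  case (trig_add f g)
  then show ?case unfolding distrib_left by (auto intro: trig_poly.intros)
qed

lemma trig_poly_mult: "trig_poly f \<Longrightarrow> trig_poly g \<Longrightarrow> trig_poly (\<lambda>x. f x * g x)"
proof (induction rule: trig_poly.induct)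
  case (trig_add f h)
  then show ?case unfolding distrib_right by (auto intro: trig_poly.intros)
qed (use trig_poly_mult_base in blast)+

lemma trig_poly_const: "trig_poly (\<lambda>x. c)"
  using trig_cos[of c 0] by simp

lemma trig_poly_sum: "finite I \<Longrightarrow> (\<And>i. i \<in> I \<Longrightarrow> trig_poly (f i)) \<Longrightarrow> trig_poly (\<lambda>x. \<Sum>i\<in>I. f i x)"
  by (induction I rule: finite_induct) (auto intro: trig_poly_const trig_add)

text \<open>A polynomial in sines is a trigonometric polynomial, since these form an algebra.\<close>

lemma trig_poly_compose_sine:
  fixes g :: "real ^ 'n::finite \<Rightarrow> real"
  assumes "real_polynomial_function g"
  shows "trig_poly (\<lambda>x. g (\<chi> j. sin (c * x $ j)))"
  using assms
proof induction
  case (linear f)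
  then have f: "linear f" by (rule bounded_linear.linear)
  have eq: "f (\<chi> j. sin (c * x $ j)) = (\<Sum>j\<in>UNIV. f (axis j 1) * sin ((c *\<^sub>R axis j 1) \<bullet> x))" for x :: "real ^ 'n"
  proof -
    have "(\<chi> j. sin (c * x $ j)) = (\<Sum>j\<in>UNIV. sin (c * x $ j) *\<^sub>R axis j 1)"
      by (simp add: vec_eq_iff axis_def if_distrib sum.delta cong: if_cong)
    then show ?thesis by (simp add: linear_sum[OF f] linear_scale[OF f] inner_axis inner_commute[of "axis _ _"] mult.commute)
  qed
  show ?case unfolding eq by (intro trig_poly_sum trig_sin) simp
qed (auto intro: trig_poly_const trig_add trig_poly_mult)

lemma trig_poly_continuous: "trig_poly f \<Longrightarrow> continuous_on UNIV f"
  by (induction rule: trig_poly.induct) (auto intro!: continuous_intros)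

lemma trig_poly_bounded: "trig_poly f \<Longrightarrow> \<exists>B. \<forall>x. \<bar>f x\<bar> \<le> B"
proof (induction rule: trig_poly.induct)
  case (trig_cos c t)
  then show ?case by (intro exI[of _ "\<bar>c\<bar>"]) (auto simp: abs_mult intro!: mult_left_le)
next
  case (trig_sin c t)
  then show ?case by (intro exI[of _ "\<bar>c\<bar>"]) (auto simp: abs_mult intro!: mult_left_le)
next
  case (trig_add f g)
  then obtain A B where "\<forall>x. \<bar>f x\<bar> \<le> A" "\<forall>x. \<bar>g x\<bar> \<le> B" by blast
  then have "\<bar>f x + g x\<bar> \<le> A + B" for x using abs_triangle_ineq[of "f x" "g x"] by (smt (verit))
  then show ?case by blast
qed

lemma (in prob_space) integrable_bounded_continuous:
  fixes f :: "'b::euclidean_space \<Rightarrow> real"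
  assumes f: "continuous_on UNIV f" "\<And>x. \<bar>f x\<bar> \<le> B" and X: "X \<in> borel_measurable M"
  shows "integrable M (\<lambda>\<omega>. f (X \<omega>))"
  using measurable_compose[OF X borel_measurable_continuous_onI[OF f(1)]] f(2)
  by (intro integrable_const_bound[of _ B]) auto

text \<open>The set \<open>B\<close> of closeness has probability almost one; the crude bound \<open>C\<close> serves on its complement.\<close>

lemma (in prob_space) expectation_close:
  assumes B: "B \<in> sets M" "1 - e \<le> prob B" and f: "integrable M f" and g: "integrable M g"
    and close: "\<And>\<omega>. \<omega> \<in> B \<Longrightarrow> \<bar>f \<omega> - g \<omega>\<bar> \<le> \<kappa>" and bound: "\<And>\<omega>. \<bar>f \<omega> - g \<omega>\<bar> \<le> C" and \<kappa>: "0 \<le> \<kappa>"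
  shows "\<bar>expectation f - expectation g\<bar> \<le> \<kappa> + C * e"
proof -
  have C: "0 \<le> C" using bound abs_ge_zero order_trans by blast
  have "\<bar>expectation f - expectation g\<bar> = \<bar>expectation (\<lambda>\<omega>. f \<omega> - g \<omega>)\<bar>" using f g by simp
  also have "\<dots> \<le> expectation (\<lambda>\<omega>. \<bar>f \<omega> - g \<omega>\<bar>)" by (rule integral_abs_bound)
  also have "\<dots> \<le> expectation (\<lambda>\<omega>. \<kappa> + C * indicator (space M - B) \<omega>)"
  proof (rule integral_mono)
    show "integrable M (\<lambda>\<omega>. \<bar>f \<omega> - g \<omega>\<bar>)" using f g by auto
    show "integrable M (\<lambda>\<omega>. \<kappa> + C * indicator (space M - B) \<omega>)"
      using B by (intro Bochner_Integration.integrable_add integrable_const integrable_mult_right integrable_real_indicator)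
        (auto simp: emeasure_eq_measure)
    show "\<bar>f \<omega> - g \<omega>\<bar> \<le> \<kappa> + C * indicator (space M - B) \<omega>" if "\<omega> \<in> space M" for \<omega>
      using close[of \<omega>] bound[of \<omega>] \<kappa> C that by (cases "\<omega> \<in> B") auto
  qed
  also have "\<dots> = \<kappa> + C * prob (space M - B)"
    using B by (subst Bochner_Integration.integral_add) (auto simp: prob_space emeasure_eq_measure)
  also have "\<dots> \<le> \<kappa> + C * e" using B C by (intro add_left_mono mult_left_mono) (auto simp: prob_compl)
  finally show ?thesis .
qed

text \<open>On a large ball the map \<open>x \<mapsto> sin (x j / R)\<close> is invertible, so a continuous function there is
  a continuous function of these sines, and by Stone and Weierstrass nearly a polynomial in them.  The
  approximating trigonometric polynomial stays bounded on the whole space, so tightness controls the rest.\<close>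

lemma weak_convergence_of_trigonometric_moments:
  fixes X :: "nat \<Rightarrow> 'w \<Rightarrow> real ^ 'n::finite"
  assumes M: "prob_space M" and X: "\<And>n. 1 \<le> n \<Longrightarrow> X n \<in> borel_measurable M"
    and \<mu>: "prob_space \<mu>" "sets \<mu> = sets borel"
    and cosc: "\<And>t. (\<lambda>n. \<integral>\<omega>. cos (t \<bullet> X n \<omega>) \<partial>M) \<longlonglongrightarrow> (\<integral>v. cos (t \<bullet> v) \<partial>\<mu>)"
    and sinc: "\<And>t. (\<lambda>n. \<integral>\<omega>. sin (t \<bullet> X n \<omega>) \<partial>M) \<longlonglongrightarrow> (\<integral>v. sin (t \<bullet> v) \<partial>\<mu>)"
    and tight: "\<And>e. e > 0 \<Longrightarrow> \<exists>R. likely M e (\<lambda>n \<omega>. norm (X n \<omega>) \<le> R)"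
  shows "converges_in_distribution M X \<mu>"
  unfolding converges_in_distribution_def
proof (intro allI impI, elim conjE)
  interpret M: prob_space M by (rule M)
  interpret \<mu>: prob_space \<mu> by (rule \<mu>)
  have id_\<mu>: "(\<lambda>v. v) \<in> borel_measurable \<mu>" unfolding measurable_cong_sets[OF \<mu>(2) refl] by simp
  have trig: "(\<lambda>n. \<integral>\<omega>. f (X n \<omega>) \<partial>M) \<longlonglongrightarrow> (\<integral>v. f v \<partial>\<mu>)" if "trig_poly f" for f
    using that
  proof induction
    case (trig_cos c t)
    then show ?case using tendsto_mult_left[OF cosc[of t], of c] by simp
  next
    case (trig_sin c t)
    then show ?case using tendsto_mult_left[OF sinc[of t], of c] by simp
  next
    case (trig_add f g)
    obtain A where A: "\<And>x. \<bar>f x\<bar> \<le> A" using trig_poly_bounded[OF trig_add.hyps(1)] by blast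
    obtain B where B: "\<And>x. \<bar>g x\<bar> \<le> B" using trig_poly_bounded[OF trig_add.hyps(2)] by blast
    note cf = trig_poly_continuous[OF trig_add.hyps(1)] and cg = trig_poly_continuous[OF trig_add.hyps(2)]
    have 1: "(\<integral>v. f v + g v \<partial>\<mu>) = (\<integral>v. f v \<partial>\<mu>) + (\<integral>v. g v \<partial>\<mu>)"
      by (intro Bochner_Integration.integral_add \<mu>.integrable_bounded_continuous[OF cf A id_\<mu>]
          \<mu>.integrable_bounded_continuous[OF cg B id_\<mu>])
    have 2: "\<forall>\<^sub>F n in sequentially. (\<integral>\<omega>. f (X n \<omega>) \<partial>M) + (\<integral>\<omega>. g (X n \<omega>) \<partial>M) = (\<integral>\<omega>. f (X n \<omega>) + g (X n \<omega>) \<partial>M)"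
      by (intro eventually_sequentiallyI[of 1] Bochner_Integration.integral_add[symmetric]
          M.integrable_bounded_continuous[OF cf A X] M.integrable_bounded_continuous[OF cg B X])
    show ?case unfolding 1 by (rule Lim_transform_eventually[OF tendsto_add[OF trig_add.IH] 2])
  qed
  fix h :: "real ^ 'n \<Rightarrow> real" assume h: "continuous_on UNIV h" and "bounded (range h)"
  then obtain B where B: "B > 0" "\<And>x. \<bar>h x\<bar> \<le> B" unfolding bounded_pos by auto
  show "(\<lambda>n. \<integral>\<omega>. h (X n \<omega>) \<partial>M) \<longlonglongrightarrow> (\<integral>v. h v \<partial>\<mu>)"
  proof (rule tendstoI)
    fix \<epsilon> :: real assume \<epsilon>: "\<epsilon> > 0"
    define e where "e = min 1 (\<epsilon> / (4 * (2 * B + 2)))"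
    have e: "e > 0" "e \<le> 1" and eB: "e * (2 * B + 2) \<le> \<epsilon> / 4"
    proof -
      show "e > 0" "e \<le> 1" using \<epsilon> B by (auto simp: e_def)
      have "e * (2 * B + 2) \<le> \<epsilon> / (4 * (2 * B + 2)) * (2 * B + 2)" using B by (intro mult_right_mono) (auto simp: e_def)
      also have "\<dots> = \<epsilon> / 4" using B by (simp add: field_simps)
      finally show "e * (2 * B + 2) \<le> \<epsilon> / 4" .
    qed
    obtain R1 where R1: "likely M e (\<lambda>n \<omega>. norm (X n \<omega>) \<le> R1)" using tight[OF e(1)] by blast
    have "\<exists>k::nat. 1 - e < \<mu>.prob {v. norm v \<le> real k}"
    proof -
      have s: "range (\<lambda>k. {v :: real ^ 'n. norm v \<le> real k}) \<subseteq> sets \<mu>" unfolding \<mu>(2) by auto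
      have "(\<lambda>k. \<mu>.prob {v. norm v \<le> real k}) \<longlonglongrightarrow> \<mu>.prob (\<Union>k. {v. norm v \<le> real k})"
        by (rule \<mu>.finite_Lim_measure_incseq[OF s]) (auto simp: incseq_def)
      moreover have "(\<Union>k. {v :: real ^ 'n. norm v \<le> real k}) = space \<mu>"
        unfolding sets_eq_imp_space_eq[OF \<mu>(2)] by (auto intro: real_arch_simple)
      ultimately have "(\<lambda>k. \<mu>.prob {v. norm v \<le> real k}) \<longlonglongrightarrow> 1" by (simp add: \<mu>.prob_space)
      from order_tendstoD(1)[OF this, of "1 - e"] e(1) show ?thesis
        unfolding eventually_sequentially by auto
    qed
    then obtain k :: nat where k: "1 - e < \<mu>.prob {v. norm v \<le> real k}" by blast
    define R where "R = max 1 (max R1 (real k))"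
    have R: "R \<ge> 1" "R1 \<le> R" "real k \<le> R" by (auto simp: R_def)
    \<comment> \<open>On the ball of radius \<open>R\<close> the arguments of the sines are at most \<open>1 < pi / 2\<close>, so \<open>arcsin\<close> recovers them.\<close>
    define E :: "real ^ 'n \<Rightarrow> real ^ 'n" where "E x = (\<chi> j. sin ((1 / R) * x $ j))" for x
    define H where "H w = h (\<chi> j. R * arcsin (max (-1) (min 1 (w $ j))))" for w :: "real ^ 'n"
    have "continuous_on UNIV (\<lambda>w :: real ^ 'n. \<chi> j. R * arcsin (max (-1) (min 1 (w $ j))))"
      by (intro continuous_on_vec_lambda continuous_on_mult_left continuous_on_compose2[OF continuous_on_arcsin'] continuous_intros) auto
    then have H: "continuous_on UNIV H" unfolding H_def by (rule continuous_on_compose2[OF h]) auto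
    have HE: "H (E x) = h x" if "norm x \<le> R" for x
    proof -
      have "R * arcsin (max (-1) (min 1 (E x $ j))) = x $ j" for j
      proof -
        have "\<bar>x $ j\<bar> \<le> R" using component_le_norm_cart[of x j] that by linarith
        then have "\<bar>(1 / R) * x $ j\<bar> \<le> 1" using R by (simp add: abs_mult divide_le_eq)
        moreover have "1 \<le> pi / 2" using pi_ge_two by simp
        ultimately have "arcsin (sin ((1 / R) * x $ j)) = (1 / R) * x $ j" by (intro arcsin_sin) linarith+
        then show ?thesis using R by (simp add: E_def)
      qed
      then show ?thesis by (simp add: H_def)
    qed
    define S :: "(real ^ 'n) set" where "S = cbox (\<chi> j. -1) (\<chi> j. 1)"
    have ES: "E x \<in> S" for x
      unfolding S_def mem_box_cart E_def vec_lambda_beta by (intro allI conjI sin_ge_minus_one sin_le_one)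
    obtain g where g: "real_polynomial_function g" "\<And>w. w \<in> S \<Longrightarrow> \<bar>H w - g w\<bar> < e"
      by (rule Stone_Weierstrass_real_polynomial_function[of S H e])
        (use continuous_on_subset[OF H] e(1) in \<open>auto simp: S_def\<close>)
    define f where "f x = g (E x)" for x
    have f: "trig_poly f" unfolding f_def E_def by (rule trig_poly_compose_sine[OF g(1)])
    have HB: "\<bar>H w\<bar> \<le> B" for w unfolding H_def by (rule B)
    have fB: "\<bar>f x\<bar> \<le> B + 1" for x using g(2)[OF ES[of x]] HB[of "E x"] e unfolding f_def by linarith
    have hf: "\<bar>h x - f x\<bar> \<le> e" if "norm x \<le> R" for x using g(2)[OF ES[of x]] HE[OF that] unfolding f_def by simp
    have hf': "\<bar>h x - f x\<bar> \<le> 2 * B + 1" for x using fB[of x] B(2)[of x] by linarith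
    note fc = trig_poly_continuous[OF f]
    have tot: "e + (2 * B + 1) * e \<le> \<epsilon> / 4" using eB by (simp add: algebra_simps)
    have m: "\<bar>(\<integral>v. h v \<partial>\<mu>) - (\<integral>v. f v \<partial>\<mu>)\<bar> \<le> e + (2 * B + 1) * e"
    proof (rule \<mu>.expectation_close[where B = "{v. norm v \<le> real k}"])
      show "{v. norm v \<le> real k} \<in> sets \<mu>" unfolding \<mu>(2) by auto
    qed (use k R hf hf' e in \<open>auto intro: \<mu>.integrable_bounded_continuous[OF h B(2) id_\<mu>] \<mu>.integrable_bounded_continuous[OF fc fB id_\<mu>]\<close>)
    have "\<forall>\<^sub>F n in sequentially. \<bar>(\<integral>\<omega>. h (X n \<omega>) \<partial>M) - (\<integral>\<omega>. f (X n \<omega>) \<partial>M)\<bar> \<le> e + (2 * B + 1) * e"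
      using R1[unfolded likely_def] eventually_ge_at_top[of 1]
    proof eventually_elim
      case (elim n)
      then obtain A where A: "A \<in> sets M" "1 - e \<le> M.prob A" "\<And>\<omega>. \<omega> \<in> A \<Longrightarrow> norm (X n \<omega>) \<le> R1" by blast
      show ?case
      proof (rule M.expectation_close[OF A(1,2)])
        show "integrable M (\<lambda>\<omega>. h (X n \<omega>))" "integrable M (\<lambda>\<omega>. f (X n \<omega>))"
          by (intro M.integrable_bounded_continuous[OF h B(2) X[OF elim(2)]] M.integrable_bounded_continuous[OF fc fB X[OF elim(2)]])+
        show "\<bar>h (X n \<omega>) - f (X n \<omega>)\<bar> \<le> e" if "\<omega> \<in> A" for \<omega>
          using A(3)[OF that] R by (intro hf) simp
      qed (use hf' e in auto)
    qed
    moreover have "\<forall>\<^sub>F n in sequentially. dist (\<integral>\<omega>. f (X n \<omega>) \<partial>M) (\<integral>v. f v \<partial>\<mu>) < \<epsilon> / 4"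
      using tendstoD[OF trig[OF f], of "\<epsilon> / 4"] \<epsilon> by simp
    ultimately show "\<forall>\<^sub>F n in sequentially. dist (\<integral>\<omega>. h (X n \<omega>) \<partial>M) (\<integral>v. h v \<partial>\<mu>) < \<epsilon>"
    proof eventually_elim
      case (elim n)
      then show ?case using m tot \<epsilon> unfolding dist_real_def by linarith
    qed
  qed
qed

lemma vec_component_measurable: "(\<lambda>v :: real ^ 'n::finite. v $ j) \<in> borel_measurable borel"
  by (intro borel_measurable_continuous_onI continuous_intros)

context iid_sample begin

lemma linear_functional_of_sample:
  fixes \<psi> :: "'z \<Rightarrow> real ^ 'n::finite"
  assumes m: "\<psi> \<in> borel_measurable borel" and sq: "\<And>j. integrable M (\<lambda>\<omega>. (\<psi> (Z 1 \<omega>) $ j)\<^sup>2)"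
    and mean: "\<And>j. expectation (\<lambda>\<omega>. \<psi> (Z 1 \<omega>) $ j) = 0"
  defines "C \<equiv> \<chi> i j. expectation (\<lambda>\<omega>. \<psi> (Z 1 \<omega>) $ i * \<psi> (Z 1 \<omega>) $ j)"
  shows "integrable M (\<lambda>\<omega>. (t \<bullet> \<psi> (Z 1 \<omega>))\<^sup>2)" "expectation (\<lambda>\<omega>. t \<bullet> \<psi> (Z 1 \<omega>)) = 0"
    and "expectation (\<lambda>\<omega>. (t \<bullet> \<psi> (Z 1 \<omega>))\<^sup>2) = t \<bullet> (C *v t)"
    and "expectation (\<lambda>\<omega>. (t \<bullet> \<psi> (Z 1 \<omega>))\<^sup>2) = (\<Sum>i\<in>UNIV. \<Sum>j\<in>UNIV. t $ i * t $ j * C $ i $ j)"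
proof -
  have mj: "(\<lambda>\<omega>. \<psi> (Z 1 \<omega>) $ j) \<in> borel_measurable M" for j
    by (rule measurable_compose[OF comp_measurable[OF m order_refl] vec_component_measurable])
  have i1: "integrable M (\<lambda>\<omega>. \<psi> (Z 1 \<omega>) $ j)" for j
    by (rule square_integrable_imp_integrable[OF mj sq])
  have i2: "integrable M (\<lambda>\<omega>. \<psi> (Z 1 \<omega>) $ i * \<psi> (Z 1 \<omega>) $ j)" for i j
  proof (rule Bochner_Integration.integrable_bound[of _ "\<lambda>\<omega>. (\<psi> (Z 1 \<omega>) $ i)\<^sup>2 + (\<psi> (Z 1 \<omega>) $ j)\<^sup>2"])
    show "integrable M (\<lambda>\<omega>. (\<psi> (Z 1 \<omega>) $ i)\<^sup>2 + (\<psi> (Z 1 \<omega>) $ j)\<^sup>2)" by (intro Bochner_Integration.integrable_add sq)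
    show "(\<lambda>\<omega>. \<psi> (Z 1 \<omega>) $ i * \<psi> (Z 1 \<omega>) $ j) \<in> borel_measurable M" using mj by measurable
    have "\<bar>a * b\<bar> \<le> a\<^sup>2 + b\<^sup>2" for a b :: real
    proof -
      have "2 * (\<bar>a\<bar> * \<bar>b\<bar>) \<le> a\<^sup>2 + b\<^sup>2" using sum_squares_bound[of "\<bar>a\<bar>" "\<bar>b\<bar>"] by (simp add: mult.assoc)
      moreover have "0 \<le> \<bar>a\<bar> * \<bar>b\<bar>" by simp
      ultimately show ?thesis unfolding abs_mult by linarith
    qed
    then show "AE \<omega> in M. norm (\<psi> (Z 1 \<omega>) $ i * \<psi> (Z 1 \<omega>) $ j) \<le> norm ((\<psi> (Z 1 \<omega>) $ i)\<^sup>2 + (\<psi> (Z 1 \<omega>) $ j)\<^sup>2)"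
      by (intro AE_I2) simp
  qed
  have inner: "t \<bullet> \<psi> (Z 1 \<omega>) = (\<Sum>j\<in>UNIV. t $ j * \<psi> (Z 1 \<omega>) $ j)" for \<omega> by (simp add: inner_vec_def)
  have inner2: "(t \<bullet> \<psi> (Z 1 \<omega>))\<^sup>2 = (\<Sum>i\<in>UNIV. \<Sum>j\<in>UNIV. (t $ i * t $ j) * (\<psi> (Z 1 \<omega>) $ i * \<psi> (Z 1 \<omega>) $ j))" for \<omega>
    unfolding inner power2_eq_square sum_product by (intro sum.cong refl) simp
  show "integrable M (\<lambda>\<omega>. (t \<bullet> \<psi> (Z 1 \<omega>))\<^sup>2)"
    unfolding inner2 by (intro Bochner_Integration.integrable_sum integrable_mult_right i2)
  show "expectation (\<lambda>\<omega>. t \<bullet> \<psi> (Z 1 \<omega>)) = 0"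
    unfolding inner by (subst Bochner_Integration.integral_sum) (use i1 mean in auto)
  show eq: "expectation (\<lambda>\<omega>. (t \<bullet> \<psi> (Z 1 \<omega>))\<^sup>2) = (\<Sum>i\<in>UNIV. \<Sum>j\<in>UNIV. t $ i * t $ j * C $ i $ j)"
    unfolding inner2 C_def using i2
    by (simp add: Bochner_Integration.integral_sum Bochner_Integration.integrable_sum)
  show "expectation (\<lambda>\<omega>. (t \<bullet> \<psi> (Z 1 \<omega>))\<^sup>2) = t \<bullet> (C *v t)"
    unfolding eq by (simp add: inner_vec_def matrix_vector_mult_def sum_distrib_left mult_ac)
qed

lemma normalized_sum_eq:
  fixes \<psi> :: "'z \<Rightarrow> real ^ 'n::finite"
  shows "t \<bullet> (sqrt (real n) *\<^sub>R sample_mean \<psi> n \<omega>) = (\<Sum>i=1..n. t \<bullet> \<psi> (Z i \<omega>)) / sqrt (real n)"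
proof -
  have "sqrt (real n) * (1 / real n) = 1 / sqrt (real n)"
  proof (cases "n = 0")
    case False
    then have "sqrt (real n) * (1 / (sqrt (real n) * sqrt (real n))) = 1 / sqrt (real n)"
      by (simp del: real_sqrt_mult_self)
    moreover have "sqrt (real n) * sqrt (real n) = real n" by simp
    ultimately show ?thesis by (simp only:)
  qed simp
  then have "sqrt (real n) *\<^sub>R sample_mean \<psi> n \<omega> = (1 / sqrt (real n)) *\<^sub>R (\<Sum>i=1..n. \<psi> (Z i \<omega>))" by (simp add: sample_mean_def)
  then show ?thesis by (simp add: inner_sum_right)
qed

lemma normalized_sum_tight:
  fixes \<psi> :: "'z \<Rightarrow> real ^ 'n::finite"
  assumes m: "\<psi> \<in> borel_measurable borel" and sq: "\<And>j. integrable M (\<lambda>\<omega>. (\<psi> (Z 1 \<omega>) $ j)\<^sup>2)"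
    and mean: "\<And>j. expectation (\<lambda>\<omega>. \<psi> (Z 1 \<omega>) $ j) = 0" and e: "e > 0"
  shows "\<exists>R. likely M e (\<lambda>n \<omega>. norm (sqrt (real n) *\<^sub>R sample_mean \<psi> n \<omega>) \<le> R)"
proof -
  define S where "S n \<omega> = sqrt (real n) *\<^sub>R sample_mean \<psi> n \<omega>" for n \<omega>
  note S_eq = normalized_sum_eq[of _ _ \<psi>, folded S_def]
  define V where "V = (\<Sum>j\<in>UNIV. expectation (\<lambda>\<omega>. (\<psi> (Z 1 \<omega>) $ j)\<^sup>2))"
  have V0: "V \<ge> 0" unfolding V_def by (intro sum_nonneg Bochner_Integration.integral_nonneg) simp
  define a where "a = (V + 1) / e"
  have a: "a > 0" using V0 e by (simp add: a_def)
  have "likely M (V / a) (\<lambda>n \<omega>. (norm (S n \<omega>))\<^sup>2 \<le> a)"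
  proof (rule likely_markov[OF eventually_sequentiallyI[of 1] a], intro conjI)
    fix n :: nat assume n: "1 \<le> n"
    have mj: "(\<lambda>z. \<psi> z $ j) \<in> borel_measurable borel" for j
      by (rule measurable_compose[OF m vec_component_measurable])
    note sm = second_moment_of_sum[OF mj sq mean]
    have Sj: "(S n \<omega> $ j)\<^sup>2 = (1 / real n) * (\<Sum>i=1..n. \<psi> (Z i \<omega>) $ j)\<^sup>2" for \<omega> j
      using S_eq[of "axis j 1" n \<omega>] n by (simp add: inner_axis' power_divide)
    have nS: "(norm (S n \<omega>))\<^sup>2 = (\<Sum>j\<in>UNIV. (1 / real n) * (\<Sum>i=1..n. \<psi> (Z i \<omega>) $ j)\<^sup>2)" for \<omega>
      unfolding Sj[symmetric] power2_norm_eq_inner inner_vec_def by (simp add: power2_eq_square)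
    show "integrable M (\<lambda>\<omega>. (norm (S n \<omega>))\<^sup>2)"
      unfolding nS by (intro Bochner_Integration.integrable_sum integrable_mult_right sm)
    have "expectation (\<lambda>\<omega>. (norm (S n \<omega>))\<^sup>2) = (\<Sum>j\<in>UNIV. (1 / real n) * (real n * expectation (\<lambda>\<omega>. (\<psi> (Z 1 \<omega>) $ j)\<^sup>2)))"
      unfolding nS sm(2)[of _ n, symmetric]
      by (subst Bochner_Integration.integral_sum) (use sm(1) in simp_all)
    then show "expectation (\<lambda>\<omega>. (norm (S n \<omega>))\<^sup>2) \<le> V" using n by (simp add: V_def)
  qed simp
  then have "likely M e (\<lambda>n \<omega>. norm (S n \<omega>) \<le> sqrt a)"
  proof (rule likely_mono)
    show "V / a \<le> e" using V0 e by (simp add: a_def field_simps)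
  qed (auto intro!: always_eventually real_le_rsqrt)
  then show ?thesis unfolding S_def by blast
qed

text \<open>The limit law is fixed before the sequence \<open>X\<close>: any two sequences that are close to the same
  normalised sums share it.\<close>

theorem central_limit_theorem_multivariate:
  fixes \<psi> :: "'z \<Rightarrow> real ^ 'n::finite"
  assumes m: "\<psi> \<in> borel_measurable borel" and sq: "\<And>j. integrable M (\<lambda>\<omega>. (\<psi> (Z 1 \<omega>) $ j)\<^sup>2)"
    and mean: "\<And>j. expectation (\<lambda>\<omega>. \<psi> (Z 1 \<omega>) $ j) = 0"
  defines "C \<equiv> \<chi> i j. expectation (\<lambda>\<omega>. \<psi> (Z 1 \<omega>) $ i * \<psi> (Z 1 \<omega>) $ j)"
  shows "\<exists>\<mu>. multivariate_normal 0 C \<mu> \<and> (\<forall>X. (\<forall>n\<ge>1. X n \<in> borel_measurable M) \<longrightarrow>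
    (\<forall>\<kappa>>0. \<forall>e>0. likely M e (\<lambda>n \<omega>. norm (X n \<omega> - sqrt (real n) *\<^sub>R sample_mean \<psi> n \<omega>) \<le> \<kappa>)) \<longrightarrow>
    converges_in_distribution M X \<mu>)"
proof -
  note lin = linear_functional_of_sample[OF m sq mean, folded C_def]
  have psd: "0 \<le> (\<Sum>i\<in>UNIV. \<Sum>j\<in>UNIV. x i * x j * C $ i $ j)" for x
  proof -
    have "0 \<le> expectation (\<lambda>\<omega>. ((\<chi> i. x i) \<bullet> \<psi> (Z 1 \<omega>))\<^sup>2)" by (rule Bochner_Integration.integral_nonneg) simp
    then show ?thesis unfolding lin(4) by simp
  qed
  have sym: "C $ i $ j = C $ j $ i" for i j by (simp add: C_def mult.commute)
  obtain A :: "real ^ 'n ^ 'n" where A: "A ** transpose A = C" by (rule covariance_square_root[OF sym psd])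
  define \<mu> where "\<mu> = distr std_normal borel (\<lambda>z. 0 + A *v z)"
  note N = multivariate_normal_facts[of A, folded \<mu>_def, unfolded A]
  define S where "S n \<omega> = sqrt (real n) *\<^sub>R sample_mean \<psi> n \<omega>" for n \<omega>
  note S_eq = normalized_sum_eq[of _ _ \<psi>, folded S_def]
  have mt: "(\<lambda>z. t \<bullet> \<psi> z) \<in> borel_measurable borel" for t using m by measurable
  have mS: "S n \<in> borel_measurable M" for n
    unfolding S_def[abs_def] sample_mean_def
    by (intro borel_measurable_scaleR borel_measurable_const borel_measurable_sum comp_measurable[OF m]) auto
  note clt = central_limit_characteristic[OF mt lin(1,2), unfolded lin(3), folded S_eq]
  note tightS = normalized_sum_tight[OF m sq mean, folded S_def]
  have "converges_in_distribution M X \<mu>"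
    if X: "\<And>n. 1 \<le> n \<Longrightarrow> X n \<in> borel_measurable M"
      and close: "\<And>\<kappa> e. \<kappa> > 0 \<Longrightarrow> e > 0 \<Longrightarrow> likely M e (\<lambda>n \<omega>. norm (X n \<omega> - S n \<omega>) \<le> \<kappa>)" for X
  proof (rule weak_convergence_of_trigonometric_moments[OF prob_space_axioms X N(1,2)])
    show "\<exists>R. likely M e (\<lambda>n \<omega>. norm (X n \<omega>) \<le> R)" if e: "e > 0" for e
    proof -
      have "e / 2 > 0" using e by simp
      from tightS[OF this] obtain R where R: "likely M (e / 2) (\<lambda>n \<omega>. norm (S n \<omega>) \<le> R)" by blast
      have "likely M e (\<lambda>n \<omega>. norm (X n \<omega>) \<le> R + 1)"
      proof (rule likely_mono[OF likely_conj[OF R close[OF zero_less_one \<open>e / 2 > 0\<close>]]])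
        show "\<forall>\<^sub>F n in sequentially. \<forall>\<omega>\<in>space M. norm (S n \<omega>) \<le> R \<and> norm (X n \<omega> - S n \<omega>) \<le> 1 \<longrightarrow> norm (X n \<omega>) \<le> R + 1"
        proof (intro always_eventually allI ballI impI, elim conjE)
          fix n \<omega> assume "norm (S n \<omega>) \<le> R" "norm (X n \<omega> - S n \<omega>) \<le> 1"
          then show "norm (X n \<omega>) \<le> R + 1" using norm_triangle_sub[of "X n \<omega>" "S n \<omega>"] by linarith
        qed
      qed simp
      then show ?thesis by blast
    qed
    have transfer: "(\<lambda>n. expectation (\<lambda>\<omega>. k (t \<bullet> X n \<omega>))) \<longlonglongrightarrow> l"
      if k: "continuous_on UNIV k" "\<And>x. \<bar>k x\<bar> \<le> 1" "\<And>x y. \<bar>k x - k y\<bar> \<le> \<bar>x - y\<bar>"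
        and lim: "(\<lambda>n. expectation (\<lambda>\<omega>. k (t \<bullet> S n \<omega>))) \<longlonglongrightarrow> l" for k :: "real \<Rightarrow> real" and t l
    proof (rule tendstoI)
      fix \<epsilon> :: real assume \<epsilon>: "\<epsilon> > 0"
      define \<kappa> where "\<kappa> = \<epsilon> / (4 * (norm t + 1))"
      have n1: "norm t + 1 > 0" by (simp add: add_nonneg_pos)
      have \<kappa>: "\<kappa> > 0" "norm t * \<kappa> \<le> \<epsilon> / 4"
      proof -
        show "\<kappa> > 0" using \<epsilon> n1 by (simp add: \<kappa>_def)
        have "norm t * \<kappa> \<le> (norm t + 1) * \<kappa>" using \<open>\<kappa> > 0\<close> by simp
        also have "\<dots> = \<epsilon> / 4" using n1 by (simp add: \<kappa>_def field_simps)
        finally show "norm t * \<kappa> \<le> \<epsilon> / 4" .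
      qed
      have kc: "continuous_on UNIV (\<lambda>x. k (t \<bullet> x))" by (intro continuous_on_compose2[OF k(1)] continuous_intros) auto
      have "\<epsilon> / 8 > 0" using \<epsilon> by simp
      from close[OF \<kappa>(1) this, unfolded likely_def] eventually_ge_at_top[of 1]
      have "\<forall>\<^sub>F n in sequentially. \<bar>expectation (\<lambda>\<omega>. k (t \<bullet> X n \<omega>)) - expectation (\<lambda>\<omega>. k (t \<bullet> S n \<omega>))\<bar> \<le> \<epsilon> / 4 + 2 * (\<epsilon> / 8)"
      proof eventually_elim
        case (elim n)
        then obtain B where B: "B \<in> sets M" "1 - \<epsilon> / 8 \<le> prob B" "\<And>\<omega>. \<omega> \<in> B \<Longrightarrow> norm (X n \<omega> - S n \<omega>) \<le> \<kappa>" by blast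
        show ?case
        proof (rule expectation_close[OF B(1,2)])
          show "integrable M (\<lambda>\<omega>. k (t \<bullet> X n \<omega>))" "integrable M (\<lambda>\<omega>. k (t \<bullet> S n \<omega>))"
            by (rule integrable_bounded_continuous[OF kc k(2) X[OF elim(2)]], rule integrable_bounded_continuous[OF kc k(2) mS])
          show "\<bar>k (t \<bullet> X n \<omega>) - k (t \<bullet> S n \<omega>)\<bar> \<le> \<epsilon> / 4" if "\<omega> \<in> B" for \<omega>
          proof -
            have "\<bar>k (t \<bullet> X n \<omega>) - k (t \<bullet> S n \<omega>)\<bar> \<le> \<bar>t \<bullet> (X n \<omega> - S n \<omega>)\<bar>" using k(3) by (simp add: inner_diff_right)
            also have "\<dots> \<le> norm t * norm (X n \<omega> - S n \<omega>)" by (rule Cauchy_Schwarz_ineq2)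
            also have "\<dots> \<le> norm t * \<kappa>" using B(3)[OF that] by (intro mult_left_mono) auto
            finally show ?thesis using \<kappa>(2) by linarith
          qed
          show "\<bar>k (t \<bullet> X n \<omega>) - k (t \<bullet> S n \<omega>)\<bar> \<le> 2" for \<omega> using k(2)[of "t \<bullet> X n \<omega>"] k(2)[of "t \<bullet> S n \<omega>"] by linarith
        qed (use \<epsilon> in simp)
      qed
      moreover have "\<forall>\<^sub>F n in sequentially. dist (expectation (\<lambda>\<omega>. k (t \<bullet> S n \<omega>))) l < \<epsilon> / 2"
        using tendstoD[OF lim, of "\<epsilon> / 2"] \<epsilon> by simp
      ultimately show "\<forall>\<^sub>F n in sequentially. dist (expectation (\<lambda>\<omega>. k (t \<bullet> X n \<omega>))) l < \<epsilon>"
      proof eventually_elim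
        case (elim n)
        then show ?case unfolding dist_real_def by linarith
      qed
    qed
    have "\<bar>cos x - cos y\<bar> \<le> \<bar>x - y\<bar>" "\<bar>sin x - sin y\<bar> \<le> \<bar>x - y\<bar>" for x y :: real
    proof -
      have "norm (cos x - cos y) \<le> 1 * norm (x - y)"
        by (rule field_differentiable_bound[of UNIV cos "\<lambda>x. - sin x"]) (auto intro!: derivative_eq_intros)
      then show "\<bar>cos x - cos y\<bar> \<le> \<bar>x - y\<bar>" by simp
      have "norm (sin x - sin y) \<le> 1 * norm (x - y)"
        by (rule field_differentiable_bound[of UNIV sin cos]) (auto intro!: derivative_eq_intros)
      then show "\<bar>sin x - sin y\<bar> \<le> \<bar>x - y\<bar>" by simp
    qed
    note l = this
    show "(\<lambda>n. expectation (\<lambda>\<omega>. cos (t \<bullet> X n \<omega>))) \<longlonglongrightarrow> (\<integral>v. cos (t \<bullet> v) \<partial>\<mu>)" for t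
      unfolding N(3) by (rule transfer[OF _ _ l(1) clt(1)[of t]]) (auto intro!: continuous_intros)
    show "(\<lambda>n. expectation (\<lambda>\<omega>. sin (t \<bullet> X n \<omega>))) \<longlonglongrightarrow> (\<integral>v. sin (t \<bullet> v) \<partial>\<mu>)" for t
      unfolding N(4) by (rule transfer[OF _ _ l(2) clt(2)[of t]]) (auto intro!: continuous_intros)
  qed
  moreover have "multivariate_normal 0 C \<mu>" unfolding multivariate_normal_def using A \<mu>_def by blast
  ultimately show ?thesis unfolding S_def by (intro exI[of _ \<mu>]) blast
qed

end

section \<open>Near-maximisers of sample means\<close>

lemma (in prob_space) likely_finite:
  assumes "finite I" "\<And>i. i \<in> I \<Longrightarrow> likely M e (Q i)" "0 \<le> e"
  shows "likely M (real (card I) * e) (\<lambda>n \<omega>. \<forall>i\<in>I. Q i n \<omega>)"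
  using assms
proof (induction I rule: finite_induct)
  case empty
  then show ?case by (intro likely_AE) auto
next
  case (insert i I)
  have "likely M (e + real (card I) * e) (\<lambda>n \<omega>. Q i n \<omega> \<and> (\<forall>i\<in>I. Q i n \<omega>))"
    using insert by (intro likely_conj) auto
  then show ?case using insert.hyps by (simp add: algebra_simps)
qed

lemma quadratic_form_entry_bound:
  fixes D :: "real ^ 'n::finite ^ 'n"
  assumes "\<And>i j. \<bar>D $ i $ j\<bar> \<le> b"
  shows "\<bar>h \<bullet> (D *v h)\<bar> \<le> (real CARD('n))\<^sup>2 * b * (norm h)\<^sup>2"
proof -
  have "h \<bullet> (D *v h) = (\<Sum>i\<in>UNIV. \<Sum>j\<in>UNIV. h $ i * (D $ i $ j * h $ j))"
    by (simp add: inner_vec_def matrix_vector_mult_def sum_distrib_left)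
  also have "\<bar>\<dots>\<bar> \<le> (\<Sum>i\<in>(UNIV :: 'n set). \<Sum>j\<in>(UNIV :: 'n set). b * (norm h)\<^sup>2)"
  proof (rule order_trans[OF sum_abs], rule sum_mono, rule order_trans[OF sum_abs], rule sum_mono)
    fix i j :: 'n
    have b: "0 \<le> b" using assms[of i j] by linarith
    have "\<bar>h $ i * (D $ i $ j * h $ j)\<bar> = \<bar>h $ i\<bar> * (\<bar>D $ i $ j\<bar> * \<bar>h $ j\<bar>)" by (simp add: abs_mult)
    also have "\<dots> \<le> norm h * (b * norm h)"
      by (intro mult_mono component_le_norm_cart assms mult_nonneg_nonneg b) auto
    finally show "\<bar>h $ i * (D $ i $ j * h $ j)\<bar> \<le> b * (norm h)\<^sup>2" by (simp add: power2_eq_square mult_ac)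
  qed
  also have "\<dots> = (real CARD('n))\<^sup>2 * b * (norm h)\<^sup>2" by (simp add: power2_eq_square mult_ac)
  finally show ?thesis .
qed

lemma symmetric_matrix_inner:
  fixes V :: "real ^ 'n::finite ^ 'n"
  assumes "\<And>i j. V $ i $ j = V $ j $ i"
  shows "x \<bullet> (V *v y) = (V *v x) \<bullet> y"
proof -
  have "x \<bullet> (V *v y) = (\<Sum>i\<in>UNIV. \<Sum>j\<in>UNIV. x $ i * (V $ i $ j * y $ j))"
    by (simp add: inner_vec_def matrix_vector_mult_def sum_distrib_left)
  also have "\<dots> = (\<Sum>j\<in>UNIV. \<Sum>i\<in>UNIV. x $ i * (V $ i $ j * y $ j))" by (rule sum.swap)
  also have "\<dots> = (\<Sum>j\<in>UNIV. \<Sum>i\<in>UNIV. (V $ j $ i * x $ i) * y $ j)"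
    by (intro sum.cong refl) (use assms in \<open>simp add: mult_ac\<close>)
  also have "\<dots> = (V *v x) \<bullet> y"
    by (simp add: inner_vec_def matrix_vector_mult_def sum_distrib_right)
  finally show ?thesis .
qed

text \<open>If the form vanished at \<open>h \<noteq> 0\<close>, then \<open>h\<close> would maximise it along the line in the direction
  \<open>V h\<close>, where its derivative is \<open>2 \<bar>V h\<bar>\<^sup>2 > 0\<close>.  Compactness of the sphere gives the constant.\<close>

lemma nonsingular_semidefinite_imp_definite:
  fixes V :: "real ^ 'n::finite ^ 'n"
  assumes sym: "\<And>i j. V $ i $ j = V $ j $ i" and inv: "invertible V" and neg: "\<And>h. h \<bullet> (V *v h) \<le> 0"
  obtains c where "c > 0" "\<And>h. h \<bullet> (V *v h) \<le> - c * (norm h)\<^sup>2"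
proof -
  let ?g = "\<lambda>h :: real ^ 'n. h \<bullet> (V *v h)"
  have ker: "V *v h = 0 \<Longrightarrow> h = 0" for h
    using inv matrix_left_invertible_ker[of V] unfolding invertible_def by blast
  have strict: "?g h < 0" if "h \<noteq> 0" for h
  proof (rule ccontr)
    assume "\<not> ?g h < 0"
    then have zero: "?g h = 0" using neg[of h] by simp
    define w where "w = V *v h"
    have w: "w \<bullet> w > 0" using ker[of h] that by (auto simp: w_def)
    define K where "K = \<bar>?g w\<bar> + 1"
    define s where "s = w \<bullet> w / K"
    have K: "K > 0" by (simp add: K_def)
    have s: "s > 0" using w K by (simp add: s_def)
    have "?g (h + s *\<^sub>R w) = ?g h + s * (h \<bullet> (V *v w)) + s * (w \<bullet> (V *v h)) + s\<^sup>2 * ?g w"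
      by (simp add: matrix_vector_right_distrib matrix_vector_mult_scaleR inner_add_left inner_add_right
          power2_eq_square algebra_simps)
    also have "h \<bullet> (V *v w) = w \<bullet> w" unfolding symmetric_matrix_inner[OF sym] w_def[symmetric] ..
    also have "w \<bullet> (V *v h) = w \<bullet> w" by (simp add: w_def)
    finally have "2 * s * (w \<bullet> w) + s\<^sup>2 * ?g w \<le> 0" using neg[of "h + s *\<^sub>R w"] zero by simp
    then have "s * (2 * (w \<bullet> w) + s * ?g w) \<le> 0" by (simp add: power2_eq_square algebra_simps)
    then have "2 * (w \<bullet> w) + s * ?g w \<le> 0" using s by (simp add: mult_le_0_iff)
    moreover have "- (s * ?g w) \<le> w \<bullet> w"
    proof -
      have "- (s * ?g w) \<le> s * \<bar>?g w\<bar>" using s neg[of w] by simp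
      also have "\<dots> \<le> s * K" using s by (intro mult_left_mono) (auto simp: K_def)
      finally show ?thesis using K by (simp add: s_def)
    qed
    ultimately show False using w by linarith
  qed
  have "compact (sphere (0 :: real ^ 'n) 1)" "sphere (0 :: real ^ 'n) 1 \<noteq> {}" by auto
  moreover have "continuous_on (sphere 0 1) ?g"
    by (intro continuous_intros linear_continuous_on matrix_vector_mul_bounded_linear)
  ultimately obtain u where u: "u \<in> sphere (0 :: real ^ 'n) 1" "\<And>h. h \<in> sphere 0 1 \<Longrightarrow> ?g h \<le> ?g u"
    using continuous_attains_sup[of "sphere (0 :: real ^ 'n) 1" ?g] by blast
  show ?thesis
  proof (rule that[of "- ?g u"])
    have "u \<noteq> 0" using u(1) by (intro notI) simp
    then show "0 < - ?g u" using strict[of u] by simp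
    show "?g h \<le> - (- ?g u) * (norm h)\<^sup>2" for h
    proof (cases "h = 0")
      case False
      define k where "k = (1 / norm h) *\<^sub>R h"
      have hk: "h = norm h *\<^sub>R k" "norm k = 1" using False by (simp_all add: k_def)
      have "?g h = (norm h)\<^sup>2 * ?g k"
        by (subst (1 2) hk(1)) (simp add: matrix_vector_mult_scaleR power2_eq_square)
      also have "\<dots> \<le> (norm h)\<^sup>2 * ?g u" using u(2)[of k] hk(2) by (intro mult_left_mono) auto
      finally show ?thesis by (simp add: mult.commute)
    qed simp
  qed
qed

text \<open>With the vertex \<open>k\<close> the quadratic at \<open>h\<close> is its value at \<open>k\<close> plus half the form at \<open>h - k\<close>, so a
  small loss in value forces a small distance.  The error \<open>\<epsilon> \<bar>h\<bar>\<^sup>2\<close> is split by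
  \<open>\<bar>h\<bar>\<^sup>2 \<le> 2 \<bar>h - k\<bar>\<^sup>2 + 2 \<bar>k\<bar>\<^sup>2\<close> and partly absorbed.\<close>

lemma near_maximizer_of_quadratic:
  fixes V :: "real ^ 'n::finite ^ 'n"
  assumes sym: "\<And>i j. V $ i $ j = V $ j $ i" and neg: "\<And>h. h \<bullet> (V *v h) \<le> - c * (norm h)\<^sup>2"
    and k: "V *v k = - S"
    and expand: "\<And>h. norm h \<le> \<delta> \<Longrightarrow> \<bar>m h - m 0 - S \<bullet> h - (h \<bullet> (V *v h)) / 2\<bar> \<le> \<epsilon> * (norm h)\<^sup>2"
    and h: "norm h \<le> \<delta>" "norm k \<le> \<delta>" and near: "m k \<le> m h + \<kappa>" and \<epsilon>: "0 \<le> \<epsilon>" "8 * \<epsilon> \<le> c"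
  shows "(c / 4) * (norm (h - k))\<^sup>2 \<le> 3 * \<epsilon> * (norm k)\<^sup>2 + \<kappa>"
proof -
  have "(h - k) \<bullet> (V *v (h - k)) = h \<bullet> (V *v h) - h \<bullet> (V *v k) - k \<bullet> (V *v h) + k \<bullet> (V *v k)"
    by (simp add: matrix_vector_mult_diff_distrib inner_diff_left inner_diff_right)
  also have "k \<bullet> (V *v h) = h \<bullet> (V *v k)" unfolding symmetric_matrix_inner[OF sym, of k] by (rule inner_commute)
  finally have "S \<bullet> h + (h \<bullet> (V *v h)) / 2 - (S \<bullet> k + (k \<bullet> (V *v k)) / 2) = ((h - k) \<bullet> (V *v (h - k))) / 2"
    unfolding k by (simp add: inner_commute)
  then have q: "S \<bullet> h + (h \<bullet> (V *v h)) / 2 - (S \<bullet> k + (k \<bullet> (V *v k)) / 2) \<le> - c * (norm (h - k))\<^sup>2 / 2"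
    using neg[of "h - k"] by linarith
  have "norm h \<le> norm (h - k) + norm k" using norm_triangle_sub[of h k] by (simp add: add.commute)
  then have "(norm h)\<^sup>2 \<le> (norm (h - k) + norm k)\<^sup>2" by (intro power_mono) auto
  also have "\<dots> \<le> 2 * (norm (h - k))\<^sup>2 + 2 * (norm k)\<^sup>2"
    using zero_le_power2[of "norm (h - k) - norm k"] by (simp add: power2_sum power2_diff)
  finally have "\<epsilon> * (norm h)\<^sup>2 \<le> \<epsilon> * (2 * (norm (h - k))\<^sup>2 + 2 * (norm k)\<^sup>2)" using \<epsilon> by (intro mult_left_mono) auto
  then have "\<epsilon> * (norm h)\<^sup>2 \<le> 2 * \<epsilon> * (norm (h - k))\<^sup>2 + 2 * \<epsilon> * (norm k)\<^sup>2" by (simp add: algebra_simps)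
  moreover have "8 * \<epsilon> * (norm (h - k))\<^sup>2 \<le> c * (norm (h - k))\<^sup>2" using \<epsilon> by (intro mult_right_mono) auto
  moreover have "c * (norm (h - k))\<^sup>2 / 2 \<le> \<epsilon> * (norm h)\<^sup>2 + \<epsilon> * (norm k)\<^sup>2 + \<kappa>"
    using q near expand[OF h(1)] expand[OF h(2)] unfolding abs_le_iff by linarith
  ultimately show ?thesis by linarith
qed

text \<open>The local parameter is \<open>h\<close>, with truth \<open>0\<close>.  The expansion admits an error \<open>\<rho>\<close> that depends on the
  observation and has small mean; this is what moment conditions at the truth provide.\<close>

locale m_estimation = iid_sample M Z for M :: "'w measure" and Z :: "nat \<Rightarrow> 'w \<Rightarrow> 'z::topological_space" +
  fixes m :: "real ^ 'n::finite \<Rightarrow> 'z \<Rightarrow> real" and \<psi> :: "'z \<Rightarrow> real ^ 'n" and Hs :: "'z \<Rightarrow> real ^ 'n ^ 'n"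
    and r0 :: real and V :: "real ^ 'n ^ 'n"
  assumes r0: "0 < r0"
    and m_measurable: "\<And>h. norm h \<le> r0 \<Longrightarrow> m h \<in> borel_measurable borel"
    and m_integrable: "\<And>h. norm h \<le> r0 \<Longrightarrow> integrable M (\<lambda>\<omega>. m h (Z 1 \<omega>))"
    and psi_measurable: "\<psi> \<in> borel_measurable borel"
    and psi_square: "\<And>j. integrable M (\<lambda>\<omega>. (\<psi> (Z 1 \<omega>) $ j)\<^sup>2)"
    and hess_measurable: "\<And>i j. (\<lambda>z. Hs z $ i $ j) \<in> borel_measurable borel"
    and hess_integrable: "\<And>i j. integrable M (\<lambda>\<omega>. Hs (Z 1 \<omega>) $ i $ j)"
    and V_eq: "\<And>i j. V $ i $ j = expectation (\<lambda>\<omega>. Hs (Z 1 \<omega>) $ i $ j)"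
    and V_sym: "\<And>i j. V $ i $ j = V $ j $ i" and V_inv: "invertible V"
    and expansion: "\<And>\<epsilon>. \<epsilon> > 0 \<Longrightarrow> \<exists>\<delta>>0. \<delta> \<le> r0 \<and> (\<exists>\<rho>\<in>borel_measurable borel. (\<forall>z. 0 \<le> \<rho> z) \<and>
        integrable M (\<lambda>\<omega>. \<rho> (Z 1 \<omega>)) \<and> expectation (\<lambda>\<omega>. \<rho> (Z 1 \<omega>)) \<le> \<epsilon> \<and>
        (AE \<omega> in M. \<forall>i\<ge>1. \<forall>h. norm h \<le> \<delta> \<longrightarrow>
          \<bar>m h (Z i \<omega>) - m 0 (Z i \<omega>) - \<psi> (Z i \<omega>) \<bullet> h - (h \<bullet> (Hs (Z i \<omega>) *v h)) / 2\<bar> \<le> \<rho> (Z i \<omega>) * (norm h)\<^sup>2))"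
    and maximum: "\<And>h. norm h \<le> r0 \<Longrightarrow> expectation (\<lambda>\<omega>. m h (Z 1 \<omega>)) \<le> expectation (\<lambda>\<omega>. m 0 (Z 1 \<omega>))"
begin

lemma psi_integrable: "integrable M (\<lambda>\<omega>. \<psi> (Z 1 \<omega>) $ j)"
  by (rule square_integrable_imp_integrable[OF _ psi_square])
    (rule measurable_compose[OF comp_measurable[OF psi_measurable order_refl] vec_component_measurable])

definition "psi_mean = (\<chi> j. expectation (\<lambda>\<omega>. \<psi> (Z 1 \<omega>) $ j))"

text \<open>Taking expectations in the expansion; the left-hand side cannot exceed the error because \<open>0\<close> is a
  maximum.\<close>

lemma population_expansion:
  assumes \<epsilon>: "\<epsilon> > 0"
  obtains \<delta> where "\<delta> > 0" "\<And>h. norm h \<le> \<delta> \<Longrightarrow> psi_mean \<bullet> h + (h \<bullet> (V *v h)) / 2 \<le> \<epsilon> * (norm h)\<^sup>2"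
proof -
  obtain \<delta> \<rho> where \<delta>: "\<delta> > 0" "\<delta> \<le> r0" and \<rho>: "integrable M (\<lambda>\<omega>. \<rho> (Z 1 \<omega>))" "expectation (\<lambda>\<omega>. \<rho> (Z 1 \<omega>)) \<le> \<epsilon>"
    and ae: "AE \<omega> in M. \<forall>i\<ge>1. \<forall>h. norm h \<le> \<delta> \<longrightarrow>
          \<bar>m h (Z i \<omega>) - m 0 (Z i \<omega>) - \<psi> (Z i \<omega>) \<bullet> h - (h \<bullet> (Hs (Z i \<omega>) *v h)) / 2\<bar> \<le> \<rho> (Z i \<omega>) * (norm h)\<^sup>2"
    using expansion[OF \<epsilon>] by blast
  show ?thesis
  proof (rule that[OF \<delta>(1)])
    fix h :: "real ^ 'n" assume h: "norm h \<le> \<delta>"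
    have inn: "\<psi> (Z 1 \<omega>) \<bullet> h = (\<Sum>j\<in>UNIV. \<psi> (Z 1 \<omega>) $ j * h $ j)" for \<omega> by (simp add: inner_vec_def)
    have hes: "h \<bullet> (Hs (Z 1 \<omega>) *v h) = (\<Sum>i\<in>UNIV. \<Sum>j\<in>UNIV. h $ i * (Hs (Z 1 \<omega>) $ i $ j * h $ j))" for \<omega>
      by (simp add: inner_vec_def matrix_vector_mult_def sum_distrib_left)
    have i1: "integrable M (\<lambda>\<omega>. \<psi> (Z 1 \<omega>) \<bullet> h)"
      unfolding inn by (intro Bochner_Integration.integrable_sum integrable_mult_left psi_integrable)
    have i2: "integrable M (\<lambda>\<omega>. h \<bullet> (Hs (Z 1 \<omega>) *v h))"
      unfolding hes by (intro Bochner_Integration.integrable_sum integrable_mult_right integrable_mult_left hess_integrable)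
    have e1: "expectation (\<lambda>\<omega>. \<psi> (Z 1 \<omega>) \<bullet> h) = psi_mean \<bullet> h"
      unfolding inn by (subst Bochner_Integration.integral_sum)
        (use psi_integrable in \<open>simp_all add: psi_mean_def inner_vec_def\<close>)
    have e2: "expectation (\<lambda>\<omega>. h \<bullet> (Hs (Z 1 \<omega>) *v h)) = h \<bullet> (V *v h)"
    proof -
      have "expectation (\<lambda>\<omega>. h \<bullet> (Hs (Z 1 \<omega>) *v h)) = (\<Sum>i\<in>UNIV. \<Sum>j\<in>UNIV. expectation (\<lambda>\<omega>. h $ i * (Hs (Z 1 \<omega>) $ i $ j * h $ j)))"
        unfolding hes using hess_integrable
        by (subst Bochner_Integration.integral_sum, intro Bochner_Integration.integrable_sum integrable_mult_right integrable_mult_left)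
          (auto intro!: sum.cong Bochner_Integration.integral_sum integrable_mult_right integrable_mult_left)
      also have "\<dots> = (\<Sum>i\<in>UNIV. \<Sum>j\<in>UNIV. h $ i * (V $ i $ j * h $ j))"
        unfolding V_eq by simp
      also have "\<dots> = h \<bullet> (V *v h)" by (simp add: inner_vec_def matrix_vector_mult_def sum_distrib_left)
      finally show ?thesis .
    qed
    have hr: "norm h \<le> r0" using h \<delta> by simp
    note ih = m_integrable[OF hr] and i0 = m_integrable[of 0, simplified, OF less_imp_le[OF r0]]
    have "expectation (\<lambda>\<omega>. \<psi> (Z 1 \<omega>) \<bullet> h + (h \<bullet> (Hs (Z 1 \<omega>) *v h)) / 2) \<le>
        expectation (\<lambda>\<omega>. (m h (Z 1 \<omega>) - m 0 (Z 1 \<omega>)) + \<rho> (Z 1 \<omega>) * (norm h)\<^sup>2)"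
    proof (rule integral_mono_AE)
      show "AE \<omega> in M. \<psi> (Z 1 \<omega>) \<bullet> h + (h \<bullet> (Hs (Z 1 \<omega>) *v h)) / 2 \<le> (m h (Z 1 \<omega>) - m 0 (Z 1 \<omega>)) + \<rho> (Z 1 \<omega>) * (norm h)\<^sup>2"
        using ae
      proof (rule AE_mp, intro AE_I2 impI)
        fix \<omega> assume "\<forall>i\<ge>1. \<forall>h. norm h \<le> \<delta> \<longrightarrow>
          \<bar>m h (Z i \<omega>) - m 0 (Z i \<omega>) - \<psi> (Z i \<omega>) \<bullet> h - (h \<bullet> (Hs (Z i \<omega>) *v h)) / 2\<bar> \<le> \<rho> (Z i \<omega>) * (norm h)\<^sup>2"
        then have "\<bar>m h (Z 1 \<omega>) - m 0 (Z 1 \<omega>) - \<psi> (Z 1 \<omega>) \<bullet> h - (h \<bullet> (Hs (Z 1 \<omega>) *v h)) / 2\<bar> \<le> \<rho> (Z 1 \<omega>) * (norm h)\<^sup>2"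
          using h by blast
        then show "\<psi> (Z 1 \<omega>) \<bullet> h + (h \<bullet> (Hs (Z 1 \<omega>) *v h)) / 2 \<le> (m h (Z 1 \<omega>) - m 0 (Z 1 \<omega>)) + \<rho> (Z 1 \<omega>) * (norm h)\<^sup>2"
          unfolding abs_le_iff by linarith
      qed
    qed (use i1 i2 ih i0 \<rho>(1) in simp_all)
    also have "\<dots> = (expectation (\<lambda>\<omega>. m h (Z 1 \<omega>)) - expectation (\<lambda>\<omega>. m 0 (Z 1 \<omega>))) + expectation (\<lambda>\<omega>. \<rho> (Z 1 \<omega>)) * (norm h)\<^sup>2"
      using ih i0 \<rho>(1) by simp
    also have "\<dots> \<le> 0 + \<epsilon> * (norm h)\<^sup>2"
      using maximum[OF hr] \<rho>(2) by (intro add_mono mult_right_mono) auto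
    also have "expectation (\<lambda>\<omega>. \<psi> (Z 1 \<omega>) \<bullet> h + (h \<bullet> (Hs (Z 1 \<omega>) *v h)) / 2) = psi_mean \<bullet> h + (h \<bullet> (V *v h)) / 2"
      using i1 i2 e1 e2 by simp
    finally show "psi_mean \<bullet> h + (h \<bullet> (V *v h)) / 2 \<le> \<epsilon> * (norm h)\<^sup>2" by simp
  qed
qed

text \<open>The first-order condition: otherwise a small step along the mean score would violate the expansion.\<close>

lemma population_score_zero: "expectation (\<lambda>\<omega>. \<psi> (Z 1 \<omega>) $ j) = 0"
proof -
  let ?a = psi_mean
  obtain \<delta> where \<delta>: "\<delta> > 0" and le: "\<And>h. norm h \<le> \<delta> \<Longrightarrow> ?a \<bullet> h + (h \<bullet> (V *v h)) / 2 \<le> 1 * (norm h)\<^sup>2"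
    by (rule population_expansion[OF zero_less_one]) blast
  have "?a = 0"
  proof (rule ccontr)
    assume ne: "?a \<noteq> 0"
    define K where "K = \<bar>?a \<bullet> (V *v ?a)\<bar> + (norm ?a)\<^sup>2"
    have K: "K > 0" using ne by (simp add: K_def add_nonneg_pos)
    define s where "s = min (\<delta> / norm ?a) ((norm ?a)\<^sup>2 / (2 * K))"
    have s: "s > 0" using \<delta> ne K by (simp add: s_def)
    have "norm (s *\<^sub>R ?a) = s * norm ?a" using s by simp
    also have "\<dots> \<le> (\<delta> / norm ?a) * norm ?a" using s by (intro mult_right_mono) (auto simp: s_def)
    finally have "norm (s *\<^sub>R ?a) \<le> \<delta>" using ne by simp
    from le[OF this] have "s * (?a \<bullet> ?a) + s\<^sup>2 * (?a \<bullet> (V *v ?a)) / 2 \<le> s\<^sup>2 * (norm ?a)\<^sup>2"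
      using s by (simp add: matrix_vector_mult_scaleR power2_eq_square mult_ac)
    then have "s * (?a \<bullet> ?a + s * (?a \<bullet> (V *v ?a)) / 2) \<le> s * (s * (norm ?a)\<^sup>2)"
      by (simp add: power2_eq_square algebra_simps)
    then have 1: "?a \<bullet> ?a + s * (?a \<bullet> (V *v ?a)) / 2 \<le> s * (norm ?a)\<^sup>2" using s by simp
    have "s * (- (?a \<bullet> (V *v ?a))) \<le> s * \<bar>?a \<bullet> (V *v ?a)\<bar>" using s by (intro mult_left_mono) auto
    moreover have "0 \<le> s * \<bar>?a \<bullet> (V *v ?a)\<bar>" using s by simp
    ultimately have "(norm ?a)\<^sup>2 \<le> s * \<bar>?a \<bullet> (V *v ?a)\<bar> + s * (norm ?a)\<^sup>2"
      using 1 unfolding power2_norm_eq_inner by linarith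
    also have "\<dots> = s * K" by (simp add: K_def algebra_simps)
    also have "\<dots> \<le> ((norm ?a)\<^sup>2 / (2 * K)) * K" using K by (intro mult_right_mono) (auto simp: s_def)
    also have "\<dots> = (norm ?a)\<^sup>2 / 2" using K by simp
    finally show False using ne by simp
  qed
  then show ?thesis by (simp add: psi_mean_def vec_eq_iff)
qed

text \<open>The second-order condition follows by scaling \<open>h\<close> to zero, and nonsingularity makes it strict.\<close>

lemma hessian_negative_definite: obtains c where "c > 0" "\<And>h. h \<bullet> (V *v h) \<le> - c * (norm h)\<^sup>2"
proof (rule nonsingular_semidefinite_imp_definite[OF V_sym V_inv])
  fix h :: "real ^ 'n"
  have a0: "psi_mean = 0" using population_score_zero by (simp add: psi_mean_def vec_eq_iff)
  show "h \<bullet> (V *v h) \<le> 0"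
  proof (rule field_le_epsilon)
    fix e :: real assume e: "e > 0"
    define N where "N = (norm h)\<^sup>2 + 1"
    define \<epsilon> where "\<epsilon> = e / (2 * N)"
    have n: "N > 0" by (simp add: N_def add_nonneg_pos)
    have \<epsilon>: "\<epsilon> > 0" using e n by (simp add: \<epsilon>_def)
    obtain \<delta> where \<delta>: "\<delta> > 0" and le: "\<And>h. norm h \<le> \<delta> \<Longrightarrow> psi_mean \<bullet> h + (h \<bullet> (V *v h)) / 2 \<le> \<epsilon> * (norm h)\<^sup>2"
      by (rule population_expansion[OF \<epsilon>]) blast
    define s where "s = \<delta> / (norm h + 1)"
    have h1: "norm h + 1 > 0" by (simp add: add_nonneg_pos)
    have s: "s > 0" using \<delta> h1 by (simp add: s_def)
    have "norm (s *\<^sub>R h) = s * norm h" using s by simp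
    also have "\<dots> \<le> s * (norm h + 1)" using s by simp
    also have "\<dots> = \<delta>" using h1 by (simp add: s_def)
    finally have "norm (s *\<^sub>R h) \<le> \<delta>" .
    from le[OF this] have "s\<^sup>2 * (h \<bullet> (V *v h)) \<le> s\<^sup>2 * (2 * (\<epsilon> * (norm h)\<^sup>2))"
      using s unfolding a0 by (simp add: matrix_vector_mult_scaleR power2_eq_square mult_ac)
    then have "h \<bullet> (V *v h) \<le> 2 * (\<epsilon> * (norm h)\<^sup>2)" using s by simp
    also have "\<dots> \<le> 2 * (\<epsilon> * N)" using \<epsilon> by (simp add: N_def)
    also have "\<dots> = e" using n by (simp add: \<epsilon>_def)
    finally show "h \<bullet> (V *v h) \<le> 0 + e" by simp
  qed
qed (use that in blast)

text \<open>The sample mean of these vectors is the vertex \<open>- V\<^sup>-\<^sup>1 S\<close> of the quadratic approximation.\<close>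

definition "influence z = - (matrix_inv V *v \<psi> z)"

lemma V_influence: "V *v influence z = - \<psi> z"
proof -
  have "V ** matrix_inv V = mat 1"
    using someI_ex[OF V_inv[unfolded invertible_def]] unfolding matrix_inv_def by blast
  then show ?thesis
    by (simp add: influence_def linear_neg[OF matrix_vector_mul_linear] matrix_vector_mul_assoc)
qed

lemma influence_measurable: "influence \<in> borel_measurable borel"
  unfolding influence_def[abs_def]
  by (intro borel_measurable_uminus measurable_compose[OF psi_measurable]
      borel_measurable_continuous_onI linear_continuous_on matrix_vector_mul_bounded_linear)

lemma influence_component: "influence z $ i = (\<Sum>j\<in>UNIV. (- matrix_inv V $ i $ j) * \<psi> z $ j)"
  by (simp add: influence_def matrix_vector_mult_def sum_negf)

lemma influence_mean: "expectation (\<lambda>\<omega>. influence (Z 1 \<omega>) $ i) = 0"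
  unfolding influence_component
  by (subst Bochner_Integration.integral_sum) (use psi_integrable population_score_zero in auto)

lemma influence_square: "integrable M (\<lambda>\<omega>. (influence (Z 1 \<omega>) $ i)\<^sup>2)"
proof -
  define t where "t = (\<chi> j. - matrix_inv V $ i $ j)"
  have "influence z $ i = t \<bullet> \<psi> z" for z by (simp add: influence_component t_def inner_vec_def)
  then show ?thesis using linear_functional_of_sample(1)[OF psi_measurable psi_square population_score_zero, of t] by simp
qed

text \<open>The law of large numbers replaces the mean of the Hessians by \<open>V\<close>, and Markov's inequality bounds
  the mean of the errors \<open>\<rho>\<close>.\<close>

lemma sample_expansion:
  assumes \<epsilon>: "\<epsilon> > 0" and e: "e > 0"
  obtains \<delta> where "\<delta> > 0" "\<delta> \<le> r0"
    "likely M e (\<lambda>n \<omega>. \<forall>h. norm h \<le> \<delta> \<longrightarrow> \<bar>sample_mean (m h) n \<omega> - sample_mean (m 0) n \<omega> - sample_mean \<psi> n \<omega> \<bullet> h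
      - (h \<bullet> (V *v h)) / 2\<bar> \<le> \<epsilon> * (norm h)\<^sup>2)"
proof -
  define b where "b = \<epsilon> / (real CARD('n))\<^sup>2"
  have b: "b > 0" using \<epsilon> by (simp add: b_def)
  define e1 where "e1 = e / (2 * (real CARD('n))\<^sup>2)"
  have e1: "e1 > 0" using e by (simp add: e1_def)
  have c2: "real (card (UNIV :: ('n \<times> 'n) set)) = (real CARD('n))\<^sup>2" by (simp add: power2_eq_square flip: UNIV_Times_UNIV)
  have "likely M (real (card (UNIV :: ('n \<times> 'n) set)) * e1) (\<lambda>n \<omega>. \<forall>ij\<in>UNIV. \<bar>sample_mean (\<lambda>z. Hs z $ fst ij $ snd ij) n \<omega> -
      expectation (\<lambda>\<omega>. Hs (Z 1 \<omega>) $ fst ij $ snd ij)\<bar> \<le> b)"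
    by (rule likely_finite[OF finite weak_law_of_large_numbers[OF hess_measurable hess_integrable b e1] less_imp_le[OF e1]])
  then have LV: "likely M (e / 2) (\<lambda>n \<omega>. \<forall>ij\<in>UNIV. \<bar>sample_mean (\<lambda>z. Hs z $ fst ij $ snd ij) n \<omega> -
      expectation (\<lambda>\<omega>. Hs (Z 1 \<omega>) $ fst ij $ snd ij)\<bar> \<le> b)"
    unfolding c2 by (simp add: e1_def)
  define \<epsilon>1 where "\<epsilon>1 = (\<epsilon> / 2) * (e / 2)"
  have \<epsilon>1: "\<epsilon>1 > 0" using \<epsilon> e by (simp add: \<epsilon>1_def)
  obtain \<delta> \<rho> where \<delta>: "\<delta> > 0" "\<delta> \<le> r0" and \<rho>: "\<rho> \<in> borel_measurable borel" "\<And>z. 0 \<le> \<rho> z"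
     "integrable M (\<lambda>\<omega>. \<rho> (Z 1 \<omega>))" "expectation (\<lambda>\<omega>. \<rho> (Z 1 \<omega>)) \<le> \<epsilon>1"
    and ae: "AE \<omega> in M. \<forall>i\<ge>1. \<forall>h. norm h \<le> \<delta> \<longrightarrow>
          \<bar>m h (Z i \<omega>) - m 0 (Z i \<omega>) - \<psi> (Z i \<omega>) \<bullet> h - (h \<bullet> (Hs (Z i \<omega>) *v h)) / 2\<bar> \<le> \<rho> (Z i \<omega>) * (norm h)\<^sup>2"
    using expansion[OF \<epsilon>1] by blast
  have "likely M (\<epsilon>1 / (\<epsilon> / 2)) (\<lambda>n \<omega>. sample_mean \<rho> n \<omega> \<le> \<epsilon> / 2)"
  proof (rule likely_markov[OF eventually_sequentiallyI[of 1]], intro conjI)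
    fix n :: nat assume n: "1 \<le> n"
    show "integrable M (sample_mean \<rho> n)" by (rule sample_mean_integrable(1)[OF \<rho>(1,3)])
    show "AE \<omega> in M. 0 \<le> sample_mean \<rho> n \<omega>" unfolding sample_mean_def by (intro AE_I2) (simp add: sum_nonneg \<rho>(2))
    show "expectation (sample_mean \<rho> n) \<le> \<epsilon>1" unfolding sample_mean_integrable(2)[OF \<rho>(1,3) n] by (rule \<rho>(4))
  qed (use \<epsilon> in simp)
  then have LR: "likely M (e / 2) (\<lambda>n \<omega>. sample_mean \<rho> n \<omega> \<le> \<epsilon> / 2)" using \<epsilon> by (simp add: \<epsilon>1_def)
  have "AE \<omega> in M. \<forall>n::nat. \<forall>i\<ge>1. \<forall>h. norm h \<le> \<delta> \<longrightarrow>
          \<bar>m h (Z i \<omega>) - m 0 (Z i \<omega>) - \<psi> (Z i \<omega>) \<bullet> h - (h \<bullet> (Hs (Z i \<omega>) *v h)) / 2\<bar> \<le> \<rho> (Z i \<omega>) * (norm h)\<^sup>2"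
    using ae by simp
  note LA = likely_AE[OF this order_refl]
  show ?thesis
  proof (rule that[OF \<delta>], rule likely_mono[OF likely_conj[OF likely_conj[OF LV LR] LA]])
    show "\<forall>\<^sub>F n in sequentially. \<forall>\<omega>\<in>space M.
        ((\<forall>ij\<in>UNIV. \<bar>sample_mean (\<lambda>z. Hs z $ fst ij $ snd ij) n \<omega> - expectation (\<lambda>\<omega>. Hs (Z 1 \<omega>) $ fst ij $ snd ij)\<bar> \<le> b) \<and>
          sample_mean \<rho> n \<omega> \<le> \<epsilon> / 2) \<and>
        (\<forall>i\<ge>1. \<forall>h. norm h \<le> \<delta> \<longrightarrow>
          \<bar>m h (Z i \<omega>) - m 0 (Z i \<omega>) - \<psi> (Z i \<omega>) \<bullet> h - (h \<bullet> (Hs (Z i \<omega>) *v h)) / 2\<bar> \<le> \<rho> (Z i \<omega>) * (norm h)\<^sup>2) \<longrightarrow>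
        (\<forall>h. norm h \<le> \<delta> \<longrightarrow> \<bar>sample_mean (m h) n \<omega> - sample_mean (m 0) n \<omega> - sample_mean \<psi> n \<omega> \<bullet> h
          - (h \<bullet> (V *v h)) / 2\<bar> \<le> \<epsilon> * (norm h)\<^sup>2)"
    proof (intro always_eventually allI ballI impI, elim conjE)
      fix n \<omega> and h :: "real ^ 'n"
      assume V: "\<forall>ij\<in>UNIV. \<bar>sample_mean (\<lambda>z. Hs z $ fst ij $ snd ij) n \<omega> - expectation (\<lambda>\<omega>. Hs (Z 1 \<omega>) $ fst ij $ snd ij)\<bar> \<le> b"
        and R: "sample_mean \<rho> n \<omega> \<le> \<epsilon> / 2" and h: "norm h \<le> \<delta>"
        and A: "\<forall>i\<ge>1. \<forall>h. norm h \<le> \<delta> \<longrightarrow>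
          \<bar>m h (Z i \<omega>) - m 0 (Z i \<omega>) - \<psi> (Z i \<omega>) \<bullet> h - (h \<bullet> (Hs (Z i \<omega>) *v h)) / 2\<bar> \<le> \<rho> (Z i \<omega>) * (norm h)\<^sup>2"
      define Vn where "Vn = sample_mean Hs n \<omega>"
      let ?q = "\<lambda>z. m h z - m 0 z - \<psi> z \<bullet> h - (h \<bullet> (Hs z *v h)) / 2"
      have lin: "linear (\<lambda>A :: real ^ 'n ^ 'n. (h \<bullet> (A *v h)) / 2)"
        by (rule linearI) (simp_all add: matrix_vector_mult_add_rdistrib inner_add_right scaleR_matrix_vector_assoc[symmetric] add_divide_distrib)
      have lin2: "linear (\<lambda>x. x \<bullet> h)" by (simp add: bounded_linear.linear bounded_linear_inner_left)
      have "sample_mean (m h) n \<omega> - sample_mean (m 0) n \<omega> - sample_mean \<psi> n \<omega> \<bullet> h - (h \<bullet> (Vn *v h)) / 2 = sample_mean ?q n \<omega>"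
        unfolding Vn_def sample_mean_linear[OF lin] sample_mean_linear[OF lin2]
        by (simp add: sample_mean_def sum_subtractf diff_divide_distrib)
      also have "\<bar>\<dots>\<bar> \<le> sample_mean (\<lambda>z. \<bar>?q z\<bar>) n \<omega>"
        unfolding sample_mean_def by (auto simp: abs_mult intro!: divide_right_mono sum_abs)
      also have "\<dots> \<le> sample_mean (\<lambda>z. \<rho> z * (norm h)\<^sup>2) n \<omega>" by (rule sample_mean_mono) (use A h in blast)
      also have "\<dots> = sample_mean \<rho> n \<omega> * (norm h)\<^sup>2" by (simp add: sample_mean_def sum_distrib_right)
      also have "\<dots> \<le> (\<epsilon> / 2) * (norm h)\<^sup>2" using R by (intro mult_right_mono) auto
      finally have 1: "\<bar>sample_mean (m h) n \<omega> - sample_mean (m 0) n \<omega> - sample_mean \<psi> n \<omega> \<bullet> h - (h \<bullet> (Vn *v h)) / 2\<bar>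
          \<le> (\<epsilon> / 2) * (norm h)\<^sup>2" .
      have "\<bar>(Vn - V) $ i $ j\<bar> \<le> b" for i j
        using V[THEN bspec[of _ _ "(i, j)"]] unfolding V_eq by (simp add: Vn_def V_eq sample_mean_def)
      from quadratic_form_entry_bound[of "Vn - V" b h, OF this]
      have "\<bar>h \<bullet> ((Vn - V) *v h)\<bar> \<le> \<epsilon> * (norm h)\<^sup>2" by (simp add: b_def)
      then have "\<bar>h \<bullet> (Vn *v h) - h \<bullet> (V *v h)\<bar> \<le> \<epsilon> * (norm h)\<^sup>2"
        by (simp add: matrix_vector_mult_diff_rdistrib inner_diff_right)
      then show "\<bar>sample_mean (m h) n \<omega> - sample_mean (m 0) n \<omega> - sample_mean \<psi> n \<omega> \<bullet> h - (h \<bullet> (V *v h)) / 2\<bar> \<le> \<epsilon> * (norm h)\<^sup>2"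
        using 1 unfolding abs_le_iff by linarith
    qed
  qed simp
qed

text \<open>The vertex of the quadratic approximation is of order \<open>1 / sqrt n\<close>, so it lies in the ball where the
  expansion holds and competes with \<open>q n\<close>.\<close>

theorem near_maximizers_asymptotically_linear:
  fixes q :: "nat \<Rightarrow> 'w \<Rightarrow> real ^ 'n"
  assumes consistent: "\<And>\<kappa> e. \<kappa> > 0 \<Longrightarrow> e > 0 \<Longrightarrow> likely M e (\<lambda>n \<omega>. norm (q n \<omega>) \<le> \<kappa>)"
    and near: "\<And>\<kappa> e. \<kappa> > 0 \<Longrightarrow> e > 0 \<Longrightarrow> likely M e (\<lambda>n \<omega>. \<forall>h. norm h \<le> r0 \<longrightarrow>
        sample_mean (m h) n \<omega> \<le> sample_mean (m (q n \<omega>)) n \<omega> + \<kappa> / real n)"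
    and \<kappa>: "\<kappa> > 0" and e: "e > 0"
  shows "likely M e (\<lambda>n \<omega>. norm (sqrt (real n) *\<^sub>R q n \<omega> - sqrt (real n) *\<^sub>R sample_mean influence n \<omega>) \<le> \<kappa>)"
proof -
  obtain c where c: "c > 0" "\<And>h. h \<bullet> (V *v h) \<le> - c * (norm h)\<^sup>2" by (rule hessian_negative_definite) blast
  have e4: "e / 4 > 0" using e by simp
  obtain R0 where R0: "likely M (e / 4) (\<lambda>n \<omega>. norm (sqrt (real n) *\<^sub>R sample_mean influence n \<omega>) \<le> R0)"
    using normalized_sum_tight[OF influence_measurable influence_square influence_mean e4] by blast
  define R where "R = max R0 1"
  \<comment> \<open>With these constants \<open>n\<close> times the bound for the quadratic is at most \<open>(c / 4) * \<kappa>\<^sup>2\<close>.\<close>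
  define \<epsilon> where "\<epsilon> = min (c / 8) (c * \<kappa>\<^sup>2 / (24 * R\<^sup>2))"
  define \<kappa>1 where "\<kappa>1 = c * \<kappa>\<^sup>2 / 8"
  have R: "R \<ge> 1" "R0 \<le> R" by (auto simp: R_def)
  have \<epsilon>: "\<epsilon> > 0" "8 * \<epsilon> \<le> c" "3 * \<epsilon> * R\<^sup>2 \<le> c * \<kappa>\<^sup>2 / 8"
  proof -
    have R2: "R\<^sup>2 > 0" using R by simp
    show "\<epsilon> > 0" "8 * \<epsilon> \<le> c" using c \<kappa> R2 by (auto simp: \<epsilon>_def)
    have "3 * \<epsilon> * R\<^sup>2 \<le> 3 * (c * \<kappa>\<^sup>2 / (24 * R\<^sup>2)) * R\<^sup>2" using R2 by (intro mult_right_mono mult_left_mono) (auto simp: \<epsilon>_def)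
    also have "\<dots> = c * \<kappa>\<^sup>2 / 8" using R2 by (simp add: field_simps)
    finally show "3 * \<epsilon> * R\<^sup>2 \<le> c * \<kappa>\<^sup>2 / 8" .
  qed
  have \<kappa>1: "\<kappa>1 > 0" using c \<kappa> by (simp add: \<kappa>1_def)
  obtain \<delta> where \<delta>: "\<delta> > 0" "\<delta> \<le> r0" and
    LE: "likely M (e / 4) (\<lambda>n \<omega>. \<forall>h. norm h \<le> \<delta> \<longrightarrow> \<bar>sample_mean (m h) n \<omega> - sample_mean (m 0) n \<omega> - sample_mean \<psi> n \<omega> \<bullet> h
      - (h \<bullet> (V *v h)) / 2\<bar> \<le> \<epsilon> * (norm h)\<^sup>2)"
    by (rule sample_expansion[OF \<epsilon>(1) e4]) blast
  have "(\<lambda>n. R\<^sup>2 / real n) \<longlonglongrightarrow> 0" by (rule lim_const_over_n)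
  then have small: "\<forall>\<^sub>F n in sequentially. R\<^sup>2 / real n < \<delta>\<^sup>2" using \<delta> by (intro order_tendstoD(2)) auto
  show ?thesis
  proof (rule likely_mono[OF likely_conj[OF likely_conj[OF R0 LE] likely_conj[OF consistent[OF \<delta>(1) e4] near[OF \<kappa>1 e4]]]])
    show "\<forall>\<^sub>F n in sequentially. \<forall>\<omega>\<in>space M.
      (norm (sqrt (real n) *\<^sub>R sample_mean influence n \<omega>) \<le> R0 \<and>
       (\<forall>h. norm h \<le> \<delta> \<longrightarrow> \<bar>sample_mean (m h) n \<omega> - sample_mean (m 0) n \<omega> - sample_mean \<psi> n \<omega> \<bullet> h
          - (h \<bullet> (V *v h)) / 2\<bar> \<le> \<epsilon> * (norm h)\<^sup>2)) \<and>
      norm (q n \<omega>) \<le> \<delta> \<and>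
      (\<forall>h. norm h \<le> r0 \<longrightarrow> sample_mean (m h) n \<omega> \<le> sample_mean (m (q n \<omega>)) n \<omega> + \<kappa>1 / real n) \<longrightarrow>
      norm (sqrt (real n) *\<^sub>R q n \<omega> - sqrt (real n) *\<^sub>R sample_mean influence n \<omega>) \<le> \<kappa>"
      using small eventually_gt_at_top[of 0]
    proof (eventually_elim, intro ballI impI, elim conjE)
      fix n :: nat and \<omega>
      assume sm: "R\<^sup>2 / real n < \<delta>\<^sup>2" and n: "0 < n"
        and t: "norm (sqrt (real n) *\<^sub>R sample_mean influence n \<omega>) \<le> R0"
        and ex: "\<forall>h. norm h \<le> \<delta> \<longrightarrow> \<bar>sample_mean (m h) n \<omega> - sample_mean (m 0) n \<omega> - sample_mean \<psi> n \<omega> \<bullet> h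
          - (h \<bullet> (V *v h)) / 2\<bar> \<le> \<epsilon> * (norm h)\<^sup>2"
        and qd: "norm (q n \<omega>) \<le> \<delta>"
        and mx: "\<forall>h. norm h \<le> r0 \<longrightarrow> sample_mean (m h) n \<omega> \<le> sample_mean (m (q n \<omega>)) n \<omega> + \<kappa>1 / real n"
      define k where "k = sample_mean influence n \<omega>"
      have "(sqrt (real n) * norm k)\<^sup>2 \<le> R\<^sup>2" using t R unfolding k_def by (intro power_mono) auto
      then have nk: "real n * (norm k)\<^sup>2 \<le> R\<^sup>2" by (simp add: power_mult_distrib)
      then have "(norm k)\<^sup>2 \<le> R\<^sup>2 / real n" using n by (simp add: field_simps)
      then have "(norm k)\<^sup>2 < \<delta>\<^sup>2" using sm by linarith
      then have k\<delta>: "norm k \<le> \<delta>" using \<delta> by (meson less_imp_le power2_less_imp_less)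
      have Vk: "V *v k = - sample_mean \<psi> n \<omega>"
      proof -
        have "linear (\<lambda>x. V *v x)" by (rule matrix_vector_mul_linear)
        then have "V *v k = sample_mean (\<lambda>z. V *v influence z) n \<omega>" unfolding k_def by (rule sample_mean_linear)
        then show ?thesis by (simp add: V_influence sample_mean_def sum_negf)
      qed
      have "sample_mean (m k) n \<omega> \<le> sample_mean (m (q n \<omega>)) n \<omega> + \<kappa>1 / real n"
        using mx k\<delta> \<delta>(2) by (meson order_trans)
      from near_maximizer_of_quadratic[where m = "\<lambda>h. sample_mean (m h) n \<omega>", OF V_sym c(2) Vk ex[rule_format] qd k\<delta> this less_imp_le[OF \<epsilon>(1)] \<epsilon>(2)]
      have "(c / 4) * (norm (q n \<omega> - k))\<^sup>2 \<le> 3 * \<epsilon> * (norm k)\<^sup>2 + \<kappa>1 / real n" by simp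
      then have "real n * ((c / 4) * (norm (q n \<omega> - k))\<^sup>2) \<le> real n * (3 * \<epsilon> * (norm k)\<^sup>2 + \<kappa>1 / real n)"
        by (rule mult_left_mono) simp
      also have "\<dots> = 3 * \<epsilon> * (real n * (norm k)\<^sup>2) + \<kappa>1" using n by (simp add: algebra_simps)
      also have "\<dots> \<le> 3 * \<epsilon> * R\<^sup>2 + \<kappa>1" using nk \<epsilon>(1) by (intro add_right_mono mult_left_mono) auto
      also have "\<dots> \<le> (c / 4) * \<kappa>\<^sup>2" using \<epsilon>(3) by (simp add: \<kappa>1_def)
      finally have "(c / 4) * (real n * (norm (q n \<omega> - k))\<^sup>2) \<le> (c / 4) * \<kappa>\<^sup>2" by (simp add: mult_ac)
      then have "real n * (norm (q n \<omega> - k))\<^sup>2 \<le> \<kappa>\<^sup>2" using c by simp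
      then have "(norm (sqrt (real n) *\<^sub>R (q n \<omega> - k)))\<^sup>2 \<le> \<kappa>\<^sup>2" by (simp add: power_mult_distrib)
      then have "norm (sqrt (real n) *\<^sub>R (q n \<omega> - k)) \<le> \<kappa>" by (rule power2_le_imp_le) (use \<kappa> in simp)
      then show "norm (sqrt (real n) *\<^sub>R q n \<omega> - sqrt (real n) *\<^sub>R sample_mean influence n \<omega>) \<le> \<kappa>"
        by (simp add: k_def scaleR_diff_right)
    qed
  qed simp
qed

corollary near_maximizers_asymptotically_normal:
  "\<exists>C \<mu>. multivariate_normal 0 C \<mu> \<and> (\<forall>q. (\<forall>n\<ge>1. q n \<in> borel_measurable M) \<longrightarrow>
    (\<forall>\<kappa>>0. \<forall>e>0. likely M e (\<lambda>n \<omega>. norm (q n \<omega>) \<le> \<kappa>)) \<longrightarrow>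
    (\<forall>\<kappa>>0. \<forall>e>0. likely M e (\<lambda>n \<omega>. \<forall>h. norm h \<le> r0 \<longrightarrow>
        sample_mean (m h) n \<omega> \<le> sample_mean (m (q n \<omega>)) n \<omega> + \<kappa> / real n)) \<longrightarrow>
    converges_in_distribution M (\<lambda>n \<omega>. sqrt (real n) *\<^sub>R q n \<omega>) \<mu>)"
proof -
  obtain C \<mu> where \<mu>: "multivariate_normal 0 C \<mu>" and conv: "\<forall>X. (\<forall>n\<ge>1. X n \<in> borel_measurable M) \<longrightarrow>
    (\<forall>\<kappa>>0. \<forall>e>0. likely M e (\<lambda>n \<omega>. norm (X n \<omega> - sqrt (real n) *\<^sub>R sample_mean influence n \<omega>) \<le> \<kappa>)) \<longrightarrow>
    converges_in_distribution M X \<mu>"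
    using central_limit_theorem_multivariate[OF influence_measurable influence_square influence_mean] by blast
  show ?thesis
  proof (rule exI[of _ C], rule exI[of _ \<mu>], rule conjI[OF \<mu>], intro allI impI)
    fix q :: "nat \<Rightarrow> 'w \<Rightarrow> real ^ 'n"
    assume q: "\<forall>n\<ge>1. q n \<in> borel_measurable M"
      and c: "\<forall>\<kappa>>0. \<forall>e>0. likely M e (\<lambda>n \<omega>. norm (q n \<omega>) \<le> \<kappa>)"
      and near: "\<forall>\<kappa>>0. \<forall>e>0. likely M e (\<lambda>n \<omega>. \<forall>h. norm h \<le> r0 \<longrightarrow>
        sample_mean (m h) n \<omega> \<le> sample_mean (m (q n \<omega>)) n \<omega> + \<kappa> / real n)"
    show "converges_in_distribution M (\<lambda>n \<omega>. sqrt (real n) *\<^sub>R q n \<omega>) \<mu>"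
    proof (rule conv[rule_format])
      show "(\<lambda>\<omega>. sqrt (real n) *\<^sub>R q n \<omega>) \<in> borel_measurable M" if "1 \<le> n" for n
        using q that by (intro borel_measurable_scaleR borel_measurable_const) auto
      show "likely M e (\<lambda>n \<omega>. norm (sqrt (real n) *\<^sub>R q n \<omega> - sqrt (real n) *\<^sub>R sample_mean influence n \<omega>) \<le> \<kappa>)"
        if "\<kappa> > 0" "e > 0" for \<kappa> e
        by (rule near_maximizers_asymptotically_linear[OF _ _ that]) (use c near in blast)+
    qed
  qed
qed

end

section \<open>Coordinates and comparability of the loss\<close>

lemma param_unit_expand:
  fixes p :: "'d::finite param"
  shows "(\<Sum>k\<in>UNIV. (p \<bullet> param_unit k) *\<^sub>R param_unit k) = p"
proof -
  have two: "(UNIV :: 2 set) = {0, 1}"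
  proof -
    have "x = 0 \<or> x = 1" for x :: 2 using exhaust_2[of x] by auto
    then show ?thesis by auto
  qed
  have U: "(UNIV :: ('d + 2) set) = UNIV <+> UNIV" by simp
  have l: "(p \<bullet> param_unit (Inl i)) *\<^sub>R param_unit (Inl i) = ((fst p $ i) *\<^sub>R axis i 1, 0, 0 :: real)" for i :: 'd
    by (cases p) (simp add: param_unit_def inner_axis inner_prod_def)
  have s: "(\<Sum>i\<in>UNIV. ((fst p $ i) *\<^sub>R axis i 1, 0 :: real, 0 :: real)) = (fst p, 0, 0)"
  proof -
    have "(\<Sum>i\<in>UNIV. (fst p $ i) *\<^sub>R axis i 1) = fst p"
      by (simp add: vec_eq_iff axis_def if_distrib sum.delta cong: if_cong)
    then show ?thesis by (simp add: sum_prod)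
  qed
  have "(\<Sum>k\<in>UNIV. (p \<bullet> param_unit k) *\<^sub>R param_unit k) =
      (\<Sum>i\<in>UNIV. (p \<bullet> param_unit (Inl i)) *\<^sub>R param_unit (Inl i)) + (\<Sum>j\<in>UNIV. (p \<bullet> param_unit (Inr j)) *\<^sub>R param_unit (Inr j))"
    unfolding U by (subst sum.Plus) auto
  also have "\<dots> = p"
    unfolding l s two by (cases p) (simp add: param_unit_def inner_prod_def)
  finally show ?thesis .
qed

lemma norm_param_coord: "norm (param_coord p) = norm p"
proof -
  have "p \<bullet> p = (\<Sum>k\<in>UNIV. (p \<bullet> param_unit k) *\<^sub>R param_unit k) \<bullet> p" unfolding param_unit_expand ..
  also have "\<dots> = param_coord p \<bullet> param_coord p"
    by (simp only: inner_sum_left inner_scaleR_left inner_vec_def param_coord_def vec_lambda_beta inner_real_def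
        inner_commute[of "param_unit _" p])
  finally show ?thesis by (simp add: norm_eq_sqrt_inner)
qed

text \<open>The inverse of \<open>param_coord\<close>.\<close>

definition of_coord :: "real ^ ('d + 2) \<Rightarrow> 'd::finite param" where
  "of_coord h = (\<Sum>k\<in>UNIV. h $ k *\<^sub>R param_unit k)"

lemma of_coord_param_coord: "of_coord (param_coord p) = p"
  unfolding of_coord_def param_coord_def vec_lambda_beta by (rule param_unit_expand)

lemma linear_of_coord: "linear of_coord"
  by (rule linearI) (simp_all add: of_coord_def scaleR_add_left sum.distrib scaleR_sum_right)

lemma linear_param_coord: "linear param_coord"
  by (rule linearI) (simp_all add: param_coord_def vec_eq_iff inner_add_left)

lemma param_unit_orthonormal: "param_unit k \<bullet> param_unit l = (if k = l then 1 else 0)"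
proof -
  have two: "x = 0 \<or> x = 1" for x :: 2 using exhaust_2[of x] by auto
  show ?thesis
  proof (cases k)
    case (Inl i)
    then show ?thesis by (cases l) (simp_all add: param_unit_def inner_axis_axis inner_prod_def)
  next
    case (Inr i)
    then show ?thesis
      using two[of i] by (cases l; use two[of "projr l"] in \<open>auto simp: param_unit_def inner_prod_def\<close>)
  qed
qed

lemma param_coord_of_coord: "param_coord (of_coord h) = h"
  by (simp add: vec_eq_iff param_coord_def of_coord_def inner_sum_left param_unit_orthonormal if_distrib
      sum.delta cong: if_cong)

lemma norm_of_coord: "norm (of_coord h) = norm h"
  using norm_param_coord[of "of_coord h"] by (simp add: param_coord_of_coord)

lemma ennreal_inverse_le_inverse:
  fixes a b :: ennreal
  assumes "a \<le> b" shows "inverse b \<le> inverse a"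
proof (cases "a = 0 \<or> b = top")
  case False
  then obtain s where s: "b = ennreal s" "0 \<le> s" by (cases b) auto
  have "a < top" using assms False by (simp add: s order_le_less_trans)
  then obtain r where r: "a = ennreal r" "0 \<le> r" by (cases a) auto
  have "0 < r" "r \<le> s" using False assms r s by (auto simp: less_le)
  then show ?thesis by (simp add: r s inverse_ennreal ennreal_leI le_imp_inverse_le)
qed auto

text \<open>The positive limit inferior is the constant \<open>d\<close>; the quotient of infimum and supremum bounds the
  quotient for any two points.\<close>

lemma tail_comparable_far:
  assumes tc: "tail_comparable h" and \<Lambda>: "compact \<Lambda>"
  obtains b d where "d > 0" "\<And>y x x'. b \<le> \<bar>y\<bar> \<Longrightarrow> x \<in> \<Lambda> \<Longrightarrow> x' \<in> \<Lambda> \<Longrightarrow> d * \<bar>h (y, x)\<bar> \<le> 1 + \<bar>h (y, x')\<bar>"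
proof -
  let ?q = "\<lambda>y::real. (1 + (INF x\<in>\<Lambda>. ennreal \<bar>h (y, x)\<bar>)) / (SUP x\<in>\<Lambda>. ennreal \<bar>h (y, x)\<bar>)"
  have pos: "Liminf at_infinity ?q > 0" using tc \<Lambda> unfolding tail_comparable_def by blast
  then obtain e where e: "0 < e" "e < Liminf at_infinity ?q" using dense by blast
  have "e < top" by (intro order_less_le_trans[OF e(2) top_greatest])
  then obtain d where d: "e = ennreal d" "d \<ge> 0" by (cases e) auto
  have d0: "d > 0" using e(1) d by simp
  have "\<forall>\<^sub>F y in at_infinity. e < ?q y" by (rule less_LiminfD[OF e(2)])
  then obtain b where b: "\<And>y. b \<le> norm y \<Longrightarrow> e < ?q y" unfolding eventually_at_infinity by blast
  show ?thesis
  proof (rule that[OF d0])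
    fix y x x' assume y: "b \<le> \<bar>y\<bar>" and x: "x \<in> \<Lambda>" "x' \<in> \<Lambda>"
    show "d * \<bar>h (y, x)\<bar> \<le> 1 + \<bar>h (y, x')\<bar>"
    proof (cases "h (y, x) = 0")
      case False
      then have hp: "0 < \<bar>h (y, x)\<bar>" by simp
      have "?q y \<le> (1 + ennreal \<bar>h (y, x')\<bar>) / ennreal \<bar>h (y, x)\<bar>"
        unfolding divide_ennreal_def
        by (intro mult_mono add_mono INF_lower x ennreal_inverse_le_inverse SUP_upper) auto
      also have "\<dots> = ennreal ((1 + \<bar>h (y, x')\<bar>) / \<bar>h (y, x)\<bar>)"
        using hp by (simp add: divide_ennreal ennreal_plus[symmetric] flip: ennreal_1 del: ennreal_plus)
      finally have "ennreal d < ennreal ((1 + \<bar>h (y, x')\<bar>) / \<bar>h (y, x)\<bar>)" using b[of y] y d by simp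
      then have "d < (1 + \<bar>h (y, x')\<bar>) / \<bar>h (y, x)\<bar>" using d0 by (simp add: ennreal_less_iff)
      then show ?thesis using hp by (simp add: less_divide_eq)
    qed simp
  qed
qed

lemma bounded_on_compact_strip:
  fixes h :: "real \<times> real \<Rightarrow> real"
  assumes h: "continuous_on UNIV h" and \<Lambda>: "compact \<Lambda>"
  obtains B where "B \<ge> 0" "\<And>y x. \<bar>y\<bar> \<le> b \<Longrightarrow> x \<in> \<Lambda> \<Longrightarrow> \<bar>h (y, x)\<bar> \<le> B"
proof -
  have "bounded (h ` (cball 0 b \<times> \<Lambda>))"
    by (intro compact_imp_bounded compact_continuous_image continuous_on_subset[OF h] compact_Times \<Lambda>) auto
  then obtain B where "B > 0" "\<And>x. x \<in> cball 0 b \<times> \<Lambda> \<Longrightarrow> \<bar>h x\<bar> \<le> B" unfolding bounded_pos by auto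
  then show ?thesis by (intro that[of B]) auto
qed

text \<open>The form in which the tail condition is used: moments at one path control moments at all paths with
  values in a compact set.  It also covers bounded outcomes, with \<open>S\<close> an interval.\<close>

definition comparable_on :: "real set \<Rightarrow> (real \<times> real \<Rightarrow> real) \<Rightarrow> bool" where
  "comparable_on S h \<longleftrightarrow> (\<forall>\<Lambda>. compact \<Lambda> \<longrightarrow> (\<exists>C\<ge>0. \<forall>y\<in>S. \<forall>x\<in>\<Lambda>. \<forall>x'\<in>\<Lambda>. \<bar>h (y, x)\<bar> \<le> C * (1 + \<bar>h (y, x')\<bar>)))"

lemma comparable_on_bounded:
  assumes h: "continuous_on UNIV h"
  shows "comparable_on {y. \<bar>y\<bar> \<le> b} h"
  unfolding comparable_on_def
proof (intro allI impI)
  fix \<Lambda> :: "real set" assume \<Lambda>: "compact \<Lambda>"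
  obtain B where B: "B \<ge> 0" "\<And>y x. \<bar>y\<bar> \<le> b \<Longrightarrow> x \<in> \<Lambda> \<Longrightarrow> \<bar>h (y, x)\<bar> \<le> B"
    by (rule bounded_on_compact_strip[OF h \<Lambda>, where b = b]) blast
  show "\<exists>C\<ge>0. \<forall>y\<in>{y. \<bar>y\<bar> \<le> b}. \<forall>x\<in>\<Lambda>. \<forall>x'\<in>\<Lambda>. \<bar>h (y, x)\<bar> \<le> C * (1 + \<bar>h (y, x')\<bar>)"
  proof (intro exI[of _ B] conjI ballI B)
    fix y x x' assume *: "y \<in> {y. \<bar>y\<bar> \<le> b}" "x \<in> \<Lambda>"
    then have "\<bar>h (y, x)\<bar> \<le> B * 1" using B(2) by simp
    also have "\<dots> \<le> B * (1 + \<bar>h (y, x')\<bar>)" using B(1) by (intro mult_left_mono) auto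
    finally show "\<bar>h (y, x)\<bar> \<le> B * (1 + \<bar>h (y, x')\<bar>)" .
  qed
qed

lemma comparable_on_tail:
  assumes h: "continuous_on UNIV h" and tc: "tail_comparable h"
  shows "comparable_on UNIV h"
  unfolding comparable_on_def
proof (intro allI impI)
  fix \<Lambda> :: "real set" assume \<Lambda>: "compact \<Lambda>"
  obtain b d where d: "d > 0" and far: "\<And>y x x'. b \<le> \<bar>y\<bar> \<Longrightarrow> x \<in> \<Lambda> \<Longrightarrow> x' \<in> \<Lambda> \<Longrightarrow> d * \<bar>h (y, x)\<bar> \<le> 1 + \<bar>h (y, x')\<bar>"
    by (rule tail_comparable_far[OF tc \<Lambda>]) blast
  obtain C where C0: "C \<ge> 0" and C1: "\<forall>y\<in>{y. \<bar>y\<bar> \<le> b}. \<forall>x\<in>\<Lambda>. \<forall>x'\<in>\<Lambda>. \<bar>h (y, x)\<bar> \<le> C * (1 + \<bar>h (y, x')\<bar>)"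
    using comparable_on_bounded[OF h, of b] \<Lambda> unfolding comparable_on_def by blast
  have C: "C \<ge> 0" "\<bar>h (y, x)\<bar> \<le> C * (1 + \<bar>h (y, x')\<bar>)" if "\<bar>y\<bar> \<le> b" "x \<in> \<Lambda>" "x' \<in> \<Lambda>" for y x x'
    using C0 C1 that by simp_all
  show "\<exists>C\<ge>0. \<forall>y\<in>UNIV. \<forall>x\<in>\<Lambda>. \<forall>x'\<in>\<Lambda>. \<bar>h (y, x)\<bar> \<le> C * (1 + \<bar>h (y, x')\<bar>)"
  proof (intro exI[of _ "C + 1 / d"] conjI ballI)
    fix y x x' assume x: "x \<in> \<Lambda>" "x' \<in> \<Lambda>"
    have "\<bar>h (y, x)\<bar> \<le> C * (1 + \<bar>h (y, x')\<bar>) \<or> \<bar>h (y, x)\<bar> \<le> (1 / d) * (1 + \<bar>h (y, x')\<bar>)"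
    proof (cases "\<bar>y\<bar> \<le> b")
      case False
      then have "d * \<bar>h (y, x)\<bar> \<le> 1 + \<bar>h (y, x')\<bar>" using far x by simp
      then show ?thesis using d by (simp add: field_simps)
    qed (use C(2) x in auto)
    moreover have "0 \<le> C * (1 + \<bar>h (y, x')\<bar>)" "0 \<le> (1 / d) * (1 + \<bar>h (y, x')\<bar>)" using C0 d by auto
    ultimately show "\<bar>h (y, x)\<bar> \<le> (C + 1 / d) * (1 + \<bar>h (y, x')\<bar>)" unfolding distrib_right by linarith
  qed (use C0 d in auto)
qed

lemma loss_derivatives:
  assumes g: "Ck_on 2 UNIV g"
  shows "((\<lambda>u. g (y, u)) has_real_derivative loss_dx g (y, x)) (at x)"
    and "((\<lambda>u. loss_dx g (y, u)) has_real_derivative loss_dxx g (y, x)) (at x)"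
    and "continuous_on UNIV g" "continuous_on UNIV (loss_dx g)" "continuous_on UNIV (loss_dxx g)"
proof -
  have line: "((\<lambda>u. k (y, u)) has_real_derivative k' (0, 1)) (at x)"
    if "(k has_derivative k') (at (y, x))" for k :: "real \<times> real \<Rightarrow> real" and k' y x
  proof -
    have "((\<lambda>u. (y, u)) has_derivative (\<lambda>s. (0, s))) (at x)" by (auto intro!: derivative_eq_intros)
    from has_derivative_compose[OF this that] have 1: "((\<lambda>u. k (y, u)) has_derivative (\<lambda>s. k' (0, s))) (at x)" .
    have "k' (0, s) = k' (0, 1) * s" for s
      using linear_scale[OF has_derivative_linear[OF that], of s "(0, 1)"] by simp
    then have "(\<lambda>s. k' (0, s)) = (*) (k' (0, 1))" by (rule ext)
    then show ?thesis using 1 unfolding has_field_derivative_def by (simp only:)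
  qed
  have "Ck_on (Suc (Suc 0)) UNIV g" using g by (simp add: numeral_2_eq_2)
  then obtain D where D: "\<And>x. (g has_derivative D x) (at x)" "\<And>v. Ck_on (Suc 0) UNIV (\<lambda>x. D x v)"
    unfolding Ck_on.simps(2)[of "Suc 0"] by auto
  have dx: "loss_dx g (y, x) = D (y, x) (0, 1)" for y x
    unfolding loss_dx_def prod.case by (rule DERIV_imp_deriv[OF line[OF D(1)]])
  then have dx_eq: "loss_dx g = (\<lambda>z. D z (0, 1))" by (auto simp: fun_eq_iff)
  obtain E where E: "\<And>x. (loss_dx g has_derivative E x) (at x)" "\<And>v. continuous_on UNIV (\<lambda>x. E x v)"
    using D(2)[of "(0, 1)"] unfolding dx_eq by auto
  have dxx: "loss_dxx g (y, x) = E (y, x) (0, 1)" for y x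
    unfolding loss_dxx_def loss_dx_def[of "loss_dx g"] prod.case by (rule DERIV_imp_deriv[OF line[OF E(1)]])
  then have dxx_eq: "loss_dxx g = (\<lambda>z. E z (0, 1))" by (auto simp: fun_eq_iff)
  show "((\<lambda>u. g (y, u)) has_real_derivative loss_dx g (y, x)) (at x)" unfolding dx by (rule line[OF D(1)])
  show "((\<lambda>u. loss_dx g (y, u)) has_real_derivative loss_dxx g (y, x)) (at x)" unfolding dxx by (rule line[OF E(1)])
  show "continuous_on UNIV g" by (rule has_derivative_continuous_on[OF D(1)])
  show "continuous_on UNIV (loss_dx g)" by (rule has_derivative_continuous_on[OF E(1)])
  show "continuous_on UNIV (loss_dxx g)" unfolding dxx_eq by (rule E(2))
qed

section \<open>Consistency\<close>

text \<open>The set \<open>S\<close> carries the outcomes: an interval if they are bounded, the whole line otherwise.  This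
  merges the two alternatives of the tail condition.\<close>

locale profiling = smooth_ivp T \<Theta> \<Gamma> F G xs zs + iid_sample P "\<lambda>i \<omega>. (Y i \<omega>, Tm i \<omega>)"
  for T :: real and \<Theta> :: "(real ^ 'd::finite) set" and \<Gamma> :: "(real \<times> real) set"
    and F G :: "real \<times> real \<times> real \<times> (real ^ 'd) \<Rightarrow> real" and xs zs :: "'d param \<Rightarrow> real \<Rightarrow> real"
    and P :: "'w measure" and Y Tm :: "nat \<Rightarrow> 'w \<Rightarrow> real" +
  fixes g :: "real \<times> real \<Rightarrow> real" and \<theta>0 :: "'d param" and S :: "real set"
  assumes theta0: "\<theta>0 \<in> \<Theta> \<times> \<Gamma>"
    and T_range: "\<And>i \<omega>. 1 \<le> i \<Longrightarrow> \<omega> \<in> space P \<Longrightarrow> Tm i \<omega> \<in> {0..T}"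
    and g_C2: "Ck_on 2 UNIV g" and g_nonneg: "\<And>y x. 0 \<le> g (y, x)"
    and g_integrable: "\<And>p. p \<in> \<Theta> \<times> \<Gamma> \<Longrightarrow> integrable P (\<lambda>\<omega>. g (Y 1 \<omega>, xs p (Tm 1 \<omega>)))"
    and criterion_continuous: "continuous_on (\<Theta> \<times> \<Gamma>) (limit_criterion P g (Y 1) (Tm 1) xs)"
    and criterion_max: "\<And>p. p \<in> \<Theta> \<times> \<Gamma> \<Longrightarrow> p \<noteq> \<theta>0 \<Longrightarrow>
      limit_criterion P g (Y 1) (Tm 1) xs p < limit_criterion P g (Y 1) (Tm 1) xs \<theta>0"
    and moment1: "integrable P (\<lambda>\<omega>. (loss_dx g (Y 1 \<omega>, xs \<theta>0 (Tm 1 \<omega>)))\<^sup>2)"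
    and moment2: "integrable P (\<lambda>\<omega>. \<bar>loss_dxx g (Y 1 \<omega>, xs \<theta>0 (Tm 1 \<omega>))\<bar>)"
    and S_borel: "S \<in> sets borel" and S_support: "AE \<omega> in P. Y 1 \<omega> \<in> S"
    and comparable1: "comparable_on S (loss_dx g)" and comparable2: "comparable_on S (loss_dxx g)"
begin

text \<open>Paths are continuous on \<open>[0, T]\<close> only.  Observation times lie there, so clamping them changes no
  sample value, and it makes the loss a Borel function on the whole plane.\<close>

definition clamp :: "real \<Rightarrow> real" where "clamp t = max 0 (min T t)"

lemma clamp_in: "clamp t \<in> {0..T}" using T_pos by (auto simp: clamp_def)
lemma clamp_id: "t \<in> {0..T} \<Longrightarrow> clamp t = t" by (auto simp: clamp_def)

lemma cont_path: "p \<in> \<Theta> \<times> \<Gamma> \<Longrightarrow> continuous_on {0..T} (xs p)"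
proof -
  assume p: "p \<in> \<Theta> \<times> \<Gamma>"
  have "continuous_on {0..T} (\<lambda>t. (p, t))" by (intro continuous_intros)
  moreover have "(\<lambda>t. (p, t)) ` {0..T} \<subseteq> (\<Theta> \<times> \<Gamma>) \<times> {0..T}" using p by auto
  ultimately show ?thesis using continuous_on_compose2[OF cont_solution, of "{0..T}" "\<lambda>t. (p, t)"] by simp
qed

lemma cont_clamped:
  assumes "continuous_on {0..T} k"
  shows "continuous_on UNIV (\<lambda>z :: real \<times> real. k (clamp (snd z)) :: real)"
proof -
  have "continuous_on UNIV (\<lambda>z :: real \<times> real. clamp (snd z))" unfolding clamp_def by (intro continuous_intros)
  moreover have "(\<lambda>z :: real \<times> real. clamp (snd z)) ` UNIV \<subseteq> {0..T}" using clamp_in by auto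
  ultimately show ?thesis using continuous_on_compose2[OF assms] by blast
qed

lemma clamped_measurable:
  "continuous_on {0..T} k \<Longrightarrow> (\<lambda>z :: real \<times> real. k (clamp (snd z)) :: real) \<in> borel_measurable borel"
  by (rule borel_measurable_continuous_onI[OF cont_clamped])

lemma loss_measurable:
  assumes h: "continuous_on UNIV (h :: real \<times> real \<Rightarrow> real)" and k: "continuous_on {0..T} k"
  shows "(\<lambda>z. h (fst z, k (clamp (snd z)))) \<in> borel_measurable borel"
proof -
  have "continuous_on UNIV (\<lambda>z :: real \<times> real. (fst z, k (clamp (snd z))))"
    by (intro continuous_on_Pair continuous_on_fst continuous_on_id cont_clamped k)
  then show ?thesis by (intro borel_measurable_continuous_onI continuous_on_compose2[OF h]) auto
qed

text \<open>The contribution of one observation \<open>(y, t)\<close> to the criterion at the exact path.\<close>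

definition m :: "'d param \<Rightarrow> real \<times> real \<Rightarrow> real" where "m p z = - g (fst z, xs p (clamp (snd z)))"

lemma m_measurable: "p \<in> \<Theta> \<times> \<Gamma> \<Longrightarrow> m p \<in> borel_measurable borel"
  unfolding m_def[abs_def] by (intro borel_measurable_uminus loss_measurable cont_path loss_derivatives(3)[OF g_C2])

lemma sample_time: "1 \<le> i \<Longrightarrow> \<omega> \<in> space P \<Longrightarrow> clamp (Tm i \<omega>) = Tm i \<omega>"
  by (rule clamp_id[OF T_range])

lemma expectation_m: "p \<in> \<Theta> \<times> \<Gamma> \<Longrightarrow> integrable P (\<lambda>\<omega>. m p (Y 1 \<omega>, Tm 1 \<omega>)) \<and>
    expectation (\<lambda>\<omega>. m p (Y 1 \<omega>, Tm 1 \<omega>)) = limit_criterion P g (Y 1) (Tm 1) xs p"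
proof -
  assume p: "p \<in> \<Theta> \<times> \<Gamma>"
  have eq: "m p (Y 1 \<omega>, Tm 1 \<omega>) = - g (Y 1 \<omega>, xs p (Tm 1 \<omega>))" if "\<omega> \<in> space P" for \<omega>
    using sample_time[OF order_refl that] by (simp add: m_def)
  have "integrable P (\<lambda>\<omega>. m p (Y 1 \<omega>, Tm 1 \<omega>)) \<longleftrightarrow> integrable P (\<lambda>\<omega>. - g (Y 1 \<omega>, xs p (Tm 1 \<omega>)))"
    by (rule Bochner_Integration.integrable_cong[OF refl eq])
  moreover have "expectation (\<lambda>\<omega>. m p (Y 1 \<omega>, Tm 1 \<omega>)) = expectation (\<lambda>\<omega>. - g (Y 1 \<omega>, xs p (Tm 1 \<omega>)))"
    by (rule Bochner_Integration.integral_cong[OF refl eq])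
  ultimately show ?thesis using g_integrable[OF p] unfolding limit_criterion_def by simp
qed

lemma empirical_eq:
  assumes "\<omega> \<in> space P"
  shows "empirical_criterion g Y Tm n \<omega> u = sample_mean (\<lambda>z. - g (fst z, u (clamp (snd z)))) n \<omega>"
  unfolding empirical_criterion_def sample_mean_def
  using sample_time[OF _ assms] by (simp add: sum_negf cong: sum.cong_simp)

lemma empirical_eq_m: "\<omega> \<in> space P \<Longrightarrow> empirical_criterion g Y Tm n \<omega> (xs p) = sample_mean (m p) n \<omega>"
  unfolding m_def[abs_def] by (rule empirical_eq)

definition regular :: "'w \<Rightarrow> bool" where "regular \<omega> \<longleftrightarrow> \<omega> \<in> space P \<and> (\<forall>i\<ge>1. Y i \<omega> \<in> S)"

lemma AE_regular: "AE \<omega> in P. regular \<omega>"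
proof -
  have "AE \<omega> in P. \<forall>i\<ge>1. fst (Y i \<omega>, Tm i \<omega>) \<in> S"
  proof (rule AE_transfer)
    have "fst -` S \<in> sets (borel :: (real \<times> real) measure)"
      using measurable_sets[OF borel_measurable_continuous_onI[OF continuous_on_fst[OF continuous_on_id]] S_borel] by simp
    then show "Measurable.pred borel (\<lambda>z :: real \<times> real. fst z \<in> S)" by (simp add: pred_def vimage_def)
  qed (use S_support in simp)
  then show ?thesis using AE_space by eventually_elim (simp add: regular_def)
qed

lemma likely_regular: "0 \<le> e \<Longrightarrow> likely P e (\<lambda>n. regular)"
  by (rule likely_AE) (use AE_regular in auto)

lemma bounded_paths:
  assumes K: "compact K" "K \<subseteq> \<Theta> \<times> \<Gamma>"
  obtains R where "R \<ge> 0" "\<And>p t. p \<in> K \<Longrightarrow> t \<in> {0..T} \<Longrightarrow> \<bar>xs p t\<bar> \<le> R"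
proof -
  have "bounded ((\<lambda>(p, t). xs p t) ` (K \<times> {0..T}))"
    by (intro compact_imp_bounded compact_continuous_image continuous_on_subset[OF cont_solution] compact_Times K) (use K in auto)
  then obtain R where "R > 0" "\<forall>x\<in>(\<lambda>(p, t). xs p t) ` (K \<times> {0..T}). norm x \<le> R" unfolding bounded_pos by blast
  then show ?thesis by (intro that[of R]) auto
qed

text \<open>By comparability the value at the true path dominates, up to a constant, the values at all paths
  bounded by \<open>R\<close>.\<close>

lemma envelope:
  assumes h: "continuous_on UNIV h" "comparable_on S h" and int: "integrable P (\<lambda>\<omega>. \<bar>h (Y 1 \<omega>, xs \<theta>0 (Tm 1 \<omega>))\<bar>)"
  obtains E where "E \<in> borel_measurable borel" "\<And>z. 0 \<le> E z" "integrable P (\<lambda>\<omega>. E (Y 1 \<omega>, Tm 1 \<omega>))"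
    "\<And>y t x. y \<in> S \<Longrightarrow> \<bar>x\<bar> \<le> R \<Longrightarrow> \<bar>h (y, x)\<bar> \<le> E (y, t)"
proof -
  obtain R0 where R0: "R0 \<ge> 0" "\<And>p t. p \<in> {\<theta>0} \<Longrightarrow> t \<in> {0..T} \<Longrightarrow> \<bar>xs p t\<bar> \<le> R0"
    by (rule bounded_paths[of "{\<theta>0}"]) (use theta0 in auto)
  define \<Lambda> where "\<Lambda> = cball (0 :: real) (max R R0)"
  have "compact \<Lambda>" by (simp add: \<Lambda>_def)
  then obtain C where C: "C \<ge> 0" "\<forall>y\<in>S. \<forall>x\<in>\<Lambda>. \<forall>x'\<in>\<Lambda>. \<bar>h (y, x)\<bar> \<le> C * (1 + \<bar>h (y, x')\<bar>)"
    using h(2) unfolding comparable_on_def by blast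
  define E where "E z = C * (1 + \<bar>h (fst z, xs \<theta>0 (clamp (snd z)))\<bar>)" for z
  show ?thesis
  proof (rule that[of E])
    show "E \<in> borel_measurable borel"
      unfolding E_def[abs_def] by (intro borel_measurable_times borel_measurable_add borel_measurable_const borel_measurable_abs
          loss_measurable h cont_path theta0)
    show "0 \<le> E z" for z using C by (simp add: E_def)
    have "integrable P (\<lambda>\<omega>. C * (1 + \<bar>h (Y 1 \<omega>, xs \<theta>0 (Tm 1 \<omega>))\<bar>))" using int by simp
    moreover have "integrable P (\<lambda>\<omega>. E (Y 1 \<omega>, Tm 1 \<omega>)) \<longleftrightarrow> integrable P (\<lambda>\<omega>. C * (1 + \<bar>h (Y 1 \<omega>, xs \<theta>0 (Tm 1 \<omega>))\<bar>))"
      by (rule Bochner_Integration.integrable_cong[OF refl]) (use sample_time[OF order_refl] in \<open>simp add: E_def\<close>)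
    ultimately show "integrable P (\<lambda>\<omega>. E (Y 1 \<omega>, Tm 1 \<omega>))" by simp
    fix y t x assume y: "y \<in> S" and x: "\<bar>x\<bar> \<le> R"
    have "x \<in> \<Lambda>" using x by (simp add: \<Lambda>_def)
    moreover have "xs \<theta>0 (clamp t) \<in> \<Lambda>" using R0(2)[OF _ clamp_in, of \<theta>0 t] by (simp add: \<Lambda>_def)
    ultimately show "\<bar>h (y, x)\<bar> \<le> E (y, t)" using C(2) y by (simp add: E_def)
  qed
qed

lemma lipschitz_from_derivative:
  fixes k k' :: "real \<Rightarrow> real"
  assumes d: "\<And>x. (k has_real_derivative k' x) (at x)" and b: "\<And>x. \<bar>x\<bar> \<le> R \<Longrightarrow> \<bar>k' x\<bar> \<le> B"
    and ab: "\<bar>a\<bar> \<le> R" "\<bar>b\<bar> \<le> R"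
  shows "\<bar>k a - k b\<bar> \<le> B * \<bar>a - b\<bar>"
proof -
  have "norm (k a - k b) \<le> B * norm (a - b)"
    by (rule field_differentiable_bound[of "cball 0 R" k k'])
      (use assms in \<open>auto intro: has_field_derivative_at_within\<close>)
  then show ?thesis by simp
qed

lemma moment1_abs: "integrable P (\<lambda>\<omega>. \<bar>loss_dx g (Y 1 \<omega>, xs \<theta>0 (Tm 1 \<omega>))\<bar>)"
proof -
  have "(\<lambda>\<omega>. loss_dx g (fst (Y 1 \<omega>, Tm 1 \<omega>), xs \<theta>0 (clamp (snd (Y 1 \<omega>, Tm 1 \<omega>))))) \<in> borel_measurable P"
    by (rule comp_measurable[OF loss_measurable[OF loss_derivatives(4)[OF g_C2] cont_path[OF theta0]] order_refl])
  moreover have "(\<lambda>\<omega>. loss_dx g (fst (Y 1 \<omega>, Tm 1 \<omega>), xs \<theta>0 (clamp (snd (Y 1 \<omega>, Tm 1 \<omega>))))) \<in> borel_measurable P \<longleftrightarrow>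
      (\<lambda>\<omega>. loss_dx g (Y 1 \<omega>, xs \<theta>0 (Tm 1 \<omega>))) \<in> borel_measurable P"
    by (rule measurable_cong) (use sample_time[OF order_refl] in simp)
  ultimately have "(\<lambda>\<omega>. loss_dx g (Y 1 \<omega>, xs \<theta>0 (Tm 1 \<omega>))) \<in> borel_measurable P" by simp
  from square_integrable_imp_integrable[OF this moment1] show ?thesis by simp
qed

lemmas envelope_dx = envelope[OF loss_derivatives(4)[OF g_C2] comparable1 moment1_abs]
lemmas envelope_dxx = envelope[OF loss_derivatives(5)[OF g_C2] comparable2 moment2]

lemma mean_bounded_likely:
  fixes E :: "real \<times> real \<Rightarrow> real"
  assumes E: "E \<in> borel_measurable borel" "\<And>z. 0 \<le> E z" "integrable P (\<lambda>\<omega>. E (Y 1 \<omega>, Tm 1 \<omega>))" and e: "e > 0"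
  obtains a where "a > 0" "likely P e (\<lambda>n \<omega>. sample_mean E n \<omega> \<le> a)"
proof -
  define a where "a = (expectation (\<lambda>\<omega>. E (Y 1 \<omega>, Tm 1 \<omega>)) + 1) / e"
  have nn: "0 \<le> expectation (\<lambda>\<omega>. E (Y 1 \<omega>, Tm 1 \<omega>))" by (intro Bochner_Integration.integral_nonneg E)
  then have a: "a > 0" using e by (simp add: a_def)
  have "likely P (expectation (\<lambda>\<omega>. E (Y 1 \<omega>, Tm 1 \<omega>)) / a) (\<lambda>n \<omega>. sample_mean E n \<omega> \<le> a)"
  proof (rule likely_markov[OF eventually_sequentiallyI[of 1] a], intro conjI)
    fix n :: nat assume n: "1 \<le> n"
    show "integrable P (sample_mean E n)" by (rule sample_mean_integrable(1)[OF E(1,3)])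
    show "AE \<omega> in P. 0 \<le> sample_mean E n \<omega>" unfolding sample_mean_def by (intro AE_I2) (simp add: sum_nonneg E(2))
    show "expectation (sample_mean E n) \<le> expectation (\<lambda>\<omega>. E (Y 1 \<omega>, Tm 1 \<omega>))"
      unfolding sample_mean_integrable(2)[OF E(1,3) n] by (rule order_refl)
  qed
  then have "likely P e (\<lambda>n \<omega>. sample_mean E n \<omega> \<le> a)"
    by (rule likely_mono) (use nn e in \<open>auto simp: a_def field_simps\<close>)
  then show ?thesis by (rule that[OF a])
qed

text \<open>The mean value theorem in each summand; the envelope of \<open>g\<^sub>x\<close> is the Lipschitz constant.\<close>

lemma empirical_criterion_lipschitz:
  assumes \<omega>: "regular \<omega>" and E: "\<And>y t x. y \<in> S \<Longrightarrow> \<bar>x\<bar> \<le> R \<Longrightarrow> \<bar>loss_dx g (y, x)\<bar> \<le> E (y, t)" and E0: "\<And>z. 0 \<le> E z"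
    and b: "\<And>t. t \<in> {0..T} \<Longrightarrow> \<bar>u t\<bar> \<le> R \<and> \<bar>v t\<bar> \<le> R \<and> \<bar>u t - v t\<bar> \<le> \<eta>"
  shows "\<bar>empirical_criterion g Y Tm n \<omega> u - empirical_criterion g Y Tm n \<omega> v\<bar> \<le> sample_mean E n \<omega> * \<eta>"
proof -
  have sp: "\<omega> \<in> space P" using \<omega> by (simp add: regular_def)
  have "empirical_criterion g Y Tm n \<omega> u - empirical_criterion g Y Tm n \<omega> v =
      (1 / real n) * (\<Sum>i=1..n. g (Y i \<omega>, v (Tm i \<omega>)) - g (Y i \<omega>, u (Tm i \<omega>)))"
    by (simp add: empirical_criterion_def sum_subtractf right_diff_distrib diff_divide_distrib)
  also have "\<bar>\<dots>\<bar> \<le> (1 / real n) * (\<Sum>i=1..n. E (Y i \<omega>, Tm i \<omega>) * \<eta>)"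
    unfolding abs_mult
  proof (rule mult_mono)
    show "\<bar>\<Sum>i=1..n. g (Y i \<omega>, v (Tm i \<omega>)) - g (Y i \<omega>, u (Tm i \<omega>))\<bar> \<le> (\<Sum>i=1..n. E (Y i \<omega>, Tm i \<omega>) * \<eta>)"
    proof (rule order_trans[OF sum_abs], rule sum_mono)
      fix i assume i: "i \<in> {1..n}"
      have t: "Tm i \<omega> \<in> {0..T}" using T_range[of i \<omega>] i sp by simp
      have y: "Y i \<omega> \<in> S" using \<omega> i by (simp add: regular_def)
      have "\<bar>g (Y i \<omega>, v (Tm i \<omega>)) - g (Y i \<omega>, u (Tm i \<omega>))\<bar> \<le> E (Y i \<omega>, Tm i \<omega>) * \<bar>v (Tm i \<omega>) - u (Tm i \<omega>)\<bar>"
        by (rule lipschitz_from_derivative[OF loss_derivatives(1)[OF g_C2] E[OF y]]) (use b[OF t] in auto)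
      also have "\<dots> \<le> E (Y i \<omega>, Tm i \<omega>) * \<eta>" using b[OF t] E0 by (intro mult_left_mono) auto
      finally show "\<bar>g (Y i \<omega>, v (Tm i \<omega>)) - g (Y i \<omega>, u (Tm i \<omega>))\<bar> \<le> E (Y i \<omega>, Tm i \<omega>) * \<eta>" .
    qed
  qed auto
  also have "\<dots> = sample_mean E n \<omega> * \<eta>" by (simp add: sample_mean_def sum_distrib_right)
  finally show ?thesis .
qed

lemma paths_close:
  assumes K: "compact K" "K \<subseteq> \<Theta> \<times> \<Gamma>" and \<eta>: "\<eta> > 0"
  obtains \<delta> where "\<delta> > 0" "\<And>p q t. p \<in> K \<Longrightarrow> q \<in> K \<Longrightarrow> dist p q < \<delta> \<Longrightarrow> t \<in> {0..T} \<Longrightarrow> \<bar>xs p t - xs q t\<bar> \<le> \<eta>"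
proof -
  have "uniformly_continuous_on (K \<times> {0..T}) (\<lambda>(p, t). xs p t)"
    by (intro compact_uniformly_continuous continuous_on_subset[OF cont_solution] compact_Times K) (use K in auto)
  then obtain \<delta> where \<delta>: "\<delta> > 0" and *: "\<forall>x\<in>K \<times> {0..T}. \<forall>x'\<in>K \<times> {0..T}. dist x' x < \<delta> \<longrightarrow>
      dist (case x' of (p, t) \<Rightarrow> xs p t) (case x of (p, t) \<Rightarrow> xs p t) < \<eta>"
    unfolding uniformly_continuous_on_def using \<eta> by blast
  show ?thesis
  proof (rule that[OF \<delta>])
    fix p q t assume "p \<in> K" "q \<in> K" "dist p q < \<delta>" "t \<in> {0..T}"
    then show "\<bar>xs p t - xs q t\<bar> \<le> \<eta>"
      using *[rule_format, of "(q, t)" "(p, t)"] by (simp add: dist_Pair_Pair dist_real_def)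
  qed
qed

text \<open>By compactness the limit criterion is smaller by some \<open>\<gamma>\<close> outside a neighbourhood of \<open>\<theta>0\<close>.  The
  law of large numbers on a finite net, and the Lipschitz bound between net points, transfer this gap to the
  sample.\<close>

lemma consistency:
  fixes q :: "nat \<Rightarrow> 'w \<Rightarrow> 'd param"
  assumes tight: "\<And>e. e > 0 \<Longrightarrow> \<exists>K. compact K \<and> K \<subseteq> \<Theta> \<times> \<Gamma> \<and> likely P e (\<lambda>n \<omega>. q n \<omega> \<in> K)"
    and near: "\<And>\<kappa> e. \<kappa> > 0 \<Longrightarrow> e > 0 \<Longrightarrow> likely P e (\<lambda>n \<omega>. sample_mean (m \<theta>0) n \<omega> \<le> sample_mean (m (q n \<omega>)) n \<omega> + \<kappa>)"
    and \<kappa>: "\<kappa> > 0" and e: "e > 0"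
  shows "likely P e (\<lambda>n \<omega>. norm (q n \<omega> - \<theta>0) \<le> \<kappa>)"
proof -
  let ?M = "limit_criterion P g (Y 1) (Tm 1) xs"
  have e4: "e / 4 > 0" using e by simp
  obtain K where K: "compact K" "K \<subseteq> \<Theta> \<times> \<Gamma>" and LK: "likely P (e / 4) (\<lambda>n \<omega>. q n \<omega> \<in> K)" using tight[OF e4] by blast
  define K1 where "K1 = K - ball \<theta>0 \<kappa>"
  have K1: "compact K1" "K1 \<subseteq> \<Theta> \<times> \<Gamma>" using K unfolding K1_def by (auto intro: compact_diff)
  have "\<exists>\<gamma>>0. \<forall>p\<in>K1. ?M p \<le> ?M \<theta>0 - \<gamma>"
  proof (cases "K1 = {}")
    case False
    obtain p where p: "p \<in> K1" "\<And>r. r \<in> K1 \<Longrightarrow> ?M r \<le> ?M p"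
      using continuous_attains_sup[OF K1(1) False continuous_on_subset[OF criterion_continuous K1(2)]] by blast
    have "p \<noteq> \<theta>0" using p(1) \<kappa> by (auto simp: K1_def)
    then have "?M p < ?M \<theta>0" using criterion_max p(1) K1(2) by blast
    then show ?thesis using p(2) by (intro exI[of _ "?M \<theta>0 - ?M p"]) auto
  qed (auto intro: exI[of _ 1])
  then obtain \<gamma> where \<gamma>: "\<gamma> > 0" "\<And>p. p \<in> K1 \<Longrightarrow> ?M p \<le> ?M \<theta>0 - \<gamma>" by blast
  obtain R where R: "R \<ge> 0" "\<And>p t. p \<in> K1 \<Longrightarrow> t \<in> {0..T} \<Longrightarrow> \<bar>xs p t\<bar> \<le> R" by (rule bounded_paths[OF K1]) blast
  obtain E where E: "E \<in> borel_measurable borel" "\<And>z. 0 \<le> E z" "integrable P (\<lambda>\<omega>. E (Y 1 \<omega>, Tm 1 \<omega>))"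
    and EB: "\<And>y t x. y \<in> S \<Longrightarrow> \<bar>x\<bar> \<le> R \<Longrightarrow> \<bar>loss_dx g (y, x)\<bar> \<le> E (y, t)" by (rule envelope_dx[of R]) blast
  obtain a where a: "a > 0" and LE: "likely P (e / 4) (\<lambda>n \<omega>. sample_mean E n \<omega> \<le> a)"
    by (rule mean_bounded_likely[OF E e4])
  have \<eta>: "\<gamma> / (8 * a) > 0" using \<gamma> a by simp
  obtain \<delta> where \<delta>: "\<delta> > 0" "\<And>p r t. p \<in> K1 \<Longrightarrow> r \<in> K1 \<Longrightarrow> dist p r < \<delta> \<Longrightarrow> t \<in> {0..T} \<Longrightarrow> \<bar>xs p t - xs r t\<bar> \<le> \<gamma> / (8 * a)"
    by (rule paths_close[OF K1 \<eta>]) blast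
  \<comment> \<open>Uniform convergence is reduced to a finite net.\<close>
  obtain Q where Q: "finite Q" "Q \<subseteq> K1" "K1 \<subseteq> (\<Union>r\<in>Q. ball r \<delta>)"
    using seq_compact_imp_totally_bounded[OF compact_imp_seq_compact[OF K1(1)], THEN spec, THEN mp, OF \<delta>(1)]
    by (elim exE conjE)
  define Q' where "Q' = insert \<theta>0 Q"
  have Q': "finite Q'" "Q' \<subseteq> \<Theta> \<times> \<Gamma>" "card Q' > 0" using Q K1 theta0 by (auto simp: Q'_def card_gt_0_iff)
  define e' where "e' = e / (4 * real (card Q'))"
  have e': "e' > 0" using e Q' by (simp add: e'_def)
  have g8: "\<gamma> / 8 > 0" using \<gamma> by simp
  have "likely P (real (card Q') * e') (\<lambda>n \<omega>. \<forall>p\<in>Q'. \<bar>sample_mean (m p) n \<omega> - ?M p\<bar> \<le> \<gamma> / 8)"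
  proof (rule likely_finite[OF Q'(1) _ less_imp_le[OF e']])
    fix p assume "p \<in> Q'"
    then have p: "p \<in> \<Theta> \<times> \<Gamma>" using Q' by blast
    show "likely P e' (\<lambda>n \<omega>. \<bar>sample_mean (m p) n \<omega> - ?M p\<bar> \<le> \<gamma> / 8)"
      using weak_law_of_large_numbers[OF m_measurable[OF p] conjunct1[OF expectation_m[OF p]] g8 e']
      unfolding conjunct2[OF expectation_m[OF p]] .
  qed
  then have LQ: "likely P (e / 4) (\<lambda>n \<omega>. \<forall>p\<in>Q'. \<bar>sample_mean (m p) n \<omega> - ?M p\<bar> \<le> \<gamma> / 8)" using Q'(3) by (simp add: e'_def)
  show ?thesis
  proof (rule likely_mono[OF likely_conj[OF likely_conj[OF LK LE] likely_conj[OF likely_conj[OF LQ near[OF g8 e4]] likely_regular[OF order_refl]]]])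
    show "\<forall>\<^sub>F n in sequentially. \<forall>\<omega>\<in>space P. (q n \<omega> \<in> K \<and> sample_mean E n \<omega> \<le> a) \<and>
       ((\<forall>p\<in>Q'. \<bar>sample_mean (m p) n \<omega> - ?M p\<bar> \<le> \<gamma> / 8) \<and> sample_mean (m \<theta>0) n \<omega> \<le> sample_mean (m (q n \<omega>)) n \<omega> + \<gamma> / 8) \<and> regular \<omega> \<longrightarrow>
       norm (q n \<omega> - \<theta>0) \<le> \<kappa>"
    proof (intro always_eventually allI ballI impI, elim conjE, rule ccontr)
      fix n \<omega> assume \<omega>: "\<omega> \<in> space P" and qK: "q n \<omega> \<in> K" and Ea: "sample_mean E n \<omega> \<le> a"
        and lq: "\<forall>p\<in>Q'. \<bar>sample_mean (m p) n \<omega> - ?M p\<bar> \<le> \<gamma> / 8"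
        and nr: "sample_mean (m \<theta>0) n \<omega> \<le> sample_mean (m (q n \<omega>)) n \<omega> + \<gamma> / 8" and reg: "regular \<omega>"
        and far: "\<not> norm (q n \<omega> - \<theta>0) \<le> \<kappa>"
      have q1: "q n \<omega> \<in> K1" using qK far by (auto simp: K1_def dist_norm norm_minus_commute)
      then obtain r where r: "r \<in> Q" "q n \<omega> \<in> ball r \<delta>" using Q(3) by blast
      have rK: "r \<in> K1" using r Q by blast
      have d: "dist (q n \<omega>) r < \<delta>" using r by (simp add: dist_commute)
      have "\<bar>empirical_criterion g Y Tm n \<omega> (xs (q n \<omega>)) - empirical_criterion g Y Tm n \<omega> (xs r)\<bar> \<le> sample_mean E n \<omega> * (\<gamma> / (8 * a))"
        by (rule empirical_criterion_lipschitz[OF reg EB E(2)]) (use R(2)[OF q1] R(2)[OF rK] \<delta>(2)[OF q1 rK d] in auto)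
      also have "\<dots> \<le> a * (\<gamma> / (8 * a))" using Ea \<eta> by (intro mult_right_mono) auto
      also have "\<dots> = \<gamma> / 8" using a by simp
      finally have 1: "\<bar>sample_mean (m (q n \<omega>)) n \<omega> - sample_mean (m r) n \<omega>\<bar> \<le> \<gamma> / 8" by (simp add: empirical_eq_m[OF \<omega>])
      have 2: "\<bar>sample_mean (m r) n \<omega> - ?M r\<bar> \<le> \<gamma> / 8" using lq r by (auto simp: Q'_def)
      have 3: "\<bar>sample_mean (m \<theta>0) n \<omega> - ?M \<theta>0\<bar> \<le> \<gamma> / 8" using lq by (auto simp: Q'_def)
      show False using 1 2 3 nr \<gamma>(2)[OF rK] \<gamma>(1) unfolding abs_le_iff by linarith
    qed
  qed simp
qed

end

section \<open>The profiled criterion\<close>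

lemma sup_norm_less_imp:
  assumes "sup_norm T f < ennreal e" "t \<in> {0..T}"
  shows "\<bar>f t\<bar> \<le> e"
proof -
  have "ennreal \<bar>f t\<bar> \<le> sup_norm T f" unfolding sup_norm_def by (rule SUP_upper[OF assms(2)])
  then have "ennreal \<bar>f t\<bar> < ennreal e" using assms(1) by simp
  then show ?thesis by (simp add: ennreal_less_iff)
qed

lemma C1_approx_error_less_imp:
  assumes "C1_approx_error T L f a < ennreal e"
  obtains w where "w \<in> L" "w 0 = a"
    "\<forall>t\<in>{0..T}. \<bar>f t - w t\<bar> \<le> e \<and> \<bar>time_deriv T f t - time_deriv T w t\<bar> \<le> e"
proof -
  obtain w where w: "w \<in> L" "w 0 = a" and m: "max (sup_norm T (\<lambda>t. f t - w t)) (sup_norm T (\<lambda>t. time_deriv T f t - time_deriv T w t)) < ennreal e"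
    using assms unfolding C1_approx_error_def INF_less_iff by blast
  have "\<bar>f t - w t\<bar> \<le> e \<and> \<bar>time_deriv T f t - time_deriv T w t\<bar> \<le> e" if t: "t \<in> {0..T}" for t
    using sup_norm_less_imp[OF _ t, of "\<lambda>t. f t - w t"] sup_norm_less_imp[OF _ t, of "\<lambda>t. time_deriv T f t - time_deriv T w t"] m
    by simp
  then show ?thesis using that w by blast
qed

locale profiled_estimation = profiling T \<Theta> \<Gamma> F G xs zs P Y Tm g \<theta>0 S
  for T :: real and \<Theta> :: "(real ^ 'd::finite) set" and \<Gamma> :: "(real \<times> real) set"
    and F G :: "real \<times> real \<times> real \<times> (real ^ 'd) \<Rightarrow> real" and xs zs :: "'d param \<Rightarrow> real \<Rightarrow> real"
    and P :: "'w measure" and Y Tm :: "nat \<Rightarrow> 'w \<Rightarrow> real"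
    and g :: "real \<times> real \<Rightarrow> real" and \<theta>0 :: "'d param" and S :: "real set" +
  fixes L :: "nat \<Rightarrow> (real \<Rightarrow> real) set" and lam :: "nat \<Rightarrow> real"
    and xh zh :: "nat \<Rightarrow> 'w \<Rightarrow> 'd param \<Rightarrow> real \<Rightarrow> real"
  assumes L_subspace: "\<And>n. n \<ge> 1 \<Longrightarrow> finite_dim_subspace_C1 T (L n)"
    and lam_pos: "\<And>n. n \<ge> 1 \<Longrightarrow> lam n > 0"
    and profile: "\<And>n \<omega> \<theta> x z. n \<ge> 1 \<Longrightarrow> \<omega> \<in> space P \<Longrightarrow> (\<theta>, x, z) \<in> \<Theta> \<times> \<Gamma> \<Longrightarrow>
      is_arg_max (\<lambda>(u, v). empirical_criterion g Y Tm n \<omega> u - lam n * penalty T F G u v \<theta>)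
        (\<lambda>(u, v). u \<in> L n \<and> v \<in> L n \<and> u 0 = x \<and> v 0 = z)
        (xh n \<omega> (\<theta>, x, z), zh n \<omega> (\<theta>, x, z))"
    and lam_rate: "filterlim (\<lambda>n. lam n / (real n)\<^sup>2) at_top sequentially"
    and r_rate: "\<And>\<Theta>0 \<Gamma>0. compact \<Theta>0 \<Longrightarrow> \<Theta>0 \<subseteq> \<Theta> \<Longrightarrow> compact \<Gamma>0 \<Longrightarrow> \<Gamma>0 \<subseteq> \<Gamma> \<Longrightarrow>
      (\<lambda>n. of_nat n * approx_rate T (L n) xs zs \<Theta>0 \<Gamma>0) \<longlonglongrightarrow> 0"
begin

text \<open>The projections of \<open>K\<close> are compact, so the approximation rate applies to the product of both.\<close>

lemma approximants_exist:
  assumes K: "compact K" "K \<subseteq> \<Theta> \<times> \<Gamma>" and s: "s > 0"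
  shows "\<forall>\<^sub>F n in sequentially. \<forall>\<theta> x z. (\<theta>, x, z) \<in> K \<longrightarrow> (\<exists>w\<in>L n. \<exists>v\<in>L n. w 0 = x \<and> v 0 = z \<and>
    (\<forall>t\<in>{0..T}. \<bar>xs (\<theta>, x, z) t - w t\<bar> \<le> s / real n \<and> \<bar>zs (\<theta>, x, z) t - v t\<bar> \<le> s / real n \<and>
      \<bar>time_deriv T (xs (\<theta>, x, z)) t - time_deriv T w t\<bar> \<le> s / real n \<and>
      \<bar>time_deriv T (zs (\<theta>, x, z)) t - time_deriv T v t\<bar> \<le> s / real n))"
proof -
  have c: "compact (fst ` K)" "compact (snd ` K)" by (intro compact_continuous_image continuous_intros K)+
  have sub: "fst ` K \<subseteq> \<Theta>" "snd ` K \<subseteq> \<Gamma>" using K by auto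
  have "\<forall>\<^sub>F n in sequentially. of_nat n * approx_rate T (L n) xs zs (fst ` K) (snd ` K) < ennreal s"
    using order_tendstoD(2)[OF r_rate[OF c(1) sub(1) c(2) sub(2)]] s by simp
  then show ?thesis using eventually_gt_at_top[of 0]
  proof eventually_elim
    case (elim n)
    let ?r = "approx_rate T (L n) xs zs (fst ` K) (snd ` K)"
    have r: "?r < ennreal (s / real n)"
    proof (rule ccontr)
      assume "\<not> ?r < ennreal (s / real n)"
      then have "of_nat n * ennreal (s / real n) \<le> of_nat n * ?r" by (intro mult_left_mono) auto
      moreover have "of_nat n * ennreal (s / real n) = ennreal s"
        using elim(2) s by (simp add: ennreal_of_nat_eq_real_of_nat flip: ennreal_mult)
      ultimately show False using elim(1) by simp
    qed
    show ?case
    proof (intro allI impI)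
      fix \<theta> x z assume p: "(\<theta>, x, z) \<in> K"
      then have pp: "(\<theta>, x, z) \<in> fst ` K \<times> snd ` K" by force
      have "C1_approx_error T (L n) (xs (\<theta>, x, z)) x \<le> ?r"
        unfolding approx_rate_def by (rule max.coboundedI1, rule SUP_upper2[OF pp]) simp
      then have "C1_approx_error T (L n) (xs (\<theta>, x, z)) x < ennreal (s / real n)" using r by simp
      then obtain w where w: "w \<in> L n" "w 0 = x" "\<forall>t\<in>{0..T}. \<bar>xs (\<theta>, x, z) t - w t\<bar> \<le> s / real n \<and>
          \<bar>time_deriv T (xs (\<theta>, x, z)) t - time_deriv T w t\<bar> \<le> s / real n"
        by (rule C1_approx_error_less_imp)
      have "C1_approx_error T (L n) (zs (\<theta>, x, z)) z \<le> ?r"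
        unfolding approx_rate_def by (rule max.coboundedI2, rule SUP_upper2[OF pp]) simp
      then have "C1_approx_error T (L n) (zs (\<theta>, x, z)) z < ennreal (s / real n)" using r by simp
      then obtain v where v: "v \<in> L n" "v 0 = z" "\<forall>t\<in>{0..T}. \<bar>zs (\<theta>, x, z) t - v t\<bar> \<le> s / real n \<and>
          \<bar>time_deriv T (zs (\<theta>, x, z)) t - time_deriv T v t\<bar> \<le> s / real n"
        by (rule C1_approx_error_less_imp)
      show "\<exists>w\<in>L n. \<exists>v\<in>L n. w 0 = x \<and> v 0 = z \<and>
        (\<forall>t\<in>{0..T}. \<bar>xs (\<theta>, x, z) t - w t\<bar> \<le> s / real n \<and> \<bar>zs (\<theta>, x, z) t - v t\<bar> \<le> s / real n \<and>
        \<bar>time_deriv T (xs (\<theta>, x, z)) t - time_deriv T w t\<bar> \<le> s / real n \<and>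
        \<bar>time_deriv T (zs (\<theta>, x, z)) t - time_deriv T v t\<bar> \<le> s / real n)"
        by (rule bexI[OF _ w(1)], rule bexI[OF _ v(1)]) (use w(2,3) v(2,3) in simp)
    qed
  qed
qed

text \<open>The maximality of the profile is used against an approximant of the exact path.\<close>

lemma profiled_criterion_close:
  assumes K: "compact K" "K \<subseteq> \<Theta> \<times> \<Gamma>" and \<kappa>: "\<kappa> > 0" and e: "e > 0"
  shows "likely P e (\<lambda>n \<omega>. \<forall>p\<in>K. \<bar>empirical_criterion g Y Tm n \<omega> (xh n \<omega> p) - empirical_criterion g Y Tm n \<omega> (xs p)\<bar> \<le> \<kappa> / real n)"
proof -
  have e2: "e / 2 > 0" using e by simp
  define K' where "K' = insert \<theta>0 K"
  have K': "compact K'" "K' \<subseteq> \<Theta> \<times> \<Gamma>" using K theta0 by (auto simp: K'_def)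
  obtain R0 where R0: "R0 \<ge> 0" "\<And>p t. p \<in> K' \<Longrightarrow> t \<in> {0..T} \<Longrightarrow> \<bar>xs p t\<bar> \<le> R0" by (rule bounded_paths[OF K']) blast
  define R where "R = R0 + 1"
  obtain E where E: "E \<in> borel_measurable borel" "\<And>z. 0 \<le> E z" "integrable P (\<lambda>\<omega>. E (Y 1 \<omega>, Tm 1 \<omega>))"
    and EB: "\<And>y t x. y \<in> S \<Longrightarrow> \<bar>x\<bar> \<le> R \<Longrightarrow> \<bar>loss_dx g (y, x)\<bar> \<le> E (y, t)" by (rule envelope_dx[of R]) blast
  obtain a where a: "a > 0" and LE: "likely P (e / 2) (\<lambda>n \<omega>. sample_mean E n \<omega> \<le> a)"
    by (rule mean_bounded_likely[OF E e2])
  have m0: "(\<lambda>z. - m \<theta>0 z) \<in> borel_measurable borel" using m_measurable[OF theta0] by measurable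
  have m1: "0 \<le> - m \<theta>0 z" for z by (simp add: m_def g_nonneg)
  have m2: "integrable P (\<lambda>\<omega>. - m \<theta>0 (Y 1 \<omega>, Tm 1 \<omega>))" using expectation_m[OF theta0] by simp
  obtain b where b: "b > 0" and LB: "likely P (e / 2) (\<lambda>n \<omega>. sample_mean (\<lambda>z. - m \<theta>0 z) n \<omega> \<le> b)"
    by (rule mean_bounded_likely[OF m0 m1 m2 e2])
  obtain \<eta>1 A1 where \<eta>1: "\<eta>1 > 0" and A1: "A1 \<ge> 1" and dist: "\<forall>\<theta> x z u v B. (\<theta>, x, z) \<in> K \<longrightarrow> Ck_on 1 {0..T} u \<longrightarrow> Ck_on 1 {0..T} v \<longrightarrow>
    u 0 = x \<longrightarrow> v 0 = z \<longrightarrow> penalty T F G u v \<theta> \<le> B \<longrightarrow> A1 * B < \<eta>1\<^sup>2 \<longrightarrow>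
    (\<forall>t\<in>{0..T}. (u t - xs (\<theta>, x, z) t)\<^sup>2 \<le> A1 * B)"
    using penalty_controls_distance[OF K] by blast
  obtain \<eta>2 A2 where \<eta>2: "\<eta>2 > 0" and A2: "A2 \<ge> 0" and app: "\<forall>\<theta> x z u v e. (\<theta>, x, z) \<in> K \<longrightarrow> Ck_on 1 {0..T} u \<longrightarrow> Ck_on 1 {0..T} v \<longrightarrow>
    e \<le> \<eta>2 \<longrightarrow> (\<forall>t\<in>{0..T}. \<bar>xs (\<theta>, x, z) t - u t\<bar> \<le> e \<and> \<bar>zs (\<theta>, x, z) t - v t\<bar> \<le> e \<and>
      \<bar>time_deriv T (xs (\<theta>, x, z)) t - time_deriv T u t\<bar> \<le> e \<and>
      \<bar>time_deriv T (zs (\<theta>, x, z)) t - time_deriv T v t\<bar> \<le> e) \<longrightarrow>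
    penalty T F G u v \<theta> \<le> A2 * e\<^sup>2"
    using penalty_of_approximant[OF K] by blast
  \<comment> \<open>The profile will be within \<open>D * s / n\<close> of the exact path, and \<open>s\<close> makes \<open>a * D * s\<close> equal to \<open>\<kappa>\<close>.\<close>
  define D where "D = sqrt (A1 * (1 + A2))"
  have D: "D > 0" "D\<^sup>2 = A1 * (1 + A2)" using A1 A2 by (auto simp: D_def)
  define s where "s = \<kappa> / (a * D)"
  have s: "s > 0" "a * (D * s) = \<kappa>" using \<kappa> a D by (auto simp: s_def)
  define c0 where "c0 = b + a * (2 * R)"
  have c0: "c0 > 0" using a b R0 by (simp add: c0_def R_def add_pos_nonneg)
  \<comment> \<open>Since \<open>\<lambda> / n\<^sup>2\<close> tends to infinity, the bounded difference \<open>c0\<close> of criteria is eventually at most \<open>\<lambda> * (s / n)\<^sup>2\<close>.\<close>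
  have ev1: "\<forall>\<^sub>F n in sequentially. c0 / s\<^sup>2 \<le> lam n / (real n)\<^sup>2"
    using lam_rate by (simp add: filterlim_at_top)
  have to0: "(\<lambda>n. c / real n) \<longlonglongrightarrow> 0" for c :: real by (rule lim_const_over_n)
  have ev2: "\<forall>\<^sub>F n in sequentially. s / real n < min 1 \<eta>2" using \<eta>2 by (intro order_tendstoD(2)[OF to0]) auto
  have ev3: "\<forall>\<^sub>F n in sequentially. D * s / real n < min 1 \<eta>1" using \<eta>1 by (intro order_tendstoD(2)[OF to0]) auto
  have LC: "likely P e (\<lambda>n \<omega>. (sample_mean E n \<omega> \<le> a \<and> sample_mean (\<lambda>z. - m \<theta>0 z) n \<omega> \<le> b) \<and> regular \<omega>)"
    using likely_conj[OF likely_conj[OF LE LB] likely_regular[OF order_refl]] by simp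
  show ?thesis
  proof (rule likely_mono[OF LC order_refl])
    show "\<forall>\<^sub>F n in sequentially. \<forall>\<omega>\<in>space P. (sample_mean E n \<omega> \<le> a \<and> sample_mean (\<lambda>z. - m \<theta>0 z) n \<omega> \<le> b) \<and> regular \<omega> \<longrightarrow>
      (\<forall>p\<in>K. \<bar>empirical_criterion g Y Tm n \<omega> (xh n \<omega> p) - empirical_criterion g Y Tm n \<omega> (xs p)\<bar> \<le> \<kappa> / real n)"
      using ev1 ev2 ev3 approximants_exist[OF K s(1)] eventually_gt_at_top[of 0]
    proof (eventually_elim, intro ballI impI, elim conjE)
      fix n :: nat and \<omega> p
      assume l: "c0 / s\<^sup>2 \<le> lam n / (real n)\<^sup>2" and sn: "s / real n < min 1 \<eta>2" and Dn: "D * s / real n < min 1 \<eta>1"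
        and ap: "\<forall>\<theta> x z. (\<theta>, x, z) \<in> K \<longrightarrow> (\<exists>w\<in>L n. \<exists>v\<in>L n. w 0 = x \<and> v 0 = z \<and>
          (\<forall>t\<in>{0..T}. \<bar>xs (\<theta>, x, z) t - w t\<bar> \<le> s / real n \<and> \<bar>zs (\<theta>, x, z) t - v t\<bar> \<le> s / real n \<and>
          \<bar>time_deriv T (xs (\<theta>, x, z)) t - time_deriv T w t\<bar> \<le> s / real n \<and>
          \<bar>time_deriv T (zs (\<theta>, x, z)) t - time_deriv T v t\<bar> \<le> s / real n))"
        and n: "0 < n" and \<omega>: "\<omega> \<in> space P" and reg: "regular \<omega>"
        and Ea: "sample_mean E n \<omega> \<le> a" and Gb: "sample_mean (\<lambda>z. - m \<theta>0 z) n \<omega> \<le> b" and p: "p \<in> K"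
      let ?H = "empirical_criterion g Y Tm n \<omega>"
      have n1: "1 \<le> n" using n by simp
      obtain \<theta> x z where pp: "p = (\<theta>, x, z)" by (cases p)
      have pK: "(\<theta>, x, z) \<in> K" and pU: "(\<theta>, x, z) \<in> \<Theta> \<times> \<Gamma>" using p K pp by auto
      let ?u = "xh n \<omega> (\<theta>, x, z)" and ?v = "zh n \<omega> (\<theta>, x, z)"
      note am = profile[OF n1 \<omega> pU, unfolded is_arg_max_linorder prod.case]
      have uL: "?u \<in> L n" "?v \<in> L n" "?u 0 = x" "?v 0 = z" using am by auto
      have C1: "w \<in> L n \<Longrightarrow> Ck_on 1 {0..T} w" for w using L_subspace[OF n1] unfolding finite_dim_subspace_C1_def by blast
      obtain w v where wv: "w \<in> L n" "v \<in> L n" "w 0 = x" "v 0 = z"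
        and cl: "\<forall>t\<in>{0..T}. \<bar>xs (\<theta>, x, z) t - w t\<bar> \<le> s / real n \<and> \<bar>zs (\<theta>, x, z) t - v t\<bar> \<le> s / real n \<and>
          \<bar>time_deriv T (xs (\<theta>, x, z)) t - time_deriv T w t\<bar> \<le> s / real n \<and>
          \<bar>time_deriv T (zs (\<theta>, x, z)) t - time_deriv T v t\<bar> \<le> s / real n"
        using ap pK by blast
      have "s / real n \<le> \<eta>2" using sn by simp
      from app[rule_format, OF pK C1[OF wv(1)] C1[OF wv(2)] this] cl
      have pw: "penalty T F G w v \<theta> \<le> A2 * (s / real n)\<^sup>2" by blast
      have "?H w - lam n * penalty T F G w v \<theta> \<le> ?H ?u - lam n * penalty T F G ?u ?v \<theta>"
        using conjunct2[OF am, THEN spec, of "(w, v)"] wv by simp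
      \<comment> \<open>Nonnegativity of the loss bounds the gain of the profile over the approximant.\<close>
      moreover have "?H ?u \<le> 0" unfolding empirical_criterion_def by (simp add: sum_nonneg g_nonneg)
      moreover have "- ?H w \<le> c0"
      proof -
        have wR: "\<bar>xs \<theta>0 t\<bar> \<le> R \<and> \<bar>w t\<bar> \<le> R \<and> \<bar>xs \<theta>0 t - w t\<bar> \<le> 2 * R" if t: "t \<in> {0..T}" for t
        proof -
          have "\<bar>xs (\<theta>, x, z) t - w t\<bar> \<le> s / real n" using cl t by blast
          moreover have "\<bar>xs (\<theta>, x, z) t\<bar> \<le> R0" "\<bar>xs \<theta>0 t\<bar> \<le> R0" using R0(2)[OF _ t] pK by (simp_all add: K'_def)
          ultimately show ?thesis using sn R0(1) unfolding R_def by (simp add: abs_le_iff)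
        qed
        have "\<bar>?H (xs \<theta>0) - ?H w\<bar> \<le> sample_mean E n \<omega> * (2 * R)" by (rule empirical_criterion_lipschitz[OF reg EB E(2) wR])
        also have "\<dots> \<le> a * (2 * R)" using Ea R0 by (intro mult_right_mono) (auto simp: R_def)
        finally have "- ?H w \<le> - ?H (xs \<theta>0) + a * (2 * R)" by (simp add: abs_le_iff)
        moreover have "- ?H (xs \<theta>0) \<le> b" using Gb unfolding empirical_eq_m[OF \<omega>] by (simp add: sample_mean_def sum_negf)
        ultimately show ?thesis by (simp add: c0_def)
      qed
      ultimately have "lam n * penalty T F G ?u ?v \<theta> \<le> c0 + lam n * penalty T F G w v \<theta>" by linarith
      also have "\<dots> \<le> lam n * (s / real n)\<^sup>2 + lam n * (A2 * (s / real n)\<^sup>2)"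
      proof (rule add_mono)
        have "c0 / s\<^sup>2 * (s\<^sup>2) \<le> lam n / (real n)\<^sup>2 * s\<^sup>2" using l by (intro mult_right_mono) auto
        then show "c0 \<le> lam n * (s / real n)\<^sup>2" using s by (simp add: power_divide)
        show "lam n * penalty T F G w v \<theta> \<le> lam n * (A2 * (s / real n)\<^sup>2)"
          using pw lam_pos[OF n1] by (intro mult_left_mono) auto
      qed
      also have "\<dots> = lam n * ((1 + A2) * (s / real n)\<^sup>2)" by (simp add: algebra_simps)
      finally have pu: "penalty T F G ?u ?v \<theta> \<le> (1 + A2) * (s / real n)\<^sup>2" using lam_pos[OF n1] by simp
      have AB: "A1 * ((1 + A2) * (s / real n)\<^sup>2) = (D * s / real n)\<^sup>2"
        by (simp add: power_mult_distrib power_divide D(2))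
      have Dpos: "0 \<le> D * s / real n" using D s by simp
      have "(D * s / real n)\<^sup>2 < \<eta>1\<^sup>2" using Dn Dpos by (intro power_strict_mono) auto
      then have "A1 * ((1 + A2) * (s / real n)\<^sup>2) < \<eta>1\<^sup>2" unfolding AB .
      from dist[rule_format, OF pK C1[OF uL(1)] C1[OF uL(2)] uL(3,4) pu this, unfolded AB]
      have near: "\<bar>?u t - xs (\<theta>, x, z) t\<bar> \<le> D * s / real n" if "t \<in> {0..T}" for t
        using that Dpos abs_le_square_iff[of "?u t - xs (\<theta>, x, z) t" "D * s / real n"] by simp
      have "\<bar>?H ?u - ?H (xs (\<theta>, x, z))\<bar> \<le> sample_mean E n \<omega> * (D * s / real n)"
      proof (rule empirical_criterion_lipschitz[OF reg EB E(2)])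
        fix t assume t: "t \<in> {0..T}"
        have "\<bar>xs (\<theta>, x, z) t\<bar> \<le> R0" using R0(2)[OF _ t] pK by (simp add: K'_def)
        then show "\<bar>?u t\<bar> \<le> R \<and> \<bar>xs (\<theta>, x, z) t\<bar> \<le> R \<and> \<bar>?u t - xs (\<theta>, x, z) t\<bar> \<le> D * s / real n"
          using near[OF t] Dn by (simp add: R_def abs_le_iff)
      qed
      also have "\<dots> \<le> a * (D * s / real n)" using Ea Dpos by (intro mult_right_mono) auto
      also have "\<dots> = \<kappa> / real n" using s(2) by simp
      finally show "\<bar>?H (xh n \<omega> p) - ?H (xs p)\<bar> \<le> \<kappa> / real n" unfolding pp .
    qed
  qed
qed

end

section \<open>The second-order expansion of the loss\<close>

lemma second_order_taylor:
  fixes \<phi> :: "real \<Rightarrow> real"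
  assumes "\<And>s. 0 \<le> s \<Longrightarrow> s \<le> 1 \<Longrightarrow> (\<phi> has_real_derivative \<phi>1 s) (at s)"
    and "\<And>s. 0 \<le> s \<Longrightarrow> s \<le> 1 \<Longrightarrow> (\<phi>1 has_real_derivative \<phi>2 s) (at s)"
  obtains \<sigma> where "0 < \<sigma>" "\<sigma> < 1" "\<phi> 1 = \<phi> 0 + \<phi>1 0 + \<phi>2 \<sigma> / 2"
proof -
  define diff where "diff k = (if k = 0 then \<phi> else if k = 1 then \<phi>1 else \<phi>2)" for k :: nat
  have "\<exists>t>0. t < 1 \<and> \<phi> 1 = (\<Sum>k<2. diff k 0 / fact k * 1 ^ k) + diff 2 t / fact 2 * 1 ^ 2"
  proof (rule Maclaurin)
    show "\<forall>k t. k < 2 \<and> 0 \<le> t \<and> t \<le> 1 \<longrightarrow> DERIV (diff k) t :> diff (Suc k) t"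
      using assms by (auto simp: diff_def less_2_cases_iff)
  qed (auto simp: diff_def)
  then show ?thesis using that by (auto simp: diff_def lessThan_nat_numeral numeral_2_eq_2)
qed

lemma linear_bound_from_basis:
  fixes l :: "'a::euclidean_space \<Rightarrow> real"
  assumes "linear l" "\<And>b. b \<in> Basis \<Longrightarrow> \<bar>l b\<bar> \<le> c"
  shows "\<bar>l v\<bar> \<le> (real DIM('a) * c) * norm v"
proof -
  have "l v = (\<Sum>b\<in>Basis. (v \<bullet> b) * l b)"
    by (subst (1) euclidean_representation[symmetric, of v])
       (simp add: linear_sum[OF assms(1)] linear_scale[OF assms(1)])
  also have "\<bar>\<dots>\<bar> \<le> (\<Sum>b\<in>(Basis :: 'a set). norm v * c)"
  proof (rule order_trans[OF sum_abs], rule sum_mono)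
    fix b :: 'a assume b: "b \<in> Basis"
    show "\<bar>(v \<bullet> b) * l b\<bar> \<le> norm v * c"
      unfolding abs_mult by (intro mult_mono Basis_le_norm assms(2) b) auto
  qed
  finally show ?thesis by (simp add: mult_ac)
qed

context profiling begin

lemma tail_expectation_small:
  fixes E :: "real \<times> real \<Rightarrow> real"
  assumes E: "E \<in> borel_measurable borel" "\<And>z. 0 \<le> E z" "integrable P (\<lambda>\<omega>. E (Y 1 \<omega>, Tm 1 \<omega>))" and \<eta>: "\<eta> > 0"
  obtains k :: nat where "expectation (\<lambda>\<omega>. E (Y 1 \<omega>, Tm 1 \<omega>) * indicator {z. real k < \<bar>fst z\<bar>} (Y 1 \<omega>, Tm 1 \<omega>)) \<le> \<eta>"
    "integrable P (\<lambda>\<omega>. E (Y 1 \<omega>, Tm 1 \<omega>) * indicator {z. real k < \<bar>fst z\<bar>} (Y 1 \<omega>, Tm 1 \<omega>))"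
    "(\<lambda>z. E z * indicator {z :: real \<times> real. real k < \<bar>fst z\<bar>} z) \<in> borel_measurable borel"
proof -
  have mk: "(\<lambda>z. E z * indicator {z :: real \<times> real. real k < \<bar>fst z\<bar>} z) \<in> borel_measurable borel" for k
  proof -
    have "open {z :: real \<times> real. real k < \<bar>fst z\<bar>}" by (intro open_Collect_less continuous_intros)
    then have "{z :: real \<times> real. real k < \<bar>fst z\<bar>} \<in> sets borel" by (rule borel_open)
    from borel_measurable_indicator[OF this] show ?thesis by (rule borel_measurable_times[OF E(1)])
  qed
  note mkZ = comp_measurable[OF mk order_refl]
  have "(\<lambda>k. expectation (\<lambda>\<omega>. E (Y 1 \<omega>, Tm 1 \<omega>) * indicator {z. real k < \<bar>fst z\<bar>} (Y 1 \<omega>, Tm 1 \<omega>))) \<longlonglongrightarrow> expectation (\<lambda>\<omega>. 0)"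
  proof (rule integral_dominated_convergence[where w = "\<lambda>\<omega>. E (Y 1 \<omega>, Tm 1 \<omega>)"])
    show "AE \<omega> in P. (\<lambda>k. E (Y 1 \<omega>, Tm 1 \<omega>) * indicator {z. real k < \<bar>fst z\<bar>} (Y 1 \<omega>, Tm 1 \<omega>)) \<longlonglongrightarrow> 0"
    proof (intro AE_I2 tendsto_eventually)
      fix \<omega>
      obtain k0 :: nat where "\<bar>Y 1 \<omega>\<bar> \<le> real k0" using real_arch_simple by blast
      then show "\<forall>\<^sub>F k in sequentially. E (Y 1 \<omega>, Tm 1 \<omega>) * indicator {z. real k < \<bar>fst z\<bar>} (Y 1 \<omega>, Tm 1 \<omega>) = 0"
        by (intro eventually_sequentiallyI[of k0]) (auto simp: indicator_def)
    qed
    show "AE \<omega> in P. norm (E (Y 1 \<omega>, Tm 1 \<omega>) * indicator {z. real k < \<bar>fst z\<bar>} (Y 1 \<omega>, Tm 1 \<omega>)) \<le> E (Y 1 \<omega>, Tm 1 \<omega>)" for k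
      using E(2) by (intro AE_I2) (auto simp: indicator_def)
  qed (use E mkZ in auto)
  then have "(\<lambda>k. expectation (\<lambda>\<omega>. E (Y 1 \<omega>, Tm 1 \<omega>) * indicator {z. real k < \<bar>fst z\<bar>} (Y 1 \<omega>, Tm 1 \<omega>))) \<longlonglongrightarrow> 0" by simp
  from order_tendstoD(2)[OF this \<eta>] obtain k where
    "expectation (\<lambda>\<omega>. E (Y 1 \<omega>, Tm 1 \<omega>) * indicator {z. real k < \<bar>fst z\<bar>} (Y 1 \<omega>, Tm 1 \<omega>)) < \<eta>"
    unfolding eventually_sequentially by blast
  moreover have "integrable P (\<lambda>\<omega>. E (Y 1 \<omega>, Tm 1 \<omega>) * indicator {z. real k < \<bar>fst z\<bar>} (Y 1 \<omega>, Tm 1 \<omega>))"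
    by (rule Bochner_Integration.integrable_bound[OF E(3) mkZ]) (use E(2) in \<open>intro AE_I2, auto simp: indicator_def\<close>)
  ultimately show ?thesis using mk by (intro that[of k]) auto
qed

text \<open>Uniform continuity on the product of a small ball with the time interval.\<close>

lemma eventually_near_in_time:
  assumes k: "continuous_on ((\<Theta> \<times> \<Gamma>) \<times> {0..T}) (\<lambda>(p, t). k p t :: real)" and \<eta>: "\<eta> > 0"
  shows "\<forall>\<^sub>F p in nhds \<theta>0. p \<in> \<Theta> \<times> \<Gamma> \<and> (\<forall>t\<in>{0..T}. \<bar>k p t - k \<theta>0 t\<bar> \<le> \<eta>)"
proof -
  have "open (\<Theta> \<times> \<Gamma>)" using open_Theta open_Gamma by (rule open_Times)
  then obtain r where r: "r > 0" "cball \<theta>0 r \<subseteq> \<Theta> \<times> \<Gamma>" using theta0 open_contains_cball by blast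
  have "uniformly_continuous_on (cball \<theta>0 r \<times> {0..T}) (\<lambda>(p, t). k p t)"
    by (intro compact_uniformly_continuous continuous_on_subset[OF k] compact_Times) (use r in auto)
  then obtain \<delta> where \<delta>: "\<delta> > 0" and *: "\<forall>x\<in>cball \<theta>0 r \<times> {0..T}. \<forall>x'\<in>cball \<theta>0 r \<times> {0..T}. dist x' x < \<delta> \<longrightarrow>
      dist (case x' of (p, t) \<Rightarrow> k p t) (case x of (p, t) \<Rightarrow> k p t) < \<eta>"
    unfolding uniformly_continuous_on_def using \<eta> by blast
  show ?thesis
    unfolding eventually_nhds_metric
  proof (intro exI[of _ "min \<delta> r"] conjI allI impI ballI)
    fix p assume p: "dist p \<theta>0 < min \<delta> r"
    then have pr: "p \<in> cball \<theta>0 r" by (simp add: dist_commute)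
    then show "p \<in> \<Theta> \<times> \<Gamma>" using r by blast
    fix t assume t: "t \<in> {0..T}"
    have "\<theta>0 \<in> cball \<theta>0 r" using r by simp
    then show "\<bar>k p t - k \<theta>0 t\<bar> \<le> \<eta>"
      using *[rule_format, of "(\<theta>0, t)" "(p, t)"] pr t p by (simp add: dist_Pair_Pair dist_real_def)
  qed (use r \<delta> in auto)
qed

lemma bounded_in_time:
  assumes k: "continuous_on ((\<Theta> \<times> \<Gamma>) \<times> {0..T}) (\<lambda>(p, t). k p t :: real)"
  obtains B where "B \<ge> 0" "\<forall>t\<in>{0..T}. \<bar>k \<theta>0 t\<bar> \<le> B"
proof -
  have "bounded ((\<lambda>(p, t). k p t) ` ({\<theta>0} \<times> {0..T}))"
    by (intro compact_imp_bounded compact_continuous_image continuous_on_subset[OF k] compact_Times) (use theta0 in auto)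
  then obtain B where "B > 0" "\<forall>x\<in>(\<lambda>(p, t). k p t) ` ({\<theta>0} \<times> {0..T}). norm x \<le> B" unfolding bounded_pos by blast
  then show ?thesis by (intro that[of B]) auto
qed

lemma cont_slice:
  assumes "continuous_on ((\<Theta> \<times> \<Gamma>) \<times> {0..T}) (\<lambda>(p, t). k p t :: real)"
  shows "continuous_on {0..T} (k \<theta>0)"
proof -
  have "continuous_on {0..T} (\<lambda>t. (\<theta>0, t))" by (intro continuous_intros)
  moreover have "(\<lambda>t. (\<theta>0, t)) ` {0..T} \<subseteq> (\<Theta> \<times> \<Gamma>) \<times> {0..T}" using theta0 by auto
  ultimately show ?thesis using continuous_on_compose2[OF assms, of "{0..T}" "\<lambda>t. (\<theta>0, t)"] by simp
qed

end

locale sensitivities = profiling T \<Theta> \<Gamma> F G xs zs P Y Tm g \<theta>0 S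
  for T :: real and \<Theta> :: "(real ^ 'd::finite) set" and \<Gamma> :: "(real \<times> real) set"
    and F G :: "real \<times> real \<times> real \<times> (real ^ 'd) \<Rightarrow> real" and xs zs :: "'d param \<Rightarrow> real \<Rightarrow> real"
    and P :: "'w measure" and Y Tm :: "nat \<Rightarrow> 'w \<Rightarrow> real"
    and g :: "real \<times> real \<Rightarrow> real" and \<theta>0 :: "'d param" and S :: "real set" +
  fixes X1 :: "'d param \<Rightarrow> 'd param \<Rightarrow> real \<Rightarrow> real" and X2 :: "'d param \<Rightarrow> 'd param \<Rightarrow> 'd param \<Rightarrow> real \<Rightarrow> real"
  assumes cont_X1: "\<And>v. continuous_on ((\<Theta> \<times> \<Gamma>) \<times> {0..T}) (\<lambda>(p, t). X1 p v t)"
    and cont_X2: "\<And>u v. continuous_on ((\<Theta> \<times> \<Gamma>) \<times> {0..T}) (\<lambda>(p, t). X2 p u v t)"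
    and X1: "\<And>p t v. p \<in> \<Theta> \<times> \<Gamma> \<Longrightarrow> t \<in> {0..T} \<Longrightarrow> ((\<lambda>s. xs (p + s *\<^sub>R v) t) has_real_derivative X1 p v t) (at 0)"
    and X2: "\<And>p t u v. p \<in> \<Theta> \<times> \<Gamma> \<Longrightarrow> t \<in> {0..T} \<Longrightarrow> ((\<lambda>s. X1 (p + s *\<^sub>R u) v t) has_real_derivative X2 p u v t) (at 0)"
    and lin_X1: "\<And>p t. p \<in> \<Theta> \<times> \<Gamma> \<Longrightarrow> t \<in> {0..T} \<Longrightarrow> linear (\<lambda>v. X1 p v t)"
    and lin_X2r: "\<And>p t u. p \<in> \<Theta> \<times> \<Gamma> \<Longrightarrow> t \<in> {0..T} \<Longrightarrow> linear (\<lambda>v. X2 p u v t)"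
    and lin_X2l: "\<And>p t v. p \<in> \<Theta> \<times> \<Gamma> \<Longrightarrow> t \<in> {0..T} \<Longrightarrow> linear (\<lambda>u. X2 p u v t)"
    and X2_sym: "\<And>p t u v. p \<in> \<Theta> \<times> \<Gamma> \<Longrightarrow> t \<in> {0..T} \<Longrightarrow> X2 p u v t = X2 p v u t"
begin

text \<open>Linearity reduces uniformity over all directions to the finitely many basis directions.\<close>

lemma X1_near:
  assumes \<eta>: "\<eta> > 0"
  shows "\<forall>\<^sub>F p in nhds \<theta>0. \<forall>t\<in>{0..T}. \<forall>v. \<bar>X1 p v t - X1 \<theta>0 v t\<bar> \<le> \<eta> * norm v"
proof -
  let ?c = "\<eta> / real DIM('d param)"
  have c: "?c > 0" using \<eta> by (intro divide_pos_pos) auto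
  have "\<forall>\<^sub>F p in nhds \<theta>0. \<forall>b\<in>Basis. p \<in> \<Theta> \<times> \<Gamma> \<and> (\<forall>t\<in>{0..T}. \<bar>X1 p b t - X1 \<theta>0 b t\<bar> \<le> ?c)"
    by (intro eventually_ball_finite finite_Basis ballI eventually_near_in_time[OF cont_X1 c])
  then show ?thesis
  proof eventually_elim
    case (elim p)
    then have p: "p \<in> \<Theta> \<times> \<Gamma>" using nonempty_Basis by blast
    show ?case
    proof (intro ballI allI)
      fix t v assume t: "t \<in> {0..T}"
      have "\<bar>(\<lambda>v. X1 p v t - X1 \<theta>0 v t) v\<bar> \<le> (real DIM('d param) * ?c) * norm v"
        by (rule linear_bound_from_basis[OF linear_compose_sub[OF lin_X1[OF p t] lin_X1[OF theta0 t]]]) (use elim t in blast)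
      then show "\<bar>X1 p v t - X1 \<theta>0 v t\<bar> \<le> \<eta> * norm v" by simp
    qed
  qed
qed

lemma X2_near:
  assumes \<eta>: "\<eta> > 0"
  shows "\<forall>\<^sub>F p in nhds \<theta>0. \<forall>t\<in>{0..T}. \<forall>v. \<bar>X2 p v v t - X2 \<theta>0 v v t\<bar> \<le> \<eta> * (norm v)\<^sup>2"
proof -
  define N where "N = real DIM('d param)"
  have N: "N > 0" by (simp add: N_def)
  let ?c = "\<eta> / (N * N)"
  have c: "?c > 0" using \<eta> N by simp
  have "\<forall>\<^sub>F p in nhds \<theta>0. \<forall>b\<in>Basis. \<forall>b'\<in>Basis. p \<in> \<Theta> \<times> \<Gamma> \<and> (\<forall>t\<in>{0..T}. \<bar>X2 p b b' t - X2 \<theta>0 b b' t\<bar> \<le> ?c)"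
    by (intro eventually_ball_finite finite_Basis ballI eventually_near_in_time[OF cont_X2 c])
  then show ?thesis
  proof eventually_elim
    case (elim p)
    then have p: "p \<in> \<Theta> \<times> \<Gamma>" using nonempty_Basis by blast
    show ?case
    proof (intro ballI allI)
      fix t v assume t: "t \<in> {0..T}"
      have 1: "\<bar>X2 p b v t - X2 \<theta>0 b v t\<bar> \<le> (N * ?c) * norm v" if b: "b \<in> Basis" for b
        unfolding N_def
        by (rule linear_bound_from_basis[OF linear_compose_sub[OF lin_X2r[OF p t] lin_X2r[OF theta0 t]]])
          (use elim t b in \<open>unfold N_def, blast\<close>)
      have "\<bar>X2 p v v t - X2 \<theta>0 v v t\<bar> \<le> (N * ((N * ?c) * norm v)) * norm v"
        unfolding N_def
        by (rule linear_bound_from_basis[OF linear_compose_sub[OF lin_X2l[OF p t] lin_X2l[OF theta0 t]]])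
          (use 1 in \<open>unfold N_def, blast\<close>)
      then show "\<bar>X2 p v v t - X2 \<theta>0 v v t\<bar> \<le> \<eta> * (norm v)\<^sup>2"
        using N by (simp add: power2_eq_square mult_ac)
    qed
  qed
qed

lemma X_bounds:
  obtains B where "B \<ge> 1" "\<forall>t\<in>{0..T}. \<forall>v. \<bar>X1 \<theta>0 v t\<bar> \<le> B * norm v" "\<forall>t\<in>{0..T}. \<forall>v. \<bar>X2 \<theta>0 v v t\<bar> \<le> B * (norm v)\<^sup>2"
proof -
  define N where "N = real DIM('d param)"
  have N: "N > 0" by (simp add: N_def)
  have "\<exists>B1. \<forall>b. 0 \<le> B1 b \<and> (\<forall>t\<in>{0..T}. \<bar>X1 \<theta>0 b t\<bar> \<le> B1 b)"
    by (rule choice) (use bounded_in_time[OF cont_X1] in blast)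
  then obtain B1 where B1: "\<And>b. 0 \<le> B1 b" "\<And>b t. t \<in> {0..T} \<Longrightarrow> \<bar>X1 \<theta>0 b t\<bar> \<le> B1 b" by blast
  have "\<exists>B2. \<forall>bb. 0 \<le> B2 bb \<and> (\<forall>t\<in>{0..T}. \<bar>X2 \<theta>0 (fst bb) (snd bb) t\<bar> \<le> B2 bb)"
    by (rule choice) (use bounded_in_time[OF cont_X2] in blast)
  then obtain B2 where B2: "\<And>bb. 0 \<le> B2 bb" "\<And>bb t. t \<in> {0..T} \<Longrightarrow> \<bar>X2 \<theta>0 (fst bb) (snd bb) t\<bar> \<le> B2 bb" by blast
  define C where "C = (\<Sum>b\<in>Basis. B1 b) + (\<Sum>bb\<in>Basis \<times> Basis. B2 bb)"
  have C1: "\<bar>X1 \<theta>0 b t\<bar> \<le> C" if "b \<in> Basis" "t \<in> {0..T}" for b t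
  proof -
    have "B1 b \<le> (\<Sum>b\<in>Basis. B1 b)" using that B1(1) by (intro member_le_sum) auto
    moreover have "0 \<le> (\<Sum>bb\<in>(Basis :: 'd param set) \<times> (Basis :: 'd param set). B2 bb)" using B2(1) by (intro sum_nonneg)
    ultimately show ?thesis using B1(2)[OF that(2), of b] unfolding C_def by linarith
  qed
  have C2: "\<bar>X2 \<theta>0 b b' t\<bar> \<le> C" if "b \<in> Basis" "b' \<in> Basis" "t \<in> {0..T}" for b b' t
  proof -
    have "B2 (b, b') \<le> (\<Sum>bb\<in>Basis \<times> Basis. B2 bb)" using that B2(1) by (intro member_le_sum) auto
    moreover have "0 \<le> (\<Sum>b\<in>(Basis :: 'd param set). B1 b)" using B1(1) by (intro sum_nonneg)
    ultimately show ?thesis using B2(2)[OF that(3), of "(b, b')"] unfolding C_def by simp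
  qed
  have b1: "\<bar>X1 \<theta>0 v t\<bar> \<le> (N * C) * norm v" if t: "t \<in> {0..T}" for t v
    unfolding N_def by (rule linear_bound_from_basis[OF lin_X1[OF theta0 t]]) (use C1 t in blast)
  have b2: "\<bar>X2 \<theta>0 v v t\<bar> \<le> (N * (N * C)) * (norm v)\<^sup>2" if t: "t \<in> {0..T}" for t v
  proof -
    have 1: "\<bar>X2 \<theta>0 b v t\<bar> \<le> (N * C) * norm v" if b: "b \<in> Basis" for b
      unfolding N_def by (rule linear_bound_from_basis[OF lin_X2r[OF theta0 t]]) (use C2 t b in blast)
    have "\<bar>X2 \<theta>0 v v t\<bar> \<le> (N * ((N * C) * norm v)) * norm v"
      unfolding N_def by (rule linear_bound_from_basis[OF lin_X2l[OF theta0 t]]) (use 1 in \<open>unfold N_def, blast\<close>)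
    then show ?thesis by (simp add: power2_eq_square mult_ac)
  qed
  define B where "B = max 1 (max (N * C) (N * (N * C)))"
  have "B \<ge> 1" "N * C \<le> B" "N * (N * C) \<le> B" by (auto simp: B_def)
  moreover from this have "\<bar>X1 \<theta>0 v t\<bar> \<le> B * norm v" "\<bar>X2 \<theta>0 v v t\<bar> \<le> B * (norm v)\<^sup>2" if "t \<in> {0..T}" for t v
    using order_trans[OF b1[OF that, of v] mult_right_mono[of "N * C" B "norm v"]]
      order_trans[OF b2[OF that, of v] mult_right_mono[of "N * (N * C)" B "(norm v)\<^sup>2"]] by simp_all
  ultimately show ?thesis by (intro that[of B]) auto
qed

text \<open>Taylor's formula for the loss along the segment, by the chain rule; the intermediate point depends on
  the observation.\<close>

lemma loss_along_ray:
  assumes seg: "\<And>s. 0 \<le> s \<Longrightarrow> s \<le> 1 \<Longrightarrow> \<theta>0 + s *\<^sub>R v \<in> \<Theta> \<times> \<Gamma>" and t: "t \<in> {0..T}"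
  obtains \<sigma> where "0 < \<sigma>" "\<sigma> < 1"
    "g (y, xs (\<theta>0 + v) t) = g (y, xs \<theta>0 t) + loss_dx g (y, xs \<theta>0 t) * X1 \<theta>0 v t +
      (loss_dx g (y, xs (\<theta>0 + \<sigma> *\<^sub>R v) t) * X2 (\<theta>0 + \<sigma> *\<^sub>R v) v v t +
       loss_dxx g (y, xs (\<theta>0 + \<sigma> *\<^sub>R v) t) * (X1 (\<theta>0 + \<sigma> *\<^sub>R v) v t)\<^sup>2) / 2"
proof -
  let ?x = "\<lambda>s. xs (\<theta>0 + s *\<^sub>R v) t" and ?x1 = "\<lambda>s. X1 (\<theta>0 + s *\<^sub>R v) v t" and ?x2 = "\<lambda>s. X2 (\<theta>0 + s *\<^sub>R v) v v t"
  have d1: "(?x has_real_derivative ?x1 s) (at s)" if "0 \<le> s" "s \<le> 1" for s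
    by (rule DERIV_along_line[OF X1[OF seg[OF that] t]])
  have d2: "(?x1 has_real_derivative ?x2 s) (at s)" if "0 \<le> s" "s \<le> 1" for s
    by (rule DERIV_along_line[of "\<lambda>p. X1 p v t", OF X2[OF seg[OF that] t]])
  have e1: "((\<lambda>s. g (y, ?x s)) has_real_derivative loss_dx g (y, ?x s) * ?x1 s) (at s)" if "0 \<le> s" "s \<le> 1" for s
    by (rule DERIV_chain2[OF loss_derivatives(1)[OF g_C2] d1[OF that]])
  have e2: "((\<lambda>s. loss_dx g (y, ?x s) * ?x1 s) has_real_derivative
      loss_dx g (y, ?x s) * ?x2 s + loss_dxx g (y, ?x s) * (?x1 s)\<^sup>2) (at s)" if "0 \<le> s" "s \<le> 1" for s
    using DERIV_mult[OF DERIV_chain2[OF loss_derivatives(2)[OF g_C2] d1[OF that]] d2[OF that]]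
    by (simp add: power2_eq_square algebra_simps)
  obtain \<sigma> where "0 < \<sigma>" "\<sigma> < 1" "g (y, ?x 1) = g (y, ?x 0) + loss_dx g (y, ?x 0) * ?x1 0 +
      (loss_dx g (y, ?x \<sigma>) * ?x2 \<sigma> + loss_dxx g (y, ?x \<sigma>) * (?x1 \<sigma>)\<^sup>2) / 2"
    by (rule second_order_taylor[OF e1 e2])
  then show ?thesis by (intro that[of \<sigma>]) simp_all
qed

definition gx :: "real \<times> real \<Rightarrow> real" where "gx z = loss_dx g (fst z, xs \<theta>0 (clamp (snd z)))"
definition gxx :: "real \<times> real \<Rightarrow> real" where "gxx z = loss_dxx g (fst z, xs \<theta>0 (clamp (snd z)))"

text \<open>The difference of the second derivatives at the intermediate point and at \<open>\<theta>0\<close> is bounded by an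
  integrable function with small mean.  For \<open>g\<^sub>x\<close> the envelope of \<open>g\<^sub>x\<^sub>x\<close> is a Lipschitz
  constant.  For \<open>g\<^sub>x\<^sub>x\<close> itself there is only uniform continuity on compact sets, so outcomes
  with large \<open>\<bar>y\<bar>\<close> are cut off and bounded by the tail of the envelope.\<close>

lemma loss_expansion:
  assumes \<epsilon>: "\<epsilon> > 0" and r0: "r0 > 0" "cball \<theta>0 r0 \<subseteq> \<Theta> \<times> \<Gamma>"
  shows "\<exists>\<delta>>0. \<delta> \<le> r0 \<and> (\<exists>\<rho>\<in>borel_measurable borel. (\<forall>z. 0 \<le> \<rho> z) \<and> integrable P (\<lambda>\<omega>. \<rho> (Y 1 \<omega>, Tm 1 \<omega>)) \<and>
    expectation (\<lambda>\<omega>. \<rho> (Y 1 \<omega>, Tm 1 \<omega>)) \<le> \<epsilon> \<and>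
    (\<forall>y\<in>S. \<forall>t\<in>{0..T}. \<forall>v. norm v \<le> \<delta> \<longrightarrow>
      \<bar>m (\<theta>0 + v) (y, t) - m \<theta>0 (y, t) + gx (y, t) * X1 \<theta>0 v t + (gx (y, t) * X2 \<theta>0 v v t + gxx (y, t) * (X1 \<theta>0 v t)\<^sup>2) / 2\<bar>
      \<le> \<rho> (y, t) * (norm v)\<^sup>2))"
proof -
  obtain B where B: "B \<ge> 1" "\<forall>t\<in>{0..T}. \<forall>v. \<bar>X1 \<theta>0 v t\<bar> \<le> B * norm v" "\<forall>t\<in>{0..T}. \<forall>v. \<bar>X2 \<theta>0 v v t\<bar> \<le> B * (norm v)\<^sup>2"
    by (rule X_bounds)
  obtain R where R: "R \<ge> 0" "\<And>p t. p \<in> cball \<theta>0 r0 \<Longrightarrow> t \<in> {0..T} \<Longrightarrow> \<bar>xs p t\<bar> \<le> R"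
    by (rule bounded_paths[OF compact_cball r0(2)]) blast
  obtain E1 where E1: "E1 \<in> borel_measurable borel" "\<And>z. 0 \<le> E1 z" "integrable P (\<lambda>\<omega>. E1 (Y 1 \<omega>, Tm 1 \<omega>))"
    and E1B: "\<And>y t x. y \<in> S \<Longrightarrow> \<bar>x\<bar> \<le> R \<Longrightarrow> \<bar>loss_dx g (y, x)\<bar> \<le> E1 (y, t)" by (rule envelope_dx[of R]) blast
  obtain E2 where E2: "E2 \<in> borel_measurable borel" "\<And>z. 0 \<le> E2 z" "integrable P (\<lambda>\<omega>. E2 (Y 1 \<omega>, Tm 1 \<omega>))"
    and E2B: "\<And>y t x. y \<in> S \<Longrightarrow> \<bar>x\<bar> \<le> R \<Longrightarrow> \<bar>loss_dxx g (y, x)\<bar> \<le> E2 (y, t)" by (rule envelope_dxx[of R]) blast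
  have B2: "B\<^sup>2 > 0" using B by simp
  have "\<epsilon> / (2 * B\<^sup>2) > 0" using \<epsilon> B2 by simp
  then obtain k :: nat where k: "expectation (\<lambda>\<omega>. E2 (Y 1 \<omega>, Tm 1 \<omega>) * indicator {z. real k < \<bar>fst z\<bar>} (Y 1 \<omega>, Tm 1 \<omega>)) \<le> \<epsilon> / (2 * B\<^sup>2)"
    and ki: "integrable P (\<lambda>\<omega>. E2 (Y 1 \<omega>, Tm 1 \<omega>) * indicator {z. real k < \<bar>fst z\<bar>} (Y 1 \<omega>, Tm 1 \<omega>))"
    and km: "(\<lambda>z. E2 z * indicator {z :: real \<times> real. real k < \<bar>fst z\<bar>} z) \<in> borel_measurable borel"
    by (rule tail_expectation_small[OF E2])
  \<comment> \<open>The oscillation allowed to \<open>g\<^sub>x\<^sub>x\<close> for outcomes with \<open>\<bar>y\<bar> \<le> k\<close>.\<close>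
  define w where "w = \<epsilon> / (2 * B\<^sup>2)"
  have w: "w > 0" using \<epsilon> B2 by (simp add: w_def)
  have "uniformly_continuous_on (cball 0 (real k) \<times> cball 0 R) (loss_dxx g)"
    by (intro compact_uniformly_continuous continuous_on_subset[OF loss_derivatives(5)[OF g_C2]] compact_Times) auto
  then obtain d where d: "d > 0" and dd: "\<forall>x\<in>cball 0 (real k) \<times> cball 0 R. \<forall>x'\<in>cball 0 (real k) \<times> cball 0 R. dist x' x < d \<longrightarrow>
      dist (loss_dxx g x') (loss_dxx g x) < w"
    unfolding uniformly_continuous_on_def using w by blast
  define I where "I = expectation (\<lambda>\<omega>. E1 (Y 1 \<omega>, Tm 1 \<omega>)) + (3 * B + 1) * expectation (\<lambda>\<omega>. E2 (Y 1 \<omega>, Tm 1 \<omega>)) + 1"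
  have I: "I \<ge> 1"
    unfolding I_def using B E1(2) E2(2) by (simp add: Bochner_Integration.integral_nonneg)
  define \<eta> where "\<eta> = min (min 1 (d / 2)) (\<epsilon> / (2 * I))"
  have \<eta>: "\<eta> > 0" "\<eta> \<le> 1" "\<eta> < d" "\<eta> * I \<le> \<epsilon> / 2"
  proof -
    have "\<eta> \<le> min 1 (d / 2)" unfolding \<eta>_def by (rule min.cobounded1)
    then show "\<eta> \<le> 1" "\<eta> < d" using d by simp_all
    show "\<eta> > 0" using d \<epsilon> I by (simp add: \<eta>_def)
    have "\<eta> * I \<le> (\<epsilon> / (2 * I)) * I" using I by (intro mult_right_mono) (auto simp: \<eta>_def)
    then show "\<eta> * I \<le> \<epsilon> / 2" using I by simp
  qed
  have "\<forall>\<^sub>F p in nhds \<theta>0. (p \<in> \<Theta> \<times> \<Gamma> \<and> (\<forall>t\<in>{0..T}. \<bar>xs p t - xs \<theta>0 t\<bar> \<le> \<eta>)) \<and>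
      (\<forall>t\<in>{0..T}. \<forall>v. \<bar>X1 p v t - X1 \<theta>0 v t\<bar> \<le> \<eta> * norm v) \<and> (\<forall>t\<in>{0..T}. \<forall>v. \<bar>X2 p v v t - X2 \<theta>0 v v t\<bar> \<le> \<eta> * (norm v)\<^sup>2)"
    by (intro eventually_conj eventually_near_in_time[OF cont_solution \<eta>(1)] X1_near X2_near \<eta>(1))
  then obtain \<delta>0 where \<delta>0: "\<delta>0 > 0" and nr: "\<And>p. dist p \<theta>0 < \<delta>0 \<Longrightarrow> (p \<in> \<Theta> \<times> \<Gamma> \<and> (\<forall>t\<in>{0..T}. \<bar>xs p t - xs \<theta>0 t\<bar> \<le> \<eta>)) \<and>
      (\<forall>t\<in>{0..T}. \<forall>v. \<bar>X1 p v t - X1 \<theta>0 v t\<bar> \<le> \<eta> * norm v) \<and> (\<forall>t\<in>{0..T}. \<forall>v. \<bar>X2 p v v t - X2 \<theta>0 v v t\<bar> \<le> \<eta> * (norm v)\<^sup>2)"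
    unfolding eventually_nhds_metric by blast
  define \<delta> where "\<delta> = min r0 (\<delta>0 / 2)"
  have \<delta>: "\<delta> > 0" "\<delta> \<le> r0" "\<delta> < \<delta>0" using \<delta>0 r0 by (auto simp: \<delta>_def)
  \<comment> \<open>In turn: the change of the second sensitivity; of \<open>g\<^sub>x\<close> and of the squared first sensitivity; of \<open>g\<^sub>x\<^sub>x\<close> below and above the cut-off.\<close>
  define \<rho> where "\<rho> z = (\<eta> * E1 z + \<eta> * (3 * B + 1) * E2 z + B\<^sup>2 * w + 2 * B\<^sup>2 * (E2 z * indicator {z. real k < \<bar>fst z\<bar>} z)) / 2" for z
  have \<rho>m: "\<rho> \<in> borel_measurable borel"
    unfolding \<rho>_def[abs_def] using E1(1) E2(1) km by measurable
  have \<rho>0: "0 \<le> \<rho> z" for z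
    unfolding \<rho>_def using E1(2) E2(2) \<eta>(1) w B by (auto intro!: add_nonneg_nonneg mult_nonneg_nonneg)
  have \<rho>i: "integrable P (\<lambda>\<omega>. \<rho> (Y 1 \<omega>, Tm 1 \<omega>))"
    unfolding \<rho>_def
    by (intro integrable_divide Bochner_Integration.integrable_add integrable_mult_right E1 E2 ki integrable_const)
  have "expectation (\<lambda>\<omega>. \<rho> (Y 1 \<omega>, Tm 1 \<omega>)) = (\<eta> * expectation (\<lambda>\<omega>. E1 (Y 1 \<omega>, Tm 1 \<omega>)) +
      \<eta> * (3 * B + 1) * expectation (\<lambda>\<omega>. E2 (Y 1 \<omega>, Tm 1 \<omega>)) + B\<^sup>2 * w +
      2 * B\<^sup>2 * expectation (\<lambda>\<omega>. E2 (Y 1 \<omega>, Tm 1 \<omega>) * indicator {z. real k < \<bar>fst z\<bar>} (Y 1 \<omega>, Tm 1 \<omega>))) / 2"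
    unfolding \<rho>_def using E1(3) E2(3) ki by (simp add: prob_space)
  also have "\<dots> \<le> (\<eta> * I + B\<^sup>2 * w + 2 * B\<^sup>2 * (\<epsilon> / (2 * B\<^sup>2))) / 2"
  proof (intro divide_right_mono add_mono mult_left_mono k)
    have "\<eta> * expectation (\<lambda>\<omega>. E1 (Y 1 \<omega>, Tm 1 \<omega>)) + \<eta> * (3 * B + 1) * expectation (\<lambda>\<omega>. E2 (Y 1 \<omega>, Tm 1 \<omega>)) = \<eta> * (I - 1)"
      by (simp add: I_def algebra_simps)
    also have "\<dots> \<le> \<eta> * I" using \<eta>(1) by simp
    finally show "\<eta> * expectation (\<lambda>\<omega>. E1 (Y 1 \<omega>, Tm 1 \<omega>)) + \<eta> * (3 * B + 1) * expectation (\<lambda>\<omega>. E2 (Y 1 \<omega>, Tm 1 \<omega>)) \<le> \<eta> * I" .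
  qed auto
  also have "\<dots> \<le> (\<epsilon> / 2 + \<epsilon> / 2 + \<epsilon>) / 2" using \<eta>(4) B2 by (simp add: w_def)
  finally have \<rho>e: "expectation (\<lambda>\<omega>. \<rho> (Y 1 \<omega>, Tm 1 \<omega>)) \<le> \<epsilon>" by simp
  have main: "\<bar>m (\<theta>0 + v) (y, t) - m \<theta>0 (y, t) + gx (y, t) * X1 \<theta>0 v t + (gx (y, t) * X2 \<theta>0 v v t + gxx (y, t) * (X1 \<theta>0 v t)\<^sup>2) / 2\<bar>
      \<le> \<rho> (y, t) * (norm v)\<^sup>2" if y: "y \<in> S" and t: "t \<in> {0..T}" and v: "norm v \<le> \<delta>" for y t v
  proof -
    have seg: "dist (\<theta>0 + s *\<^sub>R v) \<theta>0 < \<delta>0" "\<theta>0 + s *\<^sub>R v \<in> cball \<theta>0 r0" if "0 \<le> s" "s \<le> 1" for s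
    proof -
      have "norm (s *\<^sub>R v) \<le> 1 * norm v" unfolding norm_scaleR using that by (intro mult_right_mono) auto
      then show "dist (\<theta>0 + s *\<^sub>R v) \<theta>0 < \<delta>0" "\<theta>0 + s *\<^sub>R v \<in> cball \<theta>0 r0" using v \<delta> by (simp_all add: dist_norm)
    qed
    have segU: "\<theta>0 + s *\<^sub>R v \<in> \<Theta> \<times> \<Gamma>" if "0 \<le> s" "s \<le> 1" for s using seg(2)[OF that] r0(2) by blast
    obtain \<sigma> where \<sigma>: "0 < \<sigma>" "\<sigma> < 1" and tay: "g (y, xs (\<theta>0 + v) t) = g (y, xs \<theta>0 t) + loss_dx g (y, xs \<theta>0 t) * X1 \<theta>0 v t +
      (loss_dx g (y, xs (\<theta>0 + \<sigma> *\<^sub>R v) t) * X2 (\<theta>0 + \<sigma> *\<^sub>R v) v v t +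
       loss_dxx g (y, xs (\<theta>0 + \<sigma> *\<^sub>R v) t) * (X1 (\<theta>0 + \<sigma> *\<^sub>R v) v t)\<^sup>2) / 2"
      by (rule loss_along_ray[OF segU t])
    let ?p = "\<theta>0 + \<sigma> *\<^sub>R v"
    define n2 where "n2 = (norm v)\<^sup>2"
    have n2: "n2 \<ge> 0" by (simp add: n2_def)
    define a a0 b b0 c c0 A A0 D D0 where "a = X2 ?p v v t" "a0 = X2 \<theta>0 v v t" "b = X1 ?p v t" "b0 = X1 \<theta>0 v t"
      "c = xs ?p t" "c0 = xs \<theta>0 t" "A = loss_dx g (y, c)" "A0 = loss_dx g (y, c0)" "D = loss_dxx g (y, c)" "D0 = loss_dxx g (y, c0)"
    note defs = this
    have s01: "0 \<le> \<sigma>" "\<sigma> \<le> 1" using \<sigma> by auto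
    note nrp = nr[OF seg(1)[OF s01]]
    have cc: "\<bar>c - c0\<bar> \<le> \<eta>" using nrp t unfolding defs by blast
    have bb: "\<bar>b - b0\<bar> \<le> \<eta> * norm v" using nrp t unfolding defs by blast
    have aa: "\<bar>a - a0\<bar> \<le> \<eta> * n2" using nrp t unfolding defs n2_def by blast
    have b0: "\<bar>b0\<bar> \<le> B * norm v" using B(2) t unfolding defs by blast
    have a0: "\<bar>a0\<bar> \<le> B * n2" using B(3) t unfolding defs n2_def by blast
    have cR: "\<bar>c\<bar> \<le> R" "\<bar>c0\<bar> \<le> R" unfolding defs using R(2)[OF seg(2)[OF s01] t] R(2)[of \<theta>0, OF _ t] r0 by auto
    have AE: "\<bar>A\<bar> \<le> E1 (y, t)" unfolding \<open>A = _\<close> by (rule E1B[OF y cR(1)])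
    have DE: "\<bar>D\<bar> \<le> E2 (y, t)" "\<bar>D0\<bar> \<le> E2 (y, t)" unfolding \<open>D = _\<close> \<open>D0 = _\<close> by (rule E2B[OF y cR(1)], rule E2B[OF y cR(2)])
    have AA: "\<bar>A - A0\<bar> \<le> E2 (y, t) * \<eta>"
    proof -
      have "\<bar>A - A0\<bar> \<le> E2 (y, t) * \<bar>c - c0\<bar>"
        unfolding \<open>A = _\<close> \<open>A0 = _\<close> by (rule lipschitz_from_derivative[OF loss_derivatives(2)[OF g_C2] E2B[OF y] cR])
      also have "\<dots> \<le> E2 (y, t) * \<eta>" using cc E2(2) by (intro mult_left_mono) auto
      finally show ?thesis .
    qed
    have DD: "\<bar>D - D0\<bar> \<le> w + 2 * (E2 (y, t) * indicator {z. real k < \<bar>fst z\<bar>} (y, t))"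
    proof (cases "real k < \<bar>y\<bar>")
      case True
      then show ?thesis using DE w by (simp add: abs_le_iff)
    next
      case False
      have "dist (y, c) (y, c0) < d" using cc \<eta>(3) by (simp add: dist_Pair_Pair dist_real_def)
      then have "\<bar>D - D0\<bar> < w" using dd[rule_format, of "(y, c0)" "(y, c)"] False cR unfolding \<open>D = _\<close> \<open>D0 = _\<close> by (simp add: dist_real_def)
      then show ?thesis using False by simp
    qed
    have bsq: "\<bar>b\<^sup>2 - b0\<^sup>2\<bar> \<le> \<eta> * (2 * B + 1) * n2"
    proof -
      have "\<bar>b + b0\<bar> \<le> (2 * B + 1) * norm v"
      proof -
        have "\<eta> * norm v \<le> 1 * norm v" using \<eta>(2) by (intro mult_right_mono) auto
        then show ?thesis using bb b0 by (simp add: abs_le_iff algebra_simps)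
      qed
      then have "\<bar>b - b0\<bar> * \<bar>b + b0\<bar> \<le> (\<eta> * norm v) * ((2 * B + 1) * norm v)" using bb \<eta>(1) by (intro mult_mono) auto
      moreover have "b\<^sup>2 - b0\<^sup>2 = (b - b0) * (b + b0)" by (simp add: power2_eq_square algebra_simps)
      ultimately show ?thesis by (simp add: abs_mult n2_def power2_eq_square mult_ac)
    qed
    have b0sq: "b0\<^sup>2 \<le> B\<^sup>2 * n2"
    proof -
      have "\<bar>b0\<bar>\<^sup>2 \<le> (B * norm v)\<^sup>2" by (rule power_mono[OF b0]) simp
      then show ?thesis by (simp add: power_mult_distrib n2_def)
    qed
    define J where "J = indicator {z :: real \<times> real. real k < \<bar>fst z\<bar>} (y, t) * E2 (y, t)"
    have J: "J \<ge> 0" using E2(2) by (simp add: J_def)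
    have p1: "\<bar>A * (a - a0)\<bar> \<le> E1 (y, t) * (\<eta> * n2)" unfolding abs_mult using AE aa E1(2) by (intro mult_mono) auto
    have p2: "\<bar>(A - A0) * a0\<bar> \<le> (E2 (y, t) * \<eta>) * (B * n2)" unfolding abs_mult using AA a0 E2(2) \<eta>(1) by (intro mult_mono) auto
    have p3: "\<bar>D * (b\<^sup>2 - b0\<^sup>2)\<bar> \<le> E2 (y, t) * (\<eta> * (2 * B + 1) * n2)" unfolding abs_mult using DE(1) bsq E2(2) by (intro mult_mono) auto
    have p4: "\<bar>(D - D0) * b0\<^sup>2\<bar> \<le> (w + 2 * J) * (B\<^sup>2 * n2)"
      unfolding abs_mult using DD b0sq J w by (intro mult_mono) (auto simp: J_def mult.commute)
    have "A * a + D * b\<^sup>2 - (A0 * a0 + D0 * b0\<^sup>2) = A * (a - a0) + (A - A0) * a0 + D * (b\<^sup>2 - b0\<^sup>2) + (D - D0) * b0\<^sup>2"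
      by (simp add: algebra_simps)
    then have "\<bar>A * a + D * b\<^sup>2 - (A0 * a0 + D0 * b0\<^sup>2)\<bar> \<le> E1 (y, t) * (\<eta> * n2) + (E2 (y, t) * \<eta>) * (B * n2) +
        E2 (y, t) * (\<eta> * (2 * B + 1) * n2) + (w + 2 * J) * (B\<^sup>2 * n2)"
      using p1 p2 p3 p4 unfolding abs_le_iff by linarith
    also have "\<dots> = 2 * \<rho> (y, t) * n2"
      by (simp add: \<rho>_def J_def algebra_simps)
    finally have fin: "\<bar>A * a + D * b\<^sup>2 - (A0 * a0 + D0 * b0\<^sup>2)\<bar> \<le> 2 * \<rho> (y, t) * n2" .
    have ct: "clamp t = t" by (rule clamp_id[OF t])
    have eq: "m (\<theta>0 + v) (y, t) - m \<theta>0 (y, t) + gx (y, t) * X1 \<theta>0 v t + (gx (y, t) * X2 \<theta>0 v v t + gxx (y, t) * (X1 \<theta>0 v t)\<^sup>2) / 2 =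
        - (A * a + D * b\<^sup>2 - (A0 * a0 + D0 * b0\<^sup>2)) / 2"
      unfolding m_def gx_def gxx_def fst_conv snd_conv ct tay defs by (simp add: field_simps)
    have half: "\<bar>- q / 2\<bar> \<le> c" if "\<bar>q\<bar> \<le> 2 * c" for q c :: real using that by linarith
    show ?thesis unfolding eq by (rule half) (use fin in \<open>simp add: n2_def mult.assoc\<close>)
  qed
  show ?thesis
    using \<delta> \<rho>m \<rho>0 \<rho>i \<rho>e main by (intro exI[of _ \<delta>] conjI bexI[of _ \<rho>]) auto
qed

end

section \<open>Asymptotic normality\<close>

lemma (in prob_space) uniformly_tight_likely:
  fixes X :: "nat \<Rightarrow> 'a \<Rightarrow> 'b::metric_space"
  assumes tight: "uniformly_tight M S X" and X: "\<And>n. 1 \<le> n \<Longrightarrow> X n \<in> borel_measurable M" and e: "e > 0"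
  shows "\<exists>K. compact K \<and> K \<subseteq> S \<and> likely M e (\<lambda>n \<omega>. X n \<omega> \<in> K)"
proof -
  obtain K where K: "compact K" "K \<subseteq> S" and s: "(SUP n\<in>{1..}. prob {\<omega>\<in>space M. X n \<omega> \<notin> K}) < e"
    using tight e unfolding uniformly_tight_def by blast
  have "likely M e (\<lambda>n \<omega>. X n \<omega> \<in> K)"
    unfolding likely_def
  proof (rule eventually_sequentiallyI[of 1])
    fix n :: nat assume n: "1 \<le> n"
    have bdd: "bdd_above ((\<lambda>n. prob {\<omega>\<in>space M. X n \<omega> \<notin> K}) ` {1..})" by (intro bdd_aboveI2[of _ _ 1]) simp
    have "prob {\<omega>\<in>space M. X n \<omega> \<notin> K} \<le> (SUP n\<in>{1..}. prob {\<omega>\<in>space M. X n \<omega> \<notin> K})"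
      by (rule cSUP_upper[OF _ bdd]) (use n in simp)
    then have small: "prob {\<omega>\<in>space M. X n \<omega> \<notin> K} \<le> e" using s by linarith
    have B: "X n -` K \<inter> space M \<in> sets M"
      by (rule measurable_sets[OF X[OF n]]) (rule borel_closed[OF compact_imp_closed[OF K(1)]])
    have "space M - (X n -` K \<inter> space M) = {\<omega>\<in>space M. X n \<omega> \<notin> K}" by blast
    then have "1 - e \<le> prob (X n -` K \<inter> space M)" using prob_compl[OF B] small by simp
    then show "\<exists>B\<in>sets M. 1 - e \<le> prob B \<and> (\<forall>\<omega>\<in>B. X n \<omega> \<in> K)" using B by (intro bexI[of _ "X n -` K \<inter> space M"]) auto
  qed
  then show ?thesis using K by blast
qed

context profiling begin

lemma exact_near_maximal:
  assumes mx: "\<And>n \<omega>. n \<ge> 1 \<Longrightarrow> \<omega> \<in> space P \<Longrightarrow>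
      is_arg_max (\<lambda>p. empirical_criterion g Y Tm n \<omega> (xs p)) (\<lambda>p. p \<in> \<Theta> \<times> \<Gamma>) (q n \<omega>)"
    and K: "K \<subseteq> \<Theta> \<times> \<Gamma>" and \<kappa>: "\<kappa> > 0" and e: "e > 0"
  shows "likely P e (\<lambda>n \<omega>. \<forall>p\<in>K. sample_mean (m p) n \<omega> \<le> sample_mean (m (q n \<omega>)) n \<omega> + \<kappa> / real n)"
proof (rule likely_mono[OF likely_regular[of e]])
  show "\<forall>\<^sub>F n in sequentially. \<forall>\<omega>\<in>space P. regular \<omega> \<longrightarrow>
      (\<forall>p\<in>K. sample_mean (m p) n \<omega> \<le> sample_mean (m (q n \<omega>)) n \<omega> + \<kappa> / real n)"
  proof (rule eventually_sequentiallyI[of 1], intro ballI impI)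
    fix n :: nat and \<omega> p assume n: "1 \<le> n" and \<omega>: "\<omega> \<in> space P" and p: "p \<in> K"
    have "p \<in> \<Theta> \<times> \<Gamma>" using p K by blast
    then have "empirical_criterion g Y Tm n \<omega> (xs p) \<le> empirical_criterion g Y Tm n \<omega> (xs (q n \<omega>))"
      using mx[OF n \<omega>] unfolding is_arg_max_def not_less[symmetric] by blast
    moreover have "0 \<le> \<kappa> / real n" using \<kappa> by simp
    ultimately show "sample_mean (m p) n \<omega> \<le> sample_mean (m (q n \<omega>)) n \<omega> + \<kappa> / real n"
      unfolding empirical_eq_m[OF \<omega>] by linarith
  qed
qed (use e in simp_all)

end

context profiled_estimation begin

text \<open>The profiled criterion is close to the exact one both at the competitor and at the estimator; the
  latter lies in a compact set by tightness.\<close>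

lemma profiled_near_maximal:
  assumes mx: "\<And>n \<omega>. n \<ge> 1 \<Longrightarrow> \<omega> \<in> space P \<Longrightarrow>
      is_arg_max (\<lambda>p. empirical_criterion g Y Tm n \<omega> (xh n \<omega> p)) (\<lambda>p. p \<in> \<Theta> \<times> \<Gamma>) (q n \<omega>)"
    and tight: "\<And>e. e > 0 \<Longrightarrow> \<exists>K. compact K \<and> K \<subseteq> \<Theta> \<times> \<Gamma> \<and> likely P e (\<lambda>n \<omega>. q n \<omega> \<in> K)"
    and K: "compact K" "K \<subseteq> \<Theta> \<times> \<Gamma>" and \<kappa>: "\<kappa> > 0" and e: "e > 0"
  shows "likely P e (\<lambda>n \<omega>. \<forall>p\<in>K. sample_mean (m p) n \<omega> \<le> sample_mean (m (q n \<omega>)) n \<omega> + \<kappa> / real n)"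
proof -
  have e2: "e / 2 > 0" and \<kappa>2: "\<kappa> / 2 > 0" using e \<kappa> by simp_all
  obtain K' where K': "compact K'" "K' \<subseteq> \<Theta> \<times> \<Gamma>" and in_K': "likely P (e / 2) (\<lambda>n \<omega>. q n \<omega> \<in> K')" using tight[OF e2] by blast
  have U: "compact (K \<union> K')" "K \<union> K' \<subseteq> \<Theta> \<times> \<Gamma>" using K K' by (simp_all add: compact_Un)
  show ?thesis
  proof (rule likely_mono[OF likely_conj[OF in_K' profiled_criterion_close[OF U \<kappa>2 e2]]])
    show "\<forall>\<^sub>F n in sequentially. \<forall>\<omega>\<in>space P. q n \<omega> \<in> K' \<and> (\<forall>p\<in>K \<union> K'.
        \<bar>empirical_criterion g Y Tm n \<omega> (xh n \<omega> p) - empirical_criterion g Y Tm n \<omega> (xs p)\<bar> \<le> \<kappa> / 2 / real n) \<longrightarrow>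
      (\<forall>p\<in>K. sample_mean (m p) n \<omega> \<le> sample_mean (m (q n \<omega>)) n \<omega> + \<kappa> / real n)"
    proof (rule eventually_sequentiallyI[of 1], intro ballI impI, elim conjE)
      fix n :: nat and \<omega> p assume n: "1 \<le> n" and \<omega>: "\<omega> \<in> space P" and p: "p \<in> K" and q: "q n \<omega> \<in> K'"
        and close: "\<forall>p\<in>K \<union> K'. \<bar>empirical_criterion g Y Tm n \<omega> (xh n \<omega> p) - empirical_criterion g Y Tm n \<omega> (xs p)\<bar> \<le> \<kappa> / 2 / real n"
      have "p \<in> \<Theta> \<times> \<Gamma>" using p K by blast
      then have 1: "empirical_criterion g Y Tm n \<omega> (xh n \<omega> p) \<le> empirical_criterion g Y Tm n \<omega> (xh n \<omega> (q n \<omega>))"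
        using mx[OF n \<omega>] unfolding is_arg_max_def not_less[symmetric] by blast
      have 2: "\<bar>empirical_criterion g Y Tm n \<omega> (xh n \<omega> p) - empirical_criterion g Y Tm n \<omega> (xs p)\<bar> \<le> \<kappa> / 2 / real n"
        using close p by blast
      have 3: "\<bar>empirical_criterion g Y Tm n \<omega> (xh n \<omega> (q n \<omega>)) - empirical_criterion g Y Tm n \<omega> (xs (q n \<omega>))\<bar> \<le> \<kappa> / 2 / real n"
        using close q by blast
      have 4: "\<kappa> / real n = \<kappa> / 2 / real n + \<kappa> / 2 / real n" by simp
      show "sample_mean (m p) n \<omega> \<le> sample_mean (m (q n \<omega>)) n \<omega> + \<kappa> / real n"
        unfolding empirical_eq_m[OF \<omega>, symmetric] 4 using 1 2 3 by linarith
    qed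
  qed simp
qed

end

context sensitivities begin

text \<open>The gradient of \<open>m\<close> at \<open>\<theta>0\<close>.\<close>

definition score :: "real \<times> real \<Rightarrow> real ^ ('d + 2)" where
  "score z = (\<chi> k. - (gx z * X1 \<theta>0 (param_unit k) (clamp (snd z))))"

text \<open>The Hessian of \<open>m\<close> at \<open>\<theta>0\<close>.\<close>

definition curvature :: "real \<times> real \<Rightarrow> real ^ ('d + 2) ^ ('d + 2)" where
  "curvature z = (\<chi> j k. - (gx z * X2 \<theta>0 (param_unit j) (param_unit k) (clamp (snd z)) +
     gxx z * (X1 \<theta>0 (param_unit j) (clamp (snd z)) * X1 \<theta>0 (param_unit k) (clamp (snd z)))))"

lemma X1_of_coord: "t \<in> {0..T} \<Longrightarrow> X1 \<theta>0 (of_coord h) t = (\<Sum>k\<in>UNIV. h $ k * X1 \<theta>0 (param_unit k) t)"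
  unfolding of_coord_def
  by (simp add: linear_sum[OF lin_X1[OF theta0]] linear_scale[OF lin_X1[OF theta0]])

lemma X2_of_coord: "t \<in> {0..T} \<Longrightarrow> X2 \<theta>0 (of_coord h) (of_coord h) t =
    (\<Sum>j\<in>UNIV. \<Sum>k\<in>UNIV. h $ j * (X2 \<theta>0 (param_unit j) (param_unit k) t * h $ k))"
  unfolding of_coord_def
  by (simp add: linear_sum[OF lin_X2r[OF theta0]] linear_scale[OF lin_X2r[OF theta0]]
      linear_sum[OF lin_X2l[OF theta0]] linear_scale[OF lin_X2l[OF theta0]] sum_distrib_left mult_ac)
    (rule trans[OF sum.swap], intro sum.cong refl, simp add: mult_ac)

lemma score_inner: "score z \<bullet> h = - (gx z * X1 \<theta>0 (of_coord h) (clamp (snd z)))"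
  by (simp add: score_def inner_vec_def X1_of_coord[OF clamp_in] sum_negf sum_distrib_left mult_ac)

lemma curvature_form: "h \<bullet> (curvature z *v h) =
    - (gx z * X2 \<theta>0 (of_coord h) (of_coord h) (clamp (snd z)) + gxx z * (X1 \<theta>0 (of_coord h) (clamp (snd z)))\<^sup>2)"
proof -
  have "h \<bullet> (curvature z *v h) = (\<Sum>j\<in>UNIV. \<Sum>k\<in>UNIV. h $ j * (curvature z $ j $ k * h $ k))"
    by (simp add: inner_vec_def matrix_vector_mult_def sum_distrib_left)
  also have "\<dots> = - (gx z * (\<Sum>j\<in>UNIV. \<Sum>k\<in>UNIV. h $ j * (X2 \<theta>0 (param_unit j) (param_unit k) (clamp (snd z)) * h $ k)) +
      gxx z * (\<Sum>j\<in>UNIV. \<Sum>k\<in>UNIV. (h $ j * X1 \<theta>0 (param_unit j) (clamp (snd z))) * (h $ k * X1 \<theta>0 (param_unit k) (clamp (snd z)))))"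
    unfolding sum_distrib_left sum.distrib[symmetric] sum_negf[symmetric]
    by (intro sum.cong refl) (simp add: curvature_def algebra_simps)
  finally show ?thesis
    unfolding X2_of_coord[OF clamp_in] X1_of_coord[OF clamp_in] power2_eq_square sum_product .
qed

lemma partial_solution:
  "p \<in> \<Theta> \<times> \<Gamma> \<Longrightarrow> t \<in> {0..T} \<Longrightarrow> partial k (\<lambda>q. xs q t) p = X1 p (param_unit k) t"
  unfolding partial_def by (rule DERIV_imp_deriv[OF X1])

text \<open>The parameter set is open, so the first partial derivative is known near \<open>\<theta>0\<close> and can be
  differentiated there.\<close>

lemma second_partial_solution:
  assumes t: "t \<in> {0..T}"
  shows "partial j (partial k (\<lambda>q. xs q t)) \<theta>0 = X2 \<theta>0 (param_unit j) (param_unit k) t"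
proof -
  have "open ((\<lambda>s. \<theta>0 + s *\<^sub>R param_unit j) -` (\<Theta> \<times> \<Gamma>))"
    by (intro open_vimage open_Times open_Theta open_Gamma continuous_intros)
  then have "\<forall>\<^sub>F s in nhds 0. \<theta>0 + s *\<^sub>R param_unit j \<in> \<Theta> \<times> \<Gamma>"
    unfolding eventually_nhds using theta0 by (intro exI[of _ "(\<lambda>s. \<theta>0 + s *\<^sub>R param_unit j) -` (\<Theta> \<times> \<Gamma>)"]) simp
  then have "\<forall>\<^sub>F s in nhds 0. partial k (\<lambda>q. xs q t) (\<theta>0 + s *\<^sub>R param_unit j) = X1 (\<theta>0 + s *\<^sub>R param_unit j) (param_unit k) t"
    by eventually_elim (rule partial_solution[OF _ t])
  from deriv_cong_ev[OF this refl] show ?thesis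
    unfolding partial_def[of j] using DERIV_imp_deriv[OF X2[OF theta0 t]] by simp
qed

lemma gx_measurable: "gx \<in> borel_measurable borel" "gxx \<in> borel_measurable borel"
  unfolding gx_def[abs_def] gxx_def[abs_def]
  by (intro loss_measurable cont_path theta0 loss_derivatives(4,5)[OF g_C2])+

lemma gx_sample: "\<omega> \<in> space P \<Longrightarrow> gx (Y 1 \<omega>, Tm 1 \<omega>) = loss_dx g (Y 1 \<omega>, xs \<theta>0 (Tm 1 \<omega>))"
  "\<omega> \<in> space P \<Longrightarrow> gxx (Y 1 \<omega>, Tm 1 \<omega>) = loss_dxx g (Y 1 \<omega>, xs \<theta>0 (Tm 1 \<omega>))"
  unfolding gx_def gxx_def fst_conv snd_conv by (simp_all only: sample_time[OF order_refl])

lemma gx_integrable: "integrable P (\<lambda>\<omega>. (gx (Y 1 \<omega>, Tm 1 \<omega>))\<^sup>2)"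
  "integrable P (\<lambda>\<omega>. \<bar>gx (Y 1 \<omega>, Tm 1 \<omega>)\<bar>)" "integrable P (\<lambda>\<omega>. \<bar>gxx (Y 1 \<omega>, Tm 1 \<omega>)\<bar>)"
  using moment1 moment1_abs moment2
  by (simp_all only: gx_sample cong: Bochner_Integration.integrable_cong)

lemma X_measurable: "(\<lambda>z :: real \<times> real. X1 \<theta>0 v (clamp (snd z))) \<in> borel_measurable borel"
  "(\<lambda>z :: real \<times> real. X2 \<theta>0 u v (clamp (snd z))) \<in> borel_measurable borel"
  by (rule clamped_measurable[OF cont_slice[OF cont_X1]], rule clamped_measurable[OF cont_slice[OF cont_X2]])

lemma score_measurable: "(\<lambda>z. score z $ k) \<in> borel_measurable borel"
  unfolding score_def vec_lambda_beta by (intro borel_measurable_uminus borel_measurable_times gx_measurable X_measurable)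

lemma curvature_measurable: "(\<lambda>z. curvature z $ j $ k) \<in> borel_measurable borel"
  unfolding curvature_def vec_lambda_beta
  by (intro borel_measurable_uminus borel_measurable_add borel_measurable_times gx_measurable X_measurable)

lemma score_square: "integrable P (\<lambda>\<omega>. (score (Y 1 \<omega>, Tm 1 \<omega>) $ k)\<^sup>2)"
proof -
  obtain B where B: "B \<ge> 0" "\<forall>t\<in>{0..T}. \<bar>X1 \<theta>0 (param_unit k) t\<bar> \<le> B" by (rule bounded_in_time[OF cont_X1])
  show ?thesis
  proof (rule Bochner_Integration.integrable_bound[OF integrable_mult_right[OF gx_integrable(1), of "B\<^sup>2"]])
    show "(\<lambda>\<omega>. (score (Y 1 \<omega>, Tm 1 \<omega>) $ k)\<^sup>2) \<in> borel_measurable P"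
      by (intro borel_measurable_power comp_measurable[OF score_measurable order_refl])
    show "AE \<omega> in P. norm ((score (Y 1 \<omega>, Tm 1 \<omega>) $ k)\<^sup>2) \<le> norm (B\<^sup>2 * (gx (Y 1 \<omega>, Tm 1 \<omega>))\<^sup>2)"
    proof (rule AE_I2)
      fix \<omega>
      have "\<bar>X1 \<theta>0 (param_unit k) (clamp (Tm 1 \<omega>))\<bar>\<^sup>2 \<le> B\<^sup>2"
        by (rule power_mono) (use B(2) clamp_in in \<open>blast, simp\<close>)
      then show "norm ((score (Y 1 \<omega>, Tm 1 \<omega>) $ k)\<^sup>2) \<le> norm (B\<^sup>2 * (gx (Y 1 \<omega>, Tm 1 \<omega>))\<^sup>2)"
        by (simp add: score_def power_mult_distrib mult.commute mult_right_mono)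
    qed
  qed
qed

lemma curvature_integrable: "integrable P (\<lambda>\<omega>. curvature (Y 1 \<omega>, Tm 1 \<omega>) $ j $ k)"
proof -
  let ?e = "param_unit :: 'd + 2 \<Rightarrow> 'd param"
  obtain B where B: "B \<ge> 0" "\<forall>t\<in>{0..T}. \<bar>X1 \<theta>0 (?e j) t\<bar> \<le> B" by (rule bounded_in_time[OF cont_X1])
  obtain B' where B': "B' \<ge> 0" "\<forall>t\<in>{0..T}. \<bar>X1 \<theta>0 (?e k) t\<bar> \<le> B'" by (rule bounded_in_time[OF cont_X1])
  obtain D where D: "D \<ge> 0" "\<forall>t\<in>{0..T}. \<bar>X2 \<theta>0 (?e j) (?e k) t\<bar> \<le> D" by (rule bounded_in_time[OF cont_X2])
  show ?thesis
  proof (rule Bochner_Integration.integrable_bound[OF Bochner_Integration.integrable_add[OF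
        integrable_mult_left[OF gx_integrable(2), of D] integrable_mult_left[OF gx_integrable(3), of "B * B'"]]])
    show "(\<lambda>\<omega>. curvature (Y 1 \<omega>, Tm 1 \<omega>) $ j $ k) \<in> borel_measurable P"
      by (rule comp_measurable[OF curvature_measurable order_refl])
    show "AE \<omega> in P. norm (curvature (Y 1 \<omega>, Tm 1 \<omega>) $ j $ k) \<le>
        norm (\<bar>gx (Y 1 \<omega>, Tm 1 \<omega>)\<bar> * D + \<bar>gxx (Y 1 \<omega>, Tm 1 \<omega>)\<bar> * (B * B'))"
    proof (rule AE_I2)
      fix \<omega>
      let ?c = "clamp (Tm 1 \<omega>)" and ?z = "(Y 1 \<omega>, Tm 1 \<omega>)"
      have "\<bar>gx ?z * X2 \<theta>0 (?e j) (?e k) ?c\<bar> \<le> \<bar>gx ?z\<bar> * D"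
        unfolding abs_mult using D clamp_in by (intro mult_left_mono) auto
      moreover have "\<bar>gxx ?z * (X1 \<theta>0 (?e j) ?c * X1 \<theta>0 (?e k) ?c)\<bar> \<le> \<bar>gxx ?z\<bar> * (B * B')"
        unfolding abs_mult using B B' clamp_in by (intro mult_left_mono mult_mono) auto
      ultimately show "norm (curvature ?z $ j $ k) \<le> norm (\<bar>gx ?z\<bar> * D + \<bar>gxx ?z\<bar> * (B * B'))"
        unfolding curvature_def vec_lambda_beta snd_conv real_norm_def by linarith
    qed
  qed
qed

lemma expected_curvature:
  "criterion_matrix P g (Y 1) (Tm 1) xs \<theta>0 $ j $ k = expectation (\<lambda>\<omega>. curvature (Y 1 \<omega>, Tm 1 \<omega>) $ j $ k)"
proof -
  have "expectation (\<lambda>\<omega>. curvature (Y 1 \<omega>, Tm 1 \<omega>) $ j $ k) = expectation (\<lambda>\<omega>. -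
      (loss_dx g (Y 1 \<omega>, xs \<theta>0 (Tm 1 \<omega>)) * partial j (partial k (\<lambda>q. xs q (Tm 1 \<omega>))) \<theta>0 +
       loss_dxx g (Y 1 \<omega>, xs \<theta>0 (Tm 1 \<omega>)) * (partial j (\<lambda>q. xs q (Tm 1 \<omega>)) \<theta>0 * partial k (\<lambda>q. xs q (Tm 1 \<omega>)) \<theta>0)))"
  proof (rule Bochner_Integration.integral_cong[OF refl])
    fix \<omega> assume \<omega>: "\<omega> \<in> space P"
    note t = T_range[OF order_refl \<omega>]
    show "curvature (Y 1 \<omega>, Tm 1 \<omega>) $ j $ k = -
      (loss_dx g (Y 1 \<omega>, xs \<theta>0 (Tm 1 \<omega>)) * partial j (partial k (\<lambda>q. xs q (Tm 1 \<omega>))) \<theta>0 +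
       loss_dxx g (Y 1 \<omega>, xs \<theta>0 (Tm 1 \<omega>)) * (partial j (\<lambda>q. xs q (Tm 1 \<omega>)) \<theta>0 * partial k (\<lambda>q. xs q (Tm 1 \<omega>)) \<theta>0))"
      unfolding curvature_def vec_lambda_beta snd_conv gx_sample[OF \<omega>] sample_time[OF order_refl \<omega>]
        second_partial_solution[OF t] partial_solution[OF theta0 t] ..
  qed
  then show ?thesis unfolding criterion_matrix_def vec_lambda_beta Bochner_Integration.integral_minus by (rule sym)
qed

lemma local_m_estimation:
  assumes r0: "r0 > 0" "cball \<theta>0 r0 \<subseteq> \<Theta> \<times> \<Gamma>" and V: "invertible (criterion_matrix P g (Y 1) (Tm 1) xs \<theta>0)"
  shows "m_estimation P (\<lambda>i \<omega>. (Y i \<omega>, Tm i \<omega>)) (\<lambda>h. m (\<theta>0 + of_coord h)) score curvature r0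
    (criterion_matrix P g (Y 1) (Tm 1) xs \<theta>0)"
proof (rule m_estimation.intro[OF iid_sample_axioms m_estimation_axioms.intro])
  have inside: "\<theta>0 + of_coord h \<in> \<Theta> \<times> \<Gamma>" if "norm h \<le> r0" for h :: "real ^ ('d + 2)"
    using that r0 by (intro subsetD[OF r0(2)]) (simp add: dist_norm norm_of_coord)
  show "0 < r0" by (rule r0)
  show "m (\<theta>0 + of_coord h) \<in> borel_measurable borel" if "norm h \<le> r0" for h by (rule m_measurable[OF inside[OF that]])
  show "integrable P (\<lambda>\<omega>. m (\<theta>0 + of_coord h) (Y 1 \<omega>, Tm 1 \<omega>))" if "norm h \<le> r0" for h
    by (rule conjunct1[OF expectation_m[OF inside[OF that]]])
  show "score \<in> borel_measurable borel"
    by (rule borel_measurable_euclidean_space[THEN iffD2]) (auto simp: Basis_vec_def inner_axis intro: score_measurable)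
  show "integrable P (\<lambda>\<omega>. (score (Y 1 \<omega>, Tm 1 \<omega>) $ j)\<^sup>2)" for j by (rule score_square)
  show "(\<lambda>z. curvature z $ i $ j) \<in> borel_measurable borel" for i j by (rule curvature_measurable)
  show "integrable P (\<lambda>\<omega>. curvature (Y 1 \<omega>, Tm 1 \<omega>) $ i $ j)" for i j by (rule curvature_integrable)
  show "criterion_matrix P g (Y 1) (Tm 1) xs \<theta>0 $ i $ j = expectation (\<lambda>\<omega>. curvature (Y 1 \<omega>, Tm 1 \<omega>) $ i $ j)" for i j
    by (rule expected_curvature)
  show "criterion_matrix P g (Y 1) (Tm 1) xs \<theta>0 $ i $ j = criterion_matrix P g (Y 1) (Tm 1) xs \<theta>0 $ j $ i" for i j
    unfolding expected_curvature curvature_def vec_lambda_beta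
    by (subst X2_sym[OF theta0 clamp_in]) (simp only: mult.commute)
  show "invertible (criterion_matrix P g (Y 1) (Tm 1) xs \<theta>0)" by (rule V)
  have c0: "\<theta>0 + of_coord 0 = \<theta>0" using linear_0[OF linear_of_coord] by simp
  show "expectation (\<lambda>\<omega>. m (\<theta>0 + of_coord h) (Y 1 \<omega>, Tm 1 \<omega>)) \<le> expectation (\<lambda>\<omega>. m (\<theta>0 + of_coord 0) (Y 1 \<omega>, Tm 1 \<omega>))"
    if "norm h \<le> r0" for h
    unfolding c0 conjunct2[OF expectation_m[OF inside[OF that]]] conjunct2[OF expectation_m[OF theta0]]
    using criterion_max[OF inside[OF that]] by (cases "\<theta>0 + of_coord h = \<theta>0") (simp_all add: less_imp_le)
  fix \<epsilon> :: real assume \<epsilon>: "\<epsilon> > 0"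
  obtain \<delta> \<rho> where \<delta>: "\<delta> > 0" "\<delta> \<le> r0" and \<rho>: "\<rho> \<in> borel_measurable borel" "\<forall>z. 0 \<le> \<rho> z" "integrable P (\<lambda>\<omega>. \<rho> (Y 1 \<omega>, Tm 1 \<omega>))"
    "expectation (\<lambda>\<omega>. \<rho> (Y 1 \<omega>, Tm 1 \<omega>)) \<le> \<epsilon>" and ex: "\<forall>y\<in>S. \<forall>t\<in>{0..T}. \<forall>v. norm v \<le> \<delta> \<longrightarrow>
      \<bar>m (\<theta>0 + v) (y, t) - m \<theta>0 (y, t) + gx (y, t) * X1 \<theta>0 v t + (gx (y, t) * X2 \<theta>0 v v t + gxx (y, t) * (X1 \<theta>0 v t)\<^sup>2) / 2\<bar>
      \<le> \<rho> (y, t) * (norm v)\<^sup>2"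
    using loss_expansion[OF \<epsilon> r0] by blast
  have ae: "AE \<omega> in P. \<forall>i\<ge>1. \<forall>h. norm h \<le> \<delta> \<longrightarrow>
      \<bar>m (\<theta>0 + of_coord h) (Y i \<omega>, Tm i \<omega>) - m (\<theta>0 + of_coord 0) (Y i \<omega>, Tm i \<omega>) - score (Y i \<omega>, Tm i \<omega>) \<bullet> h -
        (h \<bullet> (curvature (Y i \<omega>, Tm i \<omega>) *v h)) / 2\<bar> \<le> \<rho> (Y i \<omega>, Tm i \<omega>) * (norm h)\<^sup>2"
    using AE_regular
  proof eventually_elim
    case (elim \<omega>)
    then have \<omega>: "\<omega> \<in> space P" and y: "\<forall>i\<ge>1. Y i \<omega> \<in> S" unfolding regular_def by simp_all
    show ?case
    proof (intro allI impI)
      fix i :: nat and h :: "real ^ ('d + 2)" assume i: "1 \<le> i" and h: "norm h \<le> \<delta>"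
      have "norm (of_coord h) \<le> \<delta>" using h by (simp only: norm_of_coord)
      from ex[rule_format, OF y[rule_format, OF i] T_range[OF i \<omega>] this]
      show "\<bar>m (\<theta>0 + of_coord h) (Y i \<omega>, Tm i \<omega>) - m (\<theta>0 + of_coord 0) (Y i \<omega>, Tm i \<omega>) - score (Y i \<omega>, Tm i \<omega>) \<bullet> h -
        (h \<bullet> (curvature (Y i \<omega>, Tm i \<omega>) *v h)) / 2\<bar> \<le> \<rho> (Y i \<omega>, Tm i \<omega>) * (norm h)\<^sup>2"
        unfolding c0 score_inner curvature_form snd_conv sample_time[OF i \<omega>] norm_of_coord minus_divide_left[symmetric] diff_minus_eq_add .
    qed
  qed
  show "\<exists>\<delta>>0. \<delta> \<le> r0 \<and> (\<exists>\<rho>\<in>borel_measurable borel. (\<forall>z. 0 \<le> \<rho> z) \<and>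
      integrable P (\<lambda>\<omega>. \<rho> (Y 1 \<omega>, Tm 1 \<omega>)) \<and> expectation (\<lambda>\<omega>. \<rho> (Y 1 \<omega>, Tm 1 \<omega>)) \<le> \<epsilon> \<and>
      (AE \<omega> in P. \<forall>i\<ge>1. \<forall>h. norm h \<le> \<delta> \<longrightarrow>
        \<bar>m (\<theta>0 + of_coord h) (Y i \<omega>, Tm i \<omega>) - m (\<theta>0 + of_coord 0) (Y i \<omega>, Tm i \<omega>) - score (Y i \<omega>, Tm i \<omega>) \<bullet> h -
          (h \<bullet> (curvature (Y i \<omega>, Tm i \<omega>) *v h)) / 2\<bar> \<le> \<rho> (Y i \<omega>, Tm i \<omega>) * (norm h)\<^sup>2))"
    by (rule exI[of _ \<delta>], rule conjI[OF \<delta>(1)], rule conjI[OF \<delta>(2)], rule bexI[OF _ \<rho>(1)],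
        rule conjI[OF \<rho>(2)], rule conjI[OF \<rho>(3)], rule conjI[OF \<rho>(4) ae])
qed

text \<open>One limit law serves every estimator that maximises the exact criterion up to \<open>o(1/n)\<close>.\<close>

theorem tight_near_maximizers_normal:
  assumes V: "invertible (criterion_matrix P g (Y 1) (Tm 1) xs \<theta>0)"
  shows "\<exists>C \<mu>. multivariate_normal 0 C \<mu> \<and> (\<forall>q. (\<forall>n\<ge>1. q n \<in> borel_measurable P) \<longrightarrow>
    (\<forall>e>0. \<exists>K. compact K \<and> K \<subseteq> \<Theta> \<times> \<Gamma> \<and> likely P e (\<lambda>n \<omega>. q n \<omega> \<in> K)) \<longrightarrow>
    (\<forall>K \<kappa> e. compact K \<longrightarrow> K \<subseteq> \<Theta> \<times> \<Gamma> \<longrightarrow> \<kappa> > 0 \<longrightarrow> e > 0 \<longrightarrow>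
      likely P e (\<lambda>n \<omega>. \<forall>p\<in>K. sample_mean (m p) n \<omega> \<le> sample_mean (m (q n \<omega>)) n \<omega> + \<kappa> / real n)) \<longrightarrow>
    converges_in_distribution P (\<lambda>n \<omega>. sqrt (real n) *\<^sub>R param_coord (q n \<omega> - \<theta>0)) \<mu>)"
proof -
  have "open (\<Theta> \<times> \<Gamma>)" using open_Theta open_Gamma by (rule open_Times)
  then obtain r0 where r0: "r0 > 0" "cball \<theta>0 r0 \<subseteq> \<Theta> \<times> \<Gamma>" using theta0 open_contains_cball by blast
  obtain C \<mu> where \<mu>: "multivariate_normal 0 C \<mu>" and normal: "\<forall>q. (\<forall>n\<ge>1. q n \<in> borel_measurable P) \<longrightarrow>
    (\<forall>\<kappa>>0. \<forall>e>0. likely P e (\<lambda>n \<omega>. norm (q n \<omega>) \<le> \<kappa>)) \<longrightarrow>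
    (\<forall>\<kappa>>0. \<forall>e>0. likely P e (\<lambda>n \<omega>. \<forall>h. norm h \<le> r0 \<longrightarrow>
        sample_mean (m (\<theta>0 + of_coord h)) n \<omega> \<le> sample_mean (m (\<theta>0 + of_coord (q n \<omega>))) n \<omega> + \<kappa> / real n)) \<longrightarrow>
    converges_in_distribution P (\<lambda>n \<omega>. sqrt (real n) *\<^sub>R q n \<omega>) \<mu>"
    using m_estimation.near_maximizers_asymptotically_normal[OF local_m_estimation[OF r0 V]] by blast
  show ?thesis
  proof (rule exI[of _ C], rule exI[of _ \<mu>], rule conjI[OF \<mu>], intro allI impI)
    fix q :: "nat \<Rightarrow> 'w \<Rightarrow> 'd param"
    assume meas: "\<forall>n\<ge>1. q n \<in> borel_measurable P"
      and tight: "\<forall>e>0. \<exists>K. compact K \<and> K \<subseteq> \<Theta> \<times> \<Gamma> \<and> likely P e (\<lambda>n \<omega>. q n \<omega> \<in> K)"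
      and near: "\<forall>K \<kappa> e. compact K \<longrightarrow> K \<subseteq> \<Theta> \<times> \<Gamma> \<longrightarrow> \<kappa> > 0 \<longrightarrow> e > 0 \<longrightarrow>
        likely P e (\<lambda>n \<omega>. \<forall>p\<in>K. sample_mean (m p) n \<omega> \<le> sample_mean (m (q n \<omega>)) n \<omega> + \<kappa> / real n)"
    show "converges_in_distribution P (\<lambda>n \<omega>. sqrt (real n) *\<^sub>R param_coord (q n \<omega> - \<theta>0)) \<mu>"
    proof (rule normal[rule_format])
      show "(\<lambda>\<omega>. param_coord (q n \<omega> - \<theta>0)) \<in> borel_measurable P" if "1 \<le> n" for n
      proof -
        have "q n \<in> borel_measurable P" using meas that by blast
        then have "(\<lambda>\<omega>. q n \<omega> - \<theta>0) \<in> borel_measurable P" by simp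
        then show ?thesis
          by (rule measurable_compose)
            (intro borel_measurable_continuous_onI linear_continuous_on linear_conv_bounded_linear[THEN iffD1] linear_param_coord)
      qed
      fix \<kappa> e :: real assume \<kappa>: "\<kappa> > 0" and e: "e > 0"
      have "likely P e (\<lambda>n \<omega>. norm (q n \<omega> - \<theta>0) \<le> \<kappa>)"
      proof (rule consistency[OF _ _ \<kappa> e])
        show "\<exists>K. compact K \<and> K \<subseteq> \<Theta> \<times> \<Gamma> \<and> likely P e (\<lambda>n \<omega>. q n \<omega> \<in> K)" if "e > 0" for e using tight that by blast
        show "likely P e (\<lambda>n \<omega>. sample_mean (m \<theta>0) n \<omega> \<le> sample_mean (m (q n \<omega>)) n \<omega> + \<kappa>)" if \<kappa>: "\<kappa> > 0" and e: "e > 0" for \<kappa> e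
        proof (rule likely_mono[OF near[rule_format, of "{\<theta>0}", OF _ _ \<kappa> e] order_refl])
          show "\<forall>\<^sub>F n in sequentially. \<forall>\<omega>\<in>space P.
            (\<forall>p\<in>{\<theta>0}. sample_mean (m p) n \<omega> \<le> sample_mean (m (q n \<omega>)) n \<omega> + \<kappa> / real n) \<longrightarrow>
            sample_mean (m \<theta>0) n \<omega> \<le> sample_mean (m (q n \<omega>)) n \<omega> + \<kappa>"
          proof (rule eventually_sequentiallyI[of 1], intro ballI impI)
            fix n :: nat and \<omega> assume n: "1 \<le> n"
              and a: "\<forall>p\<in>{\<theta>0}. sample_mean (m p) n \<omega> \<le> sample_mean (m (q n \<omega>)) n \<omega> + \<kappa> / real n"
            have "\<kappa> / real n \<le> \<kappa>" using n \<kappa> by (simp add: field_simps)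
            then show "sample_mean (m \<theta>0) n \<omega> \<le> sample_mean (m (q n \<omega>)) n \<omega> + \<kappa>"
              using a[rule_format, OF singletonI] by linarith
          qed
        qed (use theta0 in simp_all)
      qed
      then show "likely P e (\<lambda>n \<omega>. norm (param_coord (q n \<omega> - \<theta>0)) \<le> \<kappa>)" unfolding norm_param_coord .
      show "likely P e (\<lambda>n \<omega>. \<forall>h. norm h \<le> r0 \<longrightarrow> sample_mean (m (\<theta>0 + of_coord h)) n \<omega>
          \<le> sample_mean (m (\<theta>0 + of_coord (param_coord (q n \<omega> - \<theta>0)))) n \<omega> + \<kappa> / real n)"
      proof (rule likely_mono[OF near[rule_format, OF compact_cball r0(2) \<kappa> e] order_refl])
        show "\<forall>\<^sub>F n in sequentially. \<forall>\<omega>\<in>space P.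
            (\<forall>p\<in>cball \<theta>0 r0. sample_mean (m p) n \<omega> \<le> sample_mean (m (q n \<omega>)) n \<omega> + \<kappa> / real n) \<longrightarrow>
            (\<forall>h. norm h \<le> r0 \<longrightarrow> sample_mean (m (\<theta>0 + of_coord h)) n \<omega>
              \<le> sample_mean (m (\<theta>0 + of_coord (param_coord (q n \<omega> - \<theta>0)))) n \<omega> + \<kappa> / real n)"
          unfolding of_coord_param_coord add_diff_cancel_left' add.commute[of \<theta>0 "_ - \<theta>0"] diff_add_cancel
        proof (intro always_eventually allI ballI impI)
          fix n :: nat and \<omega> and h :: "real ^ ('d + 2)"
          assume a: "\<forall>p\<in>cball \<theta>0 r0. sample_mean (m p) n \<omega> \<le> sample_mean (m (q n \<omega>)) n \<omega> + \<kappa> / real n" and h: "norm h \<le> r0"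
          have "\<theta>0 + of_coord h \<in> cball \<theta>0 r0" using h by (simp add: dist_norm norm_of_coord)
          then show "sample_mean (m (\<theta>0 + of_coord h)) n \<omega> \<le> sample_mean (m (q n \<omega>)) n \<omega> + \<kappa> / real n" using a by blast
        qed
      qed
    qed
  qed
qed

end

theorem theorem3p3:
  fixes T :: real
    and \<Theta> :: "(real ^ 'd::finite) set" and \<Gamma> :: "(real \<times> real) set"
    and F G :: "real \<times> real \<times> real \<times> (real ^ 'd) \<Rightarrow> real"
    and xs zs :: "'d param \<Rightarrow> real \<Rightarrow> real"
    and P :: "'w measure" and Y Tm :: "nat \<Rightarrow> 'w \<Rightarrow> real"
    and g :: "real \<times> real \<Rightarrow> real" and \<theta>0 :: "'d param"
    and L :: "nat \<Rightarrow> (real \<Rightarrow> real) set" and lam :: "nat \<Rightarrow> real"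
    and xh zh :: "nat \<Rightarrow> 'w \<Rightarrow> 'd param \<Rightarrow> real \<Rightarrow> real"
    and \<theta>hat \<theta>ring :: "nat \<Rightarrow> 'w \<Rightarrow> 'd param"
  assumes T_pos: "T > 0"
    and Theta: "open \<Theta>" "convex \<Theta>"
    and Gamma: "open \<Gamma>" "convex \<Gamma>"
    and theta0: "\<theta>0 \<in> \<Theta> \<times> \<Gamma>"
    and prob: "prob_space P"
    and indep: "prob_space.indep_vars P (\<lambda>_. borel) (\<lambda>i \<omega>. (Y i \<omega>, Tm i \<omega>)) {1..}"
    and ident: "\<And>i. i \<ge> 1 \<Longrightarrow>
      distr P borel (\<lambda>\<omega>. (Y i \<omega>, Tm i \<omega>)) = distr P borel (\<lambda>\<omega>. (Y 1 \<omega>, Tm 1 \<omega>))"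
    and T_range: "\<And>i \<omega>. i \<ge> 1 \<Longrightarrow> \<omega> \<in> space P \<Longrightarrow> Tm i \<omega> \<in> {0..T}"
    and A1: "\<exists>f c C. c > 0 \<and> C > 0 \<and> (\<forall>t\<in>{0..T}. c \<le> f t \<and> f t \<le> C) \<and>
      distributed P lborel (Tm 1) (\<lambda>t. ennreal (indicator {0..T} t * f t))"
    and A2_smooth: "Ck_on 3 (UNIV \<times> UNIV \<times> {0..T} \<times> \<Theta>) F"
                   "Ck_on 3 (UNIV \<times> UNIV \<times> {0..T} \<times> \<Theta>) G"
    and A2_solution: "\<And>p. p \<in> \<Theta> \<times> \<Gamma> \<Longrightarrow> ivp_solution T F G p (xs p) (zs p)"
    and A2_unique: "\<And>p u v t. p \<in> \<Theta> \<times> \<Gamma> \<Longrightarrow> ivp_solution T F G p u v \<Longrightarrow> t \<in> {0..T} \<Longrightarrow>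
      u t = xs p t \<and> v t = zs p t"
    and A2_identifiable: "\<And>p q. p \<in> \<Theta> \<times> \<Gamma> \<Longrightarrow> q \<in> \<Theta> \<times> \<Gamma> \<Longrightarrow> p \<noteq> q \<Longrightarrow>
      \<exists>t\<in>{0..T}. xs p t \<noteq> xs q t"
    and A3_finite: "\<And>p. p \<in> \<Theta> \<times> \<Gamma> \<Longrightarrow> integrable P (\<lambda>\<omega>. g (Y 1 \<omega>, xs p (Tm 1 \<omega>)))"
    and A3_continuous: "continuous_on (\<Theta> \<times> \<Gamma>) (limit_criterion P g (Y 1) (Tm 1) xs)"
    and A3_unique_max: "\<And>p. p \<in> \<Theta> \<times> \<Gamma> \<Longrightarrow> p \<noteq> \<theta>0 \<Longrightarrow>
      limit_criterion P g (Y 1) (Tm 1) xs p < limit_criterion P g (Y 1) (Tm 1) xs \<theta>0"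
    and A6_nonneg: "\<And>y x. g (y, x) \<ge> 0"
    and A6_C2: "Ck_on 2 UNIV g"
    and A6_moment1: "integrable P (\<lambda>\<omega>. \<bar>loss_dx g (Y 1 \<omega>, xs \<theta>0 (Tm 1 \<omega>))\<bar>\<^sup>2)"
    and A6_moment2: "integrable P (\<lambda>\<omega>. \<bar>loss_dxx g (Y 1 \<omega>, xs \<theta>0 (Tm 1 \<omega>))\<bar>)"
    and A6_tails: "\<not> (\<exists>B. AE \<omega> in P. \<bar>Y 1 \<omega>\<bar> \<le> B) \<Longrightarrow>
      tail_comparable g \<and> tail_comparable (loss_dx g) \<and> tail_comparable (loss_dxx g)"
    and L_subspace: "\<And>n. n \<ge> 1 \<Longrightarrow> finite_dim_subspace_C1 T (L n)"
    and lam_pos: "\<And>n. n \<ge> 1 \<Longrightarrow> lam n > 0"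
    and profile: "\<And>n \<omega> \<theta> x z. n \<ge> 1 \<Longrightarrow> \<omega> \<in> space P \<Longrightarrow> (\<theta>, x, z) \<in> \<Theta> \<times> \<Gamma> \<Longrightarrow>
      is_arg_max (\<lambda>(u, v). empirical_criterion g Y Tm n \<omega> u - lam n * penalty T F G u v \<theta>)
        (\<lambda>(u, v). u \<in> L n \<and> v \<in> L n \<and> u 0 = x \<and> v 0 = z)
        (xh n \<omega> (\<theta>, x, z), zh n \<omega> (\<theta>, x, z))"
    and hat_measurable: "\<And>n. n \<ge> 1 \<Longrightarrow> \<theta>hat n \<in> borel_measurable P"
    and hat_max: "\<And>n \<omega>. n \<ge> 1 \<Longrightarrow> \<omega> \<in> space P \<Longrightarrow>
      is_arg_max (\<lambda>p. empirical_criterion g Y Tm n \<omega> (xh n \<omega> p)) (\<lambda>p. p \<in> \<Theta> \<times> \<Gamma>) (\<theta>hat n \<omega>)"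
    and ring_measurable: "\<And>n. n \<ge> 1 \<Longrightarrow> \<theta>ring n \<in> borel_measurable P"
    and ring_max: "\<And>n \<omega>. n \<ge> 1 \<Longrightarrow> \<omega> \<in> space P \<Longrightarrow>
      is_arg_max (\<lambda>p. empirical_criterion g Y Tm n \<omega> (xs p)) (\<lambda>p. p \<in> \<Theta> \<times> \<Gamma>) (\<theta>ring n \<omega>)"
    and hat_tight: "uniformly_tight P (\<Theta> \<times> \<Gamma>) \<theta>hat"
    and ring_tight: "uniformly_tight P (\<Theta> \<times> \<Gamma>) \<theta>ring"
    and lam_rate: "filterlim (\<lambda>n. lam n / (real n)\<^sup>2) at_top sequentially"
    and r_rate: "\<And>\<Theta>0 \<Gamma>0. compact \<Theta>0 \<Longrightarrow> \<Theta>0 \<subseteq> \<Theta> \<Longrightarrow> compact \<Gamma>0 \<Longrightarrow> \<Gamma>0 \<subseteq> \<Gamma> \<Longrightarrow>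
      (\<lambda>n. of_nat n * approx_rate T (L n) xs zs \<Theta>0 \<Gamma>0) \<longlonglongrightarrow> 0"
    and V_nonsingular: "invertible (criterion_matrix P g (Y 1) (Tm 1) xs \<theta>0)"
  shows "\<exists>C \<mu>. multivariate_normal 0 C \<mu> \<and>
    converges_in_distribution P (\<lambda>n \<omega>. sqrt (real n) *\<^sub>R param_coord (\<theta>hat n \<omega> - \<theta>0)) \<mu> \<and>
    converges_in_distribution P (\<lambda>n \<omega>. sqrt (real n) *\<^sub>R param_coord (\<theta>ring n \<omega> - \<theta>0)) \<mu>"
proof -
  note loss = loss_derivatives[OF A6_C2]
  have ivp: "smooth_ivp T \<Theta> \<Gamma> F G xs zs"
    by (rule smooth_ivp.intro[OF T_pos Theta(1) Gamma(1) A2_smooth A2_solution])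
  have iid: "iid_sample P (\<lambda>i \<omega>. (Y i \<omega>, Tm i \<omega>))"
    by (rule iid_sample.intro[OF prob iid_sample_axioms.intro[OF indep ident]])
  \<comment> \<open>Bounded and unbounded outcomes are merged through the choice of \<open>S\<close>.\<close>
  have "\<exists>S. S \<in> sets borel \<and> (AE \<omega> in P. Y 1 \<omega> \<in> S) \<and> comparable_on S (loss_dx g) \<and> comparable_on S (loss_dxx g)"
  proof (cases "\<exists>B. AE \<omega> in P. \<bar>Y 1 \<omega>\<bar> \<le> B")
    case True
    then obtain B where B: "AE \<omega> in P. \<bar>Y 1 \<omega>\<bar> \<le> B" by blast
    have "{y :: real. \<bar>y\<bar> \<le> B} \<in> sets borel" by (intro borel_closed closed_Collect_le continuous_intros)
    then show ?thesis using B comparable_on_bounded[OF loss(4), of B] comparable_on_bounded[OF loss(5), of B]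
      by (intro exI[of _ "{y. \<bar>y\<bar> \<le> B}"]) simp
  next
    case False
    from A6_tails[OF this] show ?thesis
      using comparable_on_tail[OF loss(4)] comparable_on_tail[OF loss(5)] by (intro exI[of _ UNIV]) simp
  qed
  then obtain S where S: "S \<in> sets borel" "AE \<omega> in P. Y 1 \<omega> \<in> S"
    and comparable: "comparable_on S (loss_dx g)" "comparable_on S (loss_dxx g)" by blast
  have prof: "profiling T \<Theta> \<Gamma> F G xs zs P Y Tm g \<theta>0 S"
    by (rule profiling.intro[OF ivp iid], rule profiling_axioms.intro)
      (fact theta0 T_range A6_C2 A6_nonneg A3_finite A3_continuous A3_unique_max A6_moment1[unfolded power2_abs] A6_moment2 S comparable)+
  interpret profiled_estimation T \<Theta> \<Gamma> F G xs zs P Y Tm g \<theta>0 S L lam xh zh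
    by (rule profiled_estimation.intro[OF prof profiled_estimation_axioms.intro[OF L_subspace lam_pos profile lam_rate r_rate]])
  obtain X1 X2 where cX1: "\<forall>v. continuous_on ((\<Theta> \<times> \<Gamma>) \<times> {0..T}) (\<lambda>(p, t). X1 p v t)"
    and cX2: "\<forall>u v. continuous_on ((\<Theta> \<times> \<Gamma>) \<times> {0..T}) (\<lambda>(p, t). X2 p u v t)"
    and X: "\<forall>p\<in>\<Theta> \<times> \<Gamma>. \<forall>t\<in>{0..T}.
      (\<forall>v. ((\<lambda>s. xs (p + s *\<^sub>R v) t) has_real_derivative X1 p v t) (at 0)) \<and>
      (\<forall>u v. ((\<lambda>s. X1 (p + s *\<^sub>R u) v t) has_real_derivative X2 p u v t) (at 0)) \<and>
      linear (\<lambda>v. X1 p v t) \<and> (\<forall>u. linear (\<lambda>v. X2 p u v t)) \<and> (\<forall>v. linear (\<lambda>u. X2 p u v t)) \<and>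
      (\<forall>u v. X2 p u v t = X2 p v u t)"
    using solution_C2 by (elim exE conjE) (rule that)
  interpret sensitivities T \<Theta> \<Gamma> F G xs zs P Y Tm g \<theta>0 S X1 X2
  proof (rule sensitivities.intro[OF prof sensitivities_axioms.intro])
    show "continuous_on ((\<Theta> \<times> \<Gamma>) \<times> {0..T}) (\<lambda>(p, t). X1 p v t)" for v by (rule cX1[rule_format])
    show "continuous_on ((\<Theta> \<times> \<Gamma>) \<times> {0..T}) (\<lambda>(p, t). X2 p u v t)" for u v by (rule cX2[rule_format])
    fix p t assume p: "p \<in> \<Theta> \<times> \<Gamma>" and t: "t \<in> {0..T}"
    note Xpt = X[THEN bspec, OF p, THEN bspec, OF t]
    show "((\<lambda>s. xs (p + s *\<^sub>R v) t) has_real_derivative X1 p v t) (at 0)"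
      "((\<lambda>s. X1 (p + s *\<^sub>R u) v t) has_real_derivative X2 p u v t) (at 0)"
      "linear (\<lambda>v. X1 p v t)" "linear (\<lambda>v. X2 p u v t)" "linear (\<lambda>u. X2 p u v t)" "X2 p u v t = X2 p v u t" for u v
      using Xpt by blast+
  qed
  obtain C \<mu> where \<mu>: "multivariate_normal 0 C \<mu>" and normal: "\<forall>q. (\<forall>n\<ge>1. q n \<in> borel_measurable P) \<longrightarrow>
    (\<forall>e>0. \<exists>K. compact K \<and> K \<subseteq> \<Theta> \<times> \<Gamma> \<and> likely P e (\<lambda>n \<omega>. q n \<omega> \<in> K)) \<longrightarrow>
    (\<forall>K \<kappa> e. compact K \<longrightarrow> K \<subseteq> \<Theta> \<times> \<Gamma> \<longrightarrow> \<kappa> > 0 \<longrightarrow> e > 0 \<longrightarrow>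
      likely P e (\<lambda>n \<omega>. \<forall>p\<in>K. sample_mean (m p) n \<omega> \<le> sample_mean (m (q n \<omega>)) n \<omega> + \<kappa> / real n)) \<longrightarrow>
    converges_in_distribution P (\<lambda>n \<omega>. sqrt (real n) *\<^sub>R param_coord (q n \<omega> - \<theta>0)) \<mu>"
    using tight_near_maximizers_normal[OF V_nonsingular] by (elim exE conjE) (rule that)
  note tight = uniformly_tight_likely[OF hat_tight hat_measurable] uniformly_tight_likely[OF ring_tight ring_measurable]
  have "converges_in_distribution P (\<lambda>n \<omega>. sqrt (real n) *\<^sub>R param_coord (\<theta>hat n \<omega> - \<theta>0)) \<mu>"
  proof (rule normal[THEN spec, THEN mp, THEN mp, THEN mp])
    show "\<forall>n\<ge>1. \<theta>hat n \<in> borel_measurable P" by (intro allI impI hat_measurable)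
    show "\<forall>e>0. \<exists>K. compact K \<and> K \<subseteq> \<Theta> \<times> \<Gamma> \<and> likely P e (\<lambda>n \<omega>. \<theta>hat n \<omega> \<in> K)" by (intro allI impI tight)
    show "\<forall>K \<kappa> e. compact K \<longrightarrow> K \<subseteq> \<Theta> \<times> \<Gamma> \<longrightarrow> \<kappa> > 0 \<longrightarrow> e > 0 \<longrightarrow>
      likely P e (\<lambda>n \<omega>. \<forall>p\<in>K. sample_mean (m p) n \<omega> \<le> sample_mean (m (\<theta>hat n \<omega>)) n \<omega> + \<kappa> / real n)"
      by (intro allI impI, rule profiled_near_maximal[OF hat_max tight(1)])
  qed
  moreover have "converges_in_distribution P (\<lambda>n \<omega>. sqrt (real n) *\<^sub>R param_coord (\<theta>ring n \<omega> - \<theta>0)) \<mu>"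
  proof (rule normal[THEN spec, THEN mp, THEN mp, THEN mp])
    show "\<forall>n\<ge>1. \<theta>ring n \<in> borel_measurable P" by (intro allI impI ring_measurable)
    show "\<forall>e>0. \<exists>K. compact K \<and> K \<subseteq> \<Theta> \<times> \<Gamma> \<and> likely P e (\<lambda>n \<omega>. \<theta>ring n \<omega> \<in> K)" by (intro allI impI tight)
    show "\<forall>K \<kappa> e. compact K \<longrightarrow> K \<subseteq> \<Theta> \<times> \<Gamma> \<longrightarrow> \<kappa> > 0 \<longrightarrow> e > 0 \<longrightarrow>
      likely P e (\<lambda>n \<omega>. \<forall>p\<in>K. sample_mean (m p) n \<omega> \<le> sample_mean (m (\<theta>ring n \<omega>)) n \<omega> + \<kappa> / real n)"
      by (intro allI impI, rule exact_near_maximal[OF ring_max])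
  qed
  ultimately show ?thesis using \<mu> by blast
qed

end
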